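(* Let $\Omega\subset\mathbb{R}^N$ ($1\le N\le3$) be a bounded domain with smooth boundary, $\lambda>0$, $u_0\in H^2(\Omega)\cap H_0^1(\Omega)$, and let $u\in C([0,+\infty);H^2\cap H_0^1(\Omega))\cap C^1([0,+\infty);L^2(\Omega))$ be a global solution of \[ u_t-\Delta u=\frac{\lambda}{(1-u)^2\bigl(1+\int_\Omega\frac{1}{1-u}\,dx\bigr)^2}\ (x\in\Omega,\ t>0),\quad u=0\ \text{on }\partial\Omega,\quad u(x,0)=u_0(x) \] with $\|u(\cdot,t)\|_{L^\infty}\le1-\delta$ for all $t\ge0$, some $\delta\in(0,1)$, and let $\psi$ be a solution of $-\Delta\psi=\frac{\lambda}{(1-\psi)^2(1+\int_\Omega\frac{1}{1-\psi}dx)^2}$ in $\Omega$, $\psi|_{\partial\Omega}=0$, with $\|u(\cdot,t)-\psi\|_{H^2}\to0$ as $t\to\infty$. Let $\theta\in(0,\tfrac12]$ be an exponent for which there exist $\sigma>0$ and $C>0$ such that for all $w\in H^2\cap H_0^1(\Omega)$ with $\|w-\psi\|_{H^2}\le\sigma$, \[ \Bigl\|\Delta w+\frac{\lambda}{(1-w)^2\bigl(1+\int_\Omega\frac{1}{1-w}\,dx\bigr)^2}\Bigr\|_{L^2}\ge C|E(w)-E(\psi)|^{1-\theta}. \] If $\theta=\tfrac12$, then there are constants $C_0,C_1>0$ with $\|u(\cdot,t)-\psi\|_{H^2}\le C_0e^{-C_1t}$ as $t\to+\infty$. If $\theta\in(0,\tfrac12)$, then there is a constant $C>0$ with \[ \|u(\cdot,t)-\psi\|_{H^2}\le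 C(1+t)^{-\frac{\theta}{1-2\theta}}\quad\text{as }t\to+\infty. \]
   Context: The energy functional is $E(w)=\frac12\int_\Omega|\nabla w|^2\,dx+\frac{\lambda}{1+\int_\Omega\frac{1}{1-w}\,dx}$, defined for $w\in H^2\cap H_0^1(\Omega)$ with $w<1$. *)

theory Defs
  imports "HOL-Analysis.Analysis"
begin

definition pd :: "'a::euclidean_space \<Rightarrow> ('a \<Rightarrow> real) \<Rightarrow> 'a \<Rightarrow> real" where
  "pd i f = (\<lambda>x. frechet_derivative f (at x) i)"

definition smooth_fun :: "('a::euclidean_space \<Rightarrow> real) \<Rightarrow> bool" where
  "smooth_fun f \<longleftrightarrow> (\<forall>is. set is \<subseteq> Basis \<longrightarrow> foldr pd is f differentiable_on UNIV)"

definition smooth_bounded_domain :: "'a::euclidean_space set \<Rightarrow> bool" where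
  "smooth_bounded_domain \<Omega> \<longleftrightarrow> open \<Omega> \<and> connected \<Omega> \<and> \<Omega> \<noteq> {} \<and> bounded \<Omega> \<and>
     (\<forall>p\<in>frontier \<Omega>. \<exists>U \<rho>. open U \<and> p \<in> U \<and> smooth_fun \<rho> \<and>
        (\<forall>x\<in>U. \<exists>i\<in>Basis. pd i \<rho> x \<noteq> 0) \<and> \<Omega> \<inter> U = {x\<in>U. \<rho> x < 0})"

definition test_fn :: "'a::euclidean_space set \<Rightarrow> ('a \<Rightarrow> real) \<Rightarrow> bool" where
  "test_fn \<Omega> \<phi> \<longleftrightarrow> smooth_fun \<phi> \<and> compact (closure {x. \<phi> x \<noteq> 0}) \<and>
     closure {x. \<phi> x \<noteq> 0} \<subseteq> \<Omega>"

definition L2 :: "'a::euclidean_space set \<Rightarrow> ('a \<Rightarrow> real) \<Rightarrow> bool" where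
  "L2 \<Omega> f \<longleftrightarrow> f \<in> borel_measurable (lebesgue_on \<Omega>) \<and>
     integrable (lebesgue_on \<Omega>) (\<lambda>x. (f x)\<^sup>2)"

definition l2norm :: "'a::euclidean_space set \<Rightarrow> ('a \<Rightarrow> real) \<Rightarrow> real" where
  "l2norm \<Omega> f = sqrt (\<integral>x. (f x)\<^sup>2 \<partial>lebesgue_on \<Omega>)"

definition loc_integrable :: "'a::euclidean_space set \<Rightarrow> ('a \<Rightarrow> real) \<Rightarrow> bool" where
  "loc_integrable \<Omega> f \<longleftrightarrow> (\<forall>K. compact K \<and> K \<subseteq> \<Omega> \<longrightarrow> integrable (lebesgue_on K) f)"

definition weak_deriv :: "'a::euclidean_space set \<Rightarrow> 'a \<Rightarrow> ('a \<Rightarrow> real) \<Rightarrow> ('a \<Rightarrow> real) \<Rightarrow> bool" where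
  "weak_deriv \<Omega> i f g \<longleftrightarrow> i \<in> Basis \<and> loc_integrable \<Omega> f \<and> loc_integrable \<Omega> g \<and>
     (\<forall>\<phi>. test_fn \<Omega> \<phi> \<longrightarrow>
        (\<integral>x. f x * pd i \<phi> x \<partial>lebesgue_on \<Omega>) = - (\<integral>x. g x * \<phi> x \<partial>lebesgue_on \<Omega>))"

text \<open>A chosen representative of the weak derivative (unique a.e. when it exists).\<close>
definition wd :: "'a::euclidean_space set \<Rightarrow> 'a \<Rightarrow> ('a \<Rightarrow> real) \<Rightarrow> ('a \<Rightarrow> real)" where
  "wd \<Omega> i f = (SOME g. L2 \<Omega> g \<and> weak_deriv \<Omega> i f g)"

definition H1 :: "'a::euclidean_space set \<Rightarrow> ('a \<Rightarrow> real) \<Rightarrow> bool" where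
  "H1 \<Omega> f \<longleftrightarrow> L2 \<Omega> f \<and> (\<forall>i\<in>Basis. \<exists>g. L2 \<Omega> g \<and> weak_deriv \<Omega> i f g)"

definition H2 :: "'a::euclidean_space set \<Rightarrow> ('a \<Rightarrow> real) \<Rightarrow> bool" where
  "H2 \<Omega> f \<longleftrightarrow> H1 \<Omega> f \<and> (\<forall>i\<in>Basis. H1 \<Omega> (wd \<Omega> i f))"

definition h1norm :: "'a::euclidean_space set \<Rightarrow> ('a \<Rightarrow> real) \<Rightarrow> real" where
  "h1norm \<Omega> f = sqrt ((l2norm \<Omega> f)\<^sup>2 + (\<Sum>i\<in>Basis. (l2norm \<Omega> (wd \<Omega> i f))\<^sup>2))"

definition h2norm :: "'a::euclidean_space set \<Rightarrow> ('a \<Rightarrow> real) \<Rightarrow> real" where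
  "h2norm \<Omega> f = sqrt ((l2norm \<Omega> f)\<^sup>2 + (\<Sum>i\<in>Basis. (l2norm \<Omega> (wd \<Omega> i f))\<^sup>2)
      + (\<Sum>i\<in>Basis. \<Sum>j\<in>Basis. (l2norm \<Omega> (wd \<Omega> j (wd \<Omega> i f)))\<^sup>2))"

definition H01 :: "'a::euclidean_space set \<Rightarrow> ('a \<Rightarrow> real) \<Rightarrow> bool" where
  "H01 \<Omega> f \<longleftrightarrow> H1 \<Omega> f \<and> (\<exists>\<phi>s. (\<forall>k. test_fn \<Omega> (\<phi>s k)) \<and>
      (\<lambda>k. h1norm \<Omega> (\<lambda>x. \<phi>s k x - f x)) \<longlonglongrightarrow> 0)"

definition lap :: "'a::euclidean_space set \<Rightarrow> ('a \<Rightarrow> real) \<Rightarrow> 'a \<Rightarrow> real" where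
  "lap \<Omega> f = (\<lambda>x. \<Sum>i\<in>Basis. wd \<Omega> i (wd \<Omega> i f) x)"

definition nl :: "'a::euclidean_space set \<Rightarrow> real \<Rightarrow> ('a \<Rightarrow> real) \<Rightarrow> 'a \<Rightarrow> real" where
  "nl \<Omega> lam w = (\<lambda>x. lam / ((1 - w x)\<^sup>2 * (1 + (\<integral>y. 1 / (1 - w y) \<partial>lebesgue_on \<Omega>))\<^sup>2))"

definition energy :: "'a::euclidean_space set \<Rightarrow> real \<Rightarrow> ('a \<Rightarrow> real) \<Rightarrow> real" where
  "energy \<Omega> lam w = 1/2 * (\<integral>x. (\<Sum>i\<in>Basis. (wd \<Omega> i w x)\<^sup>2) \<partial>lebesgue_on \<Omega>)
      + lam / (1 + (\<integral>x. 1 / (1 - w x) \<partial>lebesgue_on \<Omega>))"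

end

(*
Along the flow the energy E decreases at rate |u_t|^2 (L2 norms throughout), and the
Lojasiewicz-Simon inequality reads |u_t| >= C (E - E(psi))^(1-theta) near psi. Hence E - E(psi)
decays exponentially or like t^(-1/(1-2 theta)), and the length of the trajectory after time t is at
most a multiple of (E - E(psi))^theta. Differences u(t+h) - u(t) satisfy a Gronwall inequality,
so |u_t(t)|^2 is at most a multiple of E(u(t-1)) - E(u(t)); together with the equation this
controls Delta(u - psi), and the H^2 norm follows from the a priori estimate
|D^2 v| <= C (|Delta v| + |grad v|) for v in H^2 and H^1_0.

That estimate is proved without flattening the boundary and without traces. Near a boundary point
with defining function rho, the fields zeta (d_i rho e_j - d_j rho e_i) annihilate rho, so cutoffs
that are functions of rho do not contribute when one integrates by parts along them; this shows
that the tangential derivative W of v satisfies the integration by parts formula for all test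
functions of the whole space. Mollifying with a kernel shifted inwards makes W an admissible test
function in the differentiated equation, which bounds grad W. The tangential part of the Hessian
and its trace determine the Hessian.
*)
theory Submission
  imports Defs
begin

section \<open>Smooth functions\<close>

text \<open>Two gaps in regularity shape the argument. The velocity lies only in L2, so its gradient
  is not at hand: the Dirichlet integral is rewritten with the Laplacian and differentiated through
  self-adjointness, and the growth of the velocity is proved for differences in time, which lie in
  H2, before dividing by the time step. At the boundary, testing the differentiated equation with
  the tangential derivative W of v requires that W be a limit of test functions; mollifications with
  a kernel supported in inward directions are these test functions, and the integration by parts
  formula for W identifies their gradients. The exponents come from e = E - E(psi): e' = - |u_t|^2
  <= - C^2 e^(2 - 2 theta) is linear for theta = 1/2 and gives a power law below. The velocity is
  controlled by the square root of e one time unit earlier; because e < 1 eventually and theta <=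
  1/2, this is at most e^theta, the order of the distance to psi, so the passage from L2 to H2 costs
  nothing in the rate. If e reaches zero in finite time, the solution stops there, and this case is
  treated apart because powers of e are not differentiable at zero.\<close>

lemma smooth_fun_coinduct:
  assumes "f \<in> S"
    and diff: "\<And>g x. g \<in> S \<Longrightarrow> g differentiable (at x)"
    and pd: "\<And>g i. g \<in> S \<Longrightarrow> i \<in> Basis \<Longrightarrow> pd i g \<in> S"
  shows "smooth_fun f"
proof -
  have "foldr pd is f \<in> S" if "set is \<subseteq> Basis" for "is"
    using that by (induction "is") (auto intro: pd \<open>f \<in> S\<close>)
  then show ?thesis
    unfolding smooth_fun_def using diff
    by (meson differentiable_at_imp_differentiable_on)
qed

lemma smooth_fun_differentiable: "smooth_fun f \<Longrightarrow> f differentiable (at x)"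
  unfolding smooth_fun_def
  by (drule spec[of _ "[]"]) (simp add: differentiable_on_def)

lemma smooth_fun_pd:
  assumes "smooth_fun f" "i \<in> Basis"
  shows "smooth_fun (pd i f)"
  unfolding smooth_fun_def
proof (intro allI impI)
  fix "is" :: "'a list" assume "set is \<subseteq> Basis"
  then have "foldr pd (is @ [i]) f differentiable_on UNIV"
    using assms by (intro assms(1)[unfolded smooth_fun_def, rule_format]) auto
  then show "foldr pd is (pd i f) differentiable_on UNIV" by simp
qed

lemma pd_eqI: "(f has_derivative F) (at x) \<Longrightarrow> pd i f x = F i"
  unfolding pd_def using frechet_derivative_at by force

lemma smooth_has_derivative:
  assumes "smooth_fun f"
  shows "(f has_derivative (\<lambda>h. \<Sum>i\<in>Basis. (h \<bullet> i) * pd i f x)) (at x)"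
proof -
  let ?F = "frechet_derivative f (at x)"
  have D: "(f has_derivative ?F) (at x)"
    using smooth_fun_differentiable[OF assms] frechet_derivative_works by blast
  then have lin: "linear ?F" by (rule has_derivative_linear)
  have "?F h = (\<Sum>i\<in>Basis. (h \<bullet> i) * pd i f x)" for h
  proof -
    have "?F h = ?F (\<Sum>i\<in>Basis. (h \<bullet> i) *\<^sub>R i)" by (simp add: euclidean_representation)
    also have "\<dots> = (\<Sum>i\<in>Basis. (h \<bullet> i) * pd i f x)"
      by (simp add: linear_sum[OF lin] linear_cmul[OF lin] pd_def)
    finally show ?thesis .
  qed
  then have "?F = (\<lambda>h. \<Sum>i\<in>Basis. (h \<bullet> i) * pd i f x)" by auto
  with D show ?thesis by simp
qed

lemma smooth_continuous: "smooth_fun f \<Longrightarrow> continuous_on S f"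
  by (meson continuous_at_imp_continuous_on differentiable_imp_continuous_within smooth_fun_differentiable)

lemma smooth_borel: "smooth_fun f \<Longrightarrow> f \<in> borel_measurable borel"
  by (simp add: borel_measurable_continuous_onI smooth_continuous)

lemma has_derivative_imp_differentiable:
  "(f has_derivative F) (at x) \<Longrightarrow> f differentiable (at x)"
  by (auto simp: differentiable_def)

text \<open>Derivatives of the generators need only land in the algebra they generate, not among the
  generators. This is what the chain rule and the derivatives of exp(-1/s) provide, where an
  explicit invariant set would be awkward to write down.\<close>

inductive_set alg :: "('a::euclidean_space \<Rightarrow> real) set \<Rightarrow> ('a \<Rightarrow> real) set" for B where
  gen: "f \<in> B \<Longrightarrow> f \<in> alg B"
| add: "f \<in> alg B \<Longrightarrow> g \<in> alg B \<Longrightarrow> (\<lambda>x. f x + g x) \<in> alg B"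
| mult: "f \<in> alg B \<Longrightarrow> g \<in> alg B \<Longrightarrow> (\<lambda>x. f x * g x) \<in> alg B"

text \<open>The sum and product rules keep \<open>alg B\<close> closed under \<open>pd i\<close>, so
  the principle \<open>smooth_fun_coinduct\<close> applies to \<open>alg B\<close> itself.\<close>

lemma smooth_alg:
  assumes diff: "\<And>g x. g \<in> B \<Longrightarrow> g differentiable (at x)"
    and pd: "\<And>g i. g \<in> B \<Longrightarrow> i \<in> Basis \<Longrightarrow> pd i g \<in> alg B"
    and f: "f \<in> alg B"
  shows "smooth_fun f"
proof (rule smooth_fun_coinduct[OF f])
  show D: "g differentiable (at x)" if "g \<in> alg B" for g x
    using that by (induction) (auto intro: diff)
  show "pd i g \<in> alg B" if "g \<in> alg B" "i \<in> Basis" for g i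
    using that(1)
  proof induction
    case (gen f) then show ?case using pd that by auto
  next
    case (add f g)
    have "pd i (\<lambda>x. f x + g x) = (\<lambda>x. pd i f x + pd i g x)"
      using D[OF add.hyps(1)] D[OF add.hyps(2)]
      by (intro ext pd_eqI) (auto simp: pd_def intro!: derivative_eq_intros simp flip: frechet_derivative_works)
    with add show ?case by (auto intro: alg.add)
  next
    case (mult f g)
    have "pd i (\<lambda>x. f x * g x) = (\<lambda>x. f x * pd i g x + pd i f x * g x)"
    proof
      fix x
      show "pd i (\<lambda>x. f x * g x) x = f x * pd i g x + pd i f x * g x"
        unfolding pd_def[of i f] pd_def[of i g] 
        by (rule pd_eqI[OF has_derivative_mult]) (use D mult.hyps frechet_derivative_works in blast)+
    qed
    with mult show ?case by (auto intro: alg.add alg.mult)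
  qed
qed

lemma smooth_alg_smooth:
  assumes "f \<in> alg {g. smooth_fun g}"
  shows "smooth_fun f"
proof (rule smooth_alg[OF _ _ assms])
  fix g :: "'a \<Rightarrow> real" and i x :: 'a
  assume "g \<in> {g. smooth_fun g}"
  then show "g differentiable (at x)" by (simp add: smooth_fun_differentiable)
  assume "i \<in> Basis"
  with \<open>g \<in> {g. smooth_fun g}\<close> show "pd i g \<in> alg {g. smooth_fun g}" by (simp add: smooth_fun_pd alg.gen)
qed

lemma smooth_add: "smooth_fun f \<Longrightarrow> smooth_fun g \<Longrightarrow> smooth_fun (\<lambda>x. f x + g x)"
  and smooth_mult: "smooth_fun f \<Longrightarrow> smooth_fun g \<Longrightarrow> smooth_fun (\<lambda>x. f x * g x)"
  by (rule smooth_alg_smooth, intro alg.add alg.mult alg.gen; simp)+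

lemma pd_const [simp]: "pd i (\<lambda>x. c) = (\<lambda>x. 0)"
  by (auto intro!: pd_eqI[of _ "\<lambda>_. 0"])

lemma smooth_const: "smooth_fun (\<lambda>x. c)"
  by (rule smooth_fun_coinduct[of _ "range (\<lambda>c x. c)"]) auto

lemma pd_inner: "pd i (\<lambda>x. x \<bullet> e) = (\<lambda>x. i \<bullet> e)"
  by (auto intro!: pd_eqI[of _ "\<lambda>h. h \<bullet> e"] derivative_eq_intros)

lemma smooth_inner: "smooth_fun (\<lambda>x. x \<bullet> e)"
proof (rule smooth_fun_coinduct[of _ "insert (\<lambda>x. x \<bullet> e) (range (\<lambda>c x. c))"])
qed (auto simp: pd_inner intro!: derivative_intros)

lemma smooth_sum: "(\<And>k. k \<in> A \<Longrightarrow> smooth_fun (f k)) \<Longrightarrow> smooth_fun (\<lambda>x. \<Sum>k\<in>A. f k x)"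
  by (induction A rule: infinite_finite_induct) (auto intro: smooth_add smooth_const)

lemma smooth_uminus: "smooth_fun f \<Longrightarrow> smooth_fun (\<lambda>x. - f x)"
  using smooth_mult[OF smooth_const[of "-1"]] by simp

lemma smooth_diff: "smooth_fun f \<Longrightarrow> smooth_fun g \<Longrightarrow> smooth_fun (\<lambda>x. f x - g x)"
  using smooth_add[OF _ smooth_uminus] by simp

lemmas smooth_intros = smooth_add smooth_mult smooth_const smooth_inner smooth_sum smooth_uminus
  smooth_diff smooth_fun_pd

lemma pd_add:
  assumes "smooth_fun f" "smooth_fun g"
  shows "pd i (\<lambda>x. f x + g x) = (\<lambda>x. pd i f x + pd i g x)"
  unfolding pd_def[of i f] pd_def[of i g] 
  by (rule ext, rule pd_eqI[OF has_derivative_add]; 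
      use smooth_fun_differentiable assms frechet_derivative_works in blast)

lemma pd_diff:
  assumes "smooth_fun f" "smooth_fun g"
  shows "pd i (\<lambda>x. f x - g x) = (\<lambda>x. pd i f x - pd i g x)"
  unfolding pd_def[of i f] pd_def[of i g] 
  by (rule ext, rule pd_eqI[OF has_derivative_diff]; 
      use smooth_fun_differentiable assms frechet_derivative_works in blast)

lemma pd_mult:
  assumes "smooth_fun f" "smooth_fun g"
  shows "pd i (\<lambda>x. f x * g x) = (\<lambda>x. f x * pd i g x + pd i f x * g x)"
  unfolding pd_def[of i f] pd_def[of i g] 
  by (rule ext, rule pd_eqI[OF has_derivative_mult]; 
      use smooth_fun_differentiable assms frechet_derivative_works in blast)

lemma pd_sum:
  assumes "\<And>k. k \<in> A \<Longrightarrow> smooth_fun (f k)"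
  shows "pd i (\<lambda>x. \<Sum>k\<in>A. f k x) = (\<lambda>x. \<Sum>k\<in>A. pd i (f k) x)"
  using assms
  by (induction A rule: infinite_finite_induct) (auto simp: pd_add smooth_sum)

lemma has_derivative_affine_comp:
  assumes "smooth_fun f"
  shows "((\<lambda>x. f (a + c *\<^sub>R x)) has_derivative (\<lambda>h. \<Sum>i\<in>Basis. ((c *\<^sub>R h) \<bullet> i) * pd i f (a + c *\<^sub>R x))) (at x)"
  by (rule has_derivative_compose[OF _ smooth_has_derivative[OF assms]])
    (auto intro!: derivative_eq_intros)

lemma pd_affine:
  assumes "smooth_fun f" "i \<in> Basis"
  shows "pd i (\<lambda>x. f (a + c *\<^sub>R x)) = (\<lambda>x. c * pd i f (a + c *\<^sub>R x))"
proof
  fix x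
  have "pd i (\<lambda>x. f (a + c *\<^sub>R x)) x = (\<Sum>j\<in>Basis. ((c *\<^sub>R i) \<bullet> j) * pd j f (a + c *\<^sub>R x))"
    by (rule pd_eqI[OF has_derivative_affine_comp[OF assms(1)]])
  also have "\<dots> = (\<Sum>j\<in>Basis. if j = i then c * pd i f (a + c *\<^sub>R x) else 0)"
    using assms(2) by (intro sum.cong) (auto simp: inner_Basis)
  also have "\<dots> = c * pd i f (a + c *\<^sub>R x)" using assms(2) by simp
  finally show "pd i (\<lambda>x. f (a + c *\<^sub>R x)) x = c * pd i f (a + c *\<^sub>R x)" .
qed

lemma smooth_affine:
  assumes "smooth_fun f"
  shows "smooth_fun (\<lambda>x. f (a + c *\<^sub>R x))"
proof (rule smooth_fun_coinduct[of _ "{(\<lambda>x. g (a + c *\<^sub>R x)) | g. smooth_fun g}"])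
  fix g :: "'a \<Rightarrow> real" and i x :: 'a
  assume "g \<in> {(\<lambda>x. g (a + c *\<^sub>R x)) | g. smooth_fun g}"
  then obtain h where h: "smooth_fun h" "g = (\<lambda>x. h (a + c *\<^sub>R x))" by blast
  then show "g differentiable (at x)"
    by (auto intro: has_derivative_imp_differentiable[OF has_derivative_affine_comp])
  assume i: "i \<in> Basis"
  have "smooth_fun (\<lambda>y. c * pd i h y)" using h i by (intro smooth_intros)
  then show "pd i g \<in> {(\<lambda>x. g (a + c *\<^sub>R x)) | g. smooth_fun g}"
    unfolding h(2) pd_affine[OF h(1) i] by (intro CollectI exI[of _ "\<lambda>y. c * pd i h y"]) simp
next
  show "(\<lambda>x. f (a + c *\<^sub>R x)) \<in> {(\<lambda>x. g (a + c *\<^sub>R x)) | g. smooth_fun g}"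
    by (intro CollectI exI[of _ f]) (simp add: assms)
qed

lemma has_derivative_real_comp:
  fixes F :: "real \<Rightarrow> real"
  assumes "smooth_fun F" "smooth_fun f"
  shows "((\<lambda>x. F (f x)) has_derivative (\<lambda>h. (\<Sum>i\<in>Basis. (h \<bullet> i) * pd i f x) * pd 1 F (f x))) (at x)"
  using has_derivative_compose[OF smooth_has_derivative[OF assms(2)] smooth_has_derivative[OF assms(1)]]
  by simp

lemma pd_comp:
  fixes F :: "real \<Rightarrow> real"
  assumes "smooth_fun F" "smooth_fun f" "i \<in> Basis"
  shows "pd i (\<lambda>x. F (f x)) = (\<lambda>x. pd 1 F (f x) * pd i f x)"
proof
  fix x
  have "pd i (\<lambda>x. F (f x)) x = (\<Sum>j\<in>Basis. (i \<bullet> j) * pd j f x) * pd 1 F (f x)"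
    by (rule pd_eqI[OF has_derivative_real_comp[OF assms(1,2)]])
  also have "(\<Sum>j\<in>Basis. (i \<bullet> j) * pd j f x) = (\<Sum>j\<in>Basis. if j = i then pd i f x else 0)"
    using assms(3) by (intro sum.cong) (auto simp: inner_Basis)
  finally show "pd i (\<lambda>x. F (f x)) x = pd 1 F (f x) * pd i f x" using assms(3) by simp
qed

lemma smooth_comp:
  fixes F :: "real \<Rightarrow> real"
  assumes "smooth_fun F" "smooth_fun f"
  shows "smooth_fun (\<lambda>x. F (f x))"
proof -
  \<comment> \<open>The chain rule yields a composition \<open>G (f x)\<close> times
    \<open>pd i f\<close>. The second factor is not a composition with f, so all smooth functions
    are added to the generators.\<close>
  let ?B = "{(\<lambda>x. G (f x)) | G :: real \<Rightarrow> real. smooth_fun G} \<union> {h. smooth_fun h}"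
  show ?thesis
  proof (rule smooth_alg[of ?B])
    fix g :: "'a \<Rightarrow> real" and i x :: 'a
    assume g: "g \<in> ?B"
    then show "g differentiable (at x)"
      using has_derivative_real_comp[OF _ assms(2)] smooth_fun_differentiable by (auto intro: has_derivative_imp_differentiable)
    assume i: "i \<in> Basis"
    show "pd i g \<in> alg ?B"
    proof -
      consider G where "smooth_fun G" "g = (\<lambda>x. G (f x))" | "smooth_fun g" using g by blast
      then show ?thesis
      proof cases
        case 1
        have "(\<lambda>x. pd 1 G (f x)) \<in> ?B" "pd i f \<in> ?B"
          using 1 smooth_fun_pd[of G "1::real"] smooth_fun_pd[OF assms(2) i] by auto
        then show ?thesis
          unfolding 1(2) pd_comp[OF 1(1) assms(2) i] by (intro alg.mult alg.gen)
      next
        case 2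
        then show ?thesis using smooth_fun_pd[OF _ i] by (auto intro: alg.gen)
      qed
    qed
  qed (use assms in \<open>auto intro: alg.gen\<close>)
qed

section \<open>The flat function exp(-1/s) and smooth bumps on balls\<close>

definition bump :: "real \<Rightarrow> real" where
  "bump s = (if s > 0 then exp (- 1 / s) else 0)"

lemma bump_power_has_derivative:
  fixes s :: real
  shows "((\<lambda>s. if s > 0 then inverse s ^ m * exp (- 1 / s) else 0) has_real_derivative
      (if s > 0 then - (real m * (inverse s ^ (m+1) * exp (- 1 / s))) + inverse s ^ (m+2) * exp (- 1 / s) else 0)) (at s)"
proof (cases s "0::real" rule: linorder_cases)
  case less
  have "((\<lambda>s. if s > 0 then inverse s ^ m * exp (- 1 / s) else 0) has_real_derivative 0) (at s)"
    by (rule has_field_derivative_transform_within_open[of "\<lambda>_. 0" 0 s "{..<0}"]) (use less in simp_all)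
  then show ?thesis using less by simp
next
  case greater
  have "((\<lambda>s. inverse s ^ m * exp (- 1 / s)) has_real_derivative
      (- (real m * (inverse s ^ (m+1) * exp (- 1 / s))) + inverse s ^ (m+2) * exp (- 1 / s))) (at s)"
  proof -
    have "((\<lambda>s. inverse s ^ m) has_real_derivative real m * (- (inverse s * inverse s) * inverse s ^ (m - 1))) (at s)"
      using DERIV_chain2[OF DERIV_pow[of m "inverse s"] DERIV_inverse[of s]] greater by (simp add: mult_ac)
    moreover have "((\<lambda>s. exp (- 1 / s)) has_real_derivative exp (- 1 / s) * (inverse s * inverse s)) (at s)"
      using greater by (auto intro!: derivative_eq_intros simp: field_simps)
    ultimately have D: "((\<lambda>s. inverse s ^ m * exp (- 1 / s)) has_real_derivative
       real m * (- (inverse s * inverse s) * inverse s ^ (m - 1)) * exp (- 1 / s)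
        + exp (- 1 / s) * (inverse s * inverse s) * inverse s ^ m) (at s)"
      by (rule DERIV_mult)
    have E: "real m * (- (inverse s * inverse s) * inverse s ^ (m - 1)) = - (real m * inverse s ^ (m+1))"
      by (cases m) simp_all
    have "real m * (- (inverse s * inverse s) * inverse s ^ (m - 1)) * exp (- 1 / s)
        + exp (- 1 / s) * (inverse s * inverse s) * inverse s ^ m
      = - (real m * (inverse s ^ (m+1) * exp (- 1 / s))) + inverse s ^ (m+2) * exp (- 1 / s)"
      unfolding E by (simp add: mult_ac)
    with D show ?thesis by (simp only:)
  qed
  then have "((\<lambda>s. if s > 0 then inverse s ^ m * exp (- 1 / s) else 0) has_real_derivative
      (- (real m * (inverse s ^ (m+1) * exp (- 1 / s))) + inverse s ^ (m+2) * exp (- 1 / s))) (at s)"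
    by (rule has_field_derivative_transform_within_open[of _ _ _ "{0<..}"]) (use greater in simp_all)
  then show ?thesis using greater by simp
next
  case equal
  \<comment> \<open>The difference quotient at 0 of the function with exponent m is the function
    with exponent m + 1. With y = 1/h its limit from the right is that of y^(m+1) / exp y.\<close>
  let ?q = "\<lambda>h::real. if h > 0 then inverse h ^ (m+1) * exp (- 1 / h) else 0"
  have "((\<lambda>y::real. y ^ (m+1) / exp y) \<longlongrightarrow> 0) at_top" by (rule tendsto_power_div_exp_0)
  then have "((\<lambda>h::real. inverse h ^ (m+1) / exp (inverse h)) \<longlongrightarrow> 0) (at_right 0)"
    by (rule filterlim_compose[OF _ filterlim_inverse_at_top_right])
  moreover have "eventually (\<lambda>h::real. inverse h ^ (m+1) / exp (inverse h) = ?q h) (at_right 0)"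
    using eventually_at_right_less[of "0::real"]
    by eventually_elim (simp add: exp_minus divide_inverse)
  ultimately have R: "(?q \<longlongrightarrow> 0) (at_right 0)" by (rule Lim_transform_eventually)
  have "((\<lambda>h::real. 0::real) \<longlongrightarrow> 0) (at_left 0)" by simp
  moreover have "eventually (\<lambda>h::real. 0 = ?q h) (at_left 0)"
    by (auto simp: eventually_at_filter)
  ultimately have L: "(?q \<longlongrightarrow> 0) (at_left 0)" by (rule Lim_transform_eventually)
  have "(?q \<longlongrightarrow> 0) (at 0)" using L R by (rule filterlim_split_at)
  moreover have "?q h = ((if 0 + h > 0 then inverse (0+h) ^ m * exp (- 1 / (0+h)) else 0) - 0) / h" for h
    by (simp add: divide_inverse)
  ultimately show ?thesis
    unfolding DERIV_def equal by simp
qed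

text \<open>The derivative of \<open>inverse s ^ m * exp (- 1 / s)\<close> combines the functions
  with exponents m + 1 and m + 2, so this family and the constants generate an algebra closed under
  differentiation; \<open>bump\<close> is the member m = 0.\<close>

lemma smooth_bump: "smooth_fun bump"
proof -
  let ?e = "\<lambda>m::nat. \<lambda>s::real. if s > 0 then inverse s ^ m * exp (- 1 / s) else 0"
  let ?B = "range ?e \<union> range (\<lambda>c x. c)"
  have D: "(?e m has_derivative (\<lambda>h. h * (if s > 0 then - (real m * (inverse s ^ (m+1) * exp (- 1 / s))) + inverse s ^ (m+2) * exp (- 1 / s) else 0))) (at s)" for m s
    using bump_power_has_derivative[of m s] by (simp add: has_field_derivative_def mult.commute[of _ "(if _ then _ else _)"])
  have "smooth_fun (?e 0)"
  proof (rule smooth_alg[of ?B])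
    fix g :: "real \<Rightarrow> real" and i x :: real
    assume g: "g \<in> ?B"
    then show "g differentiable (at x)"
      using D by (auto intro: has_derivative_imp_differentiable)
    assume i: "i \<in> Basis"
    have "pd 1 (?e m) = (\<lambda>s. (- real m) * ?e (m+1) s + ?e (m+2) s)" for m
      by (rule ext, subst pd_eqI[OF D]) auto
    moreover have "(\<lambda>s. (- real m) * ?e (m+1) s + ?e (m+2) s) \<in> alg ?B" for m
      by (intro alg.add alg.mult) (rule alg.gen; blast)+
    ultimately have "pd 1 (?e m) \<in> alg ?B" for m by simp
    moreover have "(\<lambda>x. 0) \<in> alg ?B" by (rule alg.gen) blast
    moreover have "i = 1" using i by simp
    ultimately show "pd i g \<in> alg ?B"
      using g by (elim UnE imageE) (simp_all del: One_nat_def)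
  qed (auto intro: alg.gen)
  moreover have "?e 0 = bump" by (auto simp: bump_def)
  ultimately show ?thesis by simp
qed

lemma bump_nonneg: "0 \<le> bump s" and bump_le1: "bump s \<le> 1"
  and bump_pos_iff: "bump s > 0 \<longleftrightarrow> s > 0" and bump_eq0: "s \<le> 0 \<Longrightarrow> bump s = 0"
  by (auto simp: bump_def divide_simps)

text \<open>Squaring the norm makes the argument a polynomial, hence smooth also at the
  centre.\<close>

definition ball_bump :: "'a::euclidean_space \<Rightarrow> real \<Rightarrow> 'a \<Rightarrow> real" where
  "ball_bump p r = (\<lambda>x. bump (r\<^sup>2 - (norm (x - p))\<^sup>2))"

lemma smooth_ball_bump: "smooth_fun (ball_bump p r)"
proof -
  have "(norm (x - p))\<^sup>2 = (\<Sum>i\<in>Basis. (x \<bullet> i - p \<bullet> i) * (x \<bullet> i - p \<bullet> i))" for x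
    unfolding power2_norm_eq_inner by (subst euclidean_inner) (simp add: inner_diff_left)
  then show ?thesis
    unfolding ball_bump_def by (auto intro!: smooth_comp[OF smooth_bump] smooth_intros)
qed

lemma ball_bump_nonneg: "0 \<le> ball_bump p r x" and ball_bump_le1: "ball_bump p r x \<le> 1"
  by (auto simp: ball_bump_def bump_nonneg bump_le1)

lemma ball_bump_pos_iff:
  assumes "r > 0"
  shows "ball_bump p r x > 0 \<longleftrightarrow> x \<in> ball p r"
proof -
  have "norm (x - p) < r \<longleftrightarrow> (norm (x - p))\<^sup>2 < r\<^sup>2"
    using assms by (simp add: power_mono_iff flip: not_le)
  then show ?thesis
    unfolding ball_bump_def bump_pos_iff mem_ball dist_norm by (simp add: norm_minus_commute)
qed

section \<open>Square-integrable functions\<close>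

lemma L2_measurable: "L2 \<Omega> f \<Longrightarrow> f \<in> borel_measurable (lebesgue_on \<Omega>)"
  and L2_integrable_sq: "L2 \<Omega> f \<Longrightarrow> integrable (lebesgue_on \<Omega>) (\<lambda>x. (f x)\<^sup>2)"
  by (auto simp: L2_def)

lemma L2_mult_integrable:
  assumes "L2 \<Omega> f" "L2 \<Omega> g"
  shows "integrable (lebesgue_on \<Omega>) (\<lambda>x. f x * g x)"
proof (rule Bochner_Integration.integrable_bound)
  show "integrable (lebesgue_on \<Omega>) (\<lambda>x. (f x)\<^sup>2 + (g x)\<^sup>2)"
    using assms by (simp add: L2_def)
  show "(\<lambda>x. f x * g x) \<in> borel_measurable (lebesgue_on \<Omega>)"
    using assms by (auto simp: L2_def)
  have "\<bar>a * b\<bar> \<le> a\<^sup>2 + b\<^sup>2" for a b :: real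
  proof -
    have "0 \<le> (\<bar>a\<bar> - \<bar>b\<bar>)\<^sup>2" by simp
    then have "2 * (\<bar>a\<bar> * \<bar>b\<bar>) \<le> a\<^sup>2 + b\<^sup>2" by (simp add: power2_diff)
    moreover have "0 \<le> \<bar>a\<bar> * \<bar>b\<bar>" by simp
    ultimately show ?thesis unfolding abs_mult by linarith
  qed
  then show "AE x in lebesgue_on \<Omega>. norm (f x * g x) \<le> norm ((f x)\<^sup>2 + (g x)\<^sup>2)"
    by (intro AE_I2) (simp add: abs_of_nonneg)
qed

lemma L2_add:
  assumes "L2 \<Omega> f" "L2 \<Omega> g"
  shows "L2 \<Omega> (\<lambda>x. f x + g x)"
  using assms L2_mult_integrable[OF assms] unfolding L2_def power2_sum
  by (auto simp: mult.assoc)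

lemma L2_cmult: "L2 \<Omega> f \<Longrightarrow> L2 \<Omega> (\<lambda>x. c * f x)"
  unfolding L2_def power_mult_distrib by auto

lemma L2_uminus: "L2 \<Omega> f \<Longrightarrow> L2 \<Omega> (\<lambda>x. - f x)"
  using L2_cmult[of \<Omega> f "-1"] by simp

lemma L2_diff: "L2 \<Omega> f \<Longrightarrow> L2 \<Omega> g \<Longrightarrow> L2 \<Omega> (\<lambda>x. f x - g x)"
  using L2_add[OF _ L2_uminus] by fastforce

lemma L2_zero: "L2 \<Omega> (\<lambda>x. 0)" by (simp add: L2_def)

lemma L2_sum: "(\<And>k. k \<in> A \<Longrightarrow> L2 \<Omega> (f k)) \<Longrightarrow> L2 \<Omega> (\<lambda>x. \<Sum>k\<in>A. f k x)"
  by (induction A rule: infinite_finite_induct) (auto intro: L2_add L2_zero)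

lemma L2_bounded_mult:
  assumes "L2 \<Omega> f" "h \<in> borel_measurable (lebesgue_on \<Omega>)" "AE x in lebesgue_on \<Omega>. \<bar>h x\<bar> \<le> B"
  shows "L2 \<Omega> (\<lambda>x. h x * f x)"
    and "l2norm \<Omega> (\<lambda>x. h x * f x) \<le> B * l2norm \<Omega> f"
proof -
  have I: "integrable (lebesgue_on \<Omega>) (\<lambda>x. B\<^sup>2 * (f x)\<^sup>2)" using assms by (simp add: L2_def)
  have M: "(\<lambda>x. (h x * f x)\<^sup>2) \<in> borel_measurable (lebesgue_on \<Omega>)"
    using assms by (auto simp: L2_def)
  have le: "(h x * f x)\<^sup>2 \<le> B\<^sup>2 * (f x)\<^sup>2" if "\<bar>h x\<bar> \<le> B" for x
    using that unfolding power_mult_distrib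
    by (intro mult_right_mono) (auto simp: abs_le_square_iff[symmetric])
  then have AE: "AE x in lebesgue_on \<Omega>. (h x * f x)\<^sup>2 \<le> B\<^sup>2 * (f x)\<^sup>2"
    using assms(3) by (rule eventually_mono[rotated]) 
  have I2: "integrable (lebesgue_on \<Omega>) (\<lambda>x. (h x * f x)\<^sup>2)"
    by (rule Bochner_Integration.integrable_bound[OF I M]) (use AE in \<open>auto simp: abs_of_nonneg\<close>)
  then show "L2 \<Omega> (\<lambda>x. h x * f x)" using assms by (auto simp: L2_def)
  have "(\<integral>x. (h x * f x)\<^sup>2 \<partial>lebesgue_on \<Omega>) \<le> (\<integral>x. B\<^sup>2 * (f x)\<^sup>2 \<partial>lebesgue_on \<Omega>)"
    by (rule integral_mono_AE[OF I2 I AE])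
  then have "l2norm \<Omega> (\<lambda>x. h x * f x) \<le> \<bar>B\<bar> * l2norm \<Omega> f"
    unfolding l2norm_def by (metis Bochner_Integration.integral_mult_right_zero real_sqrt_abs real_sqrt_le_mono real_sqrt_mult)
  \<comment> \<open>No sign is assumed for B. A negative almost everywhere bound on an absolute
    value is possible only on a null space, where the norm vanishes.\<close>
  moreover have "\<bar>B\<bar> * l2norm \<Omega> f = B * l2norm \<Omega> f"
  proof (cases "B < 0")
    case True
    have "AE x in lebesgue_on \<Omega>. False" using assms(3) by eventually_elim (use True in auto)
    then have "(\<integral>x. (f x)\<^sup>2 \<partial>lebesgue_on \<Omega>) = (\<integral>x. 0 \<partial>lebesgue_on \<Omega>)"
      using assms(1) by (intro integral_cong_AE) (auto simp: L2_def)
    then show ?thesis by (simp add: l2norm_def)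
  qed simp
  ultimately show "l2norm \<Omega> (\<lambda>x. h x * f x) \<le> B * l2norm \<Omega> f" by simp
qed

lemma l2norm_nonneg: "0 \<le> l2norm \<Omega> f"
  by (simp add: l2norm_def)

lemma l2norm_sq: "(l2norm \<Omega> f)\<^sup>2 = (\<integral>x. (f x)\<^sup>2 \<partial>lebesgue_on \<Omega>)"
  by (simp add: l2norm_def)

lemma l2norm_cmult: "l2norm \<Omega> (\<lambda>x. c * f x) = \<bar>c\<bar> * l2norm \<Omega> f"
  by (simp add: l2norm_def power_mult_distrib real_sqrt_mult)

lemma l2norm_uminus: "l2norm \<Omega> (\<lambda>x. - f x) = l2norm \<Omega> f"
  by (simp add: l2norm_def)

lemma l2norm_cong_AE:
  assumes "L2 \<Omega> f" "L2 \<Omega> g" "AE x in lebesgue_on \<Omega>. f x = g x"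
  shows "l2norm \<Omega> f = l2norm \<Omega> g"
  unfolding l2norm_def using assms
  by (intro arg_cong[of _ _ sqrt] integral_cong_AE) (auto simp: L2_def)

lemma l2norm_eq0:
  assumes "L2 \<Omega> f" "l2norm \<Omega> f = 0"
  shows "AE x in lebesgue_on \<Omega>. f x = 0"
proof -
  have "(\<integral>x. (f x)\<^sup>2 \<partial>lebesgue_on \<Omega>) = 0" using assms(2) l2norm_sq by (metis power_zero_numeral)
  then have "AE x in lebesgue_on \<Omega>. (f x)\<^sup>2 = 0"
    using integral_nonneg_eq_0_iff_AE[OF L2_integrable_sq[OF assms(1)]] by simp
  then show ?thesis by simp
qed

lemma l2_Cauchy_Schwarz:
  assumes "L2 \<Omega> f" "L2 \<Omega> g"
  shows "\<bar>\<integral>x. f x * g x \<partial>lebesgue_on \<Omega>\<bar> \<le> l2norm \<Omega> f * l2norm \<Omega> g"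
proof -
  let ?p = "\<integral>x. f x * g x \<partial>lebesgue_on \<Omega>"
  define a b where "a = (l2norm \<Omega> f)\<^sup>2" "b = (l2norm \<Omega> g)\<^sup>2"
  note int = L2_mult_integrable[OF assms] L2_integrable_sq[OF assms(1)] L2_integrable_sq[OF assms(2)]
  \<comment> \<open>The squared norm of s f - t g as a quadratic form in s and t. Cauchy-Schwarz
    follows from s = b and t = p, the value of the inner product.\<close>
  have Q: "0 \<le> s\<^sup>2 * a - 2 * (s * t) * ?p + t\<^sup>2 * b" for s t
  proof -
    have "(\<integral>x. (s * f x - t * g x)\<^sup>2 \<partial>lebesgue_on \<Omega>)
        = (\<integral>x. s\<^sup>2 * (f x)\<^sup>2 - 2 * (s * t) * (f x * g x) + t\<^sup>2 * (g x)\<^sup>2 \<partial>lebesgue_on \<Omega>)"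
      by (rule Bochner_Integration.integral_cong) (auto simp: power2_diff power_mult_distrib)
    also have "\<dots> = s\<^sup>2 * a - 2 * (s * t) * ?p + t\<^sup>2 * b"
      using int by (simp add: a_b_def l2norm_sq)
    finally show ?thesis
      using Bochner_Integration.integral_nonneg[of "lebesgue_on \<Omega>" "\<lambda>x. (s * f x - t * g x)\<^sup>2"] by simp
  qed
  have "?p\<^sup>2 \<le> a * b"
  proof (cases "b = 0")
    case True
    have "?p = 0"
    proof (rule ccontr)
      assume "?p \<noteq> 0"
      \<comment> \<open>With b = 0 the form is affine in t, and t = (a + 1) / p makes it - a - 2,
        which is negative.\<close>
      have "0 \<le> a - 2 * ((a + 1) / ?p) * ?p"
        using Q[of 1 "(a+1) / ?p"] True by simp
      also have "\<dots> = - a - 2" using \<open>?p \<noteq> 0\<close> by (simp add: field_simps)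
      finally show False using a_b_def(1) zero_le_power2[of "l2norm \<Omega> f"] by linarith
    qed
    then show ?thesis using True by simp
  next
    case False
    then have "b > 0" by (simp add: a_b_def order_le_less l2norm_nonneg)
    have "0 \<le> b\<^sup>2 * a - 2 * (b * ?p) * ?p + ?p\<^sup>2 * b" by (rule Q)
    also have "\<dots> = b * (a * b - ?p\<^sup>2)" by (simp add: power2_eq_square algebra_simps)
    finally show ?thesis using \<open>b > 0\<close> by (simp add: zero_le_mult_iff)
  qed
  then have "?p\<^sup>2 \<le> (l2norm \<Omega> f * l2norm \<Omega> g)\<^sup>2" by (simp add: a_b_def power_mult_distrib)
  then show ?thesis by (metis abs_le_square_iff abs_of_nonneg l2norm_nonneg mult_nonneg_nonneg)
qed

lemma l2norm_triangle:
  assumes "L2 \<Omega> f" "L2 \<Omega> g"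
  shows "l2norm \<Omega> (\<lambda>x. f x + g x) \<le> l2norm \<Omega> f + l2norm \<Omega> g"
proof (rule power2_le_imp_le)
  note int = L2_mult_integrable[OF assms] L2_integrable_sq[OF assms(1)] L2_integrable_sq[OF assms(2)]
  have "(l2norm \<Omega> (\<lambda>x. f x + g x))\<^sup>2 = (\<integral>x. (f x)\<^sup>2 + (g x)\<^sup>2 + 2 * (f x * g x) \<partial>lebesgue_on \<Omega>)"
    unfolding l2norm_sq by (rule Bochner_Integration.integral_cong) (auto simp: power2_sum)
  also have "\<dots> = (l2norm \<Omega> f)\<^sup>2 + (l2norm \<Omega> g)\<^sup>2 + 2 * (\<integral>x. f x * g x \<partial>lebesgue_on \<Omega>)"
    using int by (simp add: l2norm_sq)
  also have "\<dots> \<le> (l2norm \<Omega> f + l2norm \<Omega> g)\<^sup>2"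
    using l2_Cauchy_Schwarz[OF assms] by (simp add: power2_sum)
  finally show "(l2norm \<Omega> (\<lambda>x. f x + g x))\<^sup>2 \<le> (l2norm \<Omega> f + l2norm \<Omega> g)\<^sup>2" .
qed (simp add: l2norm_nonneg)

lemma l2norm_triangle_diff:
  assumes "L2 \<Omega> f" "L2 \<Omega> g"
  shows "l2norm \<Omega> (\<lambda>x. f x - g x) \<le> l2norm \<Omega> f + l2norm \<Omega> g"
  using l2norm_triangle[OF assms(1) L2_uminus[OF assms(2)]] by (simp add: l2norm_uminus)

lemma l2norm_sum:
  assumes "\<And>k. k \<in> A \<Longrightarrow> L2 \<Omega> (f k)"
  shows "l2norm \<Omega> (\<lambda>x. \<Sum>k\<in>A. f k x) \<le> (\<Sum>k\<in>A. l2norm \<Omega> (f k))"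
  using assms
proof (induction A rule: infinite_finite_induct)
  case (insert k A)
  then have "l2norm \<Omega> (\<lambda>x. \<Sum>k\<in>insert k A. f k x) = l2norm \<Omega> (\<lambda>x. f k x + (\<Sum>k\<in>A. f k x))" by simp
  also have "\<dots> \<le> l2norm \<Omega> (f k) + l2norm \<Omega> (\<lambda>x. \<Sum>k\<in>A. f k x)"
    using insert.prems by (intro l2norm_triangle L2_sum) auto
  also have "\<dots> \<le> l2norm \<Omega> (f k) + (\<Sum>k\<in>A. l2norm \<Omega> (f k))" using insert by auto
  finally show ?case using insert by simp
qed (auto simp: l2norm_def)

text \<open>Expand F G - f g as (F - f)(G - g) + (F - f) g + f (G - g) and apply Cauchy-Schwarz to
  each term. The filter is arbitrary because the lemma serves mollification sequences, difference
  quotients in time and the limit of large times.\<close>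

lemma tendsto_l2_inner:
  assumes f: "((\<lambda>s. l2norm \<Omega> (\<lambda>x. F s x - f x)) \<longlongrightarrow> 0) net"
    and g: "((\<lambda>s. l2norm \<Omega> (\<lambda>x. G s x - g x)) \<longlongrightarrow> 0) net"
    and L: "L2 \<Omega> f" "L2 \<Omega> g" "eventually (\<lambda>s. L2 \<Omega> (F s)) net" "eventually (\<lambda>s. L2 \<Omega> (G s)) net"
  shows "((\<lambda>s. \<integral>x. F s x * G s x \<partial>lebesgue_on \<Omega>) \<longlongrightarrow> (\<integral>x. f x * g x \<partial>lebesgue_on \<Omega>)) net"
proof -
  let ?I = "\<lambda>f. \<integral>x. f x \<partial>lebesgue_on \<Omega>"
  let ?B = "\<lambda>s. l2norm \<Omega> (\<lambda>x. F s x - f x) * l2norm \<Omega> (\<lambda>x. G s x - g x)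
        + l2norm \<Omega> (\<lambda>x. F s x - f x) * l2norm \<Omega> g + l2norm \<Omega> f * l2norm \<Omega> (\<lambda>x. G s x - g x)"
  have "(?B \<longlongrightarrow> 0 * 0 + 0 * l2norm \<Omega> g + l2norm \<Omega> f * 0) net"
    by (intro tendsto_intros f g)
  then have B: "(?B \<longlongrightarrow> 0) net" by simp
  have "eventually (\<lambda>s. norm (?I (\<lambda>x. F s x * G s x) - ?I (\<lambda>x. f x * g x)) \<le> ?B s) net"
    using L(3,4)
  proof eventually_elim
    case (elim s)
    have L': "L2 \<Omega> (\<lambda>x. F s x - f x)" "L2 \<Omega> (\<lambda>x. G s x - g x)" using elim L L2_diff by blast+
    have "?I (\<lambda>x. F s x * G s x) = ?I (\<lambda>x. (F s x - f x) * (G s x - g x) + (F s x - f x) * g x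
        + f x * (G s x - g x) + f x * g x)"
      by (rule Bochner_Integration.integral_cong) (auto simp: algebra_simps)
    also have "\<dots> = ?I (\<lambda>x. (F s x - f x) * (G s x - g x)) + ?I (\<lambda>x. (F s x - f x) * g x)
        + ?I (\<lambda>x. f x * (G s x - g x)) + ?I (\<lambda>x. f x * g x)"
      by (simp add: L2_mult_integrable L' L del: mult_minus_right right_diff_distrib left_diff_distrib)
    finally show ?case
      using l2_Cauchy_Schwarz[OF L'] l2_Cauchy_Schwarz[OF L'(1) L(2)] l2_Cauchy_Schwarz[OF L(1) L'(2)]
      by (simp only: real_norm_def)
  qed
  then have "((\<lambda>s. ?I (\<lambda>x. F s x * G s x) - ?I (\<lambda>x. f x * g x)) \<longlongrightarrow> 0) net"
    by (rule Lim_null_comparison[OF _ B])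
  then show ?thesis by (simp add: LIM_zero_iff)
qed

lemma finite_measure_lebesgue_on_bounded:
  "bounded \<Omega> \<Longrightarrow> \<Omega> \<in> sets lebesgue \<Longrightarrow> finite_measure (lebesgue_on \<Omega>)"
  by (simp add: bounded_set_imp_lmeasurable finite_measure_lebesgue_on)

lemma L2_const:
  assumes "bounded \<Omega>" "\<Omega> \<in> sets lebesgue"
  shows "L2 \<Omega> (\<lambda>x. c)"
proof -
  interpret finite_measure "lebesgue_on \<Omega>" by (rule finite_measure_lebesgue_on_bounded[OF assms])
  show ?thesis by (simp add: L2_def)
qed

lemma L2_bounded:
  assumes "bounded \<Omega>" "\<Omega> \<in> sets lebesgue" "f \<in> borel_measurable (lebesgue_on \<Omega>)"
    "AE x in lebesgue_on \<Omega>. \<bar>f x\<bar> \<le> B"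
  shows "L2 \<Omega> f"
  using L2_bounded_mult(1)[OF L2_const[OF assms(1,2), of 1] assms(3,4)] by simp

lemma L2_integrable:
  assumes "bounded \<Omega>" "\<Omega> \<in> sets lebesgue" "L2 \<Omega> f"
  shows "integrable (lebesgue_on \<Omega>) f"
    and "\<bar>\<integral>x. f x \<partial>lebesgue_on \<Omega>\<bar> \<le> l2norm \<Omega> (\<lambda>x. 1) * l2norm \<Omega> f"
  using L2_mult_integrable[OF L2_const[OF assms(1,2), of 1] assms(3)]
    l2_Cauchy_Schwarz[OF L2_const[OF assms(1,2), of 1] assms(3)] by simp_all

section \<open>Test functions and convolution\<close>

lemma smooth_line_deriv:
  assumes "smooth_fun f"
  shows "((\<lambda>s. f (y + s *\<^sub>R h)) has_real_derivative (\<Sum>i\<in>Basis. (h \<bullet> i) * pd i f (y + s *\<^sub>R h))) (at s)"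
proof -
  have "((\<lambda>s. f (y + s *\<^sub>R h)) has_derivative
      (\<lambda>r. \<Sum>i\<in>Basis. ((r *\<^sub>R h) \<bullet> i) * pd i f (y + s *\<^sub>R h))) (at s)"
    by (rule has_derivative_compose[OF _ smooth_has_derivative[OF assms]])
      (auto intro!: derivative_eq_intros)
  then show ?thesis
    unfolding has_field_derivative_def
    by (rule has_derivative_eq_rhs) (auto simp: sum_distrib_left mult_ac intro!: sum.cong ext)
qed

lemma smooth_line_deriv_Basis:
  assumes "smooth_fun f" "i \<in> Basis"
  shows "((\<lambda>s. f (y + s *\<^sub>R i)) has_real_derivative pd i f (y + s *\<^sub>R i)) (at s)"
proof -
  have "(\<Sum>j\<in>Basis. (i \<bullet> j) * pd j f (y + s *\<^sub>R i)) = (\<Sum>j\<in>Basis. if j = i then pd i f (y + s *\<^sub>R i) else 0)"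
    using assms(2) by (intro sum.cong) (auto simp: inner_Basis)
  then show ?thesis using smooth_line_deriv[OF assms(1), of y i s] assms(2) by simp
qed

text \<open>Two uses of the mean value theorem: along i for the increment of f in direction j, then
  along j for the \<open>pd i f\<close> that results.\<close>

lemma smooth_double_difference:
  assumes f: "smooth_fun f" and i: "i \<in> Basis" and j: "j \<in> Basis" and h: "h > 0"
  shows "\<exists>a b. 0 < a \<and> a < h \<and> 0 < b \<and> b < h \<and>
     (f (x + h *\<^sub>R i + h *\<^sub>R j) - f (x + h *\<^sub>R i) - f (x + h *\<^sub>R j) + f x) / h\<^sup>2
      = pd j (pd i f) (x + a *\<^sub>R i + b *\<^sub>R j)"
proof -
  let ?g = "\<lambda>s. f ((x + h *\<^sub>R j) + s *\<^sub>R i) - f (x + s *\<^sub>R i)"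
  have "\<exists>a>0. a < h \<and> ?g h - ?g 0 = (h - 0) * (pd i f ((x + h *\<^sub>R j) + a *\<^sub>R i) - pd i f (x + a *\<^sub>R i))"
    using h by (intro MVT2 DERIV_diff smooth_line_deriv_Basis f i) auto
  then obtain a where a: "0 < a" "a < h"
    "?g h - ?g 0 = h * (pd i f ((x + h *\<^sub>R j) + a *\<^sub>R i) - pd i f (x + a *\<^sub>R i))" by auto
  let ?k = "\<lambda>s. pd i f ((x + a *\<^sub>R i) + s *\<^sub>R j)"
  have "\<exists>b>0. b < h \<and> ?k h - ?k 0 = (h - 0) * pd j (pd i f) ((x + a *\<^sub>R i) + b *\<^sub>R j)"
    using h by (intro MVT2 smooth_line_deriv_Basis smooth_fun_pd f i j) auto
  then obtain b where b: "0 < b" "b < h" "?k h - ?k 0 = h * pd j (pd i f) (x + a *\<^sub>R i + b *\<^sub>R j)" by auto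
  have "?g h - ?g 0 = h\<^sup>2 * pd j (pd i f) (x + a *\<^sub>R i + b *\<^sub>R j)"
    using a(3) b(3) by (simp add: add_ac power2_eq_square)
  then show ?thesis using a b h by (intro exI[of _ a] exI[of _ b]) (simp add: add_ac field_simps)
qed

lemma smooth_double_difference_limit:
  assumes f: "smooth_fun f" and i: "i \<in> Basis" and j: "j \<in> Basis"
  defines "h \<equiv> \<lambda>n. inverse (real (Suc n))"
  shows "(\<lambda>n. (f (x + h n *\<^sub>R i + h n *\<^sub>R j) - f (x + h n *\<^sub>R i) - f (x + h n *\<^sub>R j) + f x) / (h n)\<^sup>2)
     \<longlonglongrightarrow> pd j (pd i f) x"
proof -
  have h: "h n > 0" for n by (simp add: h_def)
  let ?D = "\<lambda>n. (f (x + h n *\<^sub>R i + h n *\<^sub>R j) - f (x + h n *\<^sub>R i) - f (x + h n *\<^sub>R j) + f x) / (h n)\<^sup>2"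
  have "\<forall>n. \<exists>a b. 0 < a \<and> a < h n \<and> 0 < b \<and> b < h n \<and> ?D n = pd j (pd i f) (x + a *\<^sub>R i + b *\<^sub>R j)"
    using smooth_double_difference[OF f i j h] by blast
  from choice[OF this] obtain a where "\<forall>n. \<exists>b. 0 < a n \<and> a n < h n \<and> 0 < b \<and> b < h n \<and>
      ?D n = pd j (pd i f) (x + a n *\<^sub>R i + b *\<^sub>R j)" ..
  from choice[OF this] obtain b where ab: "\<forall>n. 0 < a n \<and> a n < h n \<and> 0 < b n \<and> b n < h n \<and>
      ?D n = pd j (pd i f) (x + a n *\<^sub>R i + b n *\<^sub>R j)" ..
  have h0: "h \<longlonglongrightarrow> 0" unfolding h_def by (rule LIMSEQ_inverse_real_of_nat)
  have a0: "a \<longlonglongrightarrow> 0"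
    by (rule tendsto_sandwich[OF _ _ tendsto_const h0]) (use ab in \<open>auto simp: less_imp_le intro!: always_eventually\<close>)
  have b0: "b \<longlonglongrightarrow> 0"
    by (rule tendsto_sandwich[OF _ _ tendsto_const h0]) (use ab in \<open>auto simp: less_imp_le intro!: always_eventually\<close>)
  have "(\<lambda>n. x + a n *\<^sub>R i + b n *\<^sub>R j) \<longlonglongrightarrow> x + 0 *\<^sub>R i + 0 *\<^sub>R j"
    by (intro tendsto_intros a0 b0)
  then have L: "(\<lambda>n. x + a n *\<^sub>R i + b n *\<^sub>R j) \<longlonglongrightarrow> x" by simp
  have "isCont (pd j (pd i f)) x"
    using smooth_continuous[OF smooth_fun_pd[OF smooth_fun_pd[OF f i] j], of UNIV]
    by (simp add: continuous_on_eq_continuous_at)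
  from isCont_tendsto_compose[OF this L] show ?thesis
    using ab by simp
qed

text \<open>The second difference is symmetric in i and j, so both mixed derivatives are limits of
  the same sequence.\<close>

lemma pd_commute:
  assumes "smooth_fun f" "i \<in> Basis" "j \<in> Basis"
  shows "pd i (pd j f) = pd j (pd i f)"
proof
  fix x
  let ?h = "\<lambda>n. inverse (real (Suc n))"
  have eq: "(f (x + ?h n *\<^sub>R j + ?h n *\<^sub>R i) - f (x + ?h n *\<^sub>R j) - f (x + ?h n *\<^sub>R i) + f x) / (?h n)\<^sup>2
    = (f (x + ?h n *\<^sub>R i + ?h n *\<^sub>R j) - f (x + ?h n *\<^sub>R i) - f (x + ?h n *\<^sub>R j) + f x) / (?h n)\<^sup>2" for n
    by (simp add: add_ac)
  show "pd i (pd j f) x = pd j (pd i f) x"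
    using smooth_double_difference_limit[OF assms(1,3,2), of x] smooth_double_difference_limit[OF assms, of x]
    unfolding eq by (rule LIMSEQ_unique)
qed

section \<open>Test functions: support, bounds and Taylor expansion\<close>

lemma test_fnI:
  assumes "smooth_fun f" "compact K" "K \<subseteq> \<Omega>" "\<And>x. x \<notin> K \<Longrightarrow> f x = 0"
  shows "test_fn \<Omega> f"
proof -
  have "closure {x. f x \<noteq> 0} \<subseteq> K"
    using assms by (intro closure_minimal) (auto simp: compact_imp_closed)
  then show ?thesis
    unfolding test_fn_def using assms by (metis closed_closure compact_Int_closed inf.absorb_iff2 subset_trans)
qed

lemma test_fnE:
  assumes "test_fn \<Omega> f"
  obtains K where "smooth_fun f" "compact K" "K \<subseteq> \<Omega>" "\<And>x. x \<notin> K \<Longrightarrow> f x = 0"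
proof (rule that[of "closure {x. f x \<noteq> 0}"])
  show "f x = 0" if "x \<notin> closure {x. f x \<noteq> 0}" for x
    using that closure_subset[of "{x. f x \<noteq> 0}"] by blast
qed (use assms in \<open>auto simp: test_fn_def\<close>)

lemma test_fn_smooth: "test_fn \<Omega> f \<Longrightarrow> smooth_fun f"
  by (simp add: test_fn_def)

lemma pd_eq_0_off:
  assumes "\<And>x. x \<notin> K \<Longrightarrow> f x = 0" "closed K" "x \<notin> K"
  shows "pd i f x = 0"
proof (rule pd_eqI)
  show "(f has_derivative (\<lambda>h. 0)) (at x)"
    by (rule has_derivative_transform_within_open[of "\<lambda>_. 0" _ _ _ "- K"]) (use assms in auto)
qed

lemma test_fn_pd:
  assumes "test_fn \<Omega> f" "i \<in> Basis"
  shows "test_fn \<Omega> (pd i f)"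
  using assms(1)
proof (rule test_fnE)
  fix K assume "smooth_fun f" "compact K" "K \<subseteq> \<Omega>" "\<And>x. x \<notin> K \<Longrightarrow> f x = 0"
  then show ?thesis
    using assms(2) by (intro test_fnI[of _ K] smooth_fun_pd) (auto intro: pd_eq_0_off compact_imp_closed)
qed

lemma test_fn_mult:
  assumes "test_fn \<Omega> f" "smooth_fun g"
  shows "test_fn \<Omega> (\<lambda>x. f x * g x)" and "test_fn \<Omega> (\<lambda>x. g x * f x)"
proof -
  obtain K where "smooth_fun f" "compact K" "K \<subseteq> \<Omega>" "\<And>x. x \<notin> K \<Longrightarrow> f x = 0"
    using assms(1) test_fnE by blast
  then show "test_fn \<Omega> (\<lambda>x. f x * g x)" "test_fn \<Omega> (\<lambda>x. g x * f x)"
    using assms(2) by (auto intro!: test_fnI[of _ K] smooth_mult)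
qed

lemma test_fn_cmult: "test_fn \<Omega> f \<Longrightarrow> test_fn \<Omega> (\<lambda>x. c * f x)"
  by (rule test_fn_mult(2)[OF _ smooth_const])

lemma smooth_bounded_on_compact:
  assumes "smooth_fun f" "compact K"
  obtains B where "B \<ge> 0" "\<And>x. x \<in> K \<Longrightarrow> \<bar>f x\<bar> \<le> B"
proof -
  have "bounded (f ` K)"
    using assms by (intro compact_imp_bounded compact_continuous_image smooth_continuous)
  then obtain B where "\<And>x. x \<in> K \<Longrightarrow> \<bar>f x\<bar> \<le> B" by (auto simp: bounded_iff)
  then show ?thesis by (intro that[of "max B 0"]) (auto simp: le_max_iff_disj)
qed

lemma test_fn_bounded:
  assumes "test_fn \<Omega> f"
  obtains B where "B \<ge> 0" "\<And>x. \<bar>f x\<bar> \<le> B"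
proof -
  obtain K where K: "smooth_fun f" "compact K" "K \<subseteq> \<Omega>" "\<And>x. x \<notin> K \<Longrightarrow> f x = 0"
    using assms test_fnE by blast
  obtain B where "B \<ge> 0" "\<And>x. x \<in> K \<Longrightarrow> \<bar>f x\<bar> \<le> B"
    using smooth_bounded_on_compact[OF K(1,2)] by blast
  then show ?thesis using K(4) by (intro that[of B]) (metis abs_zero)+
qed

lemma test_fn_Lipschitz:
  assumes "test_fn \<Omega> f"
  obtains L where "L \<ge> 0" "\<And>x h. \<bar>f (x + h) - f x\<bar> \<le> L * norm h"
proof -
  have "\<exists>B\<ge>0. \<forall>x. \<bar>pd i f x\<bar> \<le> B" if "i \<in> Basis" for i
    using test_fn_bounded[OF test_fn_pd[OF assms that]] by metis
  then obtain B where B: "\<And>i. i \<in> Basis \<Longrightarrow> B i \<ge> 0" "\<And>i x. i \<in> Basis \<Longrightarrow> \<bar>pd i f x\<bar> \<le> B i"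
    by metis
  show ?thesis
  proof (rule that[of "\<Sum>i\<in>Basis. B i"])
    fix x h
    have "\<exists>z>0. z < 1 \<and> f (x + 1 *\<^sub>R h) - f (x + 0 *\<^sub>R h) = (1 - 0) * (\<Sum>i\<in>Basis. (h \<bullet> i) * pd i f (x + z *\<^sub>R h))"
      by (intro MVT2 smooth_line_deriv test_fn_smooth[OF assms]) auto
    then obtain z where "f (x + h) - f x = (\<Sum>i\<in>Basis. (h \<bullet> i) * pd i f (x + z *\<^sub>R h))" by auto
    moreover have "\<bar>\<Sum>i\<in>Basis. (h \<bullet> i) * pd i f (x + z *\<^sub>R h)\<bar> \<le> (\<Sum>i\<in>Basis. norm h * B i)"
      unfolding real_norm_def[symmetric]
      by (intro sum_norm_le) (auto simp: abs_mult intro!: mult_mono B Basis_le_norm)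
    ultimately show "\<bar>f (x + h) - f x\<bar> \<le> (\<Sum>i\<in>Basis. B i) * norm h"
      by (simp add: sum_distrib_left mult.commute)
  qed (auto intro: sum_nonneg B)
qed

text \<open>The first derivatives are Lipschitz with a constant valid everywhere, which makes the
  quadratic remainder uniform in x; this uniformity is what survives integration against another
  function.\<close>

lemma test_fn_Taylor:
  assumes "test_fn \<Omega> f"
  obtains M where "M \<ge> 0" "\<And>x h. \<bar>f (x + h) - f x - (\<Sum>i\<in>Basis. (h \<bullet> i) * pd i f x)\<bar> \<le> M * (norm h)\<^sup>2"
proof -
  have "\<exists>L\<ge>0. \<forall>x h. \<bar>pd i f (x + h) - pd i f x\<bar> \<le> L * norm h" if "i \<in> Basis" for i
    using test_fn_Lipschitz[OF test_fn_pd[OF assms that]] by metis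
  then obtain L where L: "\<And>i. i \<in> Basis \<Longrightarrow> L i \<ge> 0"
    "\<And>i x h. i \<in> Basis \<Longrightarrow> \<bar>pd i f (x + h) - pd i f x\<bar> \<le> L i * norm h"
    by metis
  show ?thesis
  proof (rule that[of "\<Sum>i\<in>Basis. L i"])
    fix x h
    have "\<exists>z>0. z < 1 \<and> f (x + 1 *\<^sub>R h) - f (x + 0 *\<^sub>R h) = (1 - 0) * (\<Sum>i\<in>Basis. (h \<bullet> i) * pd i f (x + z *\<^sub>R h))"
      by (intro MVT2 smooth_line_deriv test_fn_smooth[OF assms]) auto
    then obtain z where z: "0 < z" "z < 1" "f (x + h) - f x = (\<Sum>i\<in>Basis. (h \<bullet> i) * pd i f (x + z *\<^sub>R h))" by auto
    have "\<bar>pd i f (x + z *\<^sub>R h) - pd i f x\<bar> \<le> L i * norm h" if "i \<in> Basis" for i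
    proof -
      have "\<bar>pd i f (x + z *\<^sub>R h) - pd i f x\<bar> \<le> L i * norm (z *\<^sub>R h)" by (rule L(2)[OF that])
      also have "\<dots> \<le> L i * norm h"
        using z L(1)[OF that] by (intro mult_left_mono) (auto simp: mult_left_le_one_le)
      finally show ?thesis .
    qed
    then have "\<bar>\<Sum>i\<in>Basis. (h \<bullet> i) * (pd i f (x + z *\<^sub>R h) - pd i f x)\<bar> \<le> (\<Sum>i\<in>Basis. norm h * (L i * norm h))"
      unfolding real_norm_def[symmetric]
      by (intro sum_norm_le) (auto simp: abs_mult intro!: mult_mono Basis_le_norm)
    then show "\<bar>f (x + h) - f x - (\<Sum>i\<in>Basis. (h \<bullet> i) * pd i f x)\<bar> \<le> (\<Sum>i\<in>Basis. L i) * (norm h)\<^sup>2"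
      unfolding z(3) right_diff_distrib sum_subtractf
      by (simp add: sum_distrib_left power2_eq_square mult_ac)
  qed (auto intro: sum_nonneg L)
qed

section \<open>Convolution over a domain\<close>

lemma smooth_measurable:
  "smooth_fun f \<Longrightarrow> f \<in> borel_measurable (lebesgue_on \<Omega>)"
  using measurable_completion[of f lborel borel] smooth_borel[of f] measurable_restrict_space1 by auto

lemma smooth_shift_measurable:
  "smooth_fun k \<Longrightarrow> (\<lambda>y. k (x - y)) \<in> borel_measurable (lebesgue_on \<Omega>)"
  using smooth_measurable[OF smooth_affine[of k x "-1"]] by simp

text \<open>The integral runs over \<open>\<Omega>\<close> only: this is the convolution of k with
  the extension of g by zero.\<close>

definition conv :: "'a::euclidean_space set \<Rightarrow> ('a \<Rightarrow> real) \<Rightarrow> ('a \<Rightarrow> real) \<Rightarrow> 'a \<Rightarrow> real" where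
  "conv \<Omega> k g = (\<lambda>x. \<integral>y. k (x - y) * g y \<partial>lebesgue_on \<Omega>)"

lemma conv_integrable:
  assumes "test_fn A k" "integrable (lebesgue_on \<Omega>) g"
  shows "integrable (lebesgue_on \<Omega>) (\<lambda>y. k (x - y) * g y)"
proof -
  obtain B where B: "B \<ge> 0" "\<And>x. \<bar>k x\<bar> \<le> B" using test_fn_bounded[OF assms(1)] by blast
  show ?thesis
  proof (rule Bochner_Integration.integrable_bound)
    show "integrable (lebesgue_on \<Omega>) (\<lambda>y. B * g y)" using assms by simp
    show "(\<lambda>y. k (x - y) * g y) \<in> borel_measurable (lebesgue_on \<Omega>)"
      using smooth_shift_measurable[OF test_fn_smooth[OF assms(1)]] borel_measurable_integrable[OF assms(2)]
      by (intro borel_measurable_times)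
    show "AE y in lebesgue_on \<Omega>. norm (k (x - y) * g y) \<le> norm (B * g y)"
      using B by (auto simp: abs_mult intro!: mult_right_mono)
  qed
qed

text \<open>Integrating the uniform Taylor remainder of k against |g| bounds the error by a multiple
  of |h|^2, so no limit theorem for integrals is involved.\<close>

lemma conv_has_derivative:
  assumes k: "test_fn A k" and g: "integrable (lebesgue_on \<Omega>) g"
  shows "(conv \<Omega> k g has_derivative (\<lambda>h. \<Sum>i\<in>Basis. (h \<bullet> i) * conv \<Omega> (pd i k) g x)) (at x)"
proof -
  obtain M where M: "M \<ge> 0" "\<And>x h. \<bar>k (x + h) - k x - (\<Sum>i\<in>Basis. (h \<bullet> i) * pd i k x)\<bar> \<le> M * (norm h)\<^sup>2"
    using test_fn_Taylor[OF k] by blast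
  define G where "G = (\<integral>y. \<bar>g y\<bar> \<partial>lebesgue_on \<Omega>)"
  have "G \<ge> 0" by (simp add: G_def)
  have ga: "integrable (lebesgue_on \<Omega>) (\<lambda>y. \<bar>g y\<bar>)" using g by simp
  note I = conv_integrable[OF k g] conv_integrable[OF test_fn_pd[OF k] g]
  have bd: "\<bar>conv \<Omega> k g (x + h) - conv \<Omega> k g x - (\<Sum>i\<in>Basis. (h \<bullet> i) * conv \<Omega> (pd i k) g x)\<bar> \<le> M * G * (norm h)\<^sup>2" for h
  proof -
    have "conv \<Omega> k g (x + h) - conv \<Omega> k g x - (\<Sum>i\<in>Basis. (h \<bullet> i) * conv \<Omega> (pd i k) g x)
      = (\<integral>y. k (x + h - y) * g y - k (x - y) * g y - (\<Sum>i\<in>Basis. (h \<bullet> i) * (pd i k (x - y) * g y)) \<partial>lebesgue_on \<Omega>)"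
      unfolding conv_def using I by simp
    also have "\<bar>\<dots>\<bar> \<le> (\<integral>y. M * (norm h)\<^sup>2 * \<bar>g y\<bar> \<partial>lebesgue_on \<Omega>)"
      unfolding real_norm_def[symmetric]
    proof (rule Bochner_Integration.integral_norm_bound_integral)
      fix y
      have "k (x + h - y) * g y - k (x - y) * g y - (\<Sum>i\<in>Basis. (h \<bullet> i) * (pd i k (x - y) * g y))
        = (k (x - y + h) - k (x - y) - (\<Sum>i\<in>Basis. (h \<bullet> i) * pd i k (x - y))) * g y"
        by (simp add: left_diff_distrib sum_distrib_right mult.assoc diff_add_eq)
      also have "\<bar>\<dots>\<bar> \<le> (M * (norm h)\<^sup>2) * \<bar>g y\<bar>"
        unfolding abs_mult by (intro mult_right_mono M) auto
      finally show "norm (k (x + h - y) * g y - k (x - y) * g y - (\<Sum>i\<in>Basis. (h \<bullet> i) * (pd i k (x - y) * g y))) \<le> M * (norm h)\<^sup>2 * norm (g y)"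
        by simp
    qed (use I ga in auto)
    also have "\<dots> = M * G * (norm h)\<^sup>2" by (simp add: G_def)
    finally show ?thesis .
  qed
  show ?thesis
    unfolding has_derivative_at
  proof
    show "bounded_linear (\<lambda>h. \<Sum>i\<in>Basis. (h \<bullet> i) * conv \<Omega> (pd i k) g x)"
      by (intro bounded_linear_intros)
    have "((\<lambda>h. M * G * norm h) \<longlongrightarrow> M * G * norm (0::'a)) (at (0::'a))"
      by (rule tendsto_mult[OF tendsto_const tendsto_norm[OF tendsto_ident_at]])
    then have "((\<lambda>h. M * G * norm h) \<longlongrightarrow> 0) (at (0::'a))" by simp
    then show "(\<lambda>h. norm (conv \<Omega> k g (x + h) - conv \<Omega> k g x - (\<Sum>i\<in>Basis. (h \<bullet> i) * conv \<Omega> (pd i k) g x)) / norm h) \<midarrow>0\<rightarrow> 0"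
    proof (rule Lim_null_comparison[rotated], intro always_eventually allI)
      fix h :: 'a
      show "norm (norm (conv \<Omega> k g (x + h) - conv \<Omega> k g x - (\<Sum>i\<in>Basis. (h \<bullet> i) * conv \<Omega> (pd i k) g x)) / norm h) \<le> M * G * norm h"
        using bd[of h] by (cases "h = 0") (simp_all add: divide_le_eq power2_eq_square mult.assoc)
    qed
  qed
qed

lemma pd_conv:
  assumes "test_fn A k" "integrable (lebesgue_on \<Omega>) g" "i \<in> Basis"
  shows "pd i (conv \<Omega> k g) = conv \<Omega> (pd i k) g"
proof
  fix x
  have "pd i (conv \<Omega> k g) x = (\<Sum>j\<in>Basis. (i \<bullet> j) * conv \<Omega> (pd j k) g x)"
    by (rule pd_eqI[OF conv_has_derivative[OF assms(1,2)]])
  also have "\<dots> = (\<Sum>j\<in>Basis. if j = i then conv \<Omega> (pd i k) g x else 0)"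
    using assms(3) by (intro sum.cong) (auto simp: inner_Basis)
  finally show "pd i (conv \<Omega> k g) x = conv \<Omega> (pd i k) g x" using assms(3) by simp
qed

lemma smooth_conv:
  assumes "test_fn A k" "integrable (lebesgue_on \<Omega>) g"
  shows "smooth_fun (conv \<Omega> k g)"
proof (rule smooth_fun_coinduct[of _ "{conv \<Omega> k g | k. test_fn A k}"])
  fix f :: "'a \<Rightarrow> real" and i x :: 'a assume "f \<in> {conv \<Omega> k g | k. test_fn A k}"
  then obtain k where k: "test_fn A k" "f = conv \<Omega> k g" by blast
  then show "f differentiable (at x)"
    using has_derivative_imp_differentiable[OF conv_has_derivative[OF k(1) assms(2)]] by simp
  assume "i \<in> Basis"
  then show "pd i f \<in> {conv \<Omega> k g | k. test_fn A k}"
    using test_fn_pd[OF k(1)] k by (auto simp: pd_conv[OF k(1) assms(2)])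
qed (use assms in auto)

text \<open>The support lies in the sum of K and S, and only this sum has to stay inside
  \<open>A\<close>. Near a boundary, K may therefore reach further than the support of the
  convolution is allowed to.\<close>

lemma test_fn_conv:
  assumes k: "test_fn UNIV k" "\<And>z. z \<notin> S \<Longrightarrow> k z = 0" and S: "compact S"
    and g: "integrable (lebesgue_on \<Omega>) g" "\<And>y. y \<in> \<Omega> \<Longrightarrow> y \<notin> K \<Longrightarrow> g y = 0" and K: "compact K"
    and sub: "\<And>y z. y \<in> K \<Longrightarrow> z \<in> S \<Longrightarrow> y + z \<in> A"
  shows "test_fn A (conv \<Omega> k g)"
proof (rule test_fnI[OF smooth_conv[OF k(1) g(1)] compact_sums[OF K S]])
  show "{x + y |x y. x \<in> K \<and> y \<in> S} \<subseteq> A" using sub by auto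
  fix x assume x: "x \<notin> {x + y |x y. x \<in> K \<and> y \<in> S}"
  have "k (x - y) * g y = 0" if "y \<in> \<Omega>" for y
  proof (cases "y \<in> K")
    case True
    have "x - y \<notin> S"
    proof
      assume "x - y \<in> S"
      then have "y + (x - y) \<in> {x + y |x y. x \<in> K \<and> y \<in> S}" using True by blast
      then show False using x by simp
    qed
    then show ?thesis using k by simp
  qed (use g that in auto)
  then show "conv \<Omega> k g x = 0"
    unfolding conv_def by (subst Bochner_Integration.integral_cong[OF refl, of _ _ "\<lambda>_. 0"]) auto
qed

section \<open>Mollification\<close>

lemma borel_measurable_lebesgue_on:
  "f \<in> borel_measurable borel \<Longrightarrow> f \<in> borel_measurable (lebesgue_on \<Omega>)"
  by (intro measurable_restrict_space1 measurable_completion) simp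

section \<open>Integrals over a domain compared with integrals over the whole space\<close>

lemma integral_lebesgue_on_eq_lborel:
  fixes f :: "'a::euclidean_space \<Rightarrow> real"
  assumes "f \<in> borel_measurable borel" "\<And>x. x \<notin> \<Omega> \<Longrightarrow> f x = 0" "\<Omega> \<in> sets lebesgue"
  shows "(\<integral>x. f x \<partial>lebesgue_on \<Omega>) = (\<integral>x. f x \<partial>lborel)"
proof -
  have "(\<integral>x. f x \<partial>lebesgue_on \<Omega>) = (\<integral>x. indicator \<Omega> x *\<^sub>R f x \<partial>lebesgue)"
    using assms(3) by (intro integral_restrict_space) auto
  also have "\<dots> = (\<integral>x. f x \<partial>lebesgue)"
    using assms(2) by (intro Bochner_Integration.integral_cong) (auto simp: indicator_def)
  also have "\<dots> = (\<integral>x. f x \<partial>lborel)"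
    using assms(1) by (intro integral_completion) simp
  finally show ?thesis .
qed

lemma nn_integral_lebesgue_on_le_lborel:
  fixes f :: "'a::euclidean_space \<Rightarrow> ennreal"
  assumes "f \<in> borel_measurable borel" "\<Omega> \<in> sets lebesgue"
  shows "(\<integral>\<^sup>+x. f x \<partial>lebesgue_on \<Omega>) \<le> (\<integral>\<^sup>+x. f x \<partial>lborel)"
proof -
  have "(\<integral>\<^sup>+x. f x \<partial>lebesgue_on \<Omega>) = (\<integral>\<^sup>+x. f x * indicator \<Omega> x \<partial>lebesgue)"
    using assms(2) by (intro nn_integral_restrict_space) auto
  also have "\<dots> \<le> (\<integral>\<^sup>+x. f x \<partial>lebesgue)"
    by (intro nn_integral_mono) (auto simp: indicator_def)
  also have "\<dots> = (\<integral>\<^sup>+x. f x \<partial>lborel)"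
    using assms(1) by (intro nn_integral_completion) 
  finally show ?thesis .
qed

lemma nn_integral_lborel_affine:
  fixes f :: "'a::euclidean_space \<Rightarrow> ennreal"
  assumes [measurable]: "f \<in> borel_measurable borel" and "c \<noteq> 0"
  shows "(\<integral>\<^sup>+x. f x \<partial>lborel) = ennreal (\<bar>c\<bar> ^ DIM('a)) * (\<integral>\<^sup>+x. f (t + c *\<^sub>R x) \<partial>lborel)"
  by (subst lborel_affine[OF assms(2), of t])
     (simp add: nn_integral_density nn_integral_distr nn_integral_cmult)

lemma integrable_test_fn:
  assumes "test_fn \<Omega> f"
  shows "integrable lborel f"
proof -
  obtain K where K: "smooth_fun f" "compact K" "K \<subseteq> \<Omega>" "\<And>x. x \<notin> K \<Longrightarrow> f x = 0"
    using assms test_fnE by blast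
  have "integrable lborel (\<lambda>x. indicator K x *\<^sub>R f x)"
    by (rule borel_integrable_compact[OF K(2) smooth_continuous[OF K(1)]])
  moreover have "(\<lambda>x. indicator K x *\<^sub>R f x) = f" using K(4) by (auto simp: fun_eq_iff indicator_def)
  ultimately show ?thesis by simp
qed

lemma integral_lborel_translate:
  fixes f :: "'a::euclidean_space \<Rightarrow> real"
  assumes "f \<in> borel_measurable borel"
  shows "(\<integral>x. f (x + h) \<partial>lborel) = (\<integral>x. f x \<partial>lborel)"
proof -
  have "(\<integral>x. f x \<partial>lborel) = (\<integral>x. f x \<partial>distr lborel borel ((+) h))" by (simp add: lborel_distr_plus)
  also have "\<dots> = (\<integral>x. f (h + x) \<partial>lborel)" using assms by (intro integral_distr) auto
  finally show ?thesis by (simp add: add.commute)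
qed

text \<open>Difference quotients have integral zero by translation invariance, and dominated
  convergence carries this over to the derivative.\<close>

lemma integral_pd_lborel:
  assumes "test_fn \<Omega> f" "i \<in> Basis"
  shows "(\<integral>x. pd i f x \<partial>lborel) = 0"
proof -
  define h where "h n = inverse (real (Suc n))" for n
  have h: "h n > 0" "h n \<le> 1" for n by (auto simp: h_def divide_simps)
  have h0: "h \<longlonglongrightarrow> 0" unfolding h_def by (rule LIMSEQ_inverse_real_of_nat)
  obtain K where K: "smooth_fun f" "compact K" "K \<subseteq> \<Omega>" "\<And>x. x \<notin> K \<Longrightarrow> f x = 0"
    using assms(1) test_fnE by blast
  obtain R where R: "\<And>x. x \<in> K \<Longrightarrow> norm x \<le> R" using compact_imp_bounded[OF K(2)] by (auto simp: bounded_iff)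
  obtain L where L: "L \<ge> 0" "\<And>x h. \<bar>f (x + h) - f x\<bar> \<le> L * norm h" using test_fn_Lipschitz[OF assms(1)] by blast
  note int = integrable_test_fn[OF assms(1)]
  have fb: "f \<in> borel_measurable borel" by (rule smooth_borel[OF K(1)])
  have fs: "(\<lambda>x. f (x + c)) \<in> borel_measurable borel" for c using fb by measurable
  let ?s = "\<lambda>n x. (f (x + h n *\<^sub>R i) - f x) / h n"
  have lim: "(\<lambda>n. \<integral>x. ?s n x \<partial>lborel) \<longlonglongrightarrow> (\<integral>x. pd i f x \<partial>lborel)"
  proof (rule integral_dominated_convergence)
    \<comment> \<open>All steps satisfy \<open>h n \<le> 1\<close>, so every quotient vanishes
      outside the ball of radius R + 1 and is at most the Lipschitz constant inside it.\<close>
    show "integrable lborel (\<lambda>x::'a. L * indicator (cball 0 (R + 1)) x)"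
      using emeasure_lborel_cball_finite[of "0::'a" "R + 1"]
      by (intro integrable_mult_right) (simp add: integrable_indicator_iff)
    show "AE x in lborel. (\<lambda>n. ?s n x) \<longlonglongrightarrow> pd i f x"
    proof (rule AE_I2)
      fix x
      have "((\<lambda>s. f (x + s *\<^sub>R i)) has_real_derivative pd i f x) (at 0)"
        using smooth_line_deriv_Basis[OF K(1) assms(2), of x 0] by simp
      then have "((\<lambda>s. (f (x + s *\<^sub>R i) - f x) / s) \<longlongrightarrow> pd i f x) (at 0)"
        by (simp add: DERIV_def)
      moreover have "filterlim h (at 0) sequentially"
        using h0 h(1) by (auto simp: filterlim_at intro!: always_eventually) (metis less_irrefl)
      ultimately show "(\<lambda>n. ?s n x) \<longlonglongrightarrow> pd i f x" by (rule filterlim_compose)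
    qed
    fix n
    show "AE x in lborel. norm (?s n x) \<le> L * indicator (cball 0 (R + 1)) x"
    proof (rule AE_I2)
      fix x
      show "norm (?s n x) \<le> L * indicator (cball 0 (R + 1)) x"
      proof (cases "norm x \<le> R + 1")
        case True
        have "\<bar>f (x + h n *\<^sub>R i) - f x\<bar> \<le> L * norm (h n *\<^sub>R i)" by (rule L)
        then show ?thesis using True h(1)[of n] assms(2) by (simp add: divide_le_eq)
      next
        case False
        have "norm x - norm (h n *\<^sub>R i) \<le> norm (x + h n *\<^sub>R i)" by (rule norm_diff_ineq)
        then have "x + h n *\<^sub>R i \<notin> K" "x \<notin> K" using False R h[of n] assms(2) by force+
        then show ?thesis using K(4) L(1) by (simp add: indicator_def)
      qed
    qed
  qed (use smooth_borel[OF smooth_fun_pd[OF K(1) assms(2)]] fb fs in auto)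
  have zero: "(\<integral>x. ?s n x \<partial>lborel) = 0" for n
  proof -
    have "x + h n *\<^sub>R i \<in> K \<Longrightarrow> x \<in> (\<lambda>y. - (h n *\<^sub>R i) + y) ` K" for x
      by (rule image_eqI[of _ _ "x + h n *\<^sub>R i"]) auto
    then have "test_fn UNIV (\<lambda>x. f (x + h n *\<^sub>R i))"
      using smooth_affine[OF K(1), of "h n *\<^sub>R i" 1] K(4)
      by (intro test_fnI[OF _ compact_translation[OF K(2), of "- (h n *\<^sub>R i)"]]) (auto simp: add.commute)
    then have "integrable lborel (\<lambda>x. f (x + h n *\<^sub>R i))" by (rule integrable_test_fn)
    then have "(\<integral>x. ?s n x \<partial>lborel) = ((\<integral>x. f (x + h n *\<^sub>R i) \<partial>lborel) - (\<integral>x. f x \<partial>lborel)) / h n"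
      using int by simp
    then show ?thesis by (simp add: integral_lborel_translate[OF fb])
  qed
  show ?thesis using lim unfolding zero by (simp add: LIMSEQ_const_iff)
qed

lemma integral_pd_test_fn:
  assumes "test_fn \<Omega> f" "i \<in> Basis" "\<Omega> \<in> sets lebesgue"
  shows "(\<integral>x. pd i f x \<partial>lebesgue_on \<Omega>) = 0"
proof -
  obtain K where K: "smooth_fun f" "compact K" "K \<subseteq> \<Omega>" "\<And>x. x \<notin> K \<Longrightarrow> f x = 0"
    using assms(1) test_fnE by blast
  have "pd i f x = 0" if "x \<notin> \<Omega>" for x
    using that K by (intro pd_eq_0_off[of K]) (auto intro: compact_imp_closed)
  then show ?thesis
    using integral_lebesgue_on_eq_lborel[OF smooth_borel[OF smooth_fun_pd[OF K(1) assms(2)]] _ assms(3)]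
      integral_pd_lborel[OF assms(1,2)] by simp
qed

lemma test_fn_integrable_on:
  assumes "test_fn A f" "bounded \<Omega>" "\<Omega> \<in> sets lebesgue"
  shows "integrable (lebesgue_on \<Omega>) f" and "L2 \<Omega> f"
proof -
  obtain B where "\<And>x. \<bar>f x\<bar> \<le> B" using test_fn_bounded[OF assms(1)] by blast
  then show "L2 \<Omega> f"
    by (intro L2_bounded[OF assms(2,3) smooth_measurable[OF test_fn_smooth[OF assms(1)]]]) auto
  then show "integrable (lebesgue_on \<Omega>) f" using L2_integrable assms by blast
qed

lemma smooth_L2:
  assumes "smooth_fun f" "bounded \<Omega>" "\<Omega> \<in> sets lebesgue"
  shows "L2 \<Omega> f"
proof -
  have "compact (closure \<Omega>)" using assms(2) by simp
  then obtain B where "\<And>x. x \<in> closure \<Omega> \<Longrightarrow> \<bar>f x\<bar> \<le> B"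
    using smooth_bounded_on_compact[OF assms(1)] by blast
  then have "AE x in lebesgue_on \<Omega>. \<bar>f x\<bar> \<le> B"
    using closure_subset by (intro AE_I2) auto
  then show ?thesis by (intro L2_bounded[OF assms(2,3) smooth_measurable[OF assms(1)]])
qed

text \<open>Neither symmetry nor support around the origin is required, so a kernel may be shifted
  towards the interior of a domain. Measuring the mass by a nonnegative integral lets affine
  substitution and Fubini apply without integrability conditions.\<close>

definition mollifier :: "('a::euclidean_space \<Rightarrow> real) \<Rightarrow> bool" where
  "mollifier k \<longleftrightarrow> test_fn UNIV k \<and> (\<forall>x. 0 \<le> k x) \<and> (\<integral>\<^sup>+x. ennreal (k x) \<partial>lborel) = 1"

lemma mollifier_reflect:
  assumes "mollifier k"
  shows "(\<integral>\<^sup>+y. ennreal (k (x - y)) \<partial>lborel) = 1" "(\<integral>\<^sup>+x. ennreal (k (x - y)) \<partial>lborel) = 1"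
proof -
  have [measurable]: "k \<in> borel_measurable borel"
    using assms by (auto simp: mollifier_def intro: smooth_borel test_fn_smooth)
  have "(\<integral>\<^sup>+z. ennreal (k z) \<partial>lborel) = (\<integral>\<^sup>+y. ennreal (k (x - y)) \<partial>lborel)"
    using nn_integral_lborel_affine[of "\<lambda>z. ennreal (k z)" "-1" x] by simp
  then show "(\<integral>\<^sup>+y. ennreal (k (x - y)) \<partial>lborel) = 1" using assms by (simp add: mollifier_def)
  have "(\<integral>\<^sup>+z. ennreal (k z) \<partial>lborel) = (\<integral>\<^sup>+x. ennreal (k (x - y)) \<partial>lborel)"
    using nn_integral_lborel_affine[of "\<lambda>z. ennreal (k z)" 1 "-y"] by simp
  then show "(\<integral>\<^sup>+x. ennreal (k (x - y)) \<partial>lborel) = 1" using assms by (simp add: mollifier_def)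
qed

text \<open>The bump on the ball divided by its integral. The centre is free because the boundary
  argument needs kernels supported around an inward direction.\<close>

lemma mollifier_exists:
  fixes p :: "'a::euclidean_space"
  assumes "r > 0"
  shows "\<exists>k. mollifier k \<and> (\<forall>z. z \<notin> cball p r \<longrightarrow> k z = 0)"
proof -
  let ?b = "ball_bump p r"
  have z: "?b z = 0" if "z \<notin> cball p r" for z
    using that ball_bump_pos_iff[OF assms, of p z] ball_bump_nonneg[of p r z] by force
  have t: "test_fn UNIV ?b"
    by (rule test_fnI[OF smooth_ball_bump, of "cball p r"]) (use z in auto)
  have m [measurable]: "?b \<in> borel_measurable borel" by (intro smooth_borel smooth_ball_bump)
  define c where "c = (\<integral>x. ?b x \<partial>lborel)"
  have nn: "(\<integral>\<^sup>+x. ennreal (?b x) \<partial>lborel) = ennreal c"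
    unfolding c_def using integrable_test_fn[OF t] by (intro nn_integral_eq_integral) (auto simp: ball_bump_nonneg)
  have "c \<noteq> 0"
  proof
    assume "c = 0"
    then have "AE x in lborel. ?b x = 0"
      using nn nn_integral_0_iff_AE[of "\<lambda>x. ennreal (?b x)" lborel] by (simp add: ball_bump_nonneg)
    then have "AE x in lborel. x \<notin> ball p r"
      by eventually_elim (use ball_bump_pos_iff[OF assms, of p] in force)
    then have "emeasure lborel (ball p r) = 0"
      by (subst (asm) AE_iff_measurable[of "ball p r"]) auto
    then show False using content_ball_pos[OF assms, of p] by (simp add: measure_def)
  qed
  moreover have "c \<ge> 0" by (simp add: c_def ball_bump_nonneg)
  ultimately have c: "c > 0" by simp
  have "(\<integral>\<^sup>+x. ennreal (inverse c * ?b x) \<partial>lborel) = ennreal (inverse c) * ennreal c"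
    using c by (simp add: ennreal_mult ball_bump_nonneg nn_integral_cmult nn)
  also have "\<dots> = 1" using c by (simp flip: ennreal_mult)
  finally have "mollifier (\<lambda>x. inverse c * ?b x)"
    using c t by (auto simp: mollifier_def ball_bump_nonneg intro!: test_fn_cmult)
  then show ?thesis using z by (intro exI[of _ "\<lambda>x. inverse c * ?b x"]) auto
qed

text \<open>Only an inequality, since part of the mass of the translated kernel may fall outside
  \<open>\<Omega>\<close>.\<close>

lemma mollifier_integral_le1:
  assumes "mollifier k" "\<Omega> \<in> sets lebesgue"
  shows "integrable (lebesgue_on \<Omega>) (\<lambda>y. k (x - y))" "(\<integral>y. k (x - y) \<partial>lebesgue_on \<Omega>) \<le> 1"
    "(\<integral>\<^sup>+x. ennreal (k (x - y)) \<partial>lebesgue_on \<Omega>) \<le> 1"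
proof -
  have m: "smooth_fun k" using assms by (auto simp: mollifier_def intro: test_fn_smooth)
  have [measurable]: "k \<in> borel_measurable borel" using m by (rule smooth_borel)
  have le: "(\<integral>\<^sup>+y. ennreal (k (x - y)) \<partial>lebesgue_on \<Omega>) \<le> 1"
    using nn_integral_lebesgue_on_le_lborel[OF _ assms(2), of "\<lambda>y. ennreal (k (x - y))"] mollifier_reflect(1)[OF assms(1)]
    by simp
  show "(\<integral>\<^sup>+x. ennreal (k (x - y)) \<partial>lebesgue_on \<Omega>) \<le> 1"
    using nn_integral_lebesgue_on_le_lborel[OF _ assms(2), of "\<lambda>x. ennreal (k (x - y))"] mollifier_reflect(2)[OF assms(1)]
    by simp
  have nneg: "AE y in lebesgue_on \<Omega>. 0 \<le> k (x - y)" using assms by (auto simp: mollifier_def)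
  show int: "integrable (lebesgue_on \<Omega>) (\<lambda>y. k (x - y))"
    by (rule integrableI_nonneg[OF smooth_shift_measurable[OF m] nneg])
       (rule le_less_trans[OF le], simp)
  show "(\<integral>y. k (x - y) \<partial>lebesgue_on \<Omega>) \<le> 1"
    using le nn_integral_eq_integral[OF int nneg] by (simp flip: ennreal_1)
qed

text \<open>Splitting the kernel as sqrt k times sqrt k, Cauchy-Schwarz bounds the square of the
  convolution pointwise by the convolution of g^2, because the kernel has mass at most 1 over the
  domain. Fubini then integrates the kernel in the other variable.\<close>

lemma conv_L2:
  assumes k: "mollifier k" and \<Omega>: "bounded \<Omega>" "\<Omega> \<in> sets lebesgue" and g: "L2 \<Omega> g"
  shows "L2 \<Omega> (conv \<Omega> k g)" "l2norm \<Omega> (conv \<Omega> k g) \<le> l2norm \<Omega> g"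
proof -
  have t: "test_fn UNIV k" "\<And>x. 0 \<le> k x" using k by (auto simp: mollifier_def)
  note sm = test_fn_smooth[OF t(1)]
  have [measurable]: "k \<in> borel_measurable borel" by (rule smooth_borel[OF sm])
  have [measurable]: "g \<in> borel_measurable (lebesgue_on \<Omega>)" using g by (rule L2_measurable)
  have gi: "integrable (lebesgue_on \<Omega>) g" using L2_integrable \<Omega> g by blast
  show L: "L2 \<Omega> (conv \<Omega> k g)" by (rule smooth_L2[OF smooth_conv[OF t(1) gi] \<Omega>])
  have pw: "ennreal ((conv \<Omega> k g x)\<^sup>2) \<le> (\<integral>\<^sup>+y. ennreal (k (x - y) * (g y)\<^sup>2) \<partial>lebesgue_on \<Omega>)" for x
  proof -
    have km: "(\<lambda>y. k (x - y)) \<in> borel_measurable (lebesgue_on \<Omega>)" by (rule smooth_shift_measurable[OF sm])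
    have i2: "integrable (lebesgue_on \<Omega>) (\<lambda>y. k (x - y) * (g y)\<^sup>2)"
      by (rule conv_integrable[OF t(1) L2_integrable_sq[OF g]])
    have L1: "L2 \<Omega> (\<lambda>y. sqrt (k (x - y)))"
      unfolding L2_def using km mollifier_integral_le1(1)[OF k \<Omega>(2)] t(2) by simp
    have L2': "L2 \<Omega> (\<lambda>y. sqrt (k (x - y)) * g y)"
      unfolding L2_def using km i2 t(2) by (simp add: power_mult_distrib)
    have "conv \<Omega> k g x = (\<integral>y. sqrt (k (x - y)) * (sqrt (k (x - y)) * g y) \<partial>lebesgue_on \<Omega>)"
      unfolding conv_def using t(2) by (intro Bochner_Integration.integral_cong) (auto simp flip: mult.assoc)
    then have "\<bar>conv \<Omega> k g x\<bar> \<le> l2norm \<Omega> (\<lambda>y. sqrt (k (x - y))) * l2norm \<Omega> (\<lambda>y. sqrt (k (x - y)) * g y)"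
      using l2_Cauchy_Schwarz[OF L1 L2'] by simp
    then have "\<bar>conv \<Omega> k g x\<bar>\<^sup>2 \<le> (l2norm \<Omega> (\<lambda>y. sqrt (k (x - y))) * l2norm \<Omega> (\<lambda>y. sqrt (k (x - y)) * g y))\<^sup>2"
      by (intro power_mono) auto
    also have "\<dots> = (\<integral>y. k (x - y) \<partial>lebesgue_on \<Omega>) * (\<integral>y. k (x - y) * (g y)\<^sup>2 \<partial>lebesgue_on \<Omega>)"
      unfolding power_mult_distrib l2norm_sq using t(2) by simp
    also have "\<dots> \<le> 1 * (\<integral>y. k (x - y) * (g y)\<^sup>2 \<partial>lebesgue_on \<Omega>)"
      by (intro mult_right_mono mollifier_integral_le1[OF k \<Omega>(2)] Bochner_Integration.integral_nonneg) (auto simp: t(2))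
    finally have "(conv \<Omega> k g x)\<^sup>2 \<le> (\<integral>y. k (x - y) * (g y)\<^sup>2 \<partial>lebesgue_on \<Omega>)" by simp
    then have "ennreal ((conv \<Omega> k g x)\<^sup>2) \<le> ennreal (\<integral>y. k (x - y) * (g y)\<^sup>2 \<partial>lebesgue_on \<Omega>)" by (rule ennreal_leI)
    also have "\<dots> = (\<integral>\<^sup>+y. ennreal (k (x - y) * (g y)\<^sup>2) \<partial>lebesgue_on \<Omega>)"
      by (rule nn_integral_eq_integral[symmetric, OF i2]) (auto simp: t(2))
    finally show ?thesis .
  qed
  interpret finite_measure "lebesgue_on \<Omega>" by (rule finite_measure_lebesgue_on_bounded[OF \<Omega>])
  interpret P: pair_sigma_finite "lebesgue_on \<Omega>" "lebesgue_on \<Omega>" ..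
  have idm [measurable]: "(\<lambda>x. x) \<in> borel_measurable (lebesgue_on \<Omega>)"
    by (rule measurable_restrict_space1[OF measurable_completion]) simp
  have "ennreal ((l2norm \<Omega> (conv \<Omega> k g))\<^sup>2) = (\<integral>\<^sup>+x. ennreal ((conv \<Omega> k g x)\<^sup>2) \<partial>lebesgue_on \<Omega>)"
    unfolding l2norm_sq using L2_integrable_sq[OF L] by (intro nn_integral_eq_integral[symmetric]) auto
  also have "\<dots> \<le> (\<integral>\<^sup>+x. \<integral>\<^sup>+y. ennreal (k (x - y) * (g y)\<^sup>2) \<partial>lebesgue_on \<Omega> \<partial>lebesgue_on \<Omega>)"
    by (intro nn_integral_mono pw)
  also have "\<dots> = (\<integral>\<^sup>+y. \<integral>\<^sup>+x. ennreal (k (x - y) * (g y)\<^sup>2) \<partial>lebesgue_on \<Omega> \<partial>lebesgue_on \<Omega>)"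
    by (rule P.Fubini'[symmetric]) measurable
  also have "\<dots> \<le> (\<integral>\<^sup>+y. ennreal ((g y)\<^sup>2) \<partial>lebesgue_on \<Omega>)"
  proof (rule nn_integral_mono)
    fix y
    have "(\<integral>\<^sup>+x. ennreal (k (x - y) * (g y)\<^sup>2) \<partial>lebesgue_on \<Omega>) = (\<integral>\<^sup>+x. ennreal (k (x - y)) \<partial>lebesgue_on \<Omega>) * ennreal ((g y)\<^sup>2)"
      by (subst nn_integral_multc[symmetric]) (auto simp: ennreal_mult t(2))
    also have "\<dots> \<le> 1 * ennreal ((g y)\<^sup>2)"
      by (intro mult_right_mono mollifier_integral_le1[OF k \<Omega>(2)]) auto
    finally show "(\<integral>\<^sup>+x. ennreal (k (x - y) * (g y)\<^sup>2) \<partial>lebesgue_on \<Omega>) \<le> ennreal ((g y)\<^sup>2)" by simp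
  qed
  also have "\<dots> = ennreal ((l2norm \<Omega> g)\<^sup>2)"
    unfolding l2norm_sq using L2_integrable_sq[OF g] by (intro nn_integral_eq_integral) auto
  finally have "(l2norm \<Omega> (conv \<Omega> k g))\<^sup>2 \<le> (l2norm \<Omega> g)\<^sup>2" by simp
  then show "l2norm \<Omega> (conv \<Omega> k g) \<le> l2norm \<Omega> g" by (rule power2_le_imp_le) (rule l2norm_nonneg)
qed


section \<open>Approximation in L2 by continuous and by mollified functions\<close>

lemma l2_dominated_convergence:
  assumes F: "\<And>n. F n \<in> borel_measurable (lebesgue_on \<Omega>)" and f: "f \<in> borel_measurable (lebesgue_on \<Omega>)"
    and w: "L2 \<Omega> w"
    and lim: "AE x in lebesgue_on \<Omega>. (\<lambda>n. F n x) \<longlonglongrightarrow> f x"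
    and bd: "\<And>n. AE x in lebesgue_on \<Omega>. \<bar>F n x - f x\<bar> \<le> w x"
  shows "(\<lambda>n. l2norm \<Omega> (\<lambda>x. F n x - f x)) \<longlonglongrightarrow> 0"
proof -
  have "(\<lambda>n. \<integral>x. (F n x - f x)\<^sup>2 \<partial>lebesgue_on \<Omega>) \<longlonglongrightarrow> (\<integral>x. 0 \<partial>lebesgue_on \<Omega>)"
  proof (rule integral_dominated_convergence)
    show "integrable (lebesgue_on \<Omega>) (\<lambda>x. (w x)\<^sup>2)" by (rule L2_integrable_sq[OF w])
    show "AE x in lebesgue_on \<Omega>. (\<lambda>n. (F n x - f x)\<^sup>2) \<longlonglongrightarrow> 0"
      using lim
    proof eventually_elim
      case (elim x)
      have "(\<lambda>n. (F n x - f x)\<^sup>2) \<longlonglongrightarrow> (f x - f x)\<^sup>2" by (intro tendsto_intros elim)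
      then show ?case by simp
    qed
    fix n
    show "AE x in lebesgue_on \<Omega>. norm ((F n x - f x)\<^sup>2) \<le> (w x)\<^sup>2"
      using bd[of n] by eventually_elim (auto simp: power2_abs intro: abs_le_square_iff[THEN iffD1] order_trans)
  qed (use F f in auto)
  then have "(\<lambda>n. sqrt (\<integral>x. (F n x - f x)\<^sup>2 \<partial>lebesgue_on \<Omega>)) \<longlonglongrightarrow> sqrt 0"
    by (intro tendsto_real_sqrt) simp
  then show ?thesis by (simp add: l2norm_def)
qed

text \<open>First g is truncated at a large level m. The continuous functions that measurability
  supplies converge only almost everywhere; truncating them at the same level gives dominated
  convergence the constant majorant 2 m.\<close>

lemma bounded_continuous_dense_L2:
  assumes \<Omega>: "bounded \<Omega>" "\<Omega> \<in> sets lebesgue" and g: "L2 \<Omega> g" and e: "e > 0"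
  obtains h B where "continuous_on UNIV h" "\<And>x. \<bar>h x\<bar> \<le> B" "L2 \<Omega> h" "l2norm \<Omega> (\<lambda>x. h x - g x) < e"
proof -
  note gm [measurable] = L2_measurable[OF g]
  define clip where "clip m y = max (- m) (min m y)" for m y :: real
  have clip_le: "\<bar>clip m y\<bar> \<le> m" if "m \<ge> 0" for m y using that by (auto simp: clip_def)
  have clip_diff: "\<bar>clip m y - y\<bar> \<le> \<bar>y\<bar>" if "m \<ge> 0" for m y using that by (auto simp: clip_def)
  have cm: "(\<lambda>x. clip m (f x)) \<in> borel_measurable (lebesgue_on \<Omega>)"
    if "f \<in> borel_measurable (lebesgue_on \<Omega>)" for m f
    using that unfolding clip_def by measurable
  have "(\<lambda>n. l2norm \<Omega> (\<lambda>x. clip (real n) (g x) - g x)) \<longlonglongrightarrow> 0"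
  proof (rule l2_dominated_convergence[where w="\<lambda>x. \<bar>g x\<bar>"])
    show "L2 \<Omega> (\<lambda>x. \<bar>g x\<bar>)" using g by (auto simp: L2_def)
    show "AE x in lebesgue_on \<Omega>. (\<lambda>n. clip (real n) (g x)) \<longlonglongrightarrow> g x"
    proof (rule AE_I2)
      fix x
      obtain N :: nat where "\<bar>g x\<bar> \<le> real N" using real_arch_simple by blast
      then have "eventually (\<lambda>n. clip (real n) (g x) = g x) sequentially"
        by (intro eventually_sequentiallyI[of N]) (auto simp: clip_def)
      then show "(\<lambda>n. clip (real n) (g x)) \<longlonglongrightarrow> g x" by (rule tendsto_eventually)
    qed
  qed (use cm gm clip_diff in auto)
  then have "eventually (\<lambda>n. l2norm \<Omega> (\<lambda>x. clip (real n) (g x) - g x) < e / 2) sequentially"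
    using e by (intro order_tendstoD(2)) auto
  then obtain m :: nat where m: "l2norm \<Omega> (\<lambda>x. clip (real m) (g x) - g x) < e / 2"
    by (meson eventually_sequentially order_refl)
  let ?g = "\<lambda>x. clip (real m) (g x)"
  have "g measurable_on \<Omega>" using gm \<Omega>(2) by (simp add: measurable_on_iff_borel_measurable)
  then obtain N h where N: "negligible N" "\<And>n. continuous_on UNIV (h n)"
      "\<And>x. x \<notin> N \<Longrightarrow> (\<lambda>n. h n x) \<longlonglongrightarrow> (if x \<in> \<Omega> then g x else 0)"
    unfolding measurable_on_def by metis
  let ?h = "\<lambda>n x. clip (real m) (h n x)"
  have hc: "continuous_on UNIV (?h n)" for n
    unfolding clip_def by (intro continuous_intros N(2))
  have hm: "?h n \<in> borel_measurable (lebesgue_on \<Omega>)" for n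
    by (intro borel_measurable_lebesgue_on borel_measurable_continuous_onI hc)
  have "(\<lambda>n. l2norm \<Omega> (\<lambda>x. ?h n x - ?g x)) \<longlonglongrightarrow> 0"
  proof (rule l2_dominated_convergence[where w="\<lambda>x. 2 * real m"])
    show "L2 \<Omega> (\<lambda>x. 2 * real m)" by (rule L2_const[OF \<Omega>])
    have "AE x in lebesgue. x \<notin> N"
      using N(1) by (auto simp: negligible_iff_null_sets intro: AE_not_in)
    then have "AE x in lebesgue_on \<Omega>. x \<notin> N"
      using \<Omega>(2) by (auto simp: AE_restrict_space_iff elim: eventually_mono)
    then show "AE x in lebesgue_on \<Omega>. (\<lambda>n. ?h n x) \<longlonglongrightarrow> ?g x"
    proof (rule AE_mp, intro AE_I2 impI)
      fix x assume "x \<in> space (lebesgue_on \<Omega>)" "x \<notin> N"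
      then have "(\<lambda>n. h n x) \<longlonglongrightarrow> g x" using N(3)[of x] by simp
      then show "(\<lambda>n. ?h n x) \<longlonglongrightarrow> ?g x" unfolding clip_def by (intro tendsto_intros)
    qed
    show "AE x in lebesgue_on \<Omega>. \<bar>?h n x - ?g x\<bar> \<le> 2 * real m" for n
    proof (rule AE_I2)
      fix x
      show "\<bar>?h n x - ?g x\<bar> \<le> 2 * real m"
        using clip_le[of "real m" "h n x"] clip_le[of "real m" "g x"] by simp
    qed
  qed (use hm cm gm in auto)
  then have "eventually (\<lambda>n. l2norm \<Omega> (\<lambda>x. ?h n x - ?g x) < e / 2) sequentially"
    using e by (intro order_tendstoD(2)) auto
  then obtain n where n: "l2norm \<Omega> (\<lambda>x. ?h n x - ?g x) < e / 2"
    by (meson eventually_sequentially order_refl)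
  have L: "L2 \<Omega> (?h n)" by (rule L2_bounded[OF \<Omega> hm, of _ "real m"]) (use clip_le in auto)
  have L': "L2 \<Omega> ?g" by (rule L2_bounded[OF \<Omega> cm[OF gm], of _ "real m"]) (use clip_le in auto)
  have "l2norm \<Omega> (\<lambda>x. ?h n x - g x) = l2norm \<Omega> (\<lambda>x. (?h n x - ?g x) + (?g x - g x))" by simp
  also have "\<dots> \<le> l2norm \<Omega> (\<lambda>x. ?h n x - ?g x) + l2norm \<Omega> (\<lambda>x. ?g x - g x)"
    by (intro l2norm_triangle L2_diff L L' g)
  also have "\<dots> < e" using m n by simp
  finally show ?thesis using hc clip_le L by (intro that[of "?h n" "real m"]) auto
qed

text \<open>The usual mass-preserving dilation with scale 1/(n + 1); the successor keeps n = 0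
  harmless.\<close>

definition rescaled :: "('a::euclidean_space \<Rightarrow> real) \<Rightarrow> nat \<Rightarrow> 'a \<Rightarrow> real" where
  "rescaled k n = (\<lambda>z. real (Suc n) ^ DIM('a) * k (real (Suc n) *\<^sub>R z))"

lemma rescaled_support:
  assumes "\<And>z. z \<notin> S \<Longrightarrow> k z = 0" "z \<notin> (\<lambda>y. inverse (real (Suc n)) *\<^sub>R y) ` S"
  shows "rescaled k n z = 0"
proof -
  have "real (Suc n) *\<^sub>R z \<notin> S"
  proof
    assume "real (Suc n) *\<^sub>R z \<in> S"
    then have "inverse (real (Suc n)) *\<^sub>R (real (Suc n) *\<^sub>R z) \<in> (\<lambda>y. inverse (real (Suc n)) *\<^sub>R y) ` S" by blast
    then show False using assms(2) by (simp del: of_nat_Suc)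
  qed
  then show ?thesis using assms(1) by (simp add: rescaled_def)
qed

lemma mollifier_rescaled:
  fixes k :: "'a::euclidean_space \<Rightarrow> real"
  assumes "mollifier k"
  shows "mollifier (rescaled k n)"
proof -
  have t: "test_fn UNIV k" "\<And>x. 0 \<le> k x" and i: "(\<integral>\<^sup>+x. ennreal (k x) \<partial>lborel) = 1"
    using assms by (auto simp: mollifier_def)
  have [measurable]: "k \<in> borel_measurable borel" by (rule smooth_borel[OF test_fn_smooth[OF t(1)]])
  obtain K where "smooth_fun k" and K: "compact K" and "K \<subseteq> UNIV" and K0: "\<And>x. x \<notin> K \<Longrightarrow> k x = 0"
    using test_fnE[OF t(1)] by metis
  have "smooth_fun (\<lambda>z. real (Suc n) ^ DIM('a) * k (0 + real (Suc n) *\<^sub>R z))"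
    by (intro smooth_intros smooth_affine test_fn_smooth[OF t(1)])
  then have "smooth_fun (rescaled k n)" by (simp add: rescaled_def)
  then have T: "test_fn UNIV (rescaled k n)"
    by (rule test_fnI[OF _ compact_scaling[OF K] subset_UNIV rescaled_support[OF K0]])
  have "(\<integral>\<^sup>+x. ennreal (rescaled k n x) \<partial>lborel)
      = ennreal (real (Suc n) ^ DIM('a)) * (\<integral>\<^sup>+x. ennreal (k (real (Suc n) *\<^sub>R x)) \<partial>lborel)"
    unfolding rescaled_def using t(2) by (simp add: ennreal_mult nn_integral_cmult del: of_nat_Suc)
  also have "\<dots> = 1"
    using nn_integral_lborel_affine[of "\<lambda>x. ennreal (k x)" "real (Suc n)" 0] i by (simp del: of_nat_Suc)
  finally have I: "(\<integral>\<^sup>+x. ennreal (rescaled k n x) \<partial>lborel) = 1" .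
  have "0 \<le> rescaled k n x" for x using t(2) by (simp add: rescaled_def)
  with T I show ?thesis by (simp add: mollifier_def)
qed

text \<open>As x is interior, the kernel around x is eventually supported in the domain and has full
  mass 1 there, so the value at x is a weighted average of h over a shrinking neighbourhood.\<close>

lemma conv_rescaled_pointwise:
  assumes k: "mollifier k" "\<And>z. z \<notin> cball 0 R \<Longrightarrow> k z = 0"
    and \<Omega>: "open \<Omega>" "bounded \<Omega>" and h: "continuous_on UNIV h" and x: "x \<in> \<Omega>"
  shows "(\<lambda>n. conv \<Omega> (rescaled k n) h x) \<longlonglongrightarrow> h x"
proof (rule LIMSEQ_I)
  fix e :: real assume e: "e > 0"
  have \<Omega>m: "\<Omega> \<in> sets lebesgue" using \<Omega>(1) by auto
  have "isCont h x" using h by (simp add: continuous_on_eq_continuous_at)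
  then obtain d where d: "d > 0" "\<And>y. norm (y - x) < d \<Longrightarrow> \<bar>h y - h x\<bar> < e / 2"
    unfolding continuous_at_eps_delta dist_norm using half_gt_zero[OF e] by fastforce
  obtain d' where d': "d' > 0" "ball x d' \<subseteq> \<Omega>" using \<Omega>(1) x open_contains_ball by blast
  \<comment> \<open>From N on, the kernel sees only points closer to x than d, where h is nearly
    constant, and closer than d', which lie in the domain.\<close>
  obtain N :: nat where "\<bar>R\<bar> / min d d' < real N" using reals_Archimedean2 by blast
  then have N: "\<bar>R\<bar> < min d d' * real N" using d d' by (simp add: divide_less_eq mult.commute)
  have hb: "h \<in> borel_measurable borel" by (rule borel_measurable_continuous_onI[OF h])
  have hm: "h \<in> borel_measurable (lebesgue_on \<Omega>)"
    by (rule borel_measurable_lebesgue_on[OF hb])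
  have "compact (h ` closure \<Omega>)"
    using \<Omega>(2) h by (intro compact_continuous_image) (auto intro: continuous_on_subset)
  then have "bounded (h ` closure \<Omega>)" by (rule compact_imp_bounded)
  then obtain B where B: "\<And>y. y \<in> closure \<Omega> \<Longrightarrow> \<bar>h y\<bar> \<le> B"
    by (auto simp: bounded_iff)
  have "AE y in lebesgue_on \<Omega>. \<bar>h y\<bar> \<le> B" using B closure_subset by (intro AE_I2) auto
  then have hi: "integrable (lebesgue_on \<Omega>) h"
    using L2_integrable(1)[OF \<Omega>(2) \<Omega>m L2_bounded[OF \<Omega>(2) \<Omega>m hm]] by blast
  have "norm (conv \<Omega> (rescaled k n) h x - h x) < e" if "n \<ge> N" for n
  proof -
    let ?k = "rescaled k n"
    have kn: "mollifier ?k" by (rule mollifier_rescaled[OF k(1)])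
    then have kt: "test_fn UNIV ?k" "\<And>z. 0 \<le> ?k z" by (auto simp: mollifier_def)
    have kb: "?k \<in> borel_measurable borel" by (rule smooth_borel[OF test_fn_smooth[OF kt(1)]])
    have ks: "?k (x - y) = 0" if "\<not> norm (y - x) < min d d'" for y
    proof (rule rescaled_support[OF k(2)])
      show "x - y \<notin> (\<lambda>y. inverse (real (Suc n)) *\<^sub>R y) ` cball 0 R"
      proof
        assume "x - y \<in> (\<lambda>y. inverse (real (Suc n)) *\<^sub>R y) ` cball 0 R"
        then obtain z where "norm z \<le> R" "x - y = inverse (real (Suc n)) *\<^sub>R z" by auto
        then have "norm (x - y) * real (Suc n) \<le> R" by (simp add: field_simps del: of_nat_Suc)
        moreover have "min d d' * real N \<le> norm (x - y) * real (Suc n)"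
          using that \<open>n \<ge> N\<close> d d' by (intro mult_mono) (auto simp: norm_minus_commute)
        ultimately show False using N by linarith
      qed
    qed
    have "(\<integral>y. ?k (x - y) \<partial>lebesgue_on \<Omega>) = (\<integral>y. ?k (x - y) \<partial>lborel)"
    proof (rule integral_lebesgue_on_eq_lborel[OF _ _ \<Omega>m])
      show "(\<lambda>y. ?k (x - y)) \<in> borel_measurable borel" using kb by measurable
      fix y assume "y \<notin> \<Omega>"
      then have "y \<notin> ball x d'" using d' by blast
      then have "\<not> norm (y - x) < min d d'" by (simp add: dist_norm norm_minus_commute)
      then show "?k (x - y) = 0" by (rule ks)
    qed
    also have "\<dots> = 1"
    proof -
      have "(\<lambda>y. ?k (x - y)) \<in> borel_measurable lborel" using kb by measurable
      then show ?thesis using mollifier_reflect(1)[OF kn, of x] kt(2)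
        by (intro integral_eq_nn_integral[THEN trans]) auto
    qed
    finally have one: "(\<integral>y. ?k (x - y) \<partial>lebesgue_on \<Omega>) = 1" .
    note i1 = conv_integrable[OF kt(1) hi, of x] and i2 = mollifier_integral_le1(1)[OF kn \<Omega>m, of x]
    have "conv \<Omega> ?k h x - h x = (\<integral>y. ?k (x - y) * h y - ?k (x - y) * h x \<partial>lebesgue_on \<Omega>)"
      unfolding conv_def using i1 i2 one by simp
    also have "norm \<dots> \<le> (\<integral>y. ?k (x - y) * (e / 2) \<partial>lebesgue_on \<Omega>)"
    proof (rule Bochner_Integration.integral_norm_bound_integral)
      fix y
      show "norm (?k (x - y) * h y - ?k (x - y) * h x) \<le> ?k (x - y) * (e / 2)"
      proof (cases "norm (y - x) < min d d'")
        case True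
        then have "\<bar>h y - h x\<bar> \<le> e / 2" using d(2)[of y] by simp
        then have "?k (x - y) * \<bar>h y - h x\<bar> \<le> ?k (x - y) * (e / 2)" by (intro mult_left_mono kt(2))
        then show ?thesis using kt(2)[of "x - y"] by (simp add: abs_mult flip: right_diff_distrib)
      qed (simp add: ks)
    qed (use i1 i2 in auto)
    also have "\<dots> = e / 2" using one i2 by simp
    finally show ?thesis using e by simp
  qed
  then show "\<exists>no. \<forall>n\<ge>no. norm (conv \<Omega> (rescaled k n) h x - h x) < e" by blast
qed

lemma conv_diff:
  assumes "test_fn A k" "integrable (lebesgue_on \<Omega>) f" "integrable (lebesgue_on \<Omega>) g"
  shows "conv \<Omega> k (\<lambda>x. f x - g x) x = conv \<Omega> k f x - conv \<Omega> k g x"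
  unfolding conv_def right_diff_distrib
  using conv_integrable[OF assms(1,2)] conv_integrable[OF assms(1,3)] by simp

text \<open>The contraction property in \<open>conv_L2\<close> makes the error of replacing g by a
  bounded continuous h uniform in n. For h itself the pointwise limit is dominated by twice its
  bound.\<close>

lemma conv_rescaled_tendsto_L2:
  assumes k: "mollifier k" "\<And>z. z \<notin> cball 0 R \<Longrightarrow> k z = 0"
    and \<Omega>: "open \<Omega>" "bounded \<Omega>" and g: "L2 \<Omega> g"
  shows "(\<lambda>n. l2norm \<Omega> (\<lambda>x. conv \<Omega> (rescaled k n) g x - g x)) \<longlonglongrightarrow> 0"
proof (rule LIMSEQ_I)
  fix e :: real assume e: "e > 0"
  have \<Omega>m: "\<Omega> \<in> sets lebesgue" using \<Omega>(1) by auto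
  obtain h B where h: "continuous_on UNIV h" "\<And>x. \<bar>h x\<bar> \<le> B" "L2 \<Omega> h" "l2norm \<Omega> (\<lambda>x. h x - g x) < e / 3"
    using bounded_continuous_dense_L2[OF \<Omega>(2) \<Omega>m g, of "e/3"] e by auto
  have kt: "test_fn UNIV (rescaled k n)" "\<And>z. 0 \<le> rescaled k n z" for n
    using mollifier_rescaled[OF k(1)] by (auto simp: mollifier_def)
  have hi: "integrable (lebesgue_on \<Omega>) h" and gi: "integrable (lebesgue_on \<Omega>) g"
    using L2_integrable \<Omega> \<Omega>m h g by blast+
  have "(\<lambda>n. l2norm \<Omega> (\<lambda>x. conv \<Omega> (rescaled k n) h x - h x)) \<longlonglongrightarrow> 0"
  proof (rule l2_dominated_convergence[where w="\<lambda>x. 2 * B"])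
    show "L2 \<Omega> (\<lambda>x. 2 * B)" by (rule L2_const[OF \<Omega>(2) \<Omega>m])
    show "AE x in lebesgue_on \<Omega>. (\<lambda>n. conv \<Omega> (rescaled k n) h x) \<longlonglongrightarrow> h x"
      by (intro AE_I2 conv_rescaled_pointwise[OF k \<Omega> h(1)]) auto
    show "AE x in lebesgue_on \<Omega>. \<bar>conv \<Omega> (rescaled k n) h x - h x\<bar> \<le> 2 * B" for n
    proof (rule AE_I2)
      fix x
      have B: "B \<ge> 0" using h(2)[of 0] by linarith
      note i = mollifier_integral_le1(1,2)[OF mollifier_rescaled[OF k(1)] \<Omega>m, of n x]
      have "\<bar>conv \<Omega> (rescaled k n) h x\<bar> \<le> (\<integral>y. B * rescaled k n (x - y) \<partial>lebesgue_on \<Omega>)"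
        unfolding conv_def real_norm_def[symmetric]
      proof (rule Bochner_Integration.integral_norm_bound_integral)
        show "norm (rescaled k n (x - y) * h y) \<le> B * rescaled k n (x - y)" for y
          using mult_right_mono[OF h(2)[of y] kt(2)[of n "x - y"]] kt(2)[of n "x - y"] by (simp add: abs_mult mult.commute)
      qed (use conv_integrable[OF kt(1) hi] i in auto)
      also have "\<dots> \<le> B" using mult_left_mono[OF i(2) B] i(1) by simp
      finally show "\<bar>conv \<Omega> (rescaled k n) h x - h x\<bar> \<le> 2 * B" using h(2)[of x] by linarith
    qed
  qed (use h(3) L2_measurable smooth_measurable[OF smooth_conv[OF kt(1) hi]] in auto)
  then have "eventually (\<lambda>n. l2norm \<Omega> (\<lambda>x. conv \<Omega> (rescaled k n) h x - h x) < e / 3) sequentially"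
    using e by (intro order_tendstoD(2)) auto
  then obtain N where N: "\<And>n. n \<ge> N \<Longrightarrow> l2norm \<Omega> (\<lambda>x. conv \<Omega> (rescaled k n) h x - h x) < e / 3"
    unfolding eventually_sequentially by blast
  have "norm (l2norm \<Omega> (\<lambda>x. conv \<Omega> (rescaled k n) g x - g x) - 0) < e" if "n \<ge> N" for n
  proof -
    have L: "L2 \<Omega> (\<lambda>x. h x - g x)" by (intro L2_diff h g)
    note c = conv_L2[OF mollifier_rescaled[OF k(1)] \<Omega>(2) \<Omega>m, of _ n]
    have L3: "L2 \<Omega> (\<lambda>x. conv \<Omega> (rescaled k n) h x - h x)" by (intro L2_diff c(1) h)
    have "l2norm \<Omega> (\<lambda>x. conv \<Omega> (rescaled k n) g x - g x)
        = l2norm \<Omega> (\<lambda>x. ((conv \<Omega> (rescaled k n) h x - h x) + (h x - g x)) - conv \<Omega> (rescaled k n) (\<lambda>x. h x - g x) x)"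
      by (simp add: conv_diff[OF kt(1) hi gi])
    also have "\<dots> \<le> l2norm \<Omega> (\<lambda>x. (conv \<Omega> (rescaled k n) h x - h x) + (h x - g x)) + l2norm \<Omega> (conv \<Omega> (rescaled k n) (\<lambda>x. h x - g x))"
      by (intro l2norm_triangle_diff L2_add L3 L c(1))
    also have "\<dots> \<le> (l2norm \<Omega> (\<lambda>x. conv \<Omega> (rescaled k n) h x - h x) + l2norm \<Omega> (\<lambda>x. h x - g x)) + l2norm \<Omega> (\<lambda>x. h x - g x)"
      by (intro add_mono l2norm_triangle L3 L c(2))
    also have "\<dots> < e" using N[OF that] h(4) by linarith
    finally show ?thesis by (simp add: l2norm_nonneg)
  qed
  then show "\<exists>no. \<forall>n\<ge>no. norm (l2norm \<Omega> (\<lambda>x. conv \<Omega> (rescaled k n) g x - g x) - 0) < e" by blast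
qed

text \<open>Here \<open>K\<close> may touch the boundary of \<open>\<Omega>\<close>, provided that \<open>S\<close> consists of inward directions.\<close>
lemma test_fn_conv_rescaled:
  assumes k: "mollifier k" "\<And>z. z \<notin> S \<Longrightarrow> k z = 0" "compact S"
    and g: "integrable (lebesgue_on \<Omega>) g" "\<And>y. y \<in> \<Omega> \<Longrightarrow> y \<notin> K \<Longrightarrow> g y = 0" "compact K"
    and e: "e > 0" "\<And>y z t. y \<in> K \<Longrightarrow> z \<in> S \<Longrightarrow> 0 < t \<Longrightarrow> t < e \<Longrightarrow> y + t *\<^sub>R z \<in> \<Omega>"
  shows "eventually (\<lambda>n. test_fn \<Omega> (conv \<Omega> (rescaled k n) g)) sequentially"
proof -
  have "eventually (\<lambda>n. inverse (real (Suc n)) < e) sequentially"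
    using LIMSEQ_inverse_real_of_nat e(1) by (rule order_tendstoD(2))
  then show ?thesis
  proof eventually_elim
    case (elim n)
    show ?case
    proof (rule test_fn_conv[of _ "(\<lambda>y. inverse (real (Suc n)) *\<^sub>R y) ` S" _ _ K])
      show "test_fn UNIV (rescaled k n)" using mollifier_rescaled[OF k(1)] by (simp add: mollifier_def)
      show "rescaled k n z = 0" if "z \<notin> (\<lambda>y. inverse (real (Suc n)) *\<^sub>R y) ` S" for z
        by (rule rescaled_support[OF k(2) that])
      show "y + z \<in> \<Omega>" if "y \<in> K" "z \<in> (\<lambda>y. inverse (real (Suc n)) *\<^sub>R y) ` S" for y z
        using that e(2)[of y _ "inverse (real (Suc n))"] elim by (auto simp del: of_nat_Suc)
    qed (use g k compact_scaling in auto)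
  qed
qed

text \<open>For compact K let p be g restricted to K. Its mollifications are eventually test
  functions, so in the limit g is orthogonal to p, and the product of g and p is p^2. Countably many
  K exhaust the domain.\<close>

lemma test_fn_orthogonal_imp_AE_0:
  fixes g :: "'a::euclidean_space \<Rightarrow> real"
  assumes \<Omega>: "open \<Omega>" "bounded \<Omega>" and g: "L2 \<Omega> g"
    and orth: "\<And>\<phi>. test_fn \<Omega> \<phi> \<Longrightarrow> (\<integral>x. g x * \<phi> x \<partial>lebesgue_on \<Omega>) = 0"
  shows "AE x in lebesgue_on \<Omega>. g x = 0"
proof -
  have \<Omega>m: "\<Omega> \<in> sets lebesgue" using \<Omega>(1) by auto
  obtain k :: "'a \<Rightarrow> real" where k: "mollifier k" "\<And>z. z \<notin> cball 0 1 \<Longrightarrow> k z = 0"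
    using mollifier_exists[of 1 0] by auto
  have K0: "AE x in lebesgue_on \<Omega>. x \<in> K \<longrightarrow> g x = 0" if K: "compact K" "K \<subseteq> \<Omega>" for K
  proof -
    define p where "p x = indicator K x * g x" for x
    have Km: "indicator K \<in> borel_measurable (lebesgue_on \<Omega>)"
      using K(1) by (intro borel_measurable_lebesgue_on borel_measurable_indicator borel_closed compact_imp_closed)
    have p: "L2 \<Omega> p"
      unfolding p_def by (rule L2_bounded_mult(1)[OF g Km, of 1]) (auto simp: indicator_def)
    obtain e where e: "e > 0" "(\<Union>x\<in>K. cball x e) \<subseteq> \<Omega>"
      using compact_subset_open_imp_cball_epsilon_subset[OF K(1) \<Omega>(1) K(2)] by blast
    have "eventually (\<lambda>n. test_fn \<Omega> (conv \<Omega> (rescaled k n) p)) sequentially"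
    proof (rule test_fn_conv_rescaled[OF k compact_cball])
      show "integrable (lebesgue_on \<Omega>) p" using L2_integrable(1)[OF \<Omega>(2) \<Omega>m p] .
      show "y + t *\<^sub>R z \<in> \<Omega>" if "y \<in> K" "z \<in> cball 0 1" "0 < t" "t < e" for y z t
      proof -
        have "norm (t *\<^sub>R z) \<le> e" using that mult_mono[of t e "norm z" 1] by simp
        then have "y + t *\<^sub>R z \<in> cball y e" by (simp add: dist_norm)
        then show ?thesis using e that by blast
      qed
    qed (use K e in \<open>auto simp: p_def\<close>)
    then have "eventually (\<lambda>n. (\<integral>x. g x * conv \<Omega> (rescaled k n) p x \<partial>lebesgue_on \<Omega>) = 0) sequentially"
      by eventually_elim (rule orth)
    then have "(\<lambda>n. \<integral>x. g x * conv \<Omega> (rescaled k n) p x \<partial>lebesgue_on \<Omega>) \<longlonglongrightarrow> 0"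
      by (rule tendsto_eventually)
    moreover have "(\<lambda>n. \<integral>x. g x * conv \<Omega> (rescaled k n) p x \<partial>lebesgue_on \<Omega>) \<longlonglongrightarrow> (\<integral>x. g x * p x \<partial>lebesgue_on \<Omega>)"
    proof (rule tendsto_l2_inner[OF _ conv_rescaled_tendsto_L2[OF k \<Omega> p] g p])
      show "(\<lambda>n::nat. l2norm \<Omega> (\<lambda>x. g x - g x)) \<longlonglongrightarrow> 0" by (simp add: l2norm_def)
    qed (use g conv_L2(1)[OF mollifier_rescaled[OF k(1)] \<Omega>(2) \<Omega>m p] in auto)
    ultimately have "(\<integral>x. g x * p x \<partial>lebesgue_on \<Omega>) = 0" using LIMSEQ_unique by blast
    moreover have "(\<lambda>x. g x * p x) = (\<lambda>x. (p x)\<^sup>2)" by (auto simp: p_def indicator_def power2_eq_square)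
    ultimately have "l2norm \<Omega> p = 0" by (simp add: l2norm_def)
    from l2norm_eq0[OF p this] show ?thesis
      by eventually_elim (auto simp: p_def)
  qed
  obtain C where C: "\<And>n. compact (C n)" "\<And>n. C n \<subseteq> \<Omega>" "(\<Union>n::nat. C n) = \<Omega>"
    using open_Union_compact_subsets[OF \<Omega>(1)] by metis
  have "AE x in lebesgue_on \<Omega>. \<forall>n. x \<in> C n \<longrightarrow> g x = 0"
    unfolding AE_all_countable using K0[OF C(1,2)] by blast
  then show ?thesis
    by (rule AE_mp) (use C(3) in \<open>auto intro!: AE_I2\<close>)
qed

section \<open>Weak derivatives\<close>

lemma l2norm_mono_AE:
  assumes "L2 \<Omega> g" "f \<in> borel_measurable (lebesgue_on \<Omega>)" "AE x in lebesgue_on \<Omega>. \<bar>f x\<bar> \<le> \<bar>g x\<bar>"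
  shows "L2 \<Omega> f" "l2norm \<Omega> f \<le> l2norm \<Omega> g"
proof -
  have AE: "AE x in lebesgue_on \<Omega>. (f x)\<^sup>2 \<le> (g x)\<^sup>2"
    using assms(3) by eventually_elim (simp add: abs_le_square_iff)
  have I: "integrable (lebesgue_on \<Omega>) (\<lambda>x. (f x)\<^sup>2)"
    by (rule Bochner_Integration.integrable_bound[OF L2_integrable_sq[OF assms(1)]])
      (use assms(2) AE in auto)
  then show "L2 \<Omega> f" using assms(2) by (simp add: L2_def)
  show "l2norm \<Omega> f \<le> l2norm \<Omega> g"
    unfolding l2norm_def by (intro real_sqrt_le_mono integral_mono_AE I L2_integrable_sq[OF assms(1)] AE)
qed

lemma L2_smooth_mult:
  assumes "smooth_fun \<phi>" "L2 \<Omega> f" "bounded \<Omega>"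
  shows "L2 \<Omega> (\<lambda>x. \<phi> x * f x)" "L2 \<Omega> (\<lambda>x. f x * \<phi> x)"
proof -
  have "compact (closure \<Omega>)" using assms(3) by simp
  then obtain B where "\<And>x. x \<in> closure \<Omega> \<Longrightarrow> \<bar>\<phi> x\<bar> \<le> B"
    using smooth_bounded_on_compact[OF assms(1)] by blast
  then have "AE x in lebesgue_on \<Omega>. \<bar>\<phi> x\<bar> \<le> B" using closure_subset by (intro AE_I2) auto
  then show "L2 \<Omega> (\<lambda>x. \<phi> x * f x)" by (rule L2_bounded_mult(1)[OF assms(2) smooth_measurable[OF assms(1)]])
  then show "L2 \<Omega> (\<lambda>x. f x * \<phi> x)" by (simp add: mult.commute)
qed

lemma loc_integrable_L2:
  assumes "bounded \<Omega>" "\<Omega> \<in> sets lebesgue" "L2 \<Omega> f"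
  shows "loc_integrable \<Omega> f"
  unfolding loc_integrable_def
proof (intro allI impI)
  fix K :: "'a set" assume K: "compact K \<and> K \<subseteq> \<Omega>"
  have Km: "K \<in> sets lebesgue" using K by (simp add: lmeasurable_compact fmeasurableD)
  have "set_integrable lebesgue \<Omega> f"
    using L2_integrable(1)[OF assms] assms(2) unfolding set_integrable_def by (simp add: integrable_restrict_space)
  then have "set_integrable lebesgue K f"
    by (rule set_integrable_subset) (use K Km in auto)
  then show "integrable (lebesgue_on K) f"
    using Km unfolding set_integrable_def by (simp add: integrable_restrict_space)
qed

lemma weak_derivI:
  assumes "bounded \<Omega>" "\<Omega> \<in> sets lebesgue" "i \<in> Basis" "L2 \<Omega> f" "L2 \<Omega> g"
    "\<And>\<phi>. test_fn \<Omega> \<phi> \<Longrightarrow> (\<integral>x. f x * pd i \<phi> x \<partial>lebesgue_on \<Omega>) = - (\<integral>x. g x * \<phi> x \<partial>lebesgue_on \<Omega>)"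
  shows "weak_deriv \<Omega> i f g"
  using assms loc_integrable_L2[OF assms(1,2)] unfolding weak_deriv_def by blast

lemma weak_derivD:
  "weak_deriv \<Omega> i f g \<Longrightarrow> test_fn \<Omega> \<phi> \<Longrightarrow>
    (\<integral>x. f x * pd i \<phi> x \<partial>lebesgue_on \<Omega>) = - (\<integral>x. g x * \<phi> x \<partial>lebesgue_on \<Omega>)"
  "weak_deriv \<Omega> i f g \<Longrightarrow> i \<in> Basis"
  by (auto simp: weak_deriv_def)

lemma weak_deriv_unique:
  assumes \<Omega>: "open \<Omega>" "bounded \<Omega>" and "L2 \<Omega> g" "L2 \<Omega> g'" "weak_deriv \<Omega> i f g" "weak_deriv \<Omega> i f g'"
  shows "AE x in lebesgue_on \<Omega>. g x = g' x"
proof -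
  have "AE x in lebesgue_on \<Omega>. g x - g' x = 0"
  proof (rule test_fn_orthogonal_imp_AE_0[OF \<Omega>])
    show "L2 \<Omega> (\<lambda>x. g x - g' x)" using assms by (intro L2_diff)
    fix \<phi> assume \<phi>: "test_fn \<Omega> \<phi>"
    have L: "L2 \<Omega> \<phi>" using test_fn_integrable_on(2)[OF \<phi> \<Omega>(2)] \<Omega>(1) by auto
    have "(\<integral>x. (g x - g' x) * \<phi> x \<partial>lebesgue_on \<Omega>) = (\<integral>x. g x * \<phi> x \<partial>lebesgue_on \<Omega>) - (\<integral>x. g' x * \<phi> x \<partial>lebesgue_on \<Omega>)"
      using assms L by (simp add: left_diff_distrib L2_mult_integrable)
    then show "(\<integral>x. (g x - g' x) * \<phi> x \<partial>lebesgue_on \<Omega>) = 0"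
      using weak_derivD(1)[OF assms(5) \<phi>] weak_derivD(1)[OF assms(6) \<phi>] by simp
  qed
  then show ?thesis by simp
qed

text \<open>\<open>wd\<close> is a choice of representative, so identities for it hold only almost
  everywhere; they are obtained by exhibiting some weak derivative and using uniqueness.\<close>

lemma wd_eqI:
  assumes \<Omega>: "open \<Omega>" "bounded \<Omega>" and g: "L2 \<Omega> g" "weak_deriv \<Omega> i f g"
  shows "L2 \<Omega> (wd \<Omega> i f)" "weak_deriv \<Omega> i f (wd \<Omega> i f)" "AE x in lebesgue_on \<Omega>. wd \<Omega> i f x = g x"
proof -
  have "L2 \<Omega> (wd \<Omega> i f) \<and> weak_deriv \<Omega> i f (wd \<Omega> i f)"
    unfolding wd_def by (rule someI[of _ g]) (use g in auto)
  then show *: "L2 \<Omega> (wd \<Omega> i f)" "weak_deriv \<Omega> i f (wd \<Omega> i f)" by auto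
  show "AE x in lebesgue_on \<Omega>. wd \<Omega> i f x = g x"
    by (rule weak_deriv_unique[OF \<Omega> *(1) g(1) *(2) g(2)])
qed

lemma H1_wd:
  assumes "H1 \<Omega> f" "i \<in> Basis"
  shows "L2 \<Omega> (wd \<Omega> i f)" "weak_deriv \<Omega> i f (wd \<Omega> i f)"
proof -
  obtain g where g: "L2 \<Omega> g \<and> weak_deriv \<Omega> i f g" using assms by (auto simp: H1_def)
  have "L2 \<Omega> (wd \<Omega> i f) \<and> weak_deriv \<Omega> i f (wd \<Omega> i f)"
    unfolding wd_def by (rule someI[of _ g]) (use g in auto)
  then show "L2 \<Omega> (wd \<Omega> i f)" "weak_deriv \<Omega> i f (wd \<Omega> i f)" by auto
qed

lemma H1_L2: "H1 \<Omega> f \<Longrightarrow> L2 \<Omega> f"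
  by (simp add: H1_def)

section \<open>Weak derivatives of differences and of functions equal almost everywhere\<close>

lemma weak_deriv_diff:
  assumes \<Omega>: "bounded \<Omega>" "\<Omega> \<in> sets lebesgue" and L: "L2 \<Omega> f" "L2 \<Omega> g" "L2 \<Omega> f'" "L2 \<Omega> g'"
    and w: "weak_deriv \<Omega> i f g" "weak_deriv \<Omega> i f' g'"
  shows "weak_deriv \<Omega> i (\<lambda>x. f x - f' x) (\<lambda>x. g x - g' x)"
proof (rule weak_derivI[OF \<Omega>])
  show i: "i \<in> Basis" by (rule weak_derivD(2)[OF w(1)])
  fix \<phi> assume \<phi>: "test_fn \<Omega> \<phi>"
  note t = test_fn_integrable_on(2)[OF \<phi> \<Omega>] test_fn_integrable_on(2)[OF test_fn_pd[OF \<phi> i] \<Omega>]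
  show "(\<integral>x. (f x - f' x) * pd i \<phi> x \<partial>lebesgue_on \<Omega>) = - (\<integral>x. (g x - g' x) * \<phi> x \<partial>lebesgue_on \<Omega>)"
    using L t weak_derivD(1)[OF w(1) \<phi>] weak_derivD(1)[OF w(2) \<phi>]
    by (simp add: left_diff_distrib L2_mult_integrable)
qed (use L in \<open>auto intro: L2_diff\<close>)

lemma weak_deriv_cong:
  assumes \<Omega>: "bounded \<Omega>" "\<Omega> \<in> sets lebesgue" and L: "L2 \<Omega> f" "L2 \<Omega> g" "L2 \<Omega> f'"
    and w: "weak_deriv \<Omega> i f g" "AE x in lebesgue_on \<Omega>. f x = f' x"
  shows "weak_deriv \<Omega> i f' g"
proof (rule weak_derivI[OF \<Omega>])
  show i: "i \<in> Basis" by (rule weak_derivD(2)[OF w(1)])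
  fix \<phi> assume \<phi>: "test_fn \<Omega> \<phi>"
  have t: "L2 \<Omega> (pd i \<phi>)" by (rule test_fn_integrable_on(2)[OF test_fn_pd[OF \<phi> i] \<Omega>])
  have "(\<integral>x. f' x * pd i \<phi> x \<partial>lebesgue_on \<Omega>) = (\<integral>x. f x * pd i \<phi> x \<partial>lebesgue_on \<Omega>)"
    by (rule integral_cong_AE) (use L2_measurable[OF L(1)] L2_measurable[OF L(3)] L2_measurable[OF t] w(2) in auto)
  then show "(\<integral>x. f' x * pd i \<phi> x \<partial>lebesgue_on \<Omega>) = - (\<integral>x. g x * \<phi> x \<partial>lebesgue_on \<Omega>)"
    using weak_derivD(1)[OF w(1) \<phi>] by simp
qed (use L in auto)

lemma weak_deriv_smooth:
  assumes \<Omega>: "bounded \<Omega>" "\<Omega> \<in> sets lebesgue" and f: "smooth_fun f" and i: "i \<in> Basis"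
  shows "weak_deriv \<Omega> i f (pd i f)"
proof (rule weak_derivI[OF \<Omega> i])
  show L: "L2 \<Omega> f" "L2 \<Omega> (pd i f)" by (auto intro!: smooth_L2 \<Omega> f smooth_fun_pd i)
  fix \<phi> assume \<phi>: "test_fn \<Omega> \<phi>"
  note t = test_fn_integrable_on(2)[OF \<phi> \<Omega>] test_fn_integrable_on(2)[OF test_fn_pd[OF \<phi> i] \<Omega>]
  have "0 = (\<integral>x. pd i (\<lambda>x. f x * \<phi> x) x \<partial>lebesgue_on \<Omega>)"
    by (rule integral_pd_test_fn[symmetric, OF test_fn_mult(2)[OF \<phi> f] i \<Omega>(2)])
  also have "\<dots> = (\<integral>x. f x * pd i \<phi> x \<partial>lebesgue_on \<Omega>) + (\<integral>x. pd i f x * \<phi> x \<partial>lebesgue_on \<Omega>)"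
    unfolding pd_mult[OF f test_fn_smooth[OF \<phi>]] using L t by (simp add: L2_mult_integrable)
  finally show "(\<integral>x. f x * pd i \<phi> x \<partial>lebesgue_on \<Omega>) = - (\<integral>x. pd i f x * \<phi> x \<partial>lebesgue_on \<Omega>)" by simp
qed

lemma H1_smooth:
  assumes "bounded \<Omega>" "\<Omega> \<in> sets lebesgue" "smooth_fun f"
  shows "H1 \<Omega> f"
  unfolding H1_def using weak_deriv_smooth[OF assms] smooth_L2[OF _ assms(1,2)] smooth_fun_pd[OF assms(3)] assms(3) by blast

lemma H1_diff:
  assumes \<Omega>: "open \<Omega>" "bounded \<Omega>" and "H1 \<Omega> f" "H1 \<Omega> g"
  shows "H1 \<Omega> (\<lambda>x. f x - g x)"
    and "i \<in> Basis \<Longrightarrow> AE x in lebesgue_on \<Omega>. wd \<Omega> i (\<lambda>x. f x - g x) x = wd \<Omega> i f x - wd \<Omega> i g x"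
proof -
  have \<Omega>m: "\<Omega> \<in> sets lebesgue" using \<Omega>(1) by auto
  have w: "weak_deriv \<Omega> i (\<lambda>x. f x - g x) (\<lambda>x. wd \<Omega> i f x - wd \<Omega> i g x)" if "i \<in> Basis" for i
    using assms that by (intro weak_deriv_diff \<Omega> \<Omega>m H1_wd H1_L2)
  have L: "L2 \<Omega> (\<lambda>x. wd \<Omega> i f x - wd \<Omega> i g x)" if "i \<in> Basis" for i
    using assms that by (intro L2_diff H1_wd)
  show "H1 \<Omega> (\<lambda>x. f x - g x)"
    unfolding H1_def using w L assms L2_diff H1_L2 by blast
  show "AE x in lebesgue_on \<Omega>. wd \<Omega> i (\<lambda>x. f x - g x) x = wd \<Omega> i f x - wd \<Omega> i g x" if "i \<in> Basis"
    by (rule wd_eqI(3)[OF \<Omega> L[OF that] w[OF that]])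
qed

text \<open>Needed to iterate \<open>wd\<close>: the chosen derivative of a difference agrees only
  almost everywhere with the difference of the chosen derivatives, and its own derivatives must
  still be comparable.\<close>

lemma H1_cong:
  assumes \<Omega>: "open \<Omega>" "bounded \<Omega>" and f: "H1 \<Omega> f" and g: "L2 \<Omega> g" and AE: "AE x in lebesgue_on \<Omega>. f x = g x"
  shows "H1 \<Omega> g" and "i \<in> Basis \<Longrightarrow> AE x in lebesgue_on \<Omega>. wd \<Omega> i g x = wd \<Omega> i f x"
proof -
  have \<Omega>m: "\<Omega> \<in> sets lebesgue" using \<Omega>(1) by auto
  have w: "weak_deriv \<Omega> i g (wd \<Omega> i f)" if "i \<in> Basis" for i
    using that by (intro weak_deriv_cong[OF \<Omega>(2) \<Omega>m H1_L2[OF f] _ g _ AE] H1_wd f)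
  show "H1 \<Omega> g" unfolding H1_def using w g H1_wd[OF f] by blast
  show "AE x in lebesgue_on \<Omega>. wd \<Omega> i g x = wd \<Omega> i f x" if "i \<in> Basis"
    by (rule wd_eqI(3)[OF \<Omega> H1_wd(1)[OF f that] w[OF that]])
qed

lemma H2_diff:
  assumes \<Omega>: "open \<Omega>" "bounded \<Omega>" and "H2 \<Omega> f" "H2 \<Omega> g"
  shows "H2 \<Omega> (\<lambda>x. f x - g x)"
    and "i \<in> Basis \<Longrightarrow> j \<in> Basis \<Longrightarrow> AE x in lebesgue_on \<Omega>.
      wd \<Omega> j (wd \<Omega> i (\<lambda>x. f x - g x)) x = wd \<Omega> j (wd \<Omega> i f) x - wd \<Omega> j (wd \<Omega> i g) x"
proof -
  have h: "H1 \<Omega> f" "H1 \<Omega> g" "H1 \<Omega> (wd \<Omega> i f)" "H1 \<Omega> (wd \<Omega> i g)" if "i \<in> Basis" for i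
    using assms that by (auto simp: H2_def)
  have h1: "H1 \<Omega> (\<lambda>x. f x - g x)" using H1_diff(1)[OF \<Omega>] assms by (auto simp: H2_def)
  have d: "H1 \<Omega> (\<lambda>x. wd \<Omega> i f x - wd \<Omega> i g x)" if "i \<in> Basis" for i
    using H1_diff(1)[OF \<Omega>] h that by blast
  have e: "AE x in lebesgue_on \<Omega>. wd \<Omega> i f x - wd \<Omega> i g x = wd \<Omega> i (\<lambda>x. f x - g x) x" if "i \<in> Basis" for i
    using H1_diff(2)[OF \<Omega> h(1,2)[OF that] that] by (simp add: eq_commute)
  note c = H1_cong[OF \<Omega> d H1_wd(1)[OF h1] e]
  show "H2 \<Omega> (\<lambda>x. f x - g x)" using h1 c(1) by (simp add: H2_def)
  show "AE x in lebesgue_on \<Omega>. wd \<Omega> j (wd \<Omega> i (\<lambda>x. f x - g x)) x = wd \<Omega> j (wd \<Omega> i f) x - wd \<Omega> j (wd \<Omega> i g) x"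
    if "i \<in> Basis" "j \<in> Basis"
    using c(2)[OF that(1) that(1) that(1) that(2)] H1_diff(2)[OF \<Omega> h(3,4)[OF that(1)] that(2)]
    by eventually_elim simp
qed

lemma lap_L2: "H2 \<Omega> f \<Longrightarrow> L2 \<Omega> (lap \<Omega> f)"
  unfolding lap_def by (intro L2_sum H1_wd) (auto simp: H2_def)

lemma lap_diff:
  assumes \<Omega>: "open \<Omega>" "bounded \<Omega>" and "H2 \<Omega> f" "H2 \<Omega> g"
  shows "AE x in lebesgue_on \<Omega>. lap \<Omega> (\<lambda>x. f x - g x) x = lap \<Omega> f x - lap \<Omega> g x"
proof -
  have "AE x in lebesgue_on \<Omega>. \<forall>i\<in>Basis. wd \<Omega> i (wd \<Omega> i (\<lambda>x. f x - g x)) x = wd \<Omega> i (wd \<Omega> i f) x - wd \<Omega> i (wd \<Omega> i g) x"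
    using H2_diff(2)[OF assms] by (intro AE_finite_allI) auto
  then show ?thesis by eventually_elim (simp add: lap_def sum_subtractf)
qed

section \<open>Comparison of Sobolev norms and integration by parts\<close>

lemma l2norm_le_h1norm: "l2norm \<Omega> f \<le> h1norm \<Omega> f"
  and l2norm_wd_le_h1norm: "i \<in> Basis \<Longrightarrow> l2norm \<Omega> (wd \<Omega> i f) \<le> h1norm \<Omega> f"
proof -
  show "l2norm \<Omega> f \<le> h1norm \<Omega> f"
    unfolding h1norm_def by (rule real_le_rsqrt) (simp add: sum_nonneg)
  assume "i \<in> Basis"
  then have "(l2norm \<Omega> (wd \<Omega> i f))\<^sup>2 \<le> (\<Sum>i\<in>Basis. (l2norm \<Omega> (wd \<Omega> i f))\<^sup>2)"
    by (intro member_le_sum) auto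
  then show "l2norm \<Omega> (wd \<Omega> i f) \<le> h1norm \<Omega> f"
    unfolding h1norm_def by (intro real_le_rsqrt) (simp add: add_increasing)
qed

lemma l2norm_le_h2norm: "l2norm \<Omega> f \<le> h2norm \<Omega> f"
  unfolding h2norm_def by (rule real_le_rsqrt) (simp add: sum_nonneg)

lemma l2norm_wd_wd_le_h2norm:
  assumes "i \<in> Basis" "j \<in> Basis"
  shows "l2norm \<Omega> (wd \<Omega> j (wd \<Omega> i f)) \<le> h2norm \<Omega> f"
proof -
  let ?s = "\<lambda>i j. (l2norm \<Omega> (wd \<Omega> j (wd \<Omega> i f)))\<^sup>2"
  have "?s i j \<le> (\<Sum>j\<in>Basis. ?s i j)" using assms by (intro member_le_sum) auto
  also have "\<dots> \<le> (\<Sum>i\<in>Basis. \<Sum>j\<in>Basis. ?s i j)"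
    using assms by (intro member_le_sum[of i Basis "\<lambda>i. \<Sum>j\<in>Basis. ?s i j"]) (auto intro: sum_nonneg)
  finally show ?thesis
    unfolding h2norm_def by (intro real_le_rsqrt) (simp add: add_increasing sum_nonneg)
qed

text \<open>For the approximating test functions the identity is the definition of the weak
  derivative of g, and both sides are continuous in the H1 norm of f. The second factor carries no
  boundary condition.\<close>

lemma H01_integral_by_parts:
  assumes \<Omega>: "open \<Omega>" "bounded \<Omega>" and f: "H01 \<Omega> f" and g: "L2 \<Omega> g" "L2 \<Omega> g'" "weak_deriv \<Omega> i g g'"
  shows "(\<integral>x. wd \<Omega> i f x * g x \<partial>lebesgue_on \<Omega>) = - (\<integral>x. f x * g' x \<partial>lebesgue_on \<Omega>)"
proof -
  have \<Omega>m: "\<Omega> \<in> sets lebesgue" using \<Omega>(1) by auto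
  have i: "i \<in> Basis" by (rule weak_derivD(2)[OF g(3)])
  obtain \<phi> where \<phi>: "\<And>k. test_fn \<Omega> (\<phi> k)" and lim: "(\<lambda>k. h1norm \<Omega> (\<lambda>x. \<phi> k x - f x)) \<longlonglongrightarrow> 0"
    and f1: "H1 \<Omega> f" using f by (auto simp: H01_def)
  have L\<phi>: "L2 \<Omega> (\<phi> k)" "L2 \<Omega> (pd i (\<phi> k))" for k
    using test_fn_integrable_on(2)[OF \<phi> \<Omega>(2) \<Omega>m] test_fn_integrable_on(2)[OF test_fn_pd[OF \<phi> i] \<Omega>(2) \<Omega>m] by auto
  note Lf = H1_L2[OF f1] H1_wd(1)[OF f1 i]
  have lim0: "(\<lambda>k. l2norm \<Omega> (\<lambda>x. \<phi> k x - f x)) \<longlonglongrightarrow> 0"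
    by (rule tendsto_sandwich[OF _ _ tendsto_const lim]) (auto simp: l2norm_nonneg l2norm_le_h1norm)
  have "l2norm \<Omega> (wd \<Omega> i (\<lambda>x. \<phi> k x - f x)) = l2norm \<Omega> (\<lambda>x. pd i (\<phi> k) x - wd \<Omega> i f x)" for k
  proof (rule l2norm_cong_AE)
    have sm: "H1 \<Omega> (\<phi> k)" by (rule H1_smooth[OF \<Omega>(2) \<Omega>m test_fn_smooth[OF \<phi>]])
    show "L2 \<Omega> (wd \<Omega> i (\<lambda>x. \<phi> k x - f x))" by (rule H1_wd(1)[OF H1_diff(1)[OF \<Omega> sm f1] i])
    show "L2 \<Omega> (\<lambda>x. pd i (\<phi> k) x - wd \<Omega> i f x)" by (intro L2_diff L\<phi> Lf)
    show "AE x in lebesgue_on \<Omega>. wd \<Omega> i (\<lambda>x. \<phi> k x - f x) x = pd i (\<phi> k) x - wd \<Omega> i f x"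
      using H1_diff(2)[OF \<Omega> sm f1 i]
        wd_eqI(3)[OF \<Omega> L\<phi>(2) weak_deriv_smooth[OF \<Omega>(2) \<Omega>m test_fn_smooth[OF \<phi>] i], of k]
      by eventually_elim simp
  qed
  then have "l2norm \<Omega> (\<lambda>x. pd i (\<phi> k) x - wd \<Omega> i f x) \<le> h1norm \<Omega> (\<lambda>x. \<phi> k x - f x)" for k
    using l2norm_wd_le_h1norm[OF i, of \<Omega> "\<lambda>x. \<phi> k x - f x"] by simp
  then have lim1: "(\<lambda>k. l2norm \<Omega> (\<lambda>x. pd i (\<phi> k) x - wd \<Omega> i f x)) \<longlonglongrightarrow> 0"
    by (intro tendsto_sandwich[OF _ _ tendsto_const lim]) (auto simp: l2norm_nonneg)
  have z: "(\<lambda>k::nat. l2norm \<Omega> (\<lambda>x. h x - h x)) \<longlonglongrightarrow> 0" for h by (simp add: l2norm_def)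
  have "(\<lambda>k. \<integral>x. pd i (\<phi> k) x * g x \<partial>lebesgue_on \<Omega>) \<longlonglongrightarrow> (\<integral>x. wd \<Omega> i f x * g x \<partial>lebesgue_on \<Omega>)"
    by (rule tendsto_l2_inner[OF lim1 z]) (use Lf L\<phi> g in auto)
  moreover have "(\<lambda>k. - (\<integral>x. \<phi> k x * g' x \<partial>lebesgue_on \<Omega>)) \<longlonglongrightarrow> - (\<integral>x. f x * g' x \<partial>lebesgue_on \<Omega>)"
    by (intro tendsto_minus tendsto_l2_inner[OF lim0 z]) (use Lf L\<phi> g in auto)
  moreover have "(\<integral>x. pd i (\<phi> k) x * g x \<partial>lebesgue_on \<Omega>) = - (\<integral>x. \<phi> k x * g' x \<partial>lebesgue_on \<Omega>)" for k
    using weak_derivD(1)[OF g(3) \<phi>[of k]] by (simp add: mult.commute)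
  ultimately show ?thesis using LIMSEQ_unique by fastforce
qed

section \<open>Derivatives along tangential fields\<close>

text \<open>\<open>by_parts\<close> is imposed for all smooth g, also those that do not vanish on
  the boundary; in this form the zero boundary values of v enter. The derivatives are parameters, so
  the estimate does not depend on choices of representatives.\<close>

locale weak_hessian =
  fixes \<Omega> :: "'a::euclidean_space set" and v :: "'a \<Rightarrow> real" and D :: "'a \<Rightarrow> 'a \<Rightarrow> real"
    and D2 :: "'a \<Rightarrow> 'a \<Rightarrow> 'a \<Rightarrow> real"
  assumes open_dom: "open \<Omega>" and bounded_dom: "bounded \<Omega>"
    and L2v: "L2 \<Omega> v" and L2D: "i \<in> Basis \<Longrightarrow> L2 \<Omega> (D i)"
    and L2D2: "i \<in> Basis \<Longrightarrow> j \<in> Basis \<Longrightarrow> L2 \<Omega> (D2 i j)"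
    and wD: "i \<in> Basis \<Longrightarrow> weak_deriv \<Omega> i v (D i)"
    and wD2: "i \<in> Basis \<Longrightarrow> j \<in> Basis \<Longrightarrow> weak_deriv \<Omega> j (D i) (D2 i j)"
    and by_parts: "i \<in> Basis \<Longrightarrow> smooth_fun g \<Longrightarrow>
      (\<integral>x. D i x * g x \<partial>lebesgue_on \<Omega>) = - (\<integral>x. v x * pd i g x \<partial>lebesgue_on \<Omega>)"
begin

abbreviation (input) I :: "('a \<Rightarrow> real) \<Rightarrow> real" where
  "I f \<equiv> \<integral>x. f x \<partial>lebesgue_on \<Omega>"

abbreviation (input) hess_trace :: "'a \<Rightarrow> real" where
  "hess_trace \<equiv> (\<lambda>x. \<Sum>i\<in>Basis. D2 i i x)"

text \<open>The right-hand side of the a priori estimate, with the Laplacian in the form of the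
  trace of the weak Hessian.\<close>

definition data_norm :: real where
  "data_norm = l2norm \<Omega> hess_trace + (\<Sum>i\<in>Basis. l2norm \<Omega> (D i))"

lemma meas_dom: "\<Omega> \<in> sets lebesgue" using open_dom by auto

lemma smooth_L2_dom: "smooth_fun g \<Longrightarrow> L2 \<Omega> g"
  by (rule smooth_L2[OF _ bounded_dom meas_dom])

lemma int_mult: "L2 \<Omega> f \<Longrightarrow> smooth_fun g \<Longrightarrow> integrable (lebesgue_on \<Omega>) (\<lambda>x. f x * g x)"
  by (rule L2_mult_integrable[OF _ smooth_L2_dom])

lemma D2_test:
  assumes "i \<in> Basis" "j \<in> Basis" "test_fn \<Omega> \<phi>"
  shows "I (\<lambda>x. D2 i j x * \<phi> x) = I (\<lambda>x. v x * pd i (pd j \<phi>) x)"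
  using weak_derivD(1)[OF wD2[OF assms(1,2)] assms(3)] weak_derivD(1)[OF wD[OF assms(1)] test_fn_pd[OF assms(3,2)]]
  by simp

text \<open>Tested with a test function, both sides equal v integrated against a mixed second
  derivative, and these commute by \<open>pd_commute\<close>.\<close>

lemma D2_sym:
  assumes ij: "i \<in> Basis" "j \<in> Basis"
  shows "AE x in lebesgue_on \<Omega>. D2 i j x = D2 j i x"
proof -
  have "AE x in lebesgue_on \<Omega>. D2 i j x - D2 j i x = 0"
  proof (rule test_fn_orthogonal_imp_AE_0[OF open_dom bounded_dom])
    show "L2 \<Omega> (\<lambda>x. D2 i j x - D2 j i x)" by (intro L2_diff L2D2 ij)
    fix \<phi> assume \<phi>: "test_fn \<Omega> \<phi>"
    have "I (\<lambda>x. (D2 i j x - D2 j i x) * \<phi> x) = I (\<lambda>x. D2 i j x * \<phi> x) - I (\<lambda>x. D2 j i x * \<phi> x)"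
      by (simp add: left_diff_distrib int_mult L2D2 ij test_fn_smooth[OF \<phi>])
    then show "I (\<lambda>x. (D2 i j x - D2 j i x) * \<phi> x) = 0"
      by (simp add: D2_test ij \<phi> pd_commute[OF test_fn_smooth[OF \<phi>] ij])
  qed
  then show ?thesis by simp
qed

lemma D2_sym_int:
  assumes ij: "i \<in> Basis" "j \<in> Basis" and g: "smooth_fun g"
  shows "I (\<lambda>x. D2 i j x * g x) = I (\<lambda>x. D2 j i x * g x)"
proof (rule integral_cong_AE)
  show "AE x in lebesgue_on \<Omega>. D2 i j x * g x = D2 j i x * g x"
    using D2_sym[OF ij] by eventually_elim simp
qed (use int_mult[OF L2D2 g] ij in auto)

end

text \<open>Outside K the integrand already vanishes, so dominated convergence, with |p| as
  majorant, needs the cutoffs to tend to 1 only on K.\<close>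

lemma integral_cutoff_tendsto:
  assumes p: "integrable (lebesgue_on \<Omega>) p" and off: "\<And>x. x \<in> \<Omega> \<Longrightarrow> x \<notin> K \<Longrightarrow> p x = 0"
    and \<eta>: "\<And>n. smooth_fun (\<eta> n)" "\<And>n x. \<bar>\<eta> n x\<bar> \<le> 1" "\<And>x. x \<in> \<Omega> \<Longrightarrow> x \<in> K \<Longrightarrow> (\<lambda>n. \<eta> n x) \<longlonglongrightarrow> 1"
  shows "(\<lambda>n. \<integral>x. \<eta> n x * p x \<partial>lebesgue_on \<Omega>) \<longlonglongrightarrow> (\<integral>x. p x \<partial>lebesgue_on \<Omega>)"
proof (rule integral_dominated_convergence)
  show "integrable (lebesgue_on \<Omega>) (\<lambda>x. \<bar>p x\<bar>)" using p by simp
  show "AE x in lebesgue_on \<Omega>. (\<lambda>n. \<eta> n x * p x) \<longlonglongrightarrow> p x"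
  proof (rule AE_I2)
    fix x assume "x \<in> space (lebesgue_on \<Omega>)"
    then have x: "x \<in> \<Omega>" by simp
    show "(\<lambda>n. \<eta> n x * p x) \<longlonglongrightarrow> p x"
    proof (cases "x \<in> K")
      case True
      have "(\<lambda>n. \<eta> n x * p x) \<longlonglongrightarrow> 1 * p x" by (intro tendsto_mult \<eta>(3) x True tendsto_const)
      then show ?thesis by simp
    qed (simp add: off x)
  qed
  show "AE x in lebesgue_on \<Omega>. norm (\<eta> n x * p x) \<le> \<bar>p x\<bar>" for n
    using \<eta>(2) by (intro AE_I2) (simp add: abs_mult mult_left_le_one_le)
  show "(\<lambda>x. \<eta> n x * p x) \<in> borel_measurable (lebesgue_on \<Omega>)" for n
    by (intro borel_measurable_times smooth_measurable \<eta>(1) borel_measurable_integrable p)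
qed (use p in auto)

context weak_hessian
begin

text \<open>A cutoff depending only on the boundary distance is invisible to tangential derivatives, so
  integration by parts along a tangential field produces no boundary term.\<close>
lemma tangential_by_parts:
  assumes \<tau>: "\<And>l. l \<in> Basis \<Longrightarrow> smooth_fun (\<tau> l)" and K: "closed K" "\<And>l x. l \<in> Basis \<Longrightarrow> x \<notin> K \<Longrightarrow> \<tau> l x = 0"
    and \<eta>: "\<And>n. smooth_fun (\<eta> n)" "\<And>n x. \<bar>\<eta> n x\<bar> \<le> 1" "\<And>x. x \<in> \<Omega> \<Longrightarrow> x \<in> K \<Longrightarrow> (\<lambda>n. \<eta> n x) \<longlonglongrightarrow> 1"
    and \<eta>\<tau>: "\<And>n l. l \<in> Basis \<Longrightarrow> test_fn \<Omega> (\<lambda>x. \<eta> n x * \<tau> l x)"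
      "\<And>n x. (\<Sum>l\<in>Basis. \<tau> l x * pd l (\<eta> n) x) = 0"
    and \<phi>: "smooth_fun \<phi>" and k: "k \<in> Basis"
  shows "(\<Sum>l\<in>Basis. I (\<lambda>x. D2 k l x * (\<tau> l x * \<phi> x))) = - I (\<lambda>x. D k x * (\<Sum>l\<in>Basis. pd l (\<lambda>x. \<tau> l x * \<phi> x) x))"
proof -
  let ?\<tau> = "\<lambda>l x. \<tau> l x * \<phi> x"
  let ?d = "\<lambda>x. \<Sum>l\<in>Basis. pd l (?\<tau> l) x"
  have s: "smooth_fun (?\<tau> l)" if "l \<in> Basis" for l using that by (intro smooth_intros \<tau> \<phi>)
  have sd: "smooth_fun ?d" by (intro smooth_sum smooth_fun_pd s)
  have eq: "(\<Sum>l\<in>Basis. I (\<lambda>x. \<eta> n x * (D2 k l x * ?\<tau> l x))) = - I (\<lambda>x. \<eta> n x * (D k x * ?d x))" for n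
  proof -
    let ?\<psi> = "\<lambda>l x. \<eta> n x * ?\<tau> l x"
    have t: "test_fn \<Omega> (?\<psi> l)" if "l \<in> Basis" for l
      using test_fn_mult(1)[OF \<eta>\<tau>(1)[OF that] \<phi>, of n] by (simp add: mult.assoc)
    have "(\<Sum>l\<in>Basis. I (\<lambda>x. \<eta> n x * (D2 k l x * ?\<tau> l x))) = (\<Sum>l\<in>Basis. - I (\<lambda>x. D k x * pd l (?\<psi> l) x))"
      using weak_derivD(1)[OF wD2[OF k] t] by (intro sum.cong) (auto simp: mult.left_commute)
    also have "\<dots> = - I (\<lambda>x. \<Sum>l\<in>Basis. D k x * pd l (?\<psi> l) x)"
      unfolding sum_negf using test_fn_smooth[OF test_fn_pd[OF t]]
      by (subst Bochner_Integration.integral_sum) (auto intro!: int_mult L2D k)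
    also have "(\<lambda>x. \<Sum>l\<in>Basis. D k x * pd l (?\<psi> l) x) = (\<lambda>x. \<eta> n x * (D k x * ?d x))"
    proof
      fix x
      have "(\<Sum>l\<in>Basis. D k x * pd l (?\<psi> l) x) = (\<Sum>l\<in>Basis. D k x * (\<eta> n x * pd l (?\<tau> l) x + pd l (\<eta> n) x * ?\<tau> l x))"
        by (intro sum.cong) (auto simp: pd_mult \<eta>(1) s)
      \<comment> \<open>The derivative of the cutoff occurs only contracted with the field, where it
        vanishes; no term that could blow up with n survives.\<close>
      also have "\<dots> = \<eta> n x * (D k x * ?d x) + D k x * \<phi> x * (\<Sum>l\<in>Basis. \<tau> l x * pd l (\<eta> n) x)"
        by (simp add: distrib_left sum.distrib sum_distrib_left mult_ac)
      finally show "(\<Sum>l\<in>Basis. D k x * pd l (?\<psi> l) x) = \<eta> n x * (D k x * ?d x)" by (simp add: \<eta>\<tau>(2))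
    qed
    finally show ?thesis .
  qed
  have "(\<lambda>n. \<Sum>l\<in>Basis. I (\<lambda>x. \<eta> n x * (D2 k l x * ?\<tau> l x))) \<longlonglongrightarrow> (\<Sum>l\<in>Basis. I (\<lambda>x. D2 k l x * ?\<tau> l x))"
    by (intro tendsto_sum integral_cutoff_tendsto[of _ _ K] \<eta> int_mult L2D2 k s) (auto simp: K)
  moreover have "(\<lambda>n. - I (\<lambda>x. \<eta> n x * (D k x * ?d x))) \<longlonglongrightarrow> - I (\<lambda>x. D k x * ?d x)"
  proof (intro tendsto_minus integral_cutoff_tendsto[of _ _ K] \<eta> int_mult L2D k sd)
    fix x assume x: "x \<notin> K"
    have "pd l (?\<tau> l) x = 0" if "l \<in> Basis" for l
      by (rule pd_eq_0_off[of K]) (use K x that in auto)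
    then show "D k x * ?d x = 0" by simp
  qed
  ultimately show ?thesis unfolding eq by (rule LIMSEQ_unique)
qed

text \<open>Testing against functions that need not vanish on the boundary: the derivative of \<open>v\<close> along a
  tangential field has zero trace.\<close>
lemma tangential_derivative_zero_trace:
  assumes \<tau>: "\<And>l. l \<in> Basis \<Longrightarrow> smooth_fun (\<tau> l)"
    and parts: "\<And>\<phi> k. smooth_fun \<phi> \<Longrightarrow> k \<in> Basis \<Longrightarrow>
      (\<Sum>l\<in>Basis. I (\<lambda>x. D2 k l x * (\<tau> l x * \<phi> x))) = - I (\<lambda>x. D k x * (\<Sum>l\<in>Basis. pd l (\<lambda>x. \<tau> l x * \<phi> x) x))"
    and \<phi>: "smooth_fun \<phi>" and k: "k \<in> Basis"
  shows "I (\<lambda>x. (\<Sum>l\<in>Basis. \<tau> l x * D l x) * pd k \<phi> x)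
    = - I (\<lambda>x. (\<Sum>l\<in>Basis. \<tau> l x * D2 l k x + pd k (\<tau> l) x * D l x) * \<phi> x)"
proof -
  let ?\<tau> = "\<lambda>l x. \<tau> l x * \<phi> x"
  have s: "smooth_fun (?\<tau> l)" if "l \<in> Basis" for l using that by (intro smooth_intros \<tau> \<phi>)
  have s2: "smooth_fun (\<lambda>x. \<tau> l x * pd k \<phi> x)" "smooth_fun (\<lambda>x. pd k (\<tau> l) x * \<phi> x)" if "l \<in> Basis" for l
    using that by (intro smooth_intros \<tau> \<phi> k; simp)+
  have "I (\<lambda>x. (\<Sum>l\<in>Basis. \<tau> l x * D2 l k x + pd k (\<tau> l) x * D l x) * \<phi> x)
     = I (\<lambda>x. \<Sum>l\<in>Basis. D2 l k x * ?\<tau> l x + D l x * (pd k (\<tau> l) x * \<phi> x))"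
    by (intro Bochner_Integration.integral_cong) (auto simp: sum_distrib_left sum_distrib_right algebra_simps intro!: sum.cong)
  also have "\<dots> = (\<Sum>l\<in>Basis. I (\<lambda>x. D2 l k x * ?\<tau> l x) + I (\<lambda>x. D l x * (pd k (\<tau> l) x * \<phi> x)))"
    by (simp add: int_mult L2D L2D2 s s2 k)
  also have "\<dots> = (\<Sum>l\<in>Basis. I (\<lambda>x. D2 k l x * ?\<tau> l x)) + (\<Sum>l\<in>Basis. I (\<lambda>x. D l x * (pd k (\<tau> l) x * \<phi> x)))"
    by (simp add: sum.distrib D2_sym_int[OF _ k s])
  also have "(\<Sum>l\<in>Basis. I (\<lambda>x. D2 k l x * ?\<tau> l x)) = - I (\<lambda>x. D k x * (\<Sum>l\<in>Basis. pd l (?\<tau> l) x))"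
    by (rule parts[OF \<phi> k])
  \<comment> \<open>The second factor does not vanish on the boundary; the boundary condition of v
    is what permits this integration by parts.\<close>
  also have "\<dots> = I (\<lambda>x. v x * pd k (\<lambda>x. \<Sum>l\<in>Basis. pd l (?\<tau> l) x) x)"
    using by_parts[OF k, of "\<lambda>x. \<Sum>l\<in>Basis. pd l (?\<tau> l) x"] by (simp add: smooth_sum smooth_fun_pd s)
  also have "\<dots> = I (\<lambda>x. \<Sum>l\<in>Basis. v x * pd k (pd l (?\<tau> l)) x)"
    by (subst pd_sum) (auto simp: smooth_fun_pd s sum_distrib_left)
  also have "\<dots> = (\<Sum>l\<in>Basis. I (\<lambda>x. v x * pd k (pd l (?\<tau> l)) x))"
    by (rule Bochner_Integration.integral_sum) (auto intro!: int_mult L2v smooth_fun_pd s k)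
  also have "(\<Sum>l\<in>Basis. I (\<lambda>x. D l x * (pd k (\<tau> l) x * \<phi> x))) = - (\<Sum>l\<in>Basis. I (\<lambda>x. v x * pd l (\<lambda>x. pd k (\<tau> l) x * \<phi> x) x))"
    unfolding sum_negf[symmetric] by (intro sum.cong) (auto simp: by_parts s2)
  also have "(\<Sum>l\<in>Basis. I (\<lambda>x. v x * pd k (pd l (?\<tau> l)) x)) + - (\<Sum>l\<in>Basis. I (\<lambda>x. v x * pd l (\<lambda>x. pd k (\<tau> l) x * \<phi> x) x))
    = (\<Sum>l\<in>Basis. I (\<lambda>x. v x * pd k (pd l (?\<tau> l)) x) - I (\<lambda>x. v x * pd l (\<lambda>x. pd k (\<tau> l) x * \<phi> x) x))"
    by (simp add: sum_subtractf)
  \<comment> \<open>By the product rule and commuting derivatives, d_k d_l (tau_l phi) is d_l (tau_l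
    d_k phi) + d_l ((d_k tau_l) phi); the last term is the one subtracted.\<close>
  also have "\<dots> = (\<Sum>l\<in>Basis. I (\<lambda>x. v x * pd l (\<lambda>x. \<tau> l x * pd k \<phi> x) x))"
  proof (intro sum.cong refl)
    fix l :: 'a assume l: "l \<in> Basis"
    have "I (\<lambda>x. v x * pd k (pd l (?\<tau> l)) x) - I (\<lambda>x. v x * pd l (\<lambda>x. pd k (\<tau> l) x * \<phi> x) x)
      = I (\<lambda>x. v x * pd k (pd l (?\<tau> l)) x - v x * pd l (\<lambda>x. pd k (\<tau> l) x * \<phi> x) x)"
      by (subst Bochner_Integration.integral_diff) (auto intro!: int_mult L2v smooth_fun_pd s s2 k l)
    moreover have "pd k (pd l (?\<tau> l)) = (\<lambda>x. pd l (\<lambda>x. \<tau> l x * pd k \<phi> x) x + pd l (\<lambda>x. pd k (\<tau> l) x * \<phi> x) x)"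
      using pd_add[OF s2(1)[OF l] s2(2)[OF l], of l] pd_mult[OF \<tau>[OF l] \<phi>, of k] pd_commute[OF s[OF l] k l] by simp
    ultimately show "I (\<lambda>x. v x * pd k (pd l (?\<tau> l)) x) - I (\<lambda>x. v x * pd l (\<lambda>x. pd k (\<tau> l) x * \<phi> x) x)
      = I (\<lambda>x. v x * pd l (\<lambda>x. \<tau> l x * pd k \<phi> x) x)"
      by (simp add: distrib_left)
  qed
  also have "\<dots> = - (\<Sum>l\<in>Basis. I (\<lambda>x. D l x * (\<tau> l x * pd k \<phi> x)))"
    unfolding sum_negf[symmetric] by (intro sum.cong) (auto simp: by_parts s2)
  also have "(\<Sum>l\<in>Basis. I (\<lambda>x. D l x * (\<tau> l x * pd k \<phi> x))) = I (\<lambda>x. \<Sum>l\<in>Basis. D l x * (\<tau> l x * pd k \<phi> x))"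
    by (rule Bochner_Integration.integral_sum[symmetric]) (auto intro!: int_mult L2D s2)
  also have "\<dots> = I (\<lambda>x. (\<Sum>l\<in>Basis. \<tau> l x * D l x) * pd k \<phi> x)"
    by (intro Bochner_Integration.integral_cong) (auto simp: sum_distrib_left sum_distrib_right mult_ac intro!: sum.cong)
  finally show ?thesis by simp
qed

text \<open>Formally the bracket with index k is the sum over l of d_l (tau_l D_k - tau_k D_l), the
  divergence of an antisymmetric matrix, so its own divergence vanishes. As it begins with the
  Hessian contracted with the field, this is the weak equation satisfied by the derivative of v
  along the field.\<close>

lemma commuted_equation:
  assumes \<tau>: "\<And>l. l \<in> Basis \<Longrightarrow> smooth_fun (\<tau> l)" and \<phi>: "test_fn \<Omega> \<phi>"
  shows "(\<Sum>k\<in>Basis. I (\<lambda>x. ((\<Sum>l\<in>Basis. \<tau> l x * D2 l k x) + (\<Sum>l\<in>Basis. pd l (\<tau> l) x * D k x)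
       - hess_trace x * \<tau> k x - (\<Sum>l\<in>Basis. D l x * pd l (\<tau> k) x)) * pd k \<phi> x)) = 0"
proof -
  note s = test_fn_smooth[OF \<phi>]
  have sp: "smooth_fun (pd k \<phi>)" if "k \<in> Basis" for k by (rule smooth_fun_pd[OF s that])
  let ?a = "\<lambda>k l. I (\<lambda>x. D2 l k x * (\<tau> l x * pd k \<phi> x))"
  let ?b = "\<lambda>k l. I (\<lambda>x. D k x * (pd l (\<tau> l) x * pd k \<phi> x))"
  let ?c = "\<lambda>k i. I (\<lambda>x. D2 i i x * (\<tau> k x * pd k \<phi> x))"
  let ?d = "\<lambda>k l. I (\<lambda>x. D l x * (pd l (\<tau> k) x * pd k \<phi> x))"
  let ?e = "\<lambda>k l. I (\<lambda>x. D k x * (\<tau> l x * pd l (pd k \<phi>) x))"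
  have sm: "smooth_fun (\<lambda>x. \<tau> l x * pd k \<phi> x)" "smooth_fun (\<lambda>x. pd m (\<tau> l) x * pd k \<phi> x)" "smooth_fun (\<lambda>x. \<tau> l x * pd m (pd k \<phi>) x)"
    if "k \<in> Basis" "l \<in> Basis" "m \<in> Basis" for k l m
    using that by (intro smooth_mult smooth_fun_pd \<tau> s; simp)+
  have "I (\<lambda>x. ((\<Sum>l\<in>Basis. \<tau> l x * D2 l k x) + (\<Sum>l\<in>Basis. pd l (\<tau> l) x * D k x)
       - hess_trace x * \<tau> k x - (\<Sum>l\<in>Basis. D l x * pd l (\<tau> k) x)) * pd k \<phi> x)
    = (\<Sum>l\<in>Basis. ?a k l + ?b k l - ?c k l - ?d k l)" if k: "k \<in> Basis" for k
  proof -
    have "I (\<lambda>x. ((\<Sum>l\<in>Basis. \<tau> l x * D2 l k x) + (\<Sum>l\<in>Basis. pd l (\<tau> l) x * D k x)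
       - hess_trace x * \<tau> k x - (\<Sum>l\<in>Basis. D l x * pd l (\<tau> k) x)) * pd k \<phi> x)
      = I (\<lambda>x. \<Sum>l\<in>Basis. D2 l k x * (\<tau> l x * pd k \<phi> x) + D k x * (pd l (\<tau> l) x * pd k \<phi> x)
          - D2 l l x * (\<tau> k x * pd k \<phi> x) - D l x * (pd l (\<tau> k) x * pd k \<phi> x))"
      by (intro Bochner_Integration.integral_cong refl)
         (simp add: sum_distrib_right sum_distrib_left sum.distrib sum_subtractf algebra_simps)
    also have "\<dots> = (\<Sum>l\<in>Basis. ?a k l + ?b k l - ?c k l - ?d k l)"
      using k by (simp add: int_mult L2D L2D2 sm)
    finally show ?thesis .
  qed
  then have "(\<Sum>k\<in>Basis. I (\<lambda>x. ((\<Sum>l\<in>Basis. \<tau> l x * D2 l k x) + (\<Sum>l\<in>Basis. pd l (\<tau> l) x * D k x)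
       - hess_trace x * \<tau> k x - (\<Sum>l\<in>Basis. D l x * pd l (\<tau> k) x)) * pd k \<phi> x))
    = (\<Sum>k\<in>Basis. \<Sum>l\<in>Basis. ?a k l + ?b k l - ?c k l - ?d k l)" by simp
  also have "\<dots> = (\<Sum>k\<in>Basis. \<Sum>l\<in>Basis. ?a k l + ?b k l) - (\<Sum>k\<in>Basis. \<Sum>l\<in>Basis. ?c k l + ?d k l)"
    by (simp add: sum_subtractf sum.distrib)
  \<comment> \<open>Integration by parts in direction l turns this half into minus the sum of
    \<open>?e k l\<close>. The other half becomes minus the sum of \<open>?e l k\<close>, and
    exchanging the summations cancels them.\<close>
  also have "(\<Sum>k\<in>Basis. \<Sum>l\<in>Basis. ?a k l + ?b k l) = (\<Sum>k\<in>Basis. \<Sum>l\<in>Basis. - ?e k l)"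
  proof (intro sum.cong refl)
    fix k l :: 'a assume k: "k \<in> Basis" and l: "l \<in> Basis"
    have t: "test_fn \<Omega> (\<lambda>x. \<tau> l x * pd k \<phi> x)" by (rule test_fn_mult(2)[OF test_fn_pd[OF \<phi> k] \<tau>[OF l]])
    have "?a k l = I (\<lambda>x. D2 k l x * (\<tau> l x * pd k \<phi> x))" by (rule D2_sym_int[OF l k sm(1)[OF k l l]])
    also have "\<dots> = - I (\<lambda>x. D k x * pd l (\<lambda>x. \<tau> l x * pd k \<phi> x) x)"
      using weak_derivD(1)[OF wD2[OF k l] t] by simp
    also have "\<dots> = - I (\<lambda>x. D k x * (\<tau> l x * pd l (pd k \<phi>) x) + D k x * (pd l (\<tau> l) x * pd k \<phi> x))"
      unfolding pd_mult[OF \<tau>[OF l] sp[OF k]] by (simp add: distrib_left)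
    also have "\<dots> = - (?e k l + ?b k l)"
      by (subst Bochner_Integration.integral_add) (auto intro!: int_mult L2D sm k l)
    finally show "?a k l + ?b k l = - ?e k l" by simp
  qed
  also have "(\<Sum>k\<in>Basis. \<Sum>l\<in>Basis. ?c k l + ?d k l) = (\<Sum>k\<in>Basis. \<Sum>l\<in>Basis. - ?e l k)"
  proof (intro sum.cong refl)
    fix k l :: 'a assume k: "k \<in> Basis" and l: "l \<in> Basis"
    have t: "test_fn \<Omega> (\<lambda>x. \<tau> k x * pd k \<phi> x)" by (rule test_fn_mult(2)[OF test_fn_pd[OF \<phi> k] \<tau>[OF k]])
    have "?c k l = - I (\<lambda>x. D l x * pd l (\<lambda>x. \<tau> k x * pd k \<phi> x) x)"
      using weak_derivD(1)[OF wD2[OF l l] t] by simp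
    also have "\<dots> = - I (\<lambda>x. D l x * (\<tau> k x * pd k (pd l \<phi>) x) + D l x * (pd l (\<tau> k) x * pd k \<phi> x))"
      unfolding pd_mult[OF \<tau>[OF k] sp[OF k]] pd_commute[OF s l k] by (simp add: distrib_left)
    also have "\<dots> = - (?e l k + ?d k l)"
      by (subst Bochner_Integration.integral_add) (auto intro!: int_mult L2D sm k l)
    finally show "?c k l + ?d k l = - ?e l k" by simp
  qed
  also have "(\<Sum>k\<in>Basis. \<Sum>l\<in>Basis. - ?e l k) = (\<Sum>k\<in>Basis. \<Sum>l\<in>Basis. - ?e k l)" by (rule sum.swap)
  finally show ?thesis by simp
qed

text \<open>The mollifications of W are test functions because S points inwards, and their
  derivatives are the mollifications of G because W has zero trace. Inserting them in
  \<open>orth\<close> and passing to the L2 limit puts G in the place of a test function's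
  gradient.\<close>

lemma mollified_orthogonality:
  assumes W: "L2 \<Omega> W" "\<And>k. k \<in> Basis \<Longrightarrow> L2 \<Omega> (G k)" "\<And>k. k \<in> Basis \<Longrightarrow> L2 \<Omega> (Q k)"
    and zero_trace: "\<And>\<phi> k. smooth_fun \<phi> \<Longrightarrow> k \<in> Basis \<Longrightarrow> I (\<lambda>x. W x * pd k \<phi> x) = - I (\<lambda>x. G k x * \<phi> x)"
    and orth: "\<And>\<phi>. test_fn \<Omega> \<phi> \<Longrightarrow> (\<Sum>k\<in>Basis. I (\<lambda>x. Q k x * pd k \<phi> x)) = 0"
    and J: "mollifier J" "\<And>z. z \<notin> S \<Longrightarrow> J z = 0" "compact S"
    and K: "compact K" "\<And>y. y \<in> \<Omega> \<Longrightarrow> y \<notin> K \<Longrightarrow> W y = 0"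
    and e: "e > 0" "\<And>y z t. y \<in> K \<Longrightarrow> z \<in> S \<Longrightarrow> 0 < t \<Longrightarrow> t < e \<Longrightarrow> y + t *\<^sub>R z \<in> \<Omega>"
  shows "(\<Sum>k\<in>Basis. I (\<lambda>x. Q k x * G k x)) = 0"
proof -
  obtain R where R: "\<And>z. z \<in> S \<Longrightarrow> norm z \<le> R" using compact_imp_bounded[OF J(3)] by (auto simp: bounded_iff)
  have J': "J z = 0" if "z \<notin> cball 0 R" for z using that R J(2)[of z] by force
  note Wi = L2_integrable(1)[OF bounded_dom meas_dom W(1)]
  have T: "test_fn UNIV (rescaled J n)" for n using mollifier_rescaled[OF J(1)] by (simp add: mollifier_def)
  \<comment> \<open>For fixed x the reflected kernel is smooth in y but need not vanish on the
    boundary, which is why \<open>zero_trace\<close> is demanded for all smooth functions.\<close>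
  have pdc: "pd k (conv \<Omega> (rescaled J n) W) = conv \<Omega> (rescaled J n) (G k)" if k: "k \<in> Basis" for k n
  proof
    fix x
    let ?m = "\<lambda>y. rescaled J n (x + (-1) *\<^sub>R y)"
    have sm: "smooth_fun ?m" by (rule smooth_affine[OF test_fn_smooth[OF T]])
    have "pd k (conv \<Omega> (rescaled J n) W) x = I (\<lambda>y. pd k (rescaled J n) (x - y) * W y)"
      unfolding pd_conv[OF T Wi k] by (simp add: conv_def)
    also have "\<dots> = - I (\<lambda>y. W y * pd k ?m y)"
      unfolding pd_affine[OF test_fn_smooth[OF T] k] by (simp add: mult.commute)
    also have "\<dots> = I (\<lambda>y. G k y * ?m y)" using zero_trace[OF sm k] by linarith
    also have "\<dots> = conv \<Omega> (rescaled J n) (G k) x" by (simp add: conv_def mult.commute)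
    finally show "pd k (conv \<Omega> (rescaled J n) W) x = conv \<Omega> (rescaled J n) (G k) x" .
  qed
  have "eventually (\<lambda>n. test_fn \<Omega> (conv \<Omega> (rescaled J n) W)) sequentially"
    by (rule test_fn_conv_rescaled[OF J Wi K(2,1) e]) 
  then have "eventually (\<lambda>n. (\<Sum>k\<in>Basis. I (\<lambda>x. Q k x * conv \<Omega> (rescaled J n) (G k) x)) = 0) sequentially"
  proof eventually_elim
    case (elim n)
    show ?case using orth[OF elim] by (simp add: pdc)
  qed
  then have "(\<lambda>n. \<Sum>k\<in>Basis. I (\<lambda>x. Q k x * conv \<Omega> (rescaled J n) (G k) x)) \<longlonglongrightarrow> 0"
    by (rule tendsto_eventually)
  moreover have "(\<lambda>n. \<Sum>k\<in>Basis. I (\<lambda>x. Q k x * conv \<Omega> (rescaled J n) (G k) x)) \<longlonglongrightarrow> (\<Sum>k\<in>Basis. I (\<lambda>x. Q k x * G k x))"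
  proof (rule tendsto_sum)
    fix k :: 'a assume k: "k \<in> Basis"
    show "(\<lambda>n. I (\<lambda>x. Q k x * conv \<Omega> (rescaled J n) (G k) x)) \<longlonglongrightarrow> I (\<lambda>x. Q k x * G k x)"
    proof (rule tendsto_l2_inner)
      show "(\<lambda>n::nat. l2norm \<Omega> (\<lambda>x. Q k x - Q k x)) \<longlonglongrightarrow> 0" by (simp add: l2norm_def)
      show "(\<lambda>n. l2norm \<Omega> (\<lambda>x. conv \<Omega> (rescaled J n) (G k) x - G k x)) \<longlonglongrightarrow> 0"
        by (rule conv_rescaled_tendsto_L2[OF J(1) J' open_dom bounded_dom W(2)[OF k]])
    qed (use W k conv_L2(1)[OF mollifier_rescaled[OF J(1)] bounded_dom meas_dom] in auto)
  qed
  ultimately show ?thesis using LIMSEQ_unique by blast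
qed

lemma data_norm_bounds:
  "0 \<le> data_norm" "l2norm \<Omega> hess_trace \<le> data_norm" "(\<Sum>i\<in>Basis. l2norm \<Omega> (D i)) \<le> data_norm"
  "i \<in> Basis \<Longrightarrow> l2norm \<Omega> (D i) \<le> data_norm"
proof -
  have s: "0 \<le> (\<Sum>i\<in>Basis. l2norm \<Omega> (D i))" by (intro sum_nonneg l2norm_nonneg)
  show "0 \<le> data_norm" "l2norm \<Omega> hess_trace \<le> data_norm" "(\<Sum>i\<in>Basis. l2norm \<Omega> (D i)) \<le> data_norm"
    using s l2norm_nonneg[of \<Omega> hess_trace] by (simp_all add: data_norm_def)
  assume "i \<in> Basis"
  then have "l2norm \<Omega> (D i) \<le> (\<Sum>i\<in>Basis. l2norm \<Omega> (D i))" by (intro member_le_sum l2norm_nonneg) auto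
  then show "l2norm \<Omega> (D i) \<le> data_norm" using l2norm_nonneg[of \<Omega> hess_trace] by (simp add: data_norm_def)
qed

text \<open>With \<open>G\<close> the gradient of the tangential derivative and \<open>G + R\<close> orthogonal to \<open>G\<close>, the norm of
  \<open>G\<close> is at most that of \<open>R\<close>, which contains no second derivative except the trace.\<close>
lemma tangential_estimate:
  assumes \<tau>: "\<And>l. l \<in> Basis \<Longrightarrow> smooth_fun (\<tau> l)"
    and B: "\<And>l x. l \<in> Basis \<Longrightarrow> \<bar>\<tau> l x\<bar> \<le> B" "\<And>l m x. l \<in> Basis \<Longrightarrow> m \<in> Basis \<Longrightarrow> \<bar>pd m (\<tau> l) x\<bar> \<le> B"
    and parts: "\<And>\<phi> k. smooth_fun \<phi> \<Longrightarrow> k \<in> Basis \<Longrightarrow>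
      (\<Sum>l\<in>Basis. I (\<lambda>x. D2 k l x * (\<tau> l x * \<phi> x))) = - I (\<lambda>x. D k x * (\<Sum>l\<in>Basis. pd l (\<lambda>x. \<tau> l x * \<phi> x) x))"
    and J: "mollifier J" "\<And>z. z \<notin> S \<Longrightarrow> J z = 0" "compact S"
    and K: "compact K" "\<And>l y. l \<in> Basis \<Longrightarrow> y \<in> \<Omega> \<Longrightarrow> y \<notin> K \<Longrightarrow> \<tau> l y = 0"
    and e: "e > 0" "\<And>y z t. y \<in> K \<Longrightarrow> z \<in> S \<Longrightarrow> 0 < t \<Longrightarrow> t < e \<Longrightarrow> y + t *\<^sub>R z \<in> \<Omega>"
    and k: "k \<in> Basis"
  shows "l2norm \<Omega> (\<lambda>x. \<Sum>l\<in>Basis. \<tau> l x * D2 l k x) \<le> (real DIM('a) * (real DIM('a) + 3) + 1) * B * data_norm"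
proof -
  let ?N = "real DIM('a)"
  have B0: "B \<ge> 0" using B(1)[OF k, of 0] by linarith
  define W where "W x = (\<Sum>l\<in>Basis. \<tau> l x * D l x)" for x
  define G where "G k x = (\<Sum>l\<in>Basis. \<tau> l x * D2 l k x + pd k (\<tau> l) x * D l x)" for k x
  define Q where "Q k x = ((\<Sum>l\<in>Basis. \<tau> l x * D2 l k x) + (\<Sum>l\<in>Basis. pd l (\<tau> l) x * D k x)
       - hess_trace x * \<tau> k x - (\<Sum>l\<in>Basis. D l x * pd l (\<tau> k) x))" for k x
  define R where "R k x = Q k x - G k x" for k x
  note sm = L2_smooth_mult[OF _ _ bounded_dom]
  have LW: "L2 \<Omega> W" unfolding W_def by (intro L2_sum sm \<tau> L2D)
  have LG: "L2 \<Omega> (G k)" if "k \<in> Basis" for k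
    unfolding G_def using that by (intro L2_sum L2_add sm \<tau> smooth_fun_pd L2D L2D2)
  have LQ: "L2 \<Omega> (Q k)" if "k \<in> Basis" for k
    unfolding Q_def using that by (intro L2_diff L2_add L2_sum sm \<tau> smooth_fun_pd L2D L2D2)
  have LR: "L2 \<Omega> (R k)" if "k \<in> Basis" for k unfolding R_def using that by (intro L2_diff LQ LG)
  have "(\<Sum>k\<in>Basis. I (\<lambda>x. Q k x * G k x)) = 0"
  proof (rule mollified_orthogonality[OF LW LG LQ _ _ J K(1) _ e])
    show "I (\<lambda>x. W x * pd k \<phi> x) = - I (\<lambda>x. G k x * \<phi> x)" if "smooth_fun \<phi>" "k \<in> Basis" for \<phi> k
      unfolding W_def G_def by (rule tangential_derivative_zero_trace[OF \<tau> parts that])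
    show "(\<Sum>k\<in>Basis. I (\<lambda>x. Q k x * pd k \<phi> x)) = 0" if "test_fn \<Omega> \<phi>" for \<phi>
      unfolding Q_def by (rule commuted_equation[OF \<tau> that])
  qed (auto simp: W_def K)
  moreover have "I (\<lambda>x. Q k x * G k x) = I (\<lambda>x. R k x * G k x) + (l2norm \<Omega> (G k))\<^sup>2" if "k \<in> Basis" for k
  proof -
    have "I (\<lambda>x. Q k x * G k x) = I (\<lambda>x. R k x * G k x + (G k x)\<^sup>2)"
      by (intro Bochner_Integration.integral_cong) (auto simp: R_def power2_eq_square algebra_simps)
    then show ?thesis
      using that by (simp add: L2_mult_integrable LR LG L2_integrable_sq l2norm_sq)
  qed
  ultimately have E: "(\<Sum>k\<in>Basis. (l2norm \<Omega> (G k))\<^sup>2) = - (\<Sum>k\<in>Basis. I (\<lambda>x. R k x * G k x))"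
    by (simp add: sum.distrib)
  define s where "s = sqrt (\<Sum>k\<in>Basis. (l2norm \<Omega> (G k))\<^sup>2)"
  have s0: "s \<ge> 0" by (simp add: s_def sum_nonneg)
  have s2: "s\<^sup>2 = (\<Sum>k\<in>Basis. (l2norm \<Omega> (G k))\<^sup>2)" by (simp add: s_def sum_nonneg)
  have Gs: "l2norm \<Omega> (G k) \<le> s" if "k \<in> Basis" for k
    unfolding s_def using that by (intro real_le_rsqrt member_le_sum[of k Basis "\<lambda>k. (l2norm \<Omega> (G k))\<^sup>2"]) auto
  have "s\<^sup>2 \<le> (\<Sum>k\<in>Basis. \<bar>I (\<lambda>x. R k x * G k x)\<bar>)"
    unfolding s2 E using sum_abs[of "\<lambda>k. I (\<lambda>x. R k x * G k x)" Basis] by linarith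
  also have "\<dots> \<le> (\<Sum>k\<in>Basis. l2norm \<Omega> (R k) * s)"
  proof (rule sum_mono)
    fix k :: 'a assume k: "k \<in> Basis"
    have "\<bar>I (\<lambda>x. R k x * G k x)\<bar> \<le> l2norm \<Omega> (R k) * l2norm \<Omega> (G k)" by (rule l2_Cauchy_Schwarz[OF LR[OF k] LG[OF k]])
    also have "\<dots> \<le> l2norm \<Omega> (R k) * s" by (intro mult_left_mono Gs k l2norm_nonneg)
    finally show "\<bar>I (\<lambda>x. R k x * G k x)\<bar> \<le> l2norm \<Omega> (R k) * s" .
  qed
  also have "\<dots> = (\<Sum>k\<in>Basis. l2norm \<Omega> (R k)) * s" by (simp add: sum_distrib_right)
  finally have "s * s \<le> (\<Sum>k\<in>Basis. l2norm \<Omega> (R k)) * s" by (simp add: power2_eq_square)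
  then have sR: "s \<le> (\<Sum>k\<in>Basis. l2norm \<Omega> (R k))"
    using s0 by (cases "s = 0") (auto simp: sum_nonneg l2norm_nonneg)
  have bm: "l2norm \<Omega> (\<lambda>x. h x * g x) \<le> B * l2norm \<Omega> g" if "L2 \<Omega> g" "smooth_fun h" "\<And>x. \<bar>h x\<bar> \<le> B" for h g
    by (rule L2_bounded_mult(2)[OF that(1) smooth_measurable[OF that(2)]]) (use that(3) in auto)
  have bs: "l2norm \<Omega> (\<lambda>x. \<Sum>l\<in>Basis. h l x * g l x) \<le> B * (\<Sum>l\<in>Basis. l2norm \<Omega> (g l))"
    if "\<And>l. l \<in> Basis \<Longrightarrow> L2 \<Omega> (g l)" "\<And>l. l \<in> Basis \<Longrightarrow> smooth_fun (h l)" "\<And>l x. l \<in> Basis \<Longrightarrow> \<bar>h l x\<bar> \<le> B"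
    for h g :: "'a \<Rightarrow> 'a \<Rightarrow> real"
  proof -
    have "l2norm \<Omega> (\<lambda>x. \<Sum>l\<in>Basis. h l x * g l x) \<le> (\<Sum>l\<in>Basis. l2norm \<Omega> (\<lambda>x. h l x * g l x))"
      by (intro l2norm_sum sm that)
    also have "\<dots> \<le> (\<Sum>l\<in>Basis. B * l2norm \<Omega> (g l))" by (intro sum_mono bm that)
    finally show ?thesis by (simp add: sum_distrib_left)
  qed
  \<comment> \<open>The four parts of \<open>R k\<close> contribute N, 1, 1 and 1 times
    \<open>B * data_norm\<close>. Summation over the N components bounds G, and the + 1 of the final
    constant pays for removing from G the terms with derivatives of the field.\<close>
  have Rb: "l2norm \<Omega> (R k) \<le> (?N + 3) * B * data_norm" if k: "k \<in> Basis" for k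
  proof -
    let ?r1 = "\<lambda>x. \<Sum>l\<in>Basis. pd l (\<tau> l) x * D k x" and ?r2 = "\<lambda>x. \<tau> k x * hess_trace x"
      and ?r3 = "\<lambda>x. \<Sum>l\<in>Basis. pd l (\<tau> k) x * D l x" and ?r4 = "\<lambda>x. \<Sum>l\<in>Basis. pd k (\<tau> l) x * D l x"
    have eq: "R k = (\<lambda>x. ?r1 x - ?r2 x - ?r3 x - ?r4 x)"
      unfolding R_def Q_def G_def by (auto simp: sum.distrib mult_ac)
    have Lf: "L2 \<Omega> hess_trace" by (intro L2_sum L2D2)
    have L: "L2 \<Omega> ?r1" "L2 \<Omega> ?r2" "L2 \<Omega> ?r3" "L2 \<Omega> ?r4"
      using k by (intro L2_sum sm \<tau> smooth_fun_pd L2D Lf; simp)+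
    have "l2norm \<Omega> ?r1 \<le> B * (\<Sum>l\<in>(Basis::'a set). l2norm \<Omega> (D k))"
      using k by (intro bs L2D smooth_fun_pd \<tau> B)
    moreover have "B * (\<Sum>l\<in>(Basis::'a set). l2norm \<Omega> (D k)) \<le> ?N * B * data_norm"
      using mult_left_mono[OF mult_left_mono[OF data_norm_bounds(4)[OF k] B0], of ?N] by (simp add: mult_ac)
    moreover have "l2norm \<Omega> ?r2 \<le> B * l2norm \<Omega> hess_trace" using k by (intro bm Lf \<tau> B)
    moreover have "B * l2norm \<Omega> hess_trace \<le> B * data_norm" by (intro mult_left_mono data_norm_bounds B0)
    moreover have "l2norm \<Omega> ?r3 \<le> B * (\<Sum>l\<in>Basis. l2norm \<Omega> (D l))" using k by (intro bs L2D smooth_fun_pd \<tau> B)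
    moreover have "l2norm \<Omega> ?r4 \<le> B * (\<Sum>l\<in>Basis. l2norm \<Omega> (D l))" using k by (intro bs L2D smooth_fun_pd \<tau> B)
    moreover have "B * (\<Sum>l\<in>Basis. l2norm \<Omega> (D l)) \<le> B * data_norm" by (intro mult_left_mono data_norm_bounds B0)
    moreover have "l2norm \<Omega> (R k) \<le> l2norm \<Omega> ?r1 + l2norm \<Omega> ?r2 + l2norm \<Omega> ?r3 + l2norm \<Omega> ?r4"
      unfolding eq
      using l2norm_triangle_diff[OF L2_diff[OF L2_diff[OF L(1,2)] L(3)] L(4)]
        l2norm_triangle_diff[OF L2_diff[OF L(1,2)] L(3)] l2norm_triangle_diff[OF L(1,2)] by linarith
    ultimately have "l2norm \<Omega> (R k) \<le> ?N * B * data_norm + B * data_norm + B * data_norm + B * data_norm" by linarith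
    then show ?thesis by (simp add: algebra_simps)
  qed
  have "(\<Sum>k\<in>Basis. l2norm \<Omega> (R k)) \<le> (\<Sum>k\<in>(Basis::'a set). (?N + 3) * B * data_norm)" by (intro sum_mono Rb)
  then have s_le: "s \<le> ?N * (?N + 3) * B * data_norm" using sR by (simp add: mult.assoc)
  have L4: "L2 \<Omega> (\<lambda>x. \<Sum>l\<in>Basis. pd k (\<tau> l) x * D l x)" by (intro L2_sum sm \<tau> smooth_fun_pd L2D k)
  have "l2norm \<Omega> (\<lambda>x. \<Sum>l\<in>Basis. \<tau> l x * D2 l k x) = l2norm \<Omega> (\<lambda>x. G k x - (\<Sum>l\<in>Basis. pd k (\<tau> l) x * D l x))"
    by (simp add: G_def sum.distrib)
  also have "\<dots> \<le> l2norm \<Omega> (G k) + l2norm \<Omega> (\<lambda>x. \<Sum>l\<in>Basis. pd k (\<tau> l) x * D l x)"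
    by (rule l2norm_triangle_diff[OF LG[OF k] L4])
  also have "\<dots> \<le> s + B * (\<Sum>l\<in>Basis. l2norm \<Omega> (D l))"
    using k by (intro add_mono Gs bs L2D smooth_fun_pd \<tau> B)
  also have "\<dots> \<le> ?N * (?N + 3) * B * data_norm + B * data_norm"
    by (intro add_mono s_le mult_left_mono data_norm_bounds B0)
  finally show ?thesis by (simp add: algebra_simps)
qed

end

section \<open>The Hessian estimate\<close>

lemma test_fn_family_bounded:
  fixes \<tau> :: "'a::euclidean_space \<Rightarrow> 'a \<Rightarrow> real"
  assumes "\<And>l. l \<in> Basis \<Longrightarrow> test_fn A (\<tau> l)"
  obtains B where "B \<ge> 0" "\<And>l x. l \<in> Basis \<Longrightarrow> \<bar>\<tau> l x\<bar> \<le> B"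
    "\<And>l m x. l \<in> Basis \<Longrightarrow> m \<in> Basis \<Longrightarrow> \<bar>pd m (\<tau> l) x\<bar> \<le> B"
proof -
  have "\<forall>l\<in>Basis. \<exists>b\<ge>0. \<forall>x. \<bar>\<tau> l x\<bar> \<le> b" using test_fn_bounded[OF assms] by metis
  then obtain b where b: "\<And>l. l \<in> Basis \<Longrightarrow> b l \<ge> 0" "\<And>l x. l \<in> Basis \<Longrightarrow> \<bar>\<tau> l x\<bar> \<le> b l" by metis
  have "\<forall>l\<in>Basis. \<forall>m\<in>Basis. \<exists>b\<ge>0. \<forall>x. \<bar>pd m (\<tau> l) x\<bar> \<le> b"
    using test_fn_bounded[OF test_fn_pd[OF assms]] by metis
  then obtain c where c: "\<And>l m. l \<in> Basis \<Longrightarrow> m \<in> Basis \<Longrightarrow> c l m \<ge> 0"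
    "\<And>l m x. l \<in> Basis \<Longrightarrow> m \<in> Basis \<Longrightarrow> \<bar>pd m (\<tau> l) x\<bar> \<le> c l m" by metis
  let ?B = "(\<Sum>l\<in>Basis. b l) + (\<Sum>l\<in>Basis. \<Sum>m\<in>Basis. c l m)"
  have s: "0 \<le> (\<Sum>l\<in>Basis. b l)" "0 \<le> (\<Sum>l\<in>Basis. \<Sum>m\<in>Basis. c l m)"
    by (auto intro!: sum_nonneg b c)
  show ?thesis
  proof (rule that[of ?B])
    show "0 \<le> ?B" using s by simp
    fix l x :: 'a assume l: "l \<in> Basis"
    have "b l \<le> (\<Sum>l\<in>Basis. b l)" using l b(1) by (intro member_le_sum) auto
    then show "\<bar>\<tau> l x\<bar> \<le> ?B" using b(2)[OF l, of x] s by linarith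
    fix m :: 'a assume m: "m \<in> Basis"
    have "c l m \<le> (\<Sum>m\<in>Basis. c l m)" using m c(1)[OF l] by (intro member_le_sum) auto
    also have "\<dots> \<le> (\<Sum>l\<in>Basis. \<Sum>m\<in>Basis. c l m)"
      using l c(1) by (intro member_le_sum[of l Basis "\<lambda>l. \<Sum>m\<in>Basis. c l m"]) (auto intro: sum_nonneg)
    finally show "\<bar>pd m (\<tau> l) x\<bar> \<le> ?B" using c(2)[OF l m, of x] s by linarith
  qed
qed

text \<open>The constant is built from the dimension and a bound on the field and its first
  derivatives, hence fixed before v is chosen. This uniformity allows finitely many such estimates
  to be patched together.\<close>

lemma tangential_field_estimate:
  fixes \<Omega> :: "'a::euclidean_space set" and \<tau> :: "'a \<Rightarrow> 'a \<Rightarrow> real"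
  assumes \<tau>: "\<And>l. l \<in> Basis \<Longrightarrow> smooth_fun (\<tau> l)"
    and K: "compact K" "\<And>l x. l \<in> Basis \<Longrightarrow> x \<notin> K \<Longrightarrow> \<tau> l x = 0"
    and \<eta>: "\<And>n. smooth_fun (\<eta> n)" "\<And>n x. \<bar>\<eta> n x\<bar> \<le> 1" "\<And>x. x \<in> \<Omega> \<Longrightarrow> x \<in> K \<Longrightarrow> (\<lambda>n. \<eta> n x) \<longlonglongrightarrow> 1"
    and \<eta>\<tau>: "\<And>n l. l \<in> Basis \<Longrightarrow> test_fn \<Omega> (\<lambda>x. \<eta> n x * \<tau> l x)"
      "\<And>n x. (\<Sum>l\<in>Basis. \<tau> l x * pd l (\<eta> n) x) = 0"
    and J: "mollifier J" "\<And>z. z \<notin> S \<Longrightarrow> J z = 0" "compact S"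
    and e: "e > 0" "\<And>y z t. y \<in> K \<Longrightarrow> y \<in> closure \<Omega> \<Longrightarrow> z \<in> S \<Longrightarrow> 0 < t \<Longrightarrow> t < e \<Longrightarrow> y + t *\<^sub>R z \<in> \<Omega>"
  shows "\<exists>C\<ge>0. \<forall>v D D2. weak_hessian \<Omega> v D D2 \<longrightarrow>
    (\<forall>k\<in>Basis. l2norm \<Omega> (\<lambda>x. \<Sum>l\<in>Basis. \<tau> l x * D2 l k x) \<le> C * weak_hessian.data_norm \<Omega> D D2)"
proof -
  have "test_fn UNIV (\<tau> l)" if "l \<in> Basis" for l
    by (rule test_fnI[OF \<tau>[OF that] K(1) subset_UNIV K(2)[OF that]])
  then obtain B where B: "B \<ge> 0" "\<And>l x. l \<in> Basis \<Longrightarrow> \<bar>\<tau> l x\<bar> \<le> B"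
    "\<And>l m x. l \<in> Basis \<Longrightarrow> m \<in> Basis \<Longrightarrow> \<bar>pd m (\<tau> l) x\<bar> \<le> B"
    using test_fn_family_bounded[of UNIV \<tau>] by metis
  show ?thesis
  proof (intro exI[of _ "(real DIM('a) * (real DIM('a) + 3) + 1) * B"] conjI allI impI ballI)
    fix v D D2 and k :: 'a assume "weak_hessian \<Omega> v D D2" and k: "k \<in> Basis"
    then interpret weak_hessian \<Omega> v D D2 by simp
    show "l2norm \<Omega> (\<lambda>x. \<Sum>l\<in>Basis. \<tau> l x * D2 l k x) \<le> (real DIM('a) * (real DIM('a) + 3) + 1) * B * data_norm"
    \<comment> \<open>Inward motion is guaranteed only from points of the closure, so the support is
      cut down to \<open>K \<inter> closure \<Omega>\<close>, which is still compact.\<close>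
    proof (rule tangential_estimate[OF \<tau> B(2,3) _ J, where K = "K \<inter> closure \<Omega>" and e = e])
      show "(\<Sum>l\<in>Basis. I (\<lambda>x. D2 k l x * (\<tau> l x * \<phi> x))) = - I (\<lambda>x. D k x * (\<Sum>l\<in>Basis. pd l (\<lambda>x. \<tau> l x * \<phi> x) x))"
        if "smooth_fun \<phi>" "k \<in> Basis" for \<phi> k
        by (rule tangential_by_parts[OF \<tau> compact_imp_closed[OF K(1)] K(2) \<eta> \<eta>\<tau> that])
      show "compact (K \<inter> closure \<Omega>)" using K(1) by (intro compact_Int_closed) auto
      show "\<tau> l y = 0" if "l \<in> Basis" "y \<in> \<Omega>" "y \<notin> K \<inter> closure \<Omega>" for l y
        using that K(2) closure_subset by blast
    qed (use e k in auto)
  qed (use B in auto)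
qed

text \<open>A nonnegative weight that is positive at p is enough for a covering argument: finitely
  many weights with a positive sum replace a partition of unity.\<close>

definition hessian_bound_near :: "'a::euclidean_space set \<Rightarrow> 'a \<Rightarrow> ('a \<Rightarrow> real) \<Rightarrow> real \<Rightarrow> bool" where
  "hessian_bound_near \<Omega> p \<zeta> C \<longleftrightarrow> smooth_fun \<zeta> \<and> (\<forall>x. 0 \<le> \<zeta> x) \<and> \<zeta> p > 0 \<and> C \<ge> 0 \<and>
    (\<forall>v D D2. weak_hessian \<Omega> v D D2 \<longrightarrow>
      (\<forall>j\<in>Basis. \<forall>k\<in>Basis. l2norm \<Omega> (\<lambda>x. \<zeta> x * D2 j k x) \<le> C * weak_hessian.data_norm \<Omega> D D2))"

lemma ball_bump_eq_0: "r > 0 \<Longrightarrow> x \<notin> ball p r \<Longrightarrow> ball_bump p r x = 0"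
  using ball_bump_pos_iff[of r p x] ball_bump_nonneg[of p r x] by force

text \<open>Inside the domain every direction counts as tangential. The field is a bump times a
  coordinate vector, the cutoffs are constantly 1 and the kernel is centred at 0; the ball of radius
  2 r leaves room for its displacements.\<close>

lemma interior_hessian_bound:
  fixes \<Omega> :: "'a::euclidean_space set"
  assumes "open \<Omega>" "p \<in> \<Omega>"
  shows "\<exists>\<zeta> C. hessian_bound_near \<Omega> p \<zeta> C"
proof -
  obtain r where r: "r > 0" "cball p (2 * r) \<subseteq> \<Omega>"
  proof -
    obtain d where "d > 0" "cball p d \<subseteq> \<Omega>" using assms open_contains_cball by blast
    then show ?thesis by (intro that[of "d / 2"]) auto
  qed
  obtain J :: "'a \<Rightarrow> real" where J: "mollifier J" "\<And>z. z \<notin> cball 0 1 \<Longrightarrow> J z = 0"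
    using mollifier_exists[of 1 0] by auto
  let ?\<zeta> = "ball_bump p r"
  have z0: "?\<zeta> x = 0" if "x \<notin> cball p r" for x using that by (intro ball_bump_eq_0 r) auto
  have "\<exists>C\<ge>0. \<forall>v D D2. weak_hessian \<Omega> v D D2 \<longrightarrow>
    (\<forall>k\<in>Basis. l2norm \<Omega> (\<lambda>x. ?\<zeta> x * D2 j k x) \<le> C * weak_hessian.data_norm \<Omega> D D2)"
    if j: "j \<in> Basis" for j
  proof -
    let ?\<tau> = "\<lambda>l x. if l = j then ?\<zeta> x else 0"
    have "\<exists>C\<ge>0. \<forall>v D D2. weak_hessian \<Omega> v D D2 \<longrightarrow>
      (\<forall>k\<in>Basis. l2norm \<Omega> (\<lambda>x. \<Sum>l\<in>Basis. ?\<tau> l x * D2 l k x) \<le> C * weak_hessian.data_norm \<Omega> D D2)"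
    proof (rule tangential_field_estimate[where K="cball p r" and \<eta>="\<lambda>_ _. 1" and S="cball 0 1" and e=r and J=J])
      show sm: "smooth_fun (?\<tau> l)" for l by (cases "l = j") (auto intro: smooth_ball_bump smooth_const)
      show "test_fn \<Omega> (\<lambda>x. 1 * ?\<tau> l x)" for l
        using sm[of l] r z0 by (intro test_fnI[of _ "cball p r"]) auto
      show "y + t *\<^sub>R z \<in> \<Omega>" if "y \<in> cball p r" "z \<in> cball 0 1" "0 < t" "t < r" for y z t
      proof -
        have "norm (t *\<^sub>R z) \<le> r" using that mult_mono[of t r "norm z" 1] by simp
        then have "dist p (y + t *\<^sub>R z) \<le> 2 * r"
          using that(1) dist_triangle[of p "y + t *\<^sub>R z" y] by (simp add: dist_norm)
        then show ?thesis using r(2) by auto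
      qed
    qed (use J r z0 in \<open>auto simp: smooth_const\<close>)
    moreover have "(\<Sum>l\<in>Basis. ?\<tau> l x * h l) = ?\<zeta> x * h j" for x and h :: "'a \<Rightarrow> real"
      using j by (simp add: if_distrib[of "\<lambda>z. z * _"] cong: if_cong)
    ultimately show ?thesis by simp
  qed
  then obtain C where C: "\<And>j. j \<in> Basis \<Longrightarrow> C j \<ge> 0" "\<And>j v D D2 k. j \<in> Basis \<Longrightarrow> k \<in> Basis \<Longrightarrow> weak_hessian \<Omega> v D D2 \<Longrightarrow>
      l2norm \<Omega> (\<lambda>x. ?\<zeta> x * D2 j k x) \<le> C j * weak_hessian.data_norm \<Omega> D D2"
    by metis
  have "hessian_bound_near \<Omega> p ?\<zeta> (\<Sum>j\<in>Basis. C j)"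
    unfolding hessian_bound_near_def
  proof (intro conjI allI impI ballI)
    fix v D D2 and j k :: 'a assume w: "weak_hessian \<Omega> v D D2" and jk: "j \<in> Basis" "k \<in> Basis"
    have "C j \<le> (\<Sum>j\<in>Basis. C j)" using jk C(1) by (intro member_le_sum) auto
    then show "l2norm \<Omega> (\<lambda>x. ?\<zeta> x * D2 j k x) \<le> (\<Sum>j\<in>Basis. C j) * weak_hessian.data_norm \<Omega> D D2"
      using C(2)[OF jk w] mult_right_mono weak_hessian.data_norm_bounds(1)[OF w] by (meson order_trans)
  qed (use r in \<open>auto simp: smooth_ball_bump ball_bump_nonneg ball_bump_pos_iff intro: sum_nonneg C(1)\<close>)
  then show ?thesis by blast
qed

section \<open>The Hessian near a boundary point\<close>

lemma bump_tendsto_1: "(bump \<longlongrightarrow> 1) at_top"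
proof -
  have "((\<lambda>s::real. - inverse s) \<longlongrightarrow> - 0) at_top" by (intro tendsto_minus tendsto_inverse_0_at_top filterlim_ident)
  then have "((\<lambda>s::real. exp (- inverse s)) \<longlongrightarrow> exp (- 0)) at_top" by (rule tendsto_exp)
  then have "((\<lambda>s::real. exp (- inverse s)) \<longlongrightarrow> 1) at_top" by simp
  moreover have "eventually (\<lambda>s::real. exp (- inverse s) = bump s) at_top"
    using eventually_gt_at_top[of 0] by eventually_elim (simp add: bump_def divide_inverse)
  ultimately show ?thesis by (rule Lim_transform_eventually)
qed

text \<open>The tangential differences \<open>\<nu>\<^sub>i H\<^sub>j\<^sub>k - \<nu>\<^sub>j H\<^sub>i\<^sub>k\<close> and the trace determine a symmetric matrix \<open>H\<close>
  when \<open>\<nu> \<noteq> 0\<close>: contract with \<open>\<nu>\<close> to find first \<open>\<nu>\<^sup>T H \<nu>\<close>, then \<open>H \<nu>\<close>, then \<open>H\<close>.\<close>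
lemma symmetric_matrix_bound:
  fixes H :: "'a \<Rightarrow> 'a \<Rightarrow> real" and \<nu> :: "'a \<Rightarrow> real"
  assumes S: "finite S" and sym: "\<And>i j. i \<in> S \<Longrightarrow> j \<in> S \<Longrightarrow> H i j = H j i"
    and B: "\<And>i. i \<in> S \<Longrightarrow> \<bar>\<nu> i\<bar> \<le> B" "B \<ge> 0" and c: "c > 0" "c \<le> (\<Sum>i\<in>S. (\<nu> i)\<^sup>2)" "(\<Sum>i\<in>S. (\<nu> i)\<^sup>2) \<le> M"
    and jk: "j \<in> S" "k \<in> S"
  defines "a \<equiv> \<Sum>i\<in>S. \<Sum>j\<in>S. \<Sum>k\<in>S. \<bar>\<nu> i * H j k - \<nu> j * H i k\<bar>"
  shows "\<bar>H j k\<bar> \<le> (B + B * (2 * B\<^sup>2 + B * M) / c) / c * (\<bar>\<Sum>i\<in>S. H i i\<bar> + a)"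
proof -
  let ?A = "\<lambda>i j k. \<nu> i * H j k - \<nu> j * H i k"
  let ?n = "\<Sum>i\<in>S. (\<nu> i)\<^sup>2" and ?f = "\<Sum>i\<in>S. H i i"
  define h where "h k = (\<Sum>i\<in>S. \<nu> i * H i k)" for k
  define q where "q = (\<Sum>m\<in>S. \<nu> m * h m)"
  have a0: "a \<ge> 0" unfolding a_def by (intro sum_nonneg) auto
  \<comment> \<open>Contraction with nu isolates H up to nu_j (H nu)_k, where \<open>h\<close> is
    the vector H nu. The identities for q and h below are further contractions of this one.\<close>
  have contract: "(\<Sum>i\<in>S. \<nu> i * ?A i j k) = ?n * H j k - \<nu> j * h k" for j k
    unfolding h_def right_diff_distrib sum_subtractf
    by (simp add: sum_distrib_left sum_distrib_right power2_eq_square mult_ac)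
  have a1: "(\<Sum>i\<in>S. \<bar>?A i j k\<bar>) \<le> (\<Sum>i\<in>S. \<Sum>k\<in>S. \<bar>?A i j k\<bar>)" if "k \<in> S" for j k
    using S that by (intro sum_mono member_le_sum[of k S "\<lambda>k. \<bar>?A _ j k\<bar>"]) auto
  have a2: "(\<Sum>i\<in>S. \<Sum>k\<in>S. \<bar>?A i j k\<bar>) \<le> a" if "j \<in> S" for j
    unfolding a_def using S that
    by (intro sum_mono member_le_sum[of j S "\<lambda>j. \<Sum>k\<in>S. \<bar>?A _ j k\<bar>"]) (auto intro: sum_nonneg)
  have c1: "\<bar>\<Sum>i\<in>S. \<nu> i * ?A i j k\<bar> \<le> B * (\<Sum>i\<in>S. \<bar>?A i j k\<bar>)" for j k
  proof -
    have "\<bar>\<Sum>i\<in>S. \<nu> i * ?A i j k\<bar> \<le> (\<Sum>i\<in>S. \<bar>\<nu> i * ?A i j k\<bar>)" by (rule sum_abs)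
    also have "\<dots> \<le> (\<Sum>i\<in>S. B * \<bar>?A i j k\<bar>)"
      unfolding abs_mult by (intro sum_mono mult_right_mono B) auto
    finally show ?thesis by (simp add: sum_distrib_left)
  qed
  have q: "\<bar>q\<bar> \<le> M * \<bar>?f\<bar> + B * a"
  proof -
    have "(\<Sum>j\<in>S. \<Sum>i\<in>S. \<nu> i * ?A i j j) = ?n * ?f - q"
      unfolding contract sum_subtractf q_def by (simp add: sum_distrib_left)
    moreover have "\<bar>\<Sum>j\<in>S. \<Sum>i\<in>S. \<nu> i * ?A i j j\<bar> \<le> B * a"
    proof -
      have "\<bar>\<Sum>j\<in>S. \<Sum>i\<in>S. \<nu> i * ?A i j j\<bar> \<le> (\<Sum>j\<in>S. B * (\<Sum>i\<in>S. \<bar>?A i j j\<bar>))"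
        by (rule order_trans[OF sum_abs]) (intro sum_mono c1)
      also have "\<dots> = B * (\<Sum>i\<in>S. \<Sum>j\<in>S. \<bar>?A i j j\<bar>)"
        by (subst sum.swap) (simp add: sum_distrib_left)
      also have "\<dots> \<le> B * a"
        unfolding a_def using S
        by (intro mult_left_mono sum_mono B member_le_sum[of _ S "\<lambda>k. \<bar>?A _ _ k\<bar>"]) auto
      finally show ?thesis .
    qed
    moreover have "\<bar>?n * ?f\<bar> \<le> M * \<bar>?f\<bar>" unfolding abs_mult using c by (intro mult_right_mono) auto
    ultimately show ?thesis by linarith
  qed
  have h: "\<bar>h k\<bar> \<le> (2 * B\<^sup>2 + B * M) / c * (\<bar>?f\<bar> + a)"
  proof -
    have "(\<Sum>m\<in>S. \<nu> m * (\<Sum>i\<in>S. \<nu> i * ?A i k m)) = ?n * h k - \<nu> k * q"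
    proof -
      have "(\<Sum>m\<in>S. \<nu> m * (?n * H k m - \<nu> k * h m)) = ?n * (\<Sum>m\<in>S. \<nu> m * H k m) - \<nu> k * q"
        unfolding right_diff_distrib sum_subtractf q_def sum_distrib_left by (simp only: mult_ac)
      \<comment> \<open>Symmetry of H enters here: \<open>h\<close> contracts the first index of H,
        the sum at hand the second.\<close>
      moreover have "(\<Sum>m\<in>S. \<nu> m * H k m) = h k" unfolding h_def using sym jk by (intro sum.cong) auto
      ultimately show ?thesis unfolding contract by simp
    qed
    moreover have "\<bar>\<Sum>m\<in>S. \<nu> m * (\<Sum>i\<in>S. \<nu> i * ?A i k m)\<bar> \<le> B * (B * a)"
    proof -
      have "\<bar>\<Sum>m\<in>S. \<nu> m * (\<Sum>i\<in>S. \<nu> i * ?A i k m)\<bar> \<le> (\<Sum>m\<in>S. B * (B * (\<Sum>i\<in>S. \<bar>?A i k m\<bar>)))"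
        by (rule order_trans[OF sum_abs], unfold abs_mult) (intro sum_mono mult_mono B c1, auto)
      also have "\<dots> = B * (B * (\<Sum>i\<in>S. \<Sum>m\<in>S. \<bar>?A i k m\<bar>))"
        by (subst sum.swap) (simp add: sum_distrib_left)
      also have "\<dots> \<le> B * (B * a)" by (intro mult_left_mono a2 B jk)
      finally show ?thesis .
    qed
    moreover have "\<bar>\<nu> k * q\<bar> \<le> B * (M * \<bar>?f\<bar> + B * a)" unfolding abs_mult by (intro mult_mono B q jk) auto
    moreover have "c * \<bar>h k\<bar> \<le> \<bar>?n * h k\<bar>" unfolding abs_mult using c by (intro mult_right_mono) auto
    ultimately have "c * \<bar>h k\<bar> \<le> B * (B * a) + B * (M * \<bar>?f\<bar> + B * a)" by linarith
    also have "\<dots> \<le> (2 * B\<^sup>2 + B * M) * (\<bar>?f\<bar> + a)"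
    proof -
      have "0 \<le> 2 * B\<^sup>2 * \<bar>?f\<bar> + B * M * a" using B c a0 by simp
      then show ?thesis by (simp add: algebra_simps power2_eq_square)
    qed
    finally show ?thesis using c(1) by (simp add: field_simps)
  qed
  have "c * \<bar>H j k\<bar> \<le> \<bar>?n * H j k\<bar>" unfolding abs_mult using c by (intro mult_right_mono) auto
  also have "?n * H j k = (\<Sum>i\<in>S. \<nu> i * ?A i j k) + \<nu> j * h k" using contract by simp
  also have "\<bar>\<dots>\<bar> \<le> B * a + B * ((2 * B\<^sup>2 + B * M) / c * (\<bar>?f\<bar> + a))"
  proof -
    have "\<bar>\<Sum>i\<in>S. \<nu> i * ?A i j k\<bar> \<le> B * a"
      by (rule order_trans[OF c1 mult_left_mono[OF order_trans[OF a1 a2] B(2)]]) (rule jk)+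
    moreover have "\<bar>\<nu> j * h k\<bar> \<le> B * ((2 * B\<^sup>2 + B * M) / c * (\<bar>?f\<bar> + a))"
      unfolding abs_mult by (intro mult_mono B h jk) auto
    ultimately show ?thesis by linarith
  qed
  also have "\<dots> \<le> (B + B * (2 * B\<^sup>2 + B * M) / c) * (\<bar>?f\<bar> + a)"
    using B by (simp add: algebra_simps)
  finally show ?thesis using c(1) by (simp add: field_simps)
qed


text \<open>Some coordinate derivative of rho is nonzero at p. Moving against its sign decreases rho
  at a definite rate near p, and so do all directions close to that one; they form the support S of
  the shifted kernel.\<close>

lemma smooth_boundary_chart:
  fixes \<Omega> :: "'a::euclidean_space set"
  assumes dom: "smooth_bounded_domain \<Omega>" and p: "p \<in> frontier \<Omega>"
  obtains r c B \<rho> J S e where "r > 0" "smooth_fun \<rho>" "\<Omega> \<inter> cball p r = {x \<in> cball p r. \<rho> x < 0}"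
    "c > 0" "\<And>x. x \<in> cball p r \<Longrightarrow> c \<le> (\<Sum>i\<in>Basis. (pd i \<rho> x)\<^sup>2)"
    "B \<ge> 0" "\<And>i x. i \<in> Basis \<Longrightarrow> x \<in> cball p r \<Longrightarrow> \<bar>pd i \<rho> x\<bar> \<le> B"
    "mollifier J" "\<And>z. z \<notin> S \<Longrightarrow> J z = 0" "compact S" "e > 0"
    "\<And>y z t. y \<in> cball p r \<Longrightarrow> y \<in> closure \<Omega> \<Longrightarrow> z \<in> S \<Longrightarrow> 0 < t \<Longrightarrow> t < e \<Longrightarrow> y + t *\<^sub>R z \<in> \<Omega>"
proof -
  have "\<exists>U \<rho>. open U \<and> p \<in> U \<and> smooth_fun \<rho> \<and> (\<forall>x\<in>U. \<exists>i\<in>Basis. pd i \<rho> x \<noteq> 0) \<and> \<Omega> \<inter> U = {x\<in>U. \<rho> x < 0}"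
    using dom p by (simp add: smooth_bounded_domain_def)
  then obtain U \<rho> where U: "open U" "p \<in> U" and \<rho>: "smooth_fun \<rho>"
    and nz: "\<forall>x\<in>U. \<exists>i\<in>Basis. pd i \<rho> x \<noteq> 0" and \<Omega>U: "\<Omega> \<inter> U = {x \<in> U. \<rho> x < 0}"
    by (elim exE conjE)
  obtain i0 where i0: "i0 \<in> Basis" "pd i0 \<rho> p \<noteq> 0" using nz U(2) by blast
  \<comment> \<open>With this sign \<open>s * pd i0 \<rho> p\<close> is positive, so rho decreases
    in the direction \<open>- s *\<^sub>R i0\<close>.\<close>
  define s where "s = sgn (pd i0 \<rho> p)"
  define c where "c = \<bar>pd i0 \<rho> p\<bar> / 2"
  have s: "\<bar>s\<bar> = 1" "s * s = 1" "s * pd i0 \<rho> p = 2 * c" "c > 0" using i0(2) by (auto simp: s_def c_def sgn_if)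
  have "isCont (\<lambda>x. s * pd i0 \<rho> x) p"
    using smooth_continuous[OF smooth_fun_pd[OF \<rho> i0(1)], of UNIV]
    by (intro continuous_intros) (simp add: continuous_on_eq_continuous_at)
  then have "eventually (\<lambda>x. c < s * pd i0 \<rho> x) (at p)"
    using s(3,4) by (intro order_tendstoD(1)[where y="s * pd i0 \<rho> p"]) (auto simp: isCont_def)
  then obtain d where d: "d > 0" "\<And>x. x \<noteq> p \<Longrightarrow> dist x p < d \<Longrightarrow> c < s * pd i0 \<rho> x"
    unfolding eventually_at by blast
  obtain d' where d': "d' > 0" "cball p d' \<subseteq> U" using U open_contains_cball by blast
  \<comment> \<open>A third of the smaller radius: points within r of p that move by less than r
    stay within 2 r, where both the chart and the lower bound on the derivative are valid.\<close>
  define r where "r = min d d' / 3"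
  have r: "r > 0" "2 * r < d" "2 * r \<le> d'" using d(1) d'(1) by (auto simp: r_def)
  have rU: "cball p (2 * r) \<subseteq> U" using d'(2) r(3) by auto
  have rU': "cball p r \<subseteq> U" using rU r(1) by auto
  have low: "c \<le> s * pd i0 \<rho> x" if "x \<in> cball p (2 * r)" for x
    using that d(2)[of x] r s by (cases "x = p") (auto simp: dist_commute)
  have "\<forall>i\<in>Basis. \<exists>b\<ge>0. \<forall>x\<in>cball p (2 * r). \<bar>pd i \<rho> x\<bar> \<le> b"
    using smooth_bounded_on_compact[OF smooth_fun_pd[OF \<rho>] compact_cball] by metis
  then obtain b where b: "\<And>i. i \<in> Basis \<Longrightarrow> b i \<ge> 0" "\<And>i x. i \<in> Basis \<Longrightarrow> x \<in> cball p (2 * r) \<Longrightarrow> \<bar>pd i \<rho> x\<bar> \<le> b i"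
    by metis
  define B where "B = (\<Sum>i\<in>Basis. b i)"
  have bB: "b i \<le> B" if "i \<in> Basis" for i unfolding B_def using that b(1) by (intro member_le_sum) auto
  have B0: "B \<ge> 0" unfolding B_def by (intro sum_nonneg b)
  \<comment> \<open>Deviating from \<open>- s *\<^sub>R i0\<close> by at most kappa changes the
    directional derivative of rho by at most \<open>\<kappa> * B\<close>, which this choice keeps
    below c; B + 1 avoids division by zero.\<close>
  define \<kappa> where "\<kappa> = c / (2 * (B + 1))"
  have \<kappa>: "\<kappa> > 0" "\<kappa> * B < c" using s(4) B0 by (auto simp: \<kappa>_def field_simps add_strict_increasing2)
  obtain J :: "'a \<Rightarrow> real" where J: "mollifier J" "\<And>z. z \<notin> cball (- s *\<^sub>R i0) \<kappa> \<Longrightarrow> J z = 0"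
    using mollifier_exists[OF \<kappa>(1), of "- s *\<^sub>R i0"] by auto
  \<comment> \<open>A point of U with positive rho has a neighbourhood free of points of the domain,
    hence is not in the closure.\<close>
  have le0: "\<rho> y \<le> 0" if y: "y \<in> cball p r" "y \<in> closure \<Omega>" for y
  proof (rule ccontr)
    assume "\<not> \<rho> y \<le> 0"
    then have "y \<in> U \<inter> {x. 0 < \<rho> x}" using y rU' by auto
    moreover have "open (U \<inter> {x. 0 < \<rho> x})"
      by (intro open_Int U open_Collect_less smooth_continuous[OF \<rho>] continuous_on_const)
    ultimately obtain x where "x \<in> \<Omega>" "x \<in> U" "0 < \<rho> x"
      using y(2) open_Int_closure_eq_empty[of "U \<inter> {x. 0 < \<rho> x}" \<Omega>] by blast
    have "x \<in> {x \<in> U. \<rho> x < 0}" using \<open>x \<in> \<Omega>\<close> \<open>x \<in> U\<close> unfolding \<Omega>U[symmetric] by (rule IntI)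
    then show False using \<open>0 < \<rho> x\<close> by simp
  qed
  show thesis
  \<comment> \<open>Here c bounds a single derivative, so the sum of squares is bounded below by its
    square. Directions in the kernel support have norm at most 1 + kappa, whence the time bound
    \<open>r / (1 + \<kappa>)\<close>.\<close>
  proof (rule that[of r \<rho> "c\<^sup>2" B J "cball (- s *\<^sub>R i0) \<kappa>" "r / (1 + \<kappa>)"])
    show "\<Omega> \<inter> cball p r = {x \<in> cball p r. \<rho> x < 0}" using \<Omega>U rU' by blast
    show "c\<^sup>2 \<le> (\<Sum>i\<in>Basis. (pd i \<rho> x)\<^sup>2)" if "x \<in> cball p r" for x
    proof -
      have "c \<le> s * pd i0 \<rho> x" using low[of x] that r(1) by auto
      then have "c\<^sup>2 \<le> (s * pd i0 \<rho> x)\<^sup>2" using s(4) by (intro power_mono) auto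
      also have "\<dots> = (pd i0 \<rho> x)\<^sup>2" using s(2) by (simp add: power_mult_distrib power2_eq_square)
      also have "\<dots> \<le> (\<Sum>i\<in>Basis. (pd i \<rho> x)\<^sup>2)" using i0(1) by (intro member_le_sum) auto
      finally show ?thesis .
    qed
    show "\<bar>pd i \<rho> x\<bar> \<le> B" if "i \<in> Basis" "x \<in> cball p r" for i x
      using b(2)[OF that(1), of x] bB[OF that(1)] that(2) r(1) by force
    show "y + t *\<^sub>R z \<in> \<Omega>" if y: "y \<in> cball p r" "y \<in> closure \<Omega>" and z: "z \<in> cball (- s *\<^sub>R i0) \<kappa>" and t: "0 < t" "t < r / (1 + \<kappa>)" for y z t
    proof -
      have zn: "norm (z + s *\<^sub>R i0) \<le> \<kappa>" using z by (simp add: dist_norm norm_minus_commute add.commute)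
      have "norm z \<le> norm (z + s *\<^sub>R i0) + norm (s *\<^sub>R i0)" using norm_triangle_ineq4[of "z + s *\<^sub>R i0" "s *\<^sub>R i0"] by simp
      then have "norm z \<le> 1 + \<kappa>" using zn s(1) i0(1) by simp
      then have "norm (t *\<^sub>R z) \<le> t * (1 + \<kappa>)" using t(1) by (simp add: mult_left_mono)
      also have "\<dots> < r" using t \<kappa>(1) by (simp add: pos_less_divide_eq)
      finally have tz: "norm (t *\<^sub>R z) < r" .
      have in2: "y + u *\<^sub>R (t *\<^sub>R z) \<in> cball p (2 * r)" if "0 \<le> u" "u \<le> 1" for u
      proof -
        have "norm (u *\<^sub>R (t *\<^sub>R z)) = u * norm (t *\<^sub>R z)" using that by (simp only: norm_scaleR[of u] abs_of_nonneg)
        also have "\<dots> \<le> norm (t *\<^sub>R z)" using that by (intro mult_left_le_one_le) auto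
        finally have "norm (u *\<^sub>R (t *\<^sub>R z)) \<le> norm (t *\<^sub>R z)" .
        then have "dist y (y + u *\<^sub>R (t *\<^sub>R z)) \<le> r" using tz by (simp add: dist_norm)
        then show ?thesis using y(1) dist_triangle[of p "y + u *\<^sub>R (t *\<^sub>R z)" y] by simp
      qed
      have "\<exists>u>0. u < 1 \<and> \<rho> (y + 1 *\<^sub>R (t *\<^sub>R z)) - \<rho> (y + 0 *\<^sub>R (t *\<^sub>R z))
          = (1 - 0) * (\<Sum>i\<in>Basis. ((t *\<^sub>R z) \<bullet> i) * pd i \<rho> (y + u *\<^sub>R (t *\<^sub>R z)))"
        by (intro MVT2 smooth_line_deriv \<rho>) auto
      then obtain u where u: "0 < u" "u < 1" "\<rho> (y + t *\<^sub>R z) - \<rho> y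
          = (\<Sum>i\<in>Basis. ((t *\<^sub>R z) \<bullet> i) * pd i \<rho> (y + u *\<^sub>R (t *\<^sub>R z)))" by auto
      let ?x = "y + u *\<^sub>R (t *\<^sub>R z)"
      have x: "?x \<in> cball p (2 * r)" using u by (intro in2) auto
      have zi: "z \<bullet> i = (z + s *\<^sub>R i0) \<bullet> i - (if i = i0 then s else 0)" if "i \<in> Basis" for i
        using that i0(1) by (auto simp: inner_add_left inner_Basis)
      have "(\<Sum>i\<in>Basis. (z \<bullet> i) * pd i \<rho> ?x)
          = (\<Sum>i\<in>Basis. ((z + s *\<^sub>R i0) \<bullet> i) * pd i \<rho> ?x - (if i = i0 then s * pd i0 \<rho> ?x else 0))"
        by (intro sum.cong refl) (simp add: zi left_diff_distrib)
      also have "\<dots> = (\<Sum>i\<in>Basis. ((z + s *\<^sub>R i0) \<bullet> i) * pd i \<rho> ?x) - s * pd i0 \<rho> ?x"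
        using i0(1) by (simp add: sum_subtractf)
      also have "(\<Sum>i\<in>Basis. ((z + s *\<^sub>R i0) \<bullet> i) * pd i \<rho> ?x) \<le> (\<Sum>i\<in>Basis. \<kappa> * b i)"
      proof (rule sum_mono)
        fix i :: 'a assume i: "i \<in> Basis"
        have "((z + s *\<^sub>R i0) \<bullet> i) * pd i \<rho> ?x \<le> \<bar>(z + s *\<^sub>R i0) \<bullet> i\<bar> * \<bar>pd i \<rho> ?x\<bar>"
          by (simp flip: abs_mult)
        also have "\<dots> \<le> \<kappa> * b i"
          using Basis_le_norm[OF i, of "z + s *\<^sub>R i0"] zn b(2)[OF i x] by (intro mult_mono) auto
        finally show "((z + s *\<^sub>R i0) \<bullet> i) * pd i \<rho> ?x \<le> \<kappa> * b i" .
      qed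
      also have "(\<Sum>i\<in>Basis. \<kappa> * b i) = \<kappa> * B" by (simp add: B_def sum_distrib_left)
      finally have "(\<Sum>i\<in>Basis. (z \<bullet> i) * pd i \<rho> ?x) \<le> \<kappa> * B - s * pd i0 \<rho> ?x" by simp
      then have neg: "(\<Sum>i\<in>Basis. (z \<bullet> i) * pd i \<rho> ?x) < 0" using low[OF x] \<kappa>(2) by linarith
      have "\<rho> (y + t *\<^sub>R z) - \<rho> y = t * (\<Sum>i\<in>Basis. (z \<bullet> i) * pd i \<rho> ?x)"
        unfolding u(3) by (simp add: sum_distrib_left mult.assoc)
      also have "\<dots> < 0" using neg t(1) by (simp add: mult_pos_neg)
      finally have "\<rho> (y + t *\<^sub>R z) < 0" using le0[OF y] by linarith
      moreover have "y + t *\<^sub>R z \<in> U" using in2[of 1] rU by auto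
      ultimately show ?thesis using \<Omega>U by blast
    qed
  qed (use r \<rho> s(4) B0 J \<kappa> in auto)
qed

text \<open>The estimates along the fields for all pairs i, j are combined with the trace,
  pointwise, by \<open>symmetric_matrix_bound\<close> with nu the gradient of rho.\<close>

lemma boundary_hessian_bound:
  fixes \<Omega> :: "'a::euclidean_space set"
  assumes dom: "smooth_bounded_domain \<Omega>" and p: "p \<in> frontier \<Omega>"
  shows "\<exists>\<zeta> C. hessian_bound_near \<Omega> p \<zeta> C"
proof (rule smooth_boundary_chart[OF dom p])
  fix r c B e :: real and \<rho> J :: "'a \<Rightarrow> real" and S :: "'a set"
  assume r: "r > 0" and \<rho>: "smooth_fun \<rho>" and \<Omega>r: "\<Omega> \<inter> cball p r = {x \<in> cball p r. \<rho> x < 0}"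
    and c: "c > 0" "\<And>x. x \<in> cball p r \<Longrightarrow> c \<le> (\<Sum>i\<in>Basis. (pd i \<rho> x)\<^sup>2)"
    and B: "B \<ge> 0" "\<And>i x. i \<in> Basis \<Longrightarrow> x \<in> cball p r \<Longrightarrow> \<bar>pd i \<rho> x\<bar> \<le> B"
    and J: "mollifier J" "\<And>z. z \<notin> S \<Longrightarrow> J z = 0" "compact S" and e: "e > 0"
    "\<And>y z t. y \<in> cball p r \<Longrightarrow> y \<in> closure \<Omega> \<Longrightarrow> z \<in> S \<Longrightarrow> 0 < t \<Longrightarrow> t < e \<Longrightarrow> y + t *\<^sub>R z \<in> \<Omega>"
  let ?\<zeta> = "ball_bump p r"
  have z0: "?\<zeta> x = 0" if "x \<notin> cball p r" for x using that by (intro ball_bump_eq_0 r) auto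
  \<comment> \<open>\<open>\<eta> n\<close> vanishes where
    \<open>real n * \<rho> x \<ge> - 1\<close>, a set that retreats to the boundary as n grows, and
    tends to 1 wherever rho is negative. Its gradient is a multiple of that of rho.\<close>
  define \<eta> where "\<eta> n x = bump (- real n * \<rho> x - 1)" for n x
  have s\<rho>: "smooth_fun (\<lambda>x. - real n * \<rho> x - 1)" for n by (intro smooth_intros \<rho>)
  have \<eta>s: "smooth_fun (\<eta> n)" for n
    unfolding \<eta>_def by (rule smooth_comp[OF smooth_bump s\<rho>])
  have pd\<eta>: "pd l (\<eta> n) x = pd 1 bump (- real n * \<rho> x - 1) * (- real n) * pd l \<rho> x" if "l \<in> Basis" for l n x
  proof -
    have "pd l (\<lambda>x. - real n * \<rho> x - 1) = (\<lambda>x. - real n * pd l \<rho> x)"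
      using pd_diff[OF smooth_mult[OF smooth_const \<rho>] smooth_const, of l "- real n" 1]
        pd_mult[OF smooth_const \<rho>, of l "- real n"] by simp
    then show ?thesis
      unfolding \<eta>_def using pd_comp[OF smooth_bump s\<rho> that, of n] by simp
  qed
  have est: "\<exists>C\<ge>0. \<forall>v D D2. weak_hessian \<Omega> v D D2 \<longrightarrow>
    (\<forall>k\<in>Basis. l2norm \<Omega> (\<lambda>x. ?\<zeta> x * (pd i \<rho> x * D2 j k x - pd j \<rho> x * D2 i k x)) \<le> C * weak_hessian.data_norm \<Omega> D D2)"
    if ij: "i \<in> Basis" "j \<in> Basis" for i j
  proof -
    \<comment> \<open>Contracted with the gradient of rho this field gives
      \<open>pd i \<rho> x * pd j \<rho> x\<close> minus itself, up to the factor
      \<open>?\<zeta> x\<close>: it is tangential to the level sets of rho.\<close>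
    let ?\<tau> = "\<lambda>l x. ?\<zeta> x * ((if l = j then pd i \<rho> x else 0) - (if l = i then pd j \<rho> x else 0))"
    have contr: "(\<Sum>l\<in>Basis. ?\<tau> l x * h l) = ?\<zeta> x * (pd i \<rho> x * h j - pd j \<rho> x * h i)" for x and h :: "'a \<Rightarrow> real"
    proof -
      have "(\<Sum>l\<in>Basis. ?\<tau> l x * h l) = (\<Sum>l\<in>Basis. (if l = j then ?\<zeta> x * pd i \<rho> x * h l else 0) - (if l = i then ?\<zeta> x * pd j \<rho> x * h l else 0))"
        by (intro sum.cong) (auto simp: algebra_simps)
      then show ?thesis using ij by (simp add: sum_subtractf algebra_simps)
    qed
    have "\<exists>C\<ge>0. \<forall>v D D2. weak_hessian \<Omega> v D D2 \<longrightarrow>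
      (\<forall>k\<in>Basis. l2norm \<Omega> (\<lambda>x. \<Sum>l\<in>Basis. ?\<tau> l x * D2 l k x) \<le> C * weak_hessian.data_norm \<Omega> D D2)"
    proof (rule tangential_field_estimate[where K="cball p r" and \<eta>=\<eta> and S=S and e=e and J=J])
      show sm: "smooth_fun (?\<tau> l)" for l
        by (cases "l = j"; cases "l = i") (auto intro!: smooth_intros smooth_ball_bump \<rho> ij)
      show "\<bar>\<eta> n x\<bar> \<le> 1" for n x using bump_nonneg bump_le1 by (simp add: \<eta>_def)
      show "(\<lambda>n. \<eta> n x) \<longlonglongrightarrow> 1" if "x \<in> \<Omega>" "x \<in> cball p r" for x
      proof -
        have "x \<in> {x \<in> cball p r. \<rho> x < 0}" using that unfolding \<Omega>r[symmetric] by (rule IntI)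
        then have "- \<rho> x > 0" by simp
        then have "filterlim (\<lambda>n. - \<rho> x * real n) at_top sequentially"
          by (intro filterlim_tendsto_pos_mult_at_top[OF tendsto_const _ filterlim_real_sequentially])
        then have "filterlim (\<lambda>n. -1 + - \<rho> x * real n) at_top sequentially"
          by (intro filterlim_tendsto_add_at_top[OF tendsto_const])
        moreover have "(\<lambda>n. -1 + - \<rho> x * real n) = (\<lambda>n. - real n * \<rho> x - 1)" by (simp add: fun_eq_iff)
        ultimately have "filterlim (\<lambda>n. - real n * \<rho> x - 1) at_top sequentially" by simp
        then show ?thesis unfolding \<eta>_def by (rule filterlim_compose[OF bump_tendsto_1])
      qed
      show "test_fn \<Omega> (\<lambda>x. \<eta> n x * ?\<tau> l x)" for n l
      proof (rule test_fnI[of _ "cball p r \<inter> {x. real n * \<rho> x \<le> -1}"])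
        show "smooth_fun (\<lambda>x. \<eta> n x * ?\<tau> l x)" by (rule smooth_mult[OF \<eta>s sm])
        show "compact (cball p r \<inter> {x. real n * \<rho> x \<le> - 1})"
          by (intro compact_Int_closed compact_cball closed_Collect_le continuous_intros smooth_continuous[OF \<rho>])
        show "cball p r \<inter> {x. real n * \<rho> x \<le> - 1} \<subseteq> \<Omega>"
        proof
          fix x assume x: "x \<in> cball p r \<inter> {x. real n * \<rho> x \<le> - 1}"
          then have "\<rho> x < 0" by (smt (verit) IntD2 mem_Collect_eq mult_nonneg_nonneg of_nat_0_le_iff)
          then show "x \<in> \<Omega>" using x \<Omega>r by blast
        qed
        show "\<eta> n x * ?\<tau> l x = 0" if "x \<notin> cball p r \<inter> {x. real n * \<rho> x \<le> - 1}" for x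
          using that z0[of x] by (auto simp: \<eta>_def bump_eq0)
      qed
      show "(\<Sum>l\<in>Basis. ?\<tau> l x * pd l (\<eta> n) x) = 0" for n x
        unfolding contr using ij by (simp add: pd\<eta>)
    qed (use J e z0 \<eta>s in auto)
    then show ?thesis unfolding contr .
  qed
  define C where "C i j = (SOME C. C \<ge> 0 \<and> (\<forall>v D D2. weak_hessian \<Omega> v D D2 \<longrightarrow>
    (\<forall>k\<in>Basis. l2norm \<Omega> (\<lambda>x. ?\<zeta> x * (pd i \<rho> x * D2 j k x - pd j \<rho> x * D2 i k x)) \<le> C * weak_hessian.data_norm \<Omega> D D2)))" for i j
  have CP: "C i j \<ge> 0 \<and> (\<forall>v D D2. weak_hessian \<Omega> v D D2 \<longrightarrow>
    (\<forall>k\<in>Basis. l2norm \<Omega> (\<lambda>x. ?\<zeta> x * (pd i \<rho> x * D2 j k x - pd j \<rho> x * D2 i k x)) \<le> C i j * weak_hessian.data_norm \<Omega> D D2))"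
    if "i \<in> Basis" "j \<in> Basis" for i j
    using someI_ex[OF est[OF that]] unfolding C_def .
  have C: "C i j \<ge> 0" "weak_hessian \<Omega> v D D2 \<Longrightarrow> k \<in> Basis \<Longrightarrow>
      l2norm \<Omega> (\<lambda>x. ?\<zeta> x * (pd i \<rho> x * D2 j k x - pd j \<rho> x * D2 i k x)) \<le> C i j * weak_hessian.data_norm \<Omega> D D2"
    if "i \<in> Basis" "j \<in> Basis" for i j v D D2 k
    using CP[OF that] by blast+
  let ?M = "real DIM('a) * B\<^sup>2"
  \<comment> \<open>The constant of \<open>symmetric_matrix_bound\<close> for a vector with
    components at most B, whose square is then at most N B^2.\<close>
  define E where "E = (B + B * (2 * B\<^sup>2 + B * ?M) / c) / c"
  have E: "E \<ge> 0" using B c by (simp add: E_def)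
  define C' where "C' = (\<Sum>i\<in>(Basis::'a set). \<Sum>j\<in>(Basis::'a set). \<Sum>k\<in>(Basis::'a set). C i j)"
  have C': "C' \<ge> 0" unfolding C'_def by (intro sum_nonneg C)
  have "hessian_bound_near \<Omega> p ?\<zeta> (E * (1 + C'))"
    unfolding hessian_bound_near_def
  proof (intro conjI allI impI ballI)
    fix v D D2 and j k :: 'a assume w: "weak_hessian \<Omega> v D D2" and jk: "j \<in> Basis" "k \<in> Basis"
    interpret weak_hessian \<Omega> v D D2 by (rule w)
    let ?A = "\<lambda>i j k x. ?\<zeta> x * (pd i \<rho> x * D2 j k x - pd j \<rho> x * D2 i k x)"
    \<comment> \<open>A pointwise majorant with the weight already inside the absolute values.
      Outside the ball the weight is zero, so the matrix bound is used only where the gradient of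
      rho is under control.\<close>
    let ?g = "\<lambda>x. E * (\<bar>?\<zeta> x * hess_trace x\<bar> + (\<Sum>i\<in>Basis. \<Sum>j\<in>Basis. \<Sum>k\<in>Basis. \<bar>?A i j k x\<bar>))"
    note sm = L2_smooth_mult[OF _ _ bounded_dom]
    have Labs: "L2 \<Omega> (\<lambda>x. \<bar>f x\<bar>)" "l2norm \<Omega> (\<lambda>x. \<bar>f x\<bar>) = l2norm \<Omega> f" if "L2 \<Omega> f" for f
      using that by (auto simp: L2_def l2norm_def)
    have LA: "L2 \<Omega> (?A i j k)" if "i \<in> Basis" "j \<in> Basis" "k \<in> Basis" for i j k
      using that by (intro sm smooth_ball_bump L2_diff smooth_fun_pd \<rho> L2D2)
    have Lf: "L2 \<Omega> (\<lambda>x. ?\<zeta> x * hess_trace x)" by (intro sm smooth_ball_bump L2_sum L2D2)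
    have LS: "L2 \<Omega> (\<lambda>x. \<Sum>i\<in>Basis. \<Sum>j\<in>Basis. \<Sum>k\<in>Basis. \<bar>?A i j k x\<bar>)" by (intro L2_sum Labs LA)
    have Lg: "L2 \<Omega> ?g" by (intro L2_cmult L2_add Labs Lf LS)
    have pw: "AE x in lebesgue_on \<Omega>. \<bar>?\<zeta> x * D2 j k x\<bar> \<le> \<bar>?g x\<bar>"
    proof -
      have "AE x in lebesgue_on \<Omega>. \<forall>i\<in>Basis. \<forall>j\<in>Basis. D2 i j x = D2 j i x"
        using D2_sym by (intro AE_finite_allI) auto
      then show ?thesis
      proof eventually_elim
        case (elim x)
        have g0: "0 \<le> ?g x" by (intro mult_nonneg_nonneg E add_nonneg_nonneg sum_nonneg) auto
        show ?case
        proof (cases "x \<in> cball p r")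
          case True
          have M: "(\<Sum>i\<in>Basis. (pd i \<rho> x)\<^sup>2) \<le> ?M"
          proof -
            have "(pd i \<rho> x)\<^sup>2 \<le> B\<^sup>2" if "i \<in> Basis" for i
              using power_mono[OF B(2)[OF that True], of 2] by simp
            then have "(\<Sum>i\<in>Basis. (pd i \<rho> x)\<^sup>2) \<le> (\<Sum>i\<in>(Basis::'a set). B\<^sup>2)" by (intro sum_mono)
            then show ?thesis by simp
          qed
          have "\<bar>D2 j k x\<bar> \<le> E * (\<bar>hess_trace x\<bar> + (\<Sum>i\<in>Basis. \<Sum>j\<in>Basis. \<Sum>k\<in>Basis. \<bar>pd i \<rho> x * D2 j k x - pd j \<rho> x * D2 i k x\<bar>))"
            unfolding E_def using elim B(1) c(1) True jk
            by (intro symmetric_matrix_bound[where H="\<lambda>i j. D2 i j x" and \<nu>="\<lambda>i. pd i \<rho> x"] M c(2) B(2)) auto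
          then have "?\<zeta> x * \<bar>D2 j k x\<bar> \<le> ?\<zeta> x * (E * (\<bar>hess_trace x\<bar> + (\<Sum>i\<in>Basis. \<Sum>j\<in>Basis. \<Sum>k\<in>Basis. \<bar>pd i \<rho> x * D2 j k x - pd j \<rho> x * D2 i k x\<bar>)))"
            by (intro mult_left_mono ball_bump_nonneg)
          also have "\<dots> = ?g x"
            by (simp only: abs_mult abs_of_nonneg[OF ball_bump_nonneg] sum_distrib_left[symmetric] distrib_left[symmetric] mult.left_commute)
          finally show ?thesis unfolding abs_of_nonneg[OF g0] by (simp only: abs_mult abs_of_nonneg[OF ball_bump_nonneg])
        qed (simp add: z0)
      qed
    qed
    have "l2norm \<Omega> (\<lambda>x. ?\<zeta> x * D2 j k x) \<le> l2norm \<Omega> ?g"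
      by (rule l2norm_mono_AE(2)[OF Lg _ pw]) (intro L2_measurable sm smooth_ball_bump L2D2 jk)
    also have "\<dots> \<le> E * (l2norm \<Omega> hess_trace + (\<Sum>i\<in>Basis. \<Sum>j\<in>Basis. \<Sum>k\<in>Basis. l2norm \<Omega> (?A i j k)))"
    proof -
      have "l2norm \<Omega> (\<lambda>x. \<bar>?\<zeta> x * hess_trace x\<bar>) \<le> 1 * l2norm \<Omega> hess_trace"
        unfolding Labs(2)[OF Lf]
        by (rule L2_bounded_mult(2)[OF _ smooth_measurable[OF smooth_ball_bump]])
          (auto intro!: L2_sum L2D2 simp: ball_bump_nonneg ball_bump_le1)
      moreover have "l2norm \<Omega> (\<lambda>x. \<Sum>i\<in>Basis. \<Sum>j\<in>Basis. \<Sum>k\<in>Basis. \<bar>?A i j k x\<bar>)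
        \<le> (\<Sum>i\<in>Basis. \<Sum>j\<in>Basis. \<Sum>k\<in>Basis. l2norm \<Omega> (?A i j k))"
        by (rule order_trans[OF l2norm_sum] sum_mono L2_sum Labs LA | simp add: Labs(2) LA)+
      ultimately have "l2norm \<Omega> (\<lambda>x. \<bar>?\<zeta> x * hess_trace x\<bar> + (\<Sum>i\<in>Basis. \<Sum>j\<in>Basis. \<Sum>k\<in>Basis. \<bar>?A i j k x\<bar>))
        \<le> l2norm \<Omega> hess_trace + (\<Sum>i\<in>Basis. \<Sum>j\<in>Basis. \<Sum>k\<in>Basis. l2norm \<Omega> (?A i j k))"
        using l2norm_triangle[OF Labs(1)[OF Lf] LS] by linarith
      then show ?thesis unfolding l2norm_cmult abs_of_nonneg[OF E] by (rule mult_left_mono[OF _ E])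
    qed
    also have "\<dots> \<le> E * (data_norm + (\<Sum>i\<in>(Basis::'a set). \<Sum>j\<in>(Basis::'a set). \<Sum>k\<in>(Basis::'a set). C i j * data_norm))"
      by (intro mult_left_mono add_mono sum_mono data_norm_bounds E C(2)[OF _ _ w])
    also have "\<dots> = E * (1 + C') * data_norm"
    proof -
      have "(\<Sum>i\<in>(Basis::'a set). \<Sum>j\<in>(Basis::'a set). \<Sum>k\<in>(Basis::'a set). C i j * data_norm) = C' * data_norm"
        unfolding C'_def by (simp only: sum_distrib_right)
      then show ?thesis by (simp add: distrib_right)
    qed
    finally show "l2norm \<Omega> (\<lambda>x. ?\<zeta> x * D2 j k x) \<le> E * (1 + C') * data_norm" .
  qed (use r E C' in \<open>auto simp: smooth_ball_bump ball_bump_nonneg ball_bump_pos_iff\<close>)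
  then show ?thesis by blast
qed

text \<open>The sets where the local weights are positive cover the compact closure. Finitely many
  suffice, their sum has a positive minimum there, and dividing by it removes the weights.\<close>

lemma hessian_estimate:
  fixes \<Omega> :: "'a::euclidean_space set"
  assumes dom: "smooth_bounded_domain \<Omega>"
  obtains C where "C \<ge> 0" "\<And>v D D2 j k. weak_hessian \<Omega> v D D2 \<Longrightarrow> j \<in> Basis \<Longrightarrow> k \<in> Basis \<Longrightarrow>
    l2norm \<Omega> (D2 j k) \<le> C * weak_hessian.data_norm \<Omega> D D2"
proof -
  have \<Omega>: "open \<Omega>" "bounded \<Omega>" "\<Omega> \<noteq> {}" using dom by (auto simp: smooth_bounded_domain_def)
  have "\<exists>\<zeta> C. hessian_bound_near \<Omega> p \<zeta> C" if "p \<in> closure \<Omega>" for p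
    using interior_hessian_bound[OF \<Omega>(1)] boundary_hessian_bound[OF dom] that
    by (cases "p \<in> \<Omega>") (auto simp: frontier_def interior_open[OF \<Omega>(1)])
  then obtain \<zeta> C where \<zeta>C: "\<And>p. p \<in> closure \<Omega> \<Longrightarrow> hessian_bound_near \<Omega> p (\<zeta> p) (C p)" by metis
  have h: "smooth_fun (\<zeta> p)" "0 \<le> \<zeta> p x" "\<zeta> p p > 0" "C p \<ge> 0" if "p \<in> closure \<Omega>" for p x
    using \<zeta>C[OF that] by (auto simp: hessian_bound_near_def)
  have cpt: "compact (closure \<Omega>)" using \<Omega>(2) by simp
  obtain P where P: "P \<subseteq> closure \<Omega>" "finite P" "closure \<Omega> \<subseteq> (\<Union>p\<in>P. {x. 0 < \<zeta> p x})"
  proof (rule compactE_image[OF cpt, of "closure \<Omega>" "\<lambda>p. {x. 0 < \<zeta> p x}"])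
    show "open {x. 0 < \<zeta> p x}" if "p \<in> closure \<Omega>" for p
      by (intro open_Collect_less continuous_on_const smooth_continuous h(1)[OF that])
    show "closure \<Omega> \<subseteq> (\<Union>p\<in>closure \<Omega>. {x. 0 < \<zeta> p x})" using h(3) by blast
  qed
  let ?s = "\<lambda>x. \<Sum>p\<in>P. \<zeta> p x"
  have hP: "smooth_fun (\<zeta> p)" "0 \<le> \<zeta> p x" "C p \<ge> 0" if "p \<in> P" for p x using h that P(1) by blast+
  have "closure \<Omega> \<noteq> {}" using \<Omega>(3) by simp
  moreover have "continuous_on (closure \<Omega>) ?s" by (intro continuous_on_sum smooth_continuous hP)
  ultimately obtain x0 where x0: "x0 \<in> closure \<Omega>" "\<And>x. x \<in> closure \<Omega> \<Longrightarrow> ?s x0 \<le> ?s x"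
    using continuous_attains_inf[OF cpt] by blast
  have m: "?s x0 > 0"
  proof -
    obtain p where "p \<in> P" "0 < \<zeta> p x0" using P(3) x0(1) by blast
    then show ?thesis using P(2) hP(2) by (intro sum_pos2[of P p]) auto
  qed
  show thesis
  proof (rule that[of "(\<Sum>p\<in>P. C p) / ?s x0"])
    show "0 \<le> (\<Sum>p\<in>P. C p) / ?s x0" using m by (intro divide_nonneg_pos sum_nonneg hP)
    fix v D D2 and j k :: 'a assume w: "weak_hessian \<Omega> v D D2" and jk: "j \<in> Basis" "k \<in> Basis"
    interpret weak_hessian \<Omega> v D D2 by (rule w)
    have L: "L2 \<Omega> (\<lambda>x. \<zeta> p x * D2 j k x)" if "p \<in> P" for p
      by (intro L2_smooth_mult hP that L2D2 jk bounded_dom)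
    have "AE x in lebesgue_on \<Omega>. \<bar>?s x0 * D2 j k x\<bar> \<le> \<bar>\<Sum>p\<in>P. \<zeta> p x * D2 j k x\<bar>"
    proof (rule AE_I2)
      fix x assume "x \<in> space (lebesgue_on \<Omega>)"
      then have "?s x0 \<le> ?s x" using x0(2) closure_subset by auto
      then have "?s x0 * \<bar>D2 j k x\<bar> \<le> ?s x * \<bar>D2 j k x\<bar>" by (intro mult_right_mono) auto
      then show "\<bar>?s x0 * D2 j k x\<bar> \<le> \<bar>\<Sum>p\<in>P. \<zeta> p x * D2 j k x\<bar>"
        using m \<open>?s x0 \<le> ?s x\<close> by (simp add: abs_mult flip: sum_distrib_right)
    qed
    then have "l2norm \<Omega> (\<lambda>x. ?s x0 * D2 j k x) \<le> l2norm \<Omega> (\<lambda>x. \<Sum>p\<in>P. \<zeta> p x * D2 j k x)"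
      by (rule l2norm_mono_AE(2)[rotated 2]) (intro L2_sum L L2_measurable L2_cmult L2D2 jk; assumption)+
    also have "\<dots> \<le> (\<Sum>p\<in>P. l2norm \<Omega> (\<lambda>x. \<zeta> p x * D2 j k x))" by (intro l2norm_sum L)
    also have "\<dots> \<le> (\<Sum>p\<in>P. C p * data_norm)"
      using \<zeta>C P(1) w jk by (intro sum_mono) (auto simp: hessian_bound_near_def)
    finally have "?s x0 * l2norm \<Omega> (D2 j k) \<le> (\<Sum>p\<in>P. C p) * data_norm"
      unfolding l2norm_cmult abs_of_pos[OF m] by (simp only: sum_distrib_right)
    then show "l2norm \<Omega> (D2 j k) \<le> (\<Sum>p\<in>P. C p) / ?s x0 * data_norm"
      using m by (simp add: field_simps)
  qed
qed

section \<open>The Laplacian and the nonlinearity\<close>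

text \<open>Integration by parts is applied to f and g separately and subtracted, so closure of
  \<open>H01\<close> under differences is never invoked.\<close>

lemma green_diff:
  assumes \<Omega>: "open \<Omega>" "bounded \<Omega>" and fg: "H01 \<Omega> f" "H01 \<Omega> g" and h: "H2 \<Omega> h"
  shows "(\<Sum>i\<in>Basis. \<integral>x. (wd \<Omega> i f x - wd \<Omega> i g x) * wd \<Omega> i h x \<partial>lebesgue_on \<Omega>)
    = - (\<integral>x. (f x - g x) * lap \<Omega> h x \<partial>lebesgue_on \<Omega>)"
proof -
  have f1: "H1 \<Omega> f" "H1 \<Omega> g" using fg by (auto simp: H01_def)
  have h1: "H1 \<Omega> h" and h2: "\<And>i. i \<in> Basis \<Longrightarrow> H1 \<Omega> (wd \<Omega> i h)" using h by (auto simp: H2_def)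
  have Lf: "L2 \<Omega> (\<lambda>x. f x - g x)" by (intro L2_diff H1_L2 f1)
  have "(\<integral>x. (wd \<Omega> i f x - wd \<Omega> i g x) * wd \<Omega> i h x \<partial>lebesgue_on \<Omega>)
    = - (\<integral>x. (f x - g x) * wd \<Omega> i (wd \<Omega> i h) x \<partial>lebesgue_on \<Omega>)" if i: "i \<in> Basis" for i
  proof -
    note L = H1_L2[OF h2[OF i]] H1_wd(1)[OF h2[OF i] i] H1_wd(1)[OF f1(1) i] H1_wd(1)[OF f1(2) i] H1_L2[OF f1(1)] H1_L2[OF f1(2)]
    show ?thesis
      unfolding left_diff_distrib
      using H01_integral_by_parts[OF \<Omega> fg(1) L(1,2) H1_wd(2)[OF h2[OF i] i]]
        H01_integral_by_parts[OF \<Omega> fg(2) L(1,2) H1_wd(2)[OF h2[OF i] i]]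
      by (simp add: L2_mult_integrable L)
  qed
  then have "(\<Sum>i\<in>Basis. \<integral>x. (wd \<Omega> i f x - wd \<Omega> i g x) * wd \<Omega> i h x \<partial>lebesgue_on \<Omega>)
    = - (\<Sum>i\<in>Basis. \<integral>x. (f x - g x) * wd \<Omega> i (wd \<Omega> i h) x \<partial>lebesgue_on \<Omega>)" by (simp add: sum_negf)
  also have "(\<Sum>i\<in>Basis. \<integral>x. (f x - g x) * wd \<Omega> i (wd \<Omega> i h) x \<partial>lebesgue_on \<Omega>) = (\<integral>x. (f x - g x) * lap \<Omega> h x \<partial>lebesgue_on \<Omega>)"
    unfolding lap_def sum_distrib_left
    by (rule Bochner_Integration.integral_sum[symmetric]) (intro L2_mult_integrable Lf H1_wd h2)
  finally show ?thesis .
qed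

lemma green:
  assumes "open \<Omega>" "bounded \<Omega>" "H01 \<Omega> f" "H2 \<Omega> h"
  shows "(\<Sum>i\<in>Basis. \<integral>x. wd \<Omega> i f x * wd \<Omega> i h x \<partial>lebesgue_on \<Omega>) = - (\<integral>x. f x * lap \<Omega> h x \<partial>lebesgue_on \<Omega>)"
proof -
  have f1: "H1 \<Omega> f" using assms by (auto simp: H01_def)
  have h2: "\<And>i. i \<in> Basis \<Longrightarrow> H1 \<Omega> (wd \<Omega> i h)" using assms by (auto simp: H2_def)
  have "(\<Sum>i\<in>Basis. \<integral>x. wd \<Omega> i f x * wd \<Omega> i h x \<partial>lebesgue_on \<Omega>)
    = - (\<Sum>i\<in>Basis. \<integral>x. f x * wd \<Omega> i (wd \<Omega> i h) x \<partial>lebesgue_on \<Omega>)"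
    unfolding sum_negf[symmetric]
    by (intro sum.cong refl H01_integral_by_parts[OF assms(1-3)] H1_L2 H1_wd h2)
  also have "(\<Sum>i\<in>Basis. \<integral>x. f x * wd \<Omega> i (wd \<Omega> i h) x \<partial>lebesgue_on \<Omega>) = (\<integral>x. f x * lap \<Omega> h x \<partial>lebesgue_on \<Omega>)"
    unfolding lap_def sum_distrib_left
    by (rule Bochner_Integration.integral_sum[symmetric]) (intro L2_mult_integrable H1_L2 f1 H1_wd h2)
  finally show ?thesis .
qed

text \<open>By Green's formula both sides are minus the symmetric integral of the product of the
  gradients.\<close>

lemma lap_self_adjoint:
  assumes "open \<Omega>" "bounded \<Omega>" "H01 \<Omega> f" "H01 \<Omega> h" "H2 \<Omega> f" "H2 \<Omega> h"
  shows "(\<integral>x. f x * lap \<Omega> h x \<partial>lebesgue_on \<Omega>) = (\<integral>x. h x * lap \<Omega> f x \<partial>lebesgue_on \<Omega>)"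
  using green[OF assms(1,2,3,6)] green[OF assms(1,2,4,5)] by (simp add: mult.commute)

text \<open>\<open>by_parts\<close> comes from \<open>H01_integral_by_parts\<close> with a smooth
  second factor, whose classical derivative is also its weak one, applied to f and g in
  turn.\<close>

lemma weak_hessian_diff:
  assumes \<Omega>: "open \<Omega>" "bounded \<Omega>" and f: "H2 \<Omega> f" "H01 \<Omega> f" and g: "H2 \<Omega> g" "H01 \<Omega> g"
  defines "v \<equiv> \<lambda>x. f x - g x"
  shows "weak_hessian \<Omega> v (\<lambda>i. wd \<Omega> i v) (\<lambda>i j. wd \<Omega> j (wd \<Omega> i v))"
proof
  have \<Omega>m: "\<Omega> \<in> sets lebesgue" using \<Omega>(1) by auto
  have H: "H2 \<Omega> v" unfolding v_def by (rule H2_diff(1)[OF \<Omega> f(1) g(1)])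
  have H1: "H1 \<Omega> v" "\<And>i. i \<in> Basis \<Longrightarrow> H1 \<Omega> (wd \<Omega> i v)" using H by (auto simp: H2_def)
  have h1: "H1 \<Omega> f" "H1 \<Omega> g" using f g by (auto simp: H2_def)
  show "open \<Omega>" "bounded \<Omega>" by (fact \<Omega>)+
  show "L2 \<Omega> v" by (rule H1_L2[OF H1(1)])
  show "L2 \<Omega> (wd \<Omega> i v)" "weak_deriv \<Omega> i v (wd \<Omega> i v)" if "i \<in> Basis" for i using H1_wd[OF H1(1) that] .
  show "L2 \<Omega> (wd \<Omega> j (wd \<Omega> i v))" "weak_deriv \<Omega> j (wd \<Omega> i v) (wd \<Omega> j (wd \<Omega> i v))" if "i \<in> Basis" "j \<in> Basis" for i j
    using H1_wd[OF H1(2)[OF that(1)] that(2)] .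
  fix i :: 'a and k :: "'a \<Rightarrow> real" assume i: "i \<in> Basis" and k: "smooth_fun k"
  have Lk: "L2 \<Omega> k" "L2 \<Omega> (pd i k)" by (auto intro!: smooth_L2 \<Omega> \<Omega>m k smooth_fun_pd i)
  note w = weak_deriv_smooth[OF \<Omega>(2) \<Omega>m k i]
  note L = H1_wd(1)[OF h1(1) i] H1_wd(1)[OF h1(2) i] H1_wd(1)[OF H1(1) i] H1_L2[OF h1(1)] H1_L2[OF h1(2)]
  have "(\<integral>x. wd \<Omega> i v x * k x \<partial>lebesgue_on \<Omega>) = (\<integral>x. wd \<Omega> i f x * k x - wd \<Omega> i g x * k x \<partial>lebesgue_on \<Omega>)"
  proof (rule integral_cong_AE)
    show "AE x in lebesgue_on \<Omega>. wd \<Omega> i v x * k x = wd \<Omega> i f x * k x - wd \<Omega> i g x * k x"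
      using H1_diff(2)[OF \<Omega> h1 i] unfolding v_def by eventually_elim (simp add: left_diff_distrib)
  qed (use L2_measurable[OF L(1)] L2_measurable[OF L(2)] L2_measurable[OF L(3)] L2_measurable[OF Lk(1)] in auto)
  also have "\<dots> = - (\<integral>x. v x * pd i k x \<partial>lebesgue_on \<Omega>)"
    unfolding v_def left_diff_distrib
    using H01_integral_by_parts[OF \<Omega> f(2) Lk w] H01_integral_by_parts[OF \<Omega> g(2) Lk w]
    by (simp add: L2_mult_integrable L Lk)
  finally show "(\<integral>x. wd \<Omega> i v x * k x \<partial>lebesgue_on \<Omega>) = - (\<integral>x. v x * pd i k x \<partial>lebesgue_on \<Omega>)" .
qed

text \<open>Green's formula gives |grad v|^2 = - (v, Delta v), which absorbs the gradient in
  \<open>data_norm\<close> into the norms of v and its Laplacian. Along the flow only these two have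
  to be controlled.\<close>

lemma H2_estimate:
  fixes \<Omega> :: "'a::euclidean_space set"
  assumes dom: "smooth_bounded_domain \<Omega>"
  obtains C where "C > 0" "\<And>f g. H2 \<Omega> f \<Longrightarrow> H01 \<Omega> f \<Longrightarrow> H2 \<Omega> g \<Longrightarrow> H01 \<Omega> g \<Longrightarrow>
    h2norm \<Omega> (\<lambda>x. f x - g x) \<le> C * (l2norm \<Omega> (\<lambda>x. lap \<Omega> f x - lap \<Omega> g x) + l2norm \<Omega> (\<lambda>x. f x - g x))"
proof -
  have \<Omega>: "open \<Omega>" "bounded \<Omega>" using dom by (auto simp: smooth_bounded_domain_def)
  obtain C where C: "C \<ge> 0" "\<And>v D D2 j k. weak_hessian \<Omega> v D D2 \<Longrightarrow> j \<in> Basis \<Longrightarrow> k \<in> Basis \<Longrightarrow>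
    l2norm \<Omega> (D2 j k) \<le> C * weak_hessian.data_norm \<Omega> D D2" using hessian_estimate[OF dom] by metis
  let ?N = "real DIM('a)"
  \<comment> \<open>Counts the squared H2 norm in units of P^2: 1 for v, at most N for the gradient,
    and N^2 second derivatives of size C (1 + N) P each.\<close>
  define K where "K = 1 + ?N + ?N * (?N * (C * (1 + ?N))\<^sup>2)"
  have K: "K > 0" unfolding K_def by (intro add_pos_nonneg) auto
  show thesis
  proof (rule that[of "sqrt K"])
    fix f g :: "'a \<Rightarrow> real" assume f: "H2 \<Omega> f" "H01 \<Omega> f" and g: "H2 \<Omega> g" "H01 \<Omega> g"
    define v where "v = (\<lambda>x. f x - g x)"
    have w: "weak_hessian \<Omega> v (\<lambda>i. wd \<Omega> i v) (\<lambda>i j. wd \<Omega> j (wd \<Omega> i v))"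
      unfolding v_def by (rule weak_hessian_diff[OF \<Omega> f g])
    have Hv: "H2 \<Omega> v" unfolding v_def by (rule H2_diff(1)[OF \<Omega> f(1) g(1)])
    have H1v: "H1 \<Omega> v" using Hv by (auto simp: H2_def)
    have h1: "H1 \<Omega> f" "H1 \<Omega> g" using f g by (auto simp: H2_def)
    have lapv: "l2norm \<Omega> (lap \<Omega> v) = l2norm \<Omega> (\<lambda>x. lap \<Omega> f x - lap \<Omega> g x)"
      using lap_diff[OF \<Omega> f(1) g(1)] unfolding v_def[symmetric]
      by (intro l2norm_cong_AE lap_L2 Hv L2_diff f g)
    define P where "P = l2norm \<Omega> (lap \<Omega> v) + l2norm \<Omega> v"
    have P: "P \<ge> 0" "l2norm \<Omega> (lap \<Omega> v) \<le> P" "l2norm \<Omega> v \<le> P" by (auto simp: P_def l2norm_nonneg)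
    have gradsum: "(\<Sum>i\<in>Basis. (l2norm \<Omega> (wd \<Omega> i v))\<^sup>2) \<le> P\<^sup>2"
    proof -
      have "(\<Sum>i\<in>Basis. (l2norm \<Omega> (wd \<Omega> i v))\<^sup>2) = (\<Sum>i\<in>Basis. \<integral>x. (wd \<Omega> i f x - wd \<Omega> i g x) * wd \<Omega> i v x \<partial>lebesgue_on \<Omega>)"
      proof (rule sum.cong[OF refl])
        fix i :: 'a assume i: "i \<in> Basis"
        note L = H1_wd(1)[OF h1(1) i] H1_wd(1)[OF h1(2) i] H1_wd(1)[OF H1v i]
        show "(l2norm \<Omega> (wd \<Omega> i v))\<^sup>2 = (\<integral>x. (wd \<Omega> i f x - wd \<Omega> i g x) * wd \<Omega> i v x \<partial>lebesgue_on \<Omega>)"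
          unfolding l2norm_sq
        proof (rule integral_cong_AE)
          show "AE x in lebesgue_on \<Omega>. (wd \<Omega> i v x)\<^sup>2 = (wd \<Omega> i f x - wd \<Omega> i g x) * wd \<Omega> i v x"
            using H1_diff(2)[OF \<Omega> h1 i] unfolding v_def[symmetric] by eventually_elim (simp add: power2_eq_square)
        qed (use L2_measurable[OF L(1)] L2_measurable[OF L(2)] L2_measurable[OF L(3)] in auto)
      qed
      also have "\<dots> = - (\<integral>x. v x * lap \<Omega> v x \<partial>lebesgue_on \<Omega>)"
        unfolding green_diff[OF \<Omega> f(2) g(2) Hv] by (simp add: v_def)
      also have "\<dots> \<le> l2norm \<Omega> v * l2norm \<Omega> (lap \<Omega> v)"
        using l2_Cauchy_Schwarz[OF H1_L2[OF H1v] lap_L2[OF Hv]] by linarith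
      also have "\<dots> \<le> P * P" by (intro mult_mono P l2norm_nonneg)
      finally show ?thesis by (simp add: power2_eq_square)
    qed
    have grad: "l2norm \<Omega> (wd \<Omega> i v) \<le> P" if "i \<in> Basis" for i
    proof -
      have "(l2norm \<Omega> (wd \<Omega> i v))\<^sup>2 \<le> (\<Sum>i\<in>Basis. (l2norm \<Omega> (wd \<Omega> i v))\<^sup>2)" using that by (intro member_le_sum) auto
      then show ?thesis using gradsum P(1) by (meson order_trans power2_le_imp_le)
    qed
    have "weak_hessian.data_norm \<Omega> (\<lambda>i. wd \<Omega> i v) (\<lambda>i j. wd \<Omega> j (wd \<Omega> i v)) = l2norm \<Omega> (lap \<Omega> v) + (\<Sum>i\<in>Basis. l2norm \<Omega> (wd \<Omega> i v))"
      unfolding weak_hessian.data_norm_def[OF w] lap_def ..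
    also have "\<dots> \<le> P + (\<Sum>i\<in>(Basis::'a set). P)" by (intro add_mono sum_mono grad P)
    finally have data: "weak_hessian.data_norm \<Omega> (\<lambda>i. wd \<Omega> i v) (\<lambda>i j. wd \<Omega> j (wd \<Omega> i v)) \<le> (1 + ?N) * P"
      by (simp add: algebra_simps)
    have hess: "l2norm \<Omega> (wd \<Omega> j (wd \<Omega> i v)) \<le> C * (1 + ?N) * P" if "i \<in> Basis" "j \<in> Basis" for i j
      using C(2)[OF w that] mult_left_mono[OF data C(1)] by (simp add: mult.assoc)
    have "(h2norm \<Omega> v)\<^sup>2 = (l2norm \<Omega> v)\<^sup>2 + (\<Sum>i\<in>Basis. (l2norm \<Omega> (wd \<Omega> i v))\<^sup>2)
      + (\<Sum>i\<in>Basis. \<Sum>j\<in>Basis. (l2norm \<Omega> (wd \<Omega> j (wd \<Omega> i v)))\<^sup>2)"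
      unfolding h2norm_def by (intro real_sqrt_pow2) (auto intro!: add_nonneg_nonneg sum_nonneg)
    also have "\<dots> \<le> P\<^sup>2 + (\<Sum>i\<in>(Basis::'a set). P\<^sup>2) + (\<Sum>i\<in>(Basis::'a set). \<Sum>j\<in>(Basis::'a set). (C * (1 + ?N) * P)\<^sup>2)"
      by (intro add_mono sum_mono power_mono P grad hess l2norm_nonneg)
    also have "\<dots> = K * P\<^sup>2" by (simp add: K_def power_mult_distrib distrib_right)
    finally have "h2norm \<Omega> v \<le> sqrt (K * P\<^sup>2)" by (rule real_le_rsqrt)
    then have "h2norm \<Omega> v \<le> sqrt K * P" using P(1) by (simp add: real_sqrt_mult)
    then show "h2norm \<Omega> (\<lambda>x. f x - g x) \<le> sqrt K * (l2norm \<Omega> (\<lambda>x. lap \<Omega> f x - lap \<Omega> g x) + l2norm \<Omega> (\<lambda>x. f x - g x))"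
      unfolding P_def lapv unfolding v_def .
  qed (use K in simp)
qed

text \<open>Green's formula removes the gradient: apart from the mass, the energy then depends on w
  and its Laplacian through an L2 inner product.\<close>

lemma energy_eq:
  assumes "open \<Omega>" "bounded \<Omega>" "H2 \<Omega> w" "H01 \<Omega> w"
  shows "energy \<Omega> lam w = - 1/2 * (\<integral>x. w x * lap \<Omega> w x \<partial>lebesgue_on \<Omega>) + lam / (1 + (\<integral>x. 1 / (1 - w x) \<partial>lebesgue_on \<Omega>))"
proof -
  have h: "H1 \<Omega> w" using assms by (auto simp: H2_def)
  have "(\<integral>x. (\<Sum>i\<in>Basis. (wd \<Omega> i w x)\<^sup>2) \<partial>lebesgue_on \<Omega>) = (\<Sum>i\<in>Basis. \<integral>x. wd \<Omega> i w x * wd \<Omega> i w x \<partial>lebesgue_on \<Omega>)"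
    unfolding power2_eq_square by (rule Bochner_Integration.integral_sum) (intro L2_mult_integrable H1_wd h)
  then show ?thesis unfolding energy_def green[OF assms(1,2,4,3)] by simp
qed

section \<open>The reciprocal 1/(1 - w) and Lipschitz continuity of the nonlinearity\<close>

lemma bounded_away_from_1:
  fixes \<Omega> :: "'a::euclidean_space set"
  assumes \<Omega>: "open \<Omega>" "bounded \<Omega>" and \<delta>: "\<delta> > 0" and w: "L2 \<Omega> w" "AE x in lebesgue_on \<Omega>. \<bar>w x\<bar> \<le> 1 - \<delta>"
  shows "(\<lambda>x. 1 / (1 - w x)) \<in> borel_measurable (lebesgue_on \<Omega>)"
    and "AE x in lebesgue_on \<Omega>. 0 < 1 / (1 - w x) \<and> 1 / (1 - w x) \<le> 1 / \<delta> \<and> w x < 1"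
    and "L2 \<Omega> (\<lambda>x. 1 / (1 - w x))" and "0 \<le> (\<integral>x. 1 / (1 - w x) \<partial>lebesgue_on \<Omega>)"
proof -
  have \<Omega>m: "\<Omega> \<in> sets lebesgue" using \<Omega>(1) by auto
  show m: "(\<lambda>x. 1 / (1 - w x)) \<in> borel_measurable (lebesgue_on \<Omega>)" using L2_measurable[OF w(1)] by measurable
  show b: "AE x in lebesgue_on \<Omega>. 0 < 1 / (1 - w x) \<and> 1 / (1 - w x) \<le> 1 / \<delta> \<and> w x < 1"
    using w(2) by eventually_elim (use \<delta> in \<open>auto simp: abs_le_iff intro!: divide_left_mono\<close>)
  show "L2 \<Omega> (\<lambda>x. 1 / (1 - w x))"
    by (rule L2_bounded[OF \<Omega>(2) \<Omega>m m, of "1 / \<delta>"]) (use b in \<open>auto elim: eventually_mono\<close>)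
  show "0 \<le> (\<integral>x. 1 / (1 - w x) \<partial>lebesgue_on \<Omega>)"
    by (rule integral_nonneg_AE) (use b in \<open>auto elim: eventually_mono\<close>)
qed

lemma reciprocal_Lipschitz:
  fixes \<Omega> :: "'a::euclidean_space set"
  assumes \<Omega>: "open \<Omega>" "bounded \<Omega>" and \<delta>: "\<delta> > 0"
    and u: "L2 \<Omega> u" "AE x in lebesgue_on \<Omega>. \<bar>u x\<bar> \<le> 1 - \<delta>" and v: "L2 \<Omega> v" "AE x in lebesgue_on \<Omega>. \<bar>v x\<bar> \<le> 1 - \<delta>"
  shows "l2norm \<Omega> (\<lambda>x. 1 / (1 - u x) - 1 / (1 - v x)) \<le> 1 / \<delta>\<^sup>2 * l2norm \<Omega> (\<lambda>x. u x - v x)"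
    and "\<bar>(\<integral>x. 1 / (1 - u x) \<partial>lebesgue_on \<Omega>) - (\<integral>x. 1 / (1 - v x) \<partial>lebesgue_on \<Omega>)\<bar>
      \<le> l2norm \<Omega> (\<lambda>x. 1) / \<delta>\<^sup>2 * l2norm \<Omega> (\<lambda>x. u x - v x)"
proof -
  have \<Omega>m: "\<Omega> \<in> sets lebesgue" using \<Omega>(1) by auto
  note bu = bounded_away_from_1[OF \<Omega> \<delta> u] and bv = bounded_away_from_1[OF \<Omega> \<delta> v]
  have Ld: "L2 \<Omega> (\<lambda>x. 1 / (1 - u x) - 1 / (1 - v x))" by (intro L2_diff bu bv)
  have "l2norm \<Omega> (\<lambda>x. 1 / (1 - u x) - 1 / (1 - v x)) \<le> l2norm \<Omega> (\<lambda>x. 1 / \<delta>\<^sup>2 * (u x - v x))"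
  proof (rule l2norm_mono_AE(2))
    show "AE x in lebesgue_on \<Omega>. \<bar>1 / (1 - u x) - 1 / (1 - v x)\<bar> \<le> \<bar>1 / \<delta>\<^sup>2 * (u x - v x)\<bar>"
      using bu(2) bv(2)
    proof eventually_elim
      case (elim x)
      \<comment> \<open>The factor in 1/(1 - u) - 1/(1 - v) = k (u - v); each of its two factors is
        at most 1/delta.\<close>
      define k where "k = 1 / (1 - u x) * (1 / (1 - v x))"
      have k: "0 \<le> k" "k \<le> 1 / \<delta> * (1 / \<delta>)"
        unfolding k_def using elim \<delta> by (intro mult_nonneg_nonneg mult_mono; auto)+
      have "1 / (1 - u x) - 1 / (1 - v x) = k * (u x - v x)"
        using elim by (simp add: k_def field_simps)
      then have "\<bar>1 / (1 - u x) - 1 / (1 - v x)\<bar> = k * \<bar>u x - v x\<bar>"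
        by (simp only: abs_mult abs_of_nonneg[OF k(1)])
      also have "\<dots> \<le> 1 / \<delta> * (1 / \<delta>) * \<bar>u x - v x\<bar>" by (intro mult_right_mono k) auto
      also have "\<dots> = \<bar>1 / \<delta>\<^sup>2 * (u x - v x)\<bar>" using \<delta> by (simp add: abs_mult power2_eq_square)
      finally show ?case .
    qed
  qed (intro L2_cmult L2_diff u v L2_measurable[OF Ld])+
  then show A: "l2norm \<Omega> (\<lambda>x. 1 / (1 - u x) - 1 / (1 - v x)) \<le> 1 / \<delta>\<^sup>2 * l2norm \<Omega> (\<lambda>x. u x - v x)"
    unfolding l2norm_cmult by simp
  have "(\<integral>x. 1 / (1 - u x) \<partial>lebesgue_on \<Omega>) - (\<integral>x. 1 / (1 - v x) \<partial>lebesgue_on \<Omega>) = (\<integral>x. 1 / (1 - u x) - 1 / (1 - v x) \<partial>lebesgue_on \<Omega>)"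
    by (rule Bochner_Integration.integral_diff[symmetric]) (intro L2_integrable(1)[OF \<Omega>(2) \<Omega>m] bu bv)+
  also have "\<bar>\<dots>\<bar> \<le> l2norm \<Omega> (\<lambda>x. 1) * l2norm \<Omega> (\<lambda>x. 1 / (1 - u x) - 1 / (1 - v x))"
    by (rule L2_integrable(2)[OF \<Omega>(2) \<Omega>m Ld])
  also have "\<dots> \<le> l2norm \<Omega> (\<lambda>x. 1) * (1 / \<delta>\<^sup>2 * l2norm \<Omega> (\<lambda>x. u x - v x))"
    by (intro mult_left_mono A l2norm_nonneg)
  finally show "\<bar>(\<integral>x. 1 / (1 - u x) \<partial>lebesgue_on \<Omega>) - (\<integral>x. 1 / (1 - v x) \<partial>lebesgue_on \<Omega>)\<bar>
      \<le> l2norm \<Omega> (\<lambda>x. 1) / \<delta>\<^sup>2 * l2norm \<Omega> (\<lambda>x. u x - v x)" by simp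
qed

lemma nl_eq: "nl \<Omega> lam w x = lam / (1 + (\<integral>y. 1 / (1 - w y) \<partial>lebesgue_on \<Omega>))\<^sup>2 * (1 / (1 - w x) * (1 / (1 - w x)))"
  by (simp add: nl_def power2_eq_square)

lemma nl_L2:
  assumes "open \<Omega>" "bounded \<Omega>" "\<delta> > 0" "L2 \<Omega> w" "AE x in lebesgue_on \<Omega>. \<bar>w x\<bar> \<le> 1 - \<delta>"
  shows "L2 \<Omega> (nl \<Omega> lam w)"
proof -
  note b = bounded_away_from_1[OF assms]
  have "L2 \<Omega> (\<lambda>x. 1 / (1 - w x) * (1 / (1 - w x)))"
    by (rule L2_bounded_mult(1)[OF b(3,1), of "1 / \<delta>"]) (use b(2) in \<open>auto elim: eventually_mono\<close>)
  then show ?thesis unfolding nl_eq[abs_def] by (rule L2_cmult)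
qed

text \<open>With X and Y the reciprocals of 1 + mass, and a and b those of 1 - u and 1 - v, the two
  values are lam X^2 a^2 and lam Y^2 b^2. All factors are bounded and depend on u and v in a
  Lipschitz way because both stay away from 1.\<close>

lemma nl_Lipschitz:
  fixes \<Omega> :: "'a::euclidean_space set"
  assumes \<Omega>: "open \<Omega>" "bounded \<Omega>" and \<delta>: "\<delta> > 0" and lam: "lam > 0"
  obtains L where "L > 0" "\<And>u v. L2 \<Omega> u \<Longrightarrow> AE x in lebesgue_on \<Omega>. \<bar>u x\<bar> \<le> 1 - \<delta> \<Longrightarrow> L2 \<Omega> v \<Longrightarrow>
    AE x in lebesgue_on \<Omega>. \<bar>v x\<bar> \<le> 1 - \<delta> \<Longrightarrow>
    l2norm \<Omega> (\<lambda>x. nl \<Omega> lam u x - nl \<Omega> lam v x) \<le> L * l2norm \<Omega> (\<lambda>x. u x - v x)"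
proof -
  have \<Omega>m: "\<Omega> \<in> sets lebesgue" using \<Omega>(1) by auto
  let ?one = "l2norm \<Omega> (\<lambda>x. 1)"
  let ?L = "lam * (2 / \<delta> * (1 / \<delta>\<^sup>2)) + lam * (2 * (?one / \<delta>\<^sup>2)) * (1 / \<delta> * (1 / \<delta> * ?one))"
  show thesis
  proof (rule that[of ?L])
    show "?L > 0" using lam \<delta> l2norm_nonneg[of \<Omega> "\<lambda>x. 1"] by (intro add_pos_nonneg) auto
    fix u v :: "'a \<Rightarrow> real" assume u: "L2 \<Omega> u" "AE x in lebesgue_on \<Omega>. \<bar>u x\<bar> \<le> 1 - \<delta>" and v: "L2 \<Omega> v" "AE x in lebesgue_on \<Omega>. \<bar>v x\<bar> \<le> 1 - \<delta>"
    note bu = bounded_away_from_1[OF \<Omega> \<delta> u] and bv = bounded_away_from_1[OF \<Omega> \<delta> v]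
    note lip = reciprocal_Lipschitz[OF \<Omega> \<delta> u v]
    define a b where "a = (\<lambda>x. 1 / (1 - u x))" and "b = (\<lambda>x. 1 / (1 - v x))"
    define X Y where "X = 1 / (1 + integral\<^sup>L (lebesgue_on \<Omega>) a)" and "Y = 1 / (1 + integral\<^sup>L (lebesgue_on \<Omega>) b)"
    have A: "integral\<^sup>L (lebesgue_on \<Omega>) a \<ge> 0" "integral\<^sup>L (lebesgue_on \<Omega>) b \<ge> 0" using bu(4) bv(4) by (auto simp: a_def b_def)
    have XY: "0 \<le> X" "X \<le> 1" "0 \<le> Y" "Y \<le> 1" using A by (auto simp: X_def Y_def divide_simps)
    have "X - Y = (X * Y) * (integral\<^sup>L (lebesgue_on \<Omega>) b - integral\<^sup>L (lebesgue_on \<Omega>) a)"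
      using A by (simp add: X_def Y_def field_simps add_nonneg_eq_0_iff)
    then have "\<bar>X - Y\<bar> \<le> 1 * \<bar>integral\<^sup>L (lebesgue_on \<Omega>) b - integral\<^sup>L (lebesgue_on \<Omega>) a\<bar>"
      using XY by (simp only: abs_mult) (intro mult_right_mono, auto intro: mult_le_one)
    also have "\<dots> \<le> ?one / \<delta>\<^sup>2 * l2norm \<Omega> (\<lambda>x. u x - v x)" using lip(2) by (simp add: a_def b_def abs_minus_commute)
    finally have XYd: "\<bar>X - Y\<bar> \<le> ?one / \<delta>\<^sup>2 * l2norm \<Omega> (\<lambda>x. u x - v x)" .
    have "X\<^sup>2 - Y\<^sup>2 = (X + Y) * (X - Y)" by (simp add: power2_eq_square algebra_simps)
    then have "\<bar>X\<^sup>2 - Y\<^sup>2\<bar> = \<bar>X + Y\<bar> * \<bar>X - Y\<bar>" by (simp add: abs_mult)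
    also have "\<dots> \<le> 2 * (?one / \<delta>\<^sup>2 * l2norm \<Omega> (\<lambda>x. u x - v x))" using XY by (intro mult_mono XYd) auto
    finally have sq: "\<bar>X\<^sup>2 - Y\<^sup>2\<bar> \<le> 2 * (?one / \<delta>\<^sup>2 * l2norm \<Omega> (\<lambda>x. u x - v x))" .
    have am: "a \<in> borel_measurable (lebesgue_on \<Omega>)" "b \<in> borel_measurable (lebesgue_on \<Omega>)" using bu(1) bv(1) by (auto simp: a_def b_def)
    have La: "L2 \<Omega> a" "L2 \<Omega> b" using bu(3) bv(3) by (auto simp: a_def b_def)
    have ab: "AE x in lebesgue_on \<Omega>. \<bar>a x\<bar> \<le> 1 / \<delta>" "AE x in lebesgue_on \<Omega>. \<bar>b x\<bar> \<le> 1 / \<delta>"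
      using bu(2) bv(2) by (auto simp: a_def b_def elim: eventually_mono)
    have s: "AE x in lebesgue_on \<Omega>. \<bar>a x + b x\<bar> \<le> 2 / \<delta>" using ab by eventually_elim linarith
    note m1 = L2_bounded_mult[OF L2_diff[OF La] borel_measurable_add[OF am] s]
    note m2 = L2_bounded_mult[OF La(2) am(2) ab(2)]
    have "l2norm \<Omega> b = l2norm \<Omega> (\<lambda>x. b x * 1)" by simp
    also have "\<dots> \<le> 1 / \<delta> * ?one" by (rule L2_bounded_mult(2)[OF L2_const[OF \<Omega>(2) \<Omega>m] am(2) ab(2)])
    finally have lb: "l2norm \<Omega> b \<le> 1 / \<delta> * ?one" .
    have "nl \<Omega> lam w x = lam * ((1 / (1 + (\<integral>y. 1 / (1 - w y) \<partial>lebesgue_on \<Omega>)))\<^sup>2 * (1 / (1 - w x))\<^sup>2)" for w x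
      by (simp add: nl_def power_divide power_mult_distrib)
    then have e: "nl \<Omega> lam u x = lam * (X\<^sup>2 * (a x)\<^sup>2)" "nl \<Omega> lam v x = lam * (Y\<^sup>2 * (b x)\<^sup>2)" for x
      by (simp_all add: X_def Y_def a_def b_def)
    \<comment> \<open>X^2 a^2 - Y^2 b^2 = X^2 (a + b)(a - b) + (X^2 - Y^2) b^2 separates the local
      change from the nonlocal one.\<close>
    have "l2norm \<Omega> (\<lambda>x. nl \<Omega> lam u x - nl \<Omega> lam v x)
      = l2norm \<Omega> (\<lambda>x. (lam * X\<^sup>2) * ((a x + b x) * (a x - b x)) + (lam * (X\<^sup>2 - Y\<^sup>2)) * (b x * b x))"
      unfolding e by (rule arg_cong[of _ _ "l2norm \<Omega>"]) (simp add: fun_eq_iff power2_eq_square algebra_simps)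
    also have "\<dots> \<le> \<bar>lam * X\<^sup>2\<bar> * l2norm \<Omega> (\<lambda>x. (a x + b x) * (a x - b x)) + \<bar>lam * (X\<^sup>2 - Y\<^sup>2)\<bar> * l2norm \<Omega> (\<lambda>x. b x * b x)"
      using l2norm_triangle[OF L2_cmult[OF m1(1)] L2_cmult[OF m2(1)]] by (simp only: l2norm_cmult)
    also have "\<dots> \<le> lam * (2 / \<delta> * (1 / \<delta>\<^sup>2 * l2norm \<Omega> (\<lambda>x. u x - v x)))
        + lam * (2 * (?one / \<delta>\<^sup>2 * l2norm \<Omega> (\<lambda>x. u x - v x))) * (1 / \<delta> * (1 / \<delta> * ?one))"
    proof (intro add_mono mult_mono)
      show "\<bar>lam * X\<^sup>2\<bar> \<le> lam" using lam XY power_le_one[of X 2] by (simp add: abs_mult mult_left_le)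
      show "l2norm \<Omega> (\<lambda>x. (a x + b x) * (a x - b x)) \<le> 2 / \<delta> * (1 / \<delta>\<^sup>2 * l2norm \<Omega> (\<lambda>x. u x - v x))"
        by (rule order_trans[OF m1(2)], unfold a_def b_def, rule mult_left_mono[OF lip(1)]) (use \<delta> in simp)
      show "\<bar>lam * (X\<^sup>2 - Y\<^sup>2)\<bar> \<le> lam * (2 * (?one / \<delta>\<^sup>2 * l2norm \<Omega> (\<lambda>x. u x - v x)))"
        unfolding abs_mult abs_of_pos[OF lam] by (rule mult_left_mono[OF sq]) (use lam in simp)
      show "l2norm \<Omega> (\<lambda>x. b x * b x) \<le> 1 / \<delta> * (1 / \<delta> * ?one)"
        by (rule order_trans[OF m2(2)]) (use lb \<delta> in \<open>intro mult_left_mono; simp\<close>)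
    qed (use lam \<delta> in \<open>auto simp: l2norm_nonneg\<close>)
    also have "\<dots> = ?L * l2norm \<Omega> (\<lambda>x. u x - v x)" by (simp add: algebra_simps)
    finally show "l2norm \<Omega> (\<lambda>x. nl \<Omega> lam u x - nl \<Omega> lam v x) \<le> ?L * l2norm \<Omega> (\<lambda>x. u x - v x)" .
  qed
qed

section \<open>The flow\<close>

lemma L2_divide: "L2 \<Omega> f \<Longrightarrow> L2 \<Omega> (\<lambda>x. f x / c)"
  using L2_cmult[of \<Omega> f "1 / c"] by simp

lemma l2_quotient_continuous:
  assumes L: "eventually (\<lambda>s. L2 \<Omega> (F s)) (at t)" "L2 \<Omega> (F t)" "L2 \<Omega> F'"
    and q: "((\<lambda>s. l2norm \<Omega> (\<lambda>x. (F s x - F t x) / (s - t) - F' x)) \<longlongrightarrow> 0) (at t)"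
  shows "((\<lambda>s. l2norm \<Omega> (\<lambda>x. F s x - F t x)) \<longlongrightarrow> 0) (at (t::real))"
proof -
  have "((\<lambda>s. \<bar>s - t\<bar> * (l2norm \<Omega> (\<lambda>x. (F s x - F t x) / (s - t) - F' x) + l2norm \<Omega> F')) \<longlongrightarrow> \<bar>t - t\<bar> * (0 + l2norm \<Omega> F')) (at t)"
    by (intro tendsto_intros q)
  then have B: "((\<lambda>s. \<bar>s - t\<bar> * (l2norm \<Omega> (\<lambda>x. (F s x - F t x) / (s - t) - F' x) + l2norm \<Omega> F')) \<longlongrightarrow> 0) (at t)" by simp
  have ne: "eventually (\<lambda>s. s \<noteq> t) (at t)" by (simp add: eventually_at_filter)
  show ?thesis
  proof (rule tendsto_sandwich[OF _ _ tendsto_const B])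
    show "eventually (\<lambda>s. l2norm \<Omega> (\<lambda>x. F s x - F t x) \<le> \<bar>s - t\<bar> * (l2norm \<Omega> (\<lambda>x. (F s x - F t x) / (s - t) - F' x) + l2norm \<Omega> F')) (at t)"
      using L(1) ne
    proof eventually_elim
      case (elim s)
      have Lq: "L2 \<Omega> (\<lambda>x. (F s x - F t x) / (s - t))" by (intro L2_divide L2_diff elim L)
      have "l2norm \<Omega> (\<lambda>x. F s x - F t x) = l2norm \<Omega> (\<lambda>x. (s - t) * ((F s x - F t x) / (s - t)))" using elim by simp
      also have "\<dots> = \<bar>s - t\<bar> * l2norm \<Omega> (\<lambda>x. ((F s x - F t x) / (s - t) - F' x) + F' x)" unfolding l2norm_cmult by simp
      also have "\<dots> \<le> \<bar>s - t\<bar> * (l2norm \<Omega> (\<lambda>x. (F s x - F t x) / (s - t) - F' x) + l2norm \<Omega> F')"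
        by (intro mult_left_mono l2norm_triangle L2_diff Lq L) auto
      finally show ?case .
    qed
  qed (simp add: l2norm_nonneg)
qed

lemma tendsto_l2norm_const: "((\<lambda>s. l2norm \<Omega> (\<lambda>x. f x - f x)) \<longlongrightarrow> 0) F"
  by (simp add: l2norm_def)

lemma tendsto_l2_add:
  assumes "((\<lambda>s. l2norm \<Omega> (\<lambda>x. F s x - f x)) \<longlongrightarrow> 0) net" "((\<lambda>s. l2norm \<Omega> (\<lambda>x. G s x - g x)) \<longlongrightarrow> 0) net"
    and L: "L2 \<Omega> f" "L2 \<Omega> g" "eventually (\<lambda>s. L2 \<Omega> (F s)) net" "eventually (\<lambda>s. L2 \<Omega> (G s)) net"
  shows "((\<lambda>s. l2norm \<Omega> (\<lambda>x. (F s x + G s x) - (f x + g x))) \<longlongrightarrow> 0) net"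
proof (rule tendsto_sandwich[OF _ _ tendsto_const])
  show "((\<lambda>s. l2norm \<Omega> (\<lambda>x. F s x - f x) + l2norm \<Omega> (\<lambda>x. G s x - g x)) \<longlongrightarrow> 0) net"
    using tendsto_add[OF assms(1,2)] by simp
  show "eventually (\<lambda>s. l2norm \<Omega> (\<lambda>x. (F s x + G s x) - (f x + g x)) \<le> l2norm \<Omega> (\<lambda>x. F s x - f x) + l2norm \<Omega> (\<lambda>x. G s x - g x)) net"
    using L(3,4)
  proof eventually_elim
    case (elim s)
    show ?case
      using l2norm_triangle[OF L2_diff[OF elim(1) L(1)] L2_diff[OF elim(2) L(2)]] by (simp add: algebra_simps)
  qed
qed (simp add: l2norm_nonneg)

text \<open>The quotient (F_s^2 - F_t^2) / (s - t) is the difference quotient of F times F_s + F_t,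
  and both factors converge in L2.\<close>

lemma l2_square_deriv:
  assumes L: "eventually (\<lambda>s. L2 \<Omega> (F s)) (at t)" "L2 \<Omega> (F t)" "L2 \<Omega> F'"
    and q: "((\<lambda>s. l2norm \<Omega> (\<lambda>x. (F s x - F t x) / (s - t) - F' x)) \<longlongrightarrow> 0) (at t)"
  shows "((\<lambda>s. (l2norm \<Omega> (F s))\<^sup>2) has_real_derivative 2 * (\<integral>x. F' x * F t x \<partial>lebesgue_on \<Omega>)) (at (t::real))"
proof -
  note c = l2_quotient_continuous[OF L q]
  have Lq: "eventually (\<lambda>s. L2 \<Omega> (\<lambda>x. (F s x - F t x) / (s - t))) (at t)"
    using L(1) by eventually_elim (intro L2_divide L2_diff L(2))
  have Ls: "eventually (\<lambda>s. L2 \<Omega> (\<lambda>x. F s x + F t x)) (at t)"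
    using L(1) by eventually_elim (intro L2_add L(2))
  have "((\<lambda>s. \<integral>x. (F s x - F t x) / (s - t) * (F s x + F t x) \<partial>lebesgue_on \<Omega>) \<longlongrightarrow> (\<integral>x. F' x * (F t x + F t x) \<partial>lebesgue_on \<Omega>)) (at t)"
    by (intro tendsto_l2_inner[OF q tendsto_l2_add[OF c tendsto_l2norm_const]] L L2_add Lq Ls) (simp add: L)
  moreover have "(\<integral>x. F' x * (F t x + F t x) \<partial>lebesgue_on \<Omega>) = 2 * (\<integral>x. F' x * F t x \<partial>lebesgue_on \<Omega>)"
  proof -
    have "(\<lambda>x. F' x * (F t x + F t x)) = (\<lambda>x. 2 * (F' x * F t x))" by (simp add: fun_eq_iff)
    then show ?thesis by simp
  qed
  moreover have "eventually (\<lambda>s. (\<integral>x. (F s x - F t x) / (s - t) * (F s x + F t x) \<partial>lebesgue_on \<Omega>)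
      = ((l2norm \<Omega> (F s))\<^sup>2 - (l2norm \<Omega> (F t))\<^sup>2) / (s - t)) (at t)"
    using L(1)
  proof eventually_elim
    case (elim s)
    have "(\<integral>x. (F s x - F t x) / (s - t) * (F s x + F t x) \<partial>lebesgue_on \<Omega>) = (\<integral>x. ((F s x)\<^sup>2 - (F t x)\<^sup>2) / (s - t) \<partial>lebesgue_on \<Omega>)"
      by (intro Bochner_Integration.integral_cong) (auto simp: power2_eq_square algebra_simps)
    also have "\<dots> = ((l2norm \<Omega> (F s))\<^sup>2 - (l2norm \<Omega> (F t))\<^sup>2) / (s - t)"
      using L2_integrable_sq[OF elim] L2_integrable_sq[OF L(2)] by (simp add: l2norm_sq)
    finally show ?case .
  qed
  ultimately show ?thesis
    unfolding has_field_derivative_iff by (auto intro: Lim_transform_eventually)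
qed

lemma l2_inner_deriv:
  assumes L: "eventually (\<lambda>s. L2 \<Omega> (F s)) (at t)" "L2 \<Omega> (F t)" "L2 \<Omega> F'" "L2 \<Omega> g"
    and q: "((\<lambda>s. l2norm \<Omega> (\<lambda>x. (F s x - F t x) / (s - t) - F' x)) \<longlongrightarrow> 0) (at t)"
  shows "((\<lambda>s. \<integral>x. F s x * g x \<partial>lebesgue_on \<Omega>) has_real_derivative (\<integral>x. F' x * g x \<partial>lebesgue_on \<Omega>)) (at (t::real))"
proof -
  have Lq: "eventually (\<lambda>s. L2 \<Omega> (\<lambda>x. (F s x - F t x) / (s - t))) (at t)"
    using L(1) by eventually_elim (intro L2_divide L2_diff L(2))
  have "((\<lambda>s. \<integral>x. (F s x - F t x) / (s - t) * g x \<partial>lebesgue_on \<Omega>) \<longlongrightarrow> (\<integral>x. F' x * g x \<partial>lebesgue_on \<Omega>)) (at t)"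
    by (intro tendsto_l2_inner[OF q tendsto_l2norm_const] L Lq) (simp add: L)
  moreover have "eventually (\<lambda>s. (\<integral>x. (F s x - F t x) / (s - t) * g x \<partial>lebesgue_on \<Omega>)
      = ((\<integral>x. F s x * g x \<partial>lebesgue_on \<Omega>) - (\<integral>x. F t x * g x \<partial>lebesgue_on \<Omega>)) / (s - t)) (at t)"
    using L(1)
  proof eventually_elim
    case (elim s)
    show ?case by (simp add: left_diff_distrib L2_mult_integrable elim L)
  qed
  ultimately show ?thesis
    unfolding has_field_derivative_iff by (auto intro: Lim_transform_eventually)
qed

section \<open>Energy dissipation and growth of the velocity along the solution\<close>

lemma at_within_nonneg: "t > 0 \<Longrightarrow> at t within {0..} = at (t::real)"
  by (rule at_within_interior) simp

lemma eventually_pos_at: "t > 0 \<Longrightarrow> eventually (\<lambda>s. s > 0) (at (t::real))"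
  by (rule order_tendstoD(1)[OF tendsto_ident_at])

text \<open>Limits are taken at times t > 0, where they are two-sided. The Lipschitz bound of the
  nonlinearity is an assumption, so that one fixed L enters all later exponents.\<close>

locale flow =
  fixes \<Omega> :: "'a::euclidean_space set" and lam \<delta> L :: real and u ut :: "real \<Rightarrow> 'a \<Rightarrow> real"
  assumes open_dom: "open \<Omega>" and bounded_dom: "bounded \<Omega>" and \<delta>: "\<delta> > 0"
    and uH2: "t \<ge> 0 \<Longrightarrow> H2 \<Omega> (u t)" and uH01: "t \<ge> 0 \<Longrightarrow> H01 \<Omega> (u t)" and utL2: "t \<ge> 0 \<Longrightarrow> L2 \<Omega> (ut t)"
    and u_deriv: "t > 0 \<Longrightarrow> ((\<lambda>s. l2norm \<Omega> (\<lambda>x. (u s x - u t x) / (s - t) - ut t x)) \<longlongrightarrow> 0) (at t)"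
    and ut_cont: "t > 0 \<Longrightarrow> ((\<lambda>s. l2norm \<Omega> (\<lambda>x. ut s x - ut t x)) \<longlongrightarrow> 0) (at t)"
    and equation: "t > 0 \<Longrightarrow> AE x in lebesgue_on \<Omega>. ut t x - lap \<Omega> (u t) x = nl \<Omega> lam (u t) x"
    and bound: "t \<ge> 0 \<Longrightarrow> AE x in lebesgue_on \<Omega>. \<bar>u t x\<bar> \<le> 1 - \<delta>"
    and L: "L > 0" and Lipschitz: "L2 \<Omega> v \<Longrightarrow> AE x in lebesgue_on \<Omega>. \<bar>v x\<bar> \<le> 1 - \<delta> \<Longrightarrow> L2 \<Omega> w \<Longrightarrow>
      AE x in lebesgue_on \<Omega>. \<bar>w x\<bar> \<le> 1 - \<delta> \<Longrightarrow>
      l2norm \<Omega> (\<lambda>x. nl \<Omega> lam v x - nl \<Omega> lam w x) \<le> L * l2norm \<Omega> (\<lambda>x. v x - w x)"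
begin

abbreviation (input) I :: "('a \<Rightarrow> real) \<Rightarrow> real" where
  "I f \<equiv> \<integral>x. f x \<partial>lebesgue_on \<Omega>"

abbreviation (input) mass :: "('a \<Rightarrow> real) \<Rightarrow> real" where
  "mass w \<equiv> \<integral>x. 1 / (1 - w x) \<partial>lebesgue_on \<Omega>"

lemma uL2: "t \<ge> 0 \<Longrightarrow> L2 \<Omega> (u t)"
  using uH2 by (auto simp: H2_def H1_def)

lemma uL2_ev:
  assumes "t > 0"
  shows "eventually (\<lambda>s. L2 \<Omega> (u s)) (at t)"
  using eventually_pos_at[OF assms] by eventually_elim (simp add: uL2)

lemma lapL2: "t \<ge> 0 \<Longrightarrow> L2 \<Omega> (lap \<Omega> (u t))"
  by (rule lap_L2[OF uH2])

lemma nlL2: "t \<ge> 0 \<Longrightarrow> L2 \<Omega> (nl \<Omega> lam (u t))"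
  by (rule nl_L2[OF open_dom bounded_dom \<delta> uL2 bound])

lemma u_tendsto:
  assumes "t > 0"
  shows "((\<lambda>s. l2norm \<Omega> (\<lambda>x. u s x - u t x)) \<longlongrightarrow> 0) (at t)"
  by (rule l2_quotient_continuous[where F=u and F'="ut t", OF uL2_ev[OF assms] uL2 utL2 u_deriv[OF assms]])
    (use assms in auto)

text \<open>By the equation the Laplacian is the velocity minus the nonlinearity: the first is
  continuous by \<open>ut_cont\<close>, the second because it is Lipschitz in L2.\<close>

lemma lap_tendsto:
  assumes t: "t > 0"
  shows "((\<lambda>s. l2norm \<Omega> (\<lambda>x. lap \<Omega> (u s) x - lap \<Omega> (u t) x)) \<longlongrightarrow> 0) (at t)"
proof (rule tendsto_sandwich[OF _ _ tendsto_const])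
  show "((\<lambda>s. l2norm \<Omega> (\<lambda>x. ut s x - ut t x) + L * l2norm \<Omega> (\<lambda>x. u s x - u t x)) \<longlongrightarrow> 0) (at t)"
    using tendsto_add[OF ut_cont[OF t] tendsto_mult_left[OF u_tendsto[OF t], of L]] by simp
  show "eventually (\<lambda>s. l2norm \<Omega> (\<lambda>x. lap \<Omega> (u s) x - lap \<Omega> (u t) x)
      \<le> l2norm \<Omega> (\<lambda>x. ut s x - ut t x) + L * l2norm \<Omega> (\<lambda>x. u s x - u t x)) (at t)"
    using eventually_pos_at[OF t]
  proof eventually_elim
    case (elim s)
    have L2s: "L2 \<Omega> (\<lambda>x. ut s x - ut t x)" "L2 \<Omega> (\<lambda>x. nl \<Omega> lam (u s) x - nl \<Omega> lam (u t) x)"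
      using elim t by (intro L2_diff utL2 nlL2; simp)+
    have "l2norm \<Omega> (\<lambda>x. lap \<Omega> (u s) x - lap \<Omega> (u t) x)
      = l2norm \<Omega> (\<lambda>x. (ut s x - ut t x) - (nl \<Omega> lam (u s) x - nl \<Omega> lam (u t) x))"
    proof (rule l2norm_cong_AE)
      show "AE x in lebesgue_on \<Omega>. lap \<Omega> (u s) x - lap \<Omega> (u t) x = (ut s x - ut t x) - (nl \<Omega> lam (u s) x - nl \<Omega> lam (u t) x)"
        using equation[OF elim] equation[OF t] by eventually_elim linarith
    qed (use elim t L2s in \<open>auto intro!: L2_diff lapL2\<close>)
    also have "\<dots> \<le> l2norm \<Omega> (\<lambda>x. ut s x - ut t x) + l2norm \<Omega> (\<lambda>x. nl \<Omega> lam (u s) x - nl \<Omega> lam (u t) x)"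
      by (rule l2norm_triangle_diff[OF L2s])
    also have "\<dots> \<le> l2norm \<Omega> (\<lambda>x. ut s x - ut t x) + L * l2norm \<Omega> (\<lambda>x. u s x - u t x)"
      using elim t by (intro add_left_mono Lipschitz uL2 bound) auto
    finally show ?case .
  qed
qed (simp add: l2norm_nonneg)

text \<open>The gradient of the velocity need not exist, so the Dirichlet integral is not
  differentiated under the integral sign. Its increment becomes the increment of u times a sum of
  two Laplacians, and after division by s - t both factors converge in L2.\<close>

lemma energy_deriv:
  assumes t: "t > 0"
  shows "((\<lambda>s. energy \<Omega> lam (u s)) has_real_derivative - (l2norm \<Omega> (ut t))\<^sup>2) (at t)"
proof -
  have t0: "t \<ge> 0" using t by simp
  define q where "q s x = (u s x - u t x) / (s - t)" for s x
  define a where "a s x = 1 / (1 - u s x)" for s x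
  note b = bounded_away_from_1[OF open_dom bounded_dom \<delta> uL2 bound]
  have q: "((\<lambda>s. l2norm \<Omega> (\<lambda>x. q s x - ut t x)) \<longlongrightarrow> 0) (at t)" unfolding q_def by (rule u_deriv[OF t])
  have Lq: "eventually (\<lambda>s. L2 \<Omega> (q s)) (at t)"
    using uL2_ev[OF t] unfolding q_def by eventually_elim (intro L2_divide L2_diff uL2[OF t0])
  have La: "L2 \<Omega> (a s)" and am: "a s \<in> borel_measurable (lebesgue_on \<Omega>)"
    and ab: "AE x in lebesgue_on \<Omega>. \<bar>a s x\<bar> \<le> 1 / \<delta>" and mass0: "0 \<le> mass (u s)" if "s \<ge> 0" for s
    using b[OF that that] unfolding a_def by (auto elim: eventually_mono)
  have La2: "L2 \<Omega> (\<lambda>x. a s x * a r x)" if "s \<ge> 0" "r \<ge> 0" for s r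
    by (rule L2_bounded_mult(1)[OF La am ab]) (use that in auto)
  have mass_lim: "((\<lambda>s. mass (u s)) \<longlongrightarrow> mass (u t)) (at t)"
  proof -
    have "((\<lambda>s. l2norm \<Omega> (\<lambda>x. 1) / \<delta>\<^sup>2 * l2norm \<Omega> (\<lambda>x. u s x - u t x)) \<longlongrightarrow> 0) (at t)"
      by (rule tendsto_mult_right_zero[OF u_tendsto[OF t]])
    moreover have "eventually (\<lambda>s. norm (mass (u s) - mass (u t)) \<le> l2norm \<Omega> (\<lambda>x. 1) / \<delta>\<^sup>2 * l2norm \<Omega> (\<lambda>x. u s x - u t x)) (at t)"
      using eventually_pos_at[OF t]
    proof eventually_elim
      case (elim s)
      show ?case
        using reciprocal_Lipschitz(2)[OF open_dom bounded_dom \<delta> uL2[of s] bound[of s] uL2[OF t0] bound[OF t0]] elim by simp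
    qed
    ultimately have "((\<lambda>s. mass (u s) - mass (u t)) \<longlongrightarrow> 0) (at t)" by (rule Lim_null_comparison[rotated])
    then show ?thesis by (simp add: LIM_zero_iff)
  qed
  have aa_lim: "((\<lambda>s. l2norm \<Omega> (\<lambda>x. a t x * a s x - a t x * a t x)) \<longlongrightarrow> 0) (at t)"
  proof (rule tendsto_sandwich[OF _ _ tendsto_const])
    show "((\<lambda>s. 1 / \<delta> * (1 / \<delta>\<^sup>2 * l2norm \<Omega> (\<lambda>x. u s x - u t x))) \<longlongrightarrow> 0) (at t)"
      by (intro tendsto_mult_right_zero u_tendsto[OF t])
    show "eventually (\<lambda>s. l2norm \<Omega> (\<lambda>x. a t x * a s x - a t x * a t x) \<le> 1 / \<delta> * (1 / \<delta>\<^sup>2 * l2norm \<Omega> (\<lambda>x. u s x - u t x))) (at t)"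
      using eventually_pos_at[OF t]
    proof eventually_elim
      case (elim s)
      have "l2norm \<Omega> (\<lambda>x. a t x * (a s x - a t x)) \<le> 1 / \<delta> * l2norm \<Omega> (\<lambda>x. a s x - a t x)"
        using elim t0 by (intro L2_bounded_mult(2)[OF _ am ab] L2_diff La) auto
      also have "\<dots> \<le> 1 / \<delta> * (1 / \<delta>\<^sup>2 * l2norm \<Omega> (\<lambda>x. u s x - u t x))"
        unfolding a_def using elim t0 \<delta>
        by (intro mult_left_mono reciprocal_Lipschitz(1)[OF open_dom bounded_dom \<delta>] uL2 bound) auto
      finally show ?case by (simp add: right_diff_distrib)
    qed
  qed (simp add: l2norm_nonneg)
  \<comment> \<open>The quotient of the energy, rearranged: the first term uses self-adjointness of
    the Laplacian, the second that 1/(1 - u_s) - 1/(1 - u_t) is (u_s - u_t) times both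
    reciprocals.\<close>
  let ?R = "\<lambda>s. - 1/2 * I (\<lambda>x. q s x * (lap \<Omega> (u s) x + lap \<Omega> (u t) x))
      - lam / ((1 + mass (u s)) * (1 + mass (u t))) * I (\<lambda>x. q s x * (a t x * a s x))"
  have lim1: "((\<lambda>s. I (\<lambda>x. q s x * (lap \<Omega> (u s) x + lap \<Omega> (u t) x))) \<longlongrightarrow> I (\<lambda>x. ut t x * (lap \<Omega> (u t) x + lap \<Omega> (u t) x))) (at t)"
  proof (rule tendsto_l2_inner[OF q tendsto_l2_add[OF lap_tendsto[OF t] tendsto_l2norm_const]])
    show "eventually (\<lambda>s. L2 \<Omega> (lap \<Omega> (u s))) (at t)" "eventually (\<lambda>s. L2 \<Omega> (\<lambda>x. lap \<Omega> (u s) x + lap \<Omega> (u t) x)) (at t)"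
      using eventually_pos_at[OF t] by (eventually_elim, auto intro!: L2_add lapL2 t0)+
  qed (use Lq in \<open>auto intro!: L2_cmult lapL2 utL2 t0\<close>)
  have lim2: "((\<lambda>s. I (\<lambda>x. q s x * (a t x * a s x))) \<longlongrightarrow> I (\<lambda>x. ut t x * (a t x * a t x))) (at t)"
  proof (rule tendsto_l2_inner[OF q aa_lim utL2[OF t0] La2[OF t0 t0] Lq])
    show "eventually (\<lambda>s. L2 \<Omega> (\<lambda>x. a t x * a s x)) (at t)"
      using eventually_pos_at[OF t] by eventually_elim (auto intro!: La2 t0)
  qed
  have lim: "(?R \<longlongrightarrow> - 1/2 * I (\<lambda>x. ut t x * (lap \<Omega> (u t) x + lap \<Omega> (u t) x))
      - lam / ((1 + mass (u t)) * (1 + mass (u t))) * I (\<lambda>x. ut t x * (a t x * a t x))) (at t)"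
    using mass0[OF t0] by (intro tendsto_intros lim1 lim2 mass_lim) auto
  \<comment> \<open>The limit is minus the integral of the velocity times Laplacian plus
    nonlinearity; by the equation the latter sum is again the velocity.\<close>
  have val: "- 1/2 * I (\<lambda>x. ut t x * (lap \<Omega> (u t) x + lap \<Omega> (u t) x))
      - lam / ((1 + mass (u t)) * (1 + mass (u t))) * I (\<lambda>x. ut t x * (a t x * a t x)) = - (l2norm \<Omega> (ut t))\<^sup>2"
  proof -
    let ?k = "lam / ((1 + mass (u t)) * (1 + mass (u t)))"
    have nl: "nl \<Omega> lam (u t) x = ?k * (a t x * a t x)" for x by (simp add: nl_eq a_def power2_eq_square)
    note i1 = L2_mult_integrable[OF utL2[OF t0] lapL2[OF t0]] and i2 = L2_mult_integrable[OF utL2[OF t0] La2[OF t0 t0]]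
    have "(l2norm \<Omega> (ut t))\<^sup>2 = I (\<lambda>x. ut t x * lap \<Omega> (u t) x + ?k * (ut t x * (a t x * a t x)))"
      unfolding l2norm_sq
    proof (rule integral_cong_AE)
      show "AE x in lebesgue_on \<Omega>. (ut t x)\<^sup>2 = ut t x * lap \<Omega> (u t) x + ?k * (ut t x * (a t x * a t x))"
        using equation[OF t]
      proof eventually_elim
        case (elim x)
        have "(ut t x)\<^sup>2 = ut t x * (lap \<Omega> (u t) x + nl \<Omega> lam (u t) x)" using elim by (simp add: power2_eq_square)
        then show ?case unfolding nl by (simp add: algebra_simps)
      qed
    qed (use L2_integrable_sq[OF utL2[OF t0]] i1 i2 in auto)
    also have "\<dots> = I (\<lambda>x. ut t x * lap \<Omega> (u t) x) + ?k * I (\<lambda>x. ut t x * (a t x * a t x))"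
      using i1 i2 by simp
    finally show ?thesis unfolding distrib_left using i1 by simp
  qed
  have "eventually (\<lambda>s. ?R s = (energy \<Omega> lam (u s) - energy \<Omega> lam (u t)) / (s - t)) (at t)"
  proof -
    have ne: "eventually (\<lambda>s. s \<noteq> t) (at t)" by (simp add: eventually_at_filter)
    show ?thesis
      using eventually_pos_at[OF t] ne
    proof eventually_elim
      case (elim s)
      have s0: "s \<ge> 0" using elim by simp
      have "I (\<lambda>x. q s x * (lap \<Omega> (u s) x + lap \<Omega> (u t) x))
        = I (\<lambda>x. (u s x * lap \<Omega> (u s) x + u s x * lap \<Omega> (u t) x - u t x * lap \<Omega> (u s) x - u t x * lap \<Omega> (u t) x) / (s - t))"
        by (intro Bochner_Integration.integral_cong refl) (simp add: q_def algebra_simps)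
      also have "\<dots> = (I (\<lambda>x. u s x * lap \<Omega> (u s) x) + I (\<lambda>x. u s x * lap \<Omega> (u t) x)
          - I (\<lambda>x. u t x * lap \<Omega> (u s) x) - I (\<lambda>x. u t x * lap \<Omega> (u t) x)) / (s - t)"
        by (simp add: L2_mult_integrable uL2 lapL2 s0 t0)
      \<comment> \<open>The two mixed terms cancel by \<open>lap_self_adjoint\<close>.\<close>
      also have "\<dots> = (I (\<lambda>x. u s x * lap \<Omega> (u s) x) - I (\<lambda>x. u t x * lap \<Omega> (u t) x)) / (s - t)"
        using lap_self_adjoint[OF open_dom bounded_dom uH01[OF s0] uH01[OF t0] uH2[OF s0] uH2[OF t0]] by simp
      finally have A: "I (\<lambda>x. q s x * (lap \<Omega> (u s) x + lap \<Omega> (u t) x))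
        = (I (\<lambda>x. u s x * lap \<Omega> (u s) x) - I (\<lambda>x. u t x * lap \<Omega> (u t) x)) / (s - t)" .
      have La_int: "integrable (lebesgue_on \<Omega>) (a s)" "integrable (lebesgue_on \<Omega>) (a t)"
        using L2_integrable(1)[OF bounded_dom _ La] open_dom s0 t0 by auto
      have Lqs: "L2 \<Omega> (q s)" unfolding q_def by (intro L2_divide L2_diff uL2 s0 t0)
      have "I (\<lambda>x. q s x * (a t x * a s x)) = I (\<lambda>x. (a s x - a t x) / (s - t))"
      proof (rule integral_cong_AE)
        show "AE x in lebesgue_on \<Omega>. q s x * (a t x * a s x) = (a s x - a t x) / (s - t)"
          using b(2)[OF s0 s0] b(2)[OF t0 t0]
          by eventually_elim (use elim in \<open>simp add: q_def a_def field_simps\<close>)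
      qed (use L2_mult_integrable[OF Lqs La2[OF t0 s0]] La_int in auto)
      also have "\<dots> = (I (a s) - I (a t)) / (s - t)" using La_int by simp
      also have "\<dots> = (mass (u s) - mass (u t)) / (s - t)" by (simp add: a_def[abs_def])
      finally have B: "I (\<lambda>x. q s x * (a t x * a s x)) = (mass (u s) - mass (u t)) / (s - t)" .
      have fr: "lam / (1 + mass (u s)) - lam / (1 + mass (u t))
          = - (lam / ((1 + mass (u s)) * (1 + mass (u t)))) * (mass (u s) - mass (u t))"
        using mass0[OF s0] mass0[OF t0] by (simp add: divide_simps) (simp add: algebra_simps)
      have "(energy \<Omega> lam (u s) - energy \<Omega> lam (u t)) / (s - t)
        = (- 1/2 * (I (\<lambda>x. u s x * lap \<Omega> (u s) x) - I (\<lambda>x. u t x * lap \<Omega> (u t) x))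
           + (lam / (1 + mass (u s)) - lam / (1 + mass (u t)))) / (s - t)"
        using energy_eq[OF open_dom bounded_dom uH2[OF s0] uH01[OF s0], of lam]
          energy_eq[OF open_dom bounded_dom uH2[OF t0] uH01[OF t0], of lam] by (simp add: algebra_simps)
      also have "\<dots> = ?R s"
      proof -
        have "(- 1/2 * X + - k * Y) / d = - 1/2 * (X / d) - k * (Y / d)" for X Y k d :: real
          by (simp add: diff_divide_distrib)
        then show ?thesis unfolding A B fr .
      qed
      finally show ?case by simp
    qed
  qed
  then show ?thesis
    unfolding has_field_derivative_iff using Lim_transform_eventually[OF lim] val by simp
qed

text \<open>The squared norm N of the difference satisfies N' <= 2 L N: the Laplacian contributes
  minus the squared gradient, the nonlinearity at most L N before doubling. Hence exp(-2 L r) N is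
  nonincreasing. Differences lie in H2, which the velocity need not.\<close>

lemma difference_decay:
  assumes h: "h > 0" and s: "0 < s" "s \<le> t"
  shows "l2norm \<Omega> (\<lambda>x. u (t + h) x - u t x) \<le> exp (L * (t - s)) * l2norm \<Omega> (\<lambda>x. u (s + h) x - u s x)"
proof -
  define d where "d r x = u (r + h) x - u r x" for r x
  define N where "N r = (l2norm \<Omega> (d r))\<^sup>2" for r
  have Ld: "L2 \<Omega> (d r)" if "r \<ge> 0" for r unfolding d_def using that h by (intro L2_diff uL2) auto
  have der: "(N has_real_derivative 2 * I (\<lambda>x. (ut (r + h) x - ut r x) * d r x)) (at r)" if r: "r > 0" for r
    unfolding N_def
  proof (rule l2_square_deriv)
    show "eventually (\<lambda>s. L2 \<Omega> (d s)) (at r)" using eventually_pos_at[OF r] by eventually_elim (simp add: Ld)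
    show "L2 \<Omega> (d r)" using Ld r by simp
    show Lu: "L2 \<Omega> (\<lambda>x. ut (r + h) x - ut r x)" using r h by (intro L2_diff utL2) auto
    \<comment> \<open>The shift by h carries punctured neighbourhoods of r to those of r + h, so the
      quotient of the shifted solution converges as well.\<close>
    have sh: "filterlim (\<lambda>s. s + h) (at (r + h)) (at r)"
      by (auto simp: filterlim_at eventually_at_filter intro!: tendsto_eq_intros)
    have q1: "((\<lambda>s. l2norm \<Omega> (\<lambda>x. (u (s + h) x - u (r + h) x) / ((s + h) - (r + h)) - ut (r + h) x)) \<longlongrightarrow> 0) (at r)"
      by (rule filterlim_compose[OF u_deriv sh]) (use r h in auto)
    show "((\<lambda>s. l2norm \<Omega> (\<lambda>x. (d s x - d r x) / (s - r) - (ut (r + h) x - ut r x))) \<longlongrightarrow> 0) (at r)"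
    proof (rule tendsto_sandwich[OF _ _ tendsto_const tendsto_add_zero[OF q1 u_deriv[OF r]]])
      show "eventually (\<lambda>s. l2norm \<Omega> (\<lambda>x. (d s x - d r x) / (s - r) - (ut (r + h) x - ut r x))
        \<le> l2norm \<Omega> (\<lambda>x. (u (s + h) x - u (r + h) x) / ((s + h) - (r + h)) - ut (r + h) x)
          + l2norm \<Omega> (\<lambda>x. (u s x - u r x) / (s - r) - ut r x)) (at r)"
        using eventually_pos_at[OF r]
      proof eventually_elim
        case (elim s)
        have "L2 \<Omega> (\<lambda>x. (u (s + h) x - u (r + h) x) / ((s + h) - (r + h)) - ut (r + h) x)"
          "L2 \<Omega> (\<lambda>x. (u s x - u r x) / (s - r) - ut r x)"
          using elim r h by (intro L2_diff L2_divide uL2 utL2; simp)+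
        from l2norm_triangle_diff[OF this] show ?case
          by (rule order_trans[OF eq_refl, rotated], intro arg_cong[of _ _ "l2norm \<Omega>"])
             (simp add: d_def fun_eq_iff add_divide_distrib diff_divide_distrib)
      qed
    qed (simp add: l2norm_nonneg)
  qed
  have le: "2 * I (\<lambda>x. (ut (r + h) x - ut r x) * d r x) \<le> 2 * L * N r" if r: "r > 0" for r
  proof -
    have r0: "r \<ge> 0" "r + h \<ge> 0" "r + h > 0" using r h by auto
    let ?l = "\<lambda>x. lap \<Omega> (u (r + h)) x - lap \<Omega> (u r) x" and ?n = "\<lambda>x. nl \<Omega> lam (u (r + h)) x - nl \<Omega> lam (u r) x"
    have Ll: "L2 \<Omega> ?l" "L2 \<Omega> ?n" by (intro L2_diff lapL2 nlL2 r0)+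
    have "I (\<lambda>x. (ut (r + h) x - ut r x) * d r x) = I (\<lambda>x. ?l x * d r x + ?n x * d r x)"
    proof (rule integral_cong_AE)
      show "AE x in lebesgue_on \<Omega>. (ut (r + h) x - ut r x) * d r x = ?l x * d r x + ?n x * d r x"
        using equation[OF r0(3)] equation[OF r]
      proof eventually_elim
        case (elim x)
        have "ut (r + h) x - ut r x = ?l x + ?n x" using elim by linarith
        then show ?case by (simp only: distrib_right)
      qed
      show "(\<lambda>x. (ut (r + h) x - ut r x) * d r x) \<in> borel_measurable (lebesgue_on \<Omega>)"
        by (intro borel_measurable_integrable L2_mult_integrable L2_diff utL2 r0 Ld)
      show "(\<lambda>x. ?l x * d r x + ?n x * d r x) \<in> borel_measurable (lebesgue_on \<Omega>)"
        by (intro borel_measurable_add borel_measurable_integrable L2_mult_integrable Ll r0 Ld)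
    qed
    also have "\<dots> = I (\<lambda>x. ?l x * d r x) + I (\<lambda>x. ?n x * d r x)"
      by (rule Bochner_Integration.integral_add) (intro L2_mult_integrable Ll Ld r0)+
    also have "I (\<lambda>x. ?l x * d r x) \<le> 0"
    proof -
      have h1: "H1 \<Omega> (u (r + h))" "H1 \<Omega> (u r)" using uH2 r0 by (auto simp: H2_def)
      let ?w = "\<lambda>i x. wd \<Omega> i (u (r + h)) x - wd \<Omega> i (u r) x"
      have Lw: "L2 \<Omega> (?w i)" if "i \<in> Basis" for i using that by (intro L2_diff H1_wd h1)
      have "I (\<lambda>x. ?l x * d r x) = I (\<lambda>x. (u (r + h) x - u r x) * lap \<Omega> (u (r + h)) x - (u (r + h) x - u r x) * lap \<Omega> (u r) x)"
        by (intro Bochner_Integration.integral_cong) (auto simp: d_def algebra_simps)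
      also have "\<dots> = I (\<lambda>x. (u (r + h) x - u r x) * lap \<Omega> (u (r + h)) x) - I (\<lambda>x. (u (r + h) x - u r x) * lap \<Omega> (u r) x)"
        by (rule Bochner_Integration.integral_diff) (intro L2_mult_integrable L2_diff uL2 lapL2 r0)+
      also have "\<dots> = - ((\<Sum>i\<in>Basis. I (\<lambda>x. ?w i x * wd \<Omega> i (u (r + h)) x)) - (\<Sum>i\<in>Basis. I (\<lambda>x. ?w i x * wd \<Omega> i (u r) x)))"
        using green_diff[OF open_dom bounded_dom uH01 uH01 uH2, of "r + h" r "r + h"]
          green_diff[OF open_dom bounded_dom uH01 uH01 uH2, of "r + h" r r] r0 by simp
      also have "\<dots> = - (\<Sum>i\<in>Basis. (l2norm \<Omega> (?w i))\<^sup>2)"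
      proof -
        have "I (\<lambda>x. ?w i x * wd \<Omega> i (u (r + h)) x) - I (\<lambda>x. ?w i x * wd \<Omega> i (u r) x) = (l2norm \<Omega> (?w i))\<^sup>2"
          if i: "i \<in> Basis" for i
        proof -
          have "I (\<lambda>x. ?w i x * wd \<Omega> i (u (r + h)) x) - I (\<lambda>x. ?w i x * wd \<Omega> i (u r) x)
            = I (\<lambda>x. ?w i x * wd \<Omega> i (u (r + h)) x - ?w i x * wd \<Omega> i (u r) x)"
            by (rule Bochner_Integration.integral_diff[symmetric]) (intro L2_mult_integrable Lw i H1_wd h1)+
          then show ?thesis unfolding l2norm_sq by (simp only: right_diff_distrib[symmetric] power2_eq_square)
        qed
        then show ?thesis by (simp flip: sum_subtractf)
      qed
      also have "\<dots> \<le> 0" by (simp add: sum_nonneg)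
      finally show ?thesis .
    qed
    also have "I (\<lambda>x. ?n x * d r x) \<le> l2norm \<Omega> ?n * l2norm \<Omega> (d r)"
      using l2_Cauchy_Schwarz[OF Ll(2) Ld[OF r0(1)]] by linarith
    also have "\<dots> \<le> (L * l2norm \<Omega> (d r)) * l2norm \<Omega> (d r)"
      unfolding d_def by (intro mult_right_mono Lipschitz uL2 bound r0 l2norm_nonneg)
    finally show ?thesis by (simp add: N_def power2_eq_square)
  qed
  have "exp (- 2 * L * t) * N t \<le> exp (- 2 * L * s) * N s"
  proof (rule DERIV_nonpos_imp_nonincreasing[OF s(2)])
    fix r assume "s \<le> r" "r \<le> t"
    then have r: "r > 0" using s by simp
    have "((\<lambda>r. exp (- 2 * L * r) * N r) has_real_derivative
        exp (- 2 * L * r) * (- 2 * L) * N r + 2 * I (\<lambda>x. (ut (r + h) x - ut r x) * d r x) * exp (- 2 * L * r)) (at r)"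
      by (rule DERIV_mult[OF _ der[OF r]]) (auto intro!: derivative_eq_intros)
    moreover have "exp (- 2 * L * r) * (- 2 * L) * N r + 2 * I (\<lambda>x. (ut (r + h) x - ut r x) * d r x) * exp (- 2 * L * r) \<le> 0"
      using mult_left_mono[OF le[OF r], of "exp (- 2 * L * r)"] by (simp add: algebra_simps)
    ultimately show "\<exists>y. ((\<lambda>r. exp (- 2 * L * r) * N r) has_real_derivative y) (at r) \<and> y \<le> 0" by blast
  qed
  then have "exp (2 * L * t) * (exp (- 2 * L * t) * N t) \<le> exp (2 * L * t) * (exp (- 2 * L * s) * N s)"
    by (intro mult_left_mono) auto
  then have "N t \<le> exp (2 * L * t + - 2 * L * s) * N s"
    by (simp only: mult.assoc[symmetric] exp_add[symmetric]) simp
  also have "exp (2 * L * t + - 2 * L * s) = (exp (L * (t - s)))\<^sup>2"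
    by (simp add: exp_double[symmetric] algebra_simps flip: exp_of_nat_mult)
  finally have "(l2norm \<Omega> (d t))\<^sup>2 \<le> (exp (L * (t - s)) * l2norm \<Omega> (d s))\<^sup>2"
    by (simp add: N_def power_mult_distrib)
  then have "l2norm \<Omega> (d t) \<le> exp (L * (t - s)) * l2norm \<Omega> (d s)"
    by (rule power2_le_imp_le) (simp add: l2norm_nonneg)
  then show ?thesis by (simp add: d_def[abs_def])
qed

lemma velocity_quotient_tendsto:
  assumes t: "t > 0"
  shows "((\<lambda>h. l2norm \<Omega> (\<lambda>x. u (t + h) x - u t x) / h) \<longlongrightarrow> l2norm \<Omega> (ut t)) (at_right 0)"
proof -
  have sh: "filterlim (\<lambda>h. t + h) (at t) (at_right 0)"
    by (auto simp: filterlim_at eventually_at_filter intro!: tendsto_eq_intros)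
  have q: "((\<lambda>h. l2norm \<Omega> (\<lambda>x. (u (t + h) x - u t x) / ((t + h) - t) - ut t x)) \<longlongrightarrow> 0) (at_right 0)"
    by (rule filterlim_compose[OF u_deriv[OF t] sh])
  have "((\<lambda>h. l2norm \<Omega> (\<lambda>x. u (t + h) x - u t x) / h - l2norm \<Omega> (ut t)) \<longlongrightarrow> 0) (at_right 0)"
  proof (rule Lim_null_comparison[OF _ q])
    show "eventually (\<lambda>h. norm (l2norm \<Omega> (\<lambda>x. u (t + h) x - u t x) / h - l2norm \<Omega> (ut t))
      \<le> l2norm \<Omega> (\<lambda>x. (u (t + h) x - u t x) / ((t + h) - t) - ut t x)) (at_right 0)"
      using eventually_at_right_less[of "0::real"]
    proof eventually_elim
      case (elim h)
      have Lq: "L2 \<Omega> (\<lambda>x. (u (t + h) x - u t x) / h)" using elim t by (intro L2_divide L2_diff uL2) auto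
      have Lu: "L2 \<Omega> (ut t)" using utL2 t by simp
      have e: "l2norm \<Omega> (\<lambda>x. (u (t + h) x - u t x) / h) = l2norm \<Omega> (\<lambda>x. u (t + h) x - u t x) / h"
        using l2norm_cmult[of \<Omega> "1 / h" "\<lambda>x. u (t + h) x - u t x"] elim by simp
      have "l2norm \<Omega> (\<lambda>x. (u (t + h) x - u t x) / h) \<le> l2norm \<Omega> (\<lambda>x. (u (t + h) x - u t x) / h - ut t x) + l2norm \<Omega> (ut t)"
        using l2norm_triangle[OF L2_diff[OF Lq Lu] Lu] by simp
      moreover have "l2norm \<Omega> (ut t) \<le> l2norm \<Omega> (\<lambda>x. (u (t + h) x - u t x) / h) + l2norm \<Omega> (\<lambda>x. (u (t + h) x - u t x) / h - ut t x)"
        using l2norm_triangle_diff[OF Lq L2_diff[OF Lq Lu]] by simp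
      ultimately show ?case unfolding e by (simp add: abs_le_iff)
    qed
  qed
  then show ?thesis by (simp add: LIM_zero_iff)
qed

text \<open>Divide \<open>difference_decay\<close> by h and let h tend to 0 from the right.\<close>

lemma velocity_growth:
  assumes s: "0 < s" "s \<le> t"
  shows "l2norm \<Omega> (ut t) \<le> exp (L * (t - s)) * l2norm \<Omega> (ut s)"
proof (rule tendsto_le)
  show "((\<lambda>h. l2norm \<Omega> (\<lambda>x. u (t + h) x - u t x) / h) \<longlongrightarrow> l2norm \<Omega> (ut t)) (at_right 0)"
    using s by (intro velocity_quotient_tendsto) simp
  show "((\<lambda>h. exp (L * (t - s)) * (l2norm \<Omega> (\<lambda>x. u (s + h) x - u s x) / h)) \<longlongrightarrow> exp (L * (t - s)) * l2norm \<Omega> (ut s)) (at_right 0)"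
    by (intro tendsto_mult_left velocity_quotient_tendsto s)
  show "eventually (\<lambda>h. l2norm \<Omega> (\<lambda>x. u (t + h) x - u t x) / h \<le> exp (L * (t - s)) * (l2norm \<Omega> (\<lambda>x. u (s + h) x - u s x) / h)) (at_right 0)"
    using eventually_at_right_less[of "0::real"]
  proof eventually_elim
    case (elim h)
    show ?case using difference_decay[OF elim s] elim by (simp add: divide_right_mono)
  qed
qed (rule trivial_limit_at_right_real)

text \<open>By the mean value theorem the energy lost on the unit interval before t is the squared
  speed at some z in it, and from z to t the speed grows at most by the factor exp L. The condition
  t > 1 keeps the interval among positive times.\<close>

lemma velocity_energy_bound:
  assumes t: "t > 1"
  shows "(l2norm \<Omega> (ut t))\<^sup>2 \<le> (exp L)\<^sup>2 * (energy \<Omega> lam (u (t - 1)) - energy \<Omega> lam (u t))"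
proof -
  have "\<exists>z>t - 1. z < t \<and> energy \<Omega> lam (u t) - energy \<Omega> lam (u (t - 1)) = (t - (t - 1)) * - (l2norm \<Omega> (ut z))\<^sup>2"
    using t by (intro MVT2 energy_deriv) auto
  then obtain z where z: "t - 1 < z" "z < t" "energy \<Omega> lam (u (t - 1)) - energy \<Omega> lam (u t) = (l2norm \<Omega> (ut z))\<^sup>2" by auto
  have "l2norm \<Omega> (ut t) \<le> exp (L * (t - z)) * l2norm \<Omega> (ut z)" using z t by (intro velocity_growth) auto
  also have "\<dots> \<le> exp L * l2norm \<Omega> (ut z)" using z L by (intro mult_right_mono l2norm_nonneg) auto
  finally have "(l2norm \<Omega> (ut t))\<^sup>2 \<le> (exp L * l2norm \<Omega> (ut z))\<^sup>2" by (intro power_mono l2norm_nonneg)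
  then show ?thesis by (simp add: z(3) power_mult_distrib)
qed

text \<open>If \<open>- m'\<close> dominates the speed, then \<open>m\<close> bounds the length of the trajectory. Testing \<open>u\<close> against
  \<open>u t - u s\<close> avoids integrating the speed.\<close>
lemma trajectory_length_bound:
  assumes s: "0 < s" "s \<le> t"
    and m: "\<And>r. s \<le> r \<Longrightarrow> r \<le> t \<Longrightarrow> \<exists>y. (m has_real_derivative y) (at r) \<and> l2norm \<Omega> (ut r) \<le> - y"
  shows "l2norm \<Omega> (\<lambda>x. u t x - u s x) \<le> m s - m t"
proof -
  define g where "g = (\<lambda>x. u t x - u s x)"
  have Lg: "L2 \<Omega> g" unfolding g_def using s by (intro L2_diff uL2) auto
  \<comment> \<open>The derivative of this expression is at most |ut| |g| + |g| m' <= 0. Since g is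
    the difference of u at the two ends, comparing them gives |g|^2 <= |g| (m s - m t).\<close>
  have "I (\<lambda>x. u t x * g x) + l2norm \<Omega> g * m t \<le> I (\<lambda>x. u s x * g x) + l2norm \<Omega> g * m s"
  proof (rule DERIV_nonpos_imp_nonincreasing[OF s(2)])
    fix r assume r: "s \<le> r" "r \<le> t"
    then obtain y where y: "(m has_real_derivative y) (at r)" "l2norm \<Omega> (ut r) \<le> - y" using m by blast
    have r0: "r > 0" "r \<ge> 0" using r s by auto
    have "((\<lambda>r. I (\<lambda>x. u r x * g x) + l2norm \<Omega> g * m r) has_real_derivative I (\<lambda>x. ut r x * g x) + l2norm \<Omega> g * y) (at r)"
      by (intro DERIV_add DERIV_cmult y l2_inner_deriv uL2_ev uL2 utL2 Lg u_deriv r0)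
    moreover have "I (\<lambda>x. ut r x * g x) + l2norm \<Omega> g * y \<le> 0"
    proof -
      have "I (\<lambda>x. ut r x * g x) \<le> l2norm \<Omega> (ut r) * l2norm \<Omega> g"
        using l2_Cauchy_Schwarz[OF utL2[OF r0(2)] Lg] by linarith
      also have "\<dots> \<le> - y * l2norm \<Omega> g" by (intro mult_right_mono y l2norm_nonneg)
      finally show ?thesis by (simp add: mult.commute)
    qed
    ultimately show "\<exists>y. ((\<lambda>r. I (\<lambda>x. u r x * g x) + l2norm \<Omega> g * m r) has_real_derivative y) (at r) \<and> y \<le> 0" by blast
  qed
  moreover have "(l2norm \<Omega> g)\<^sup>2 = I (\<lambda>x. u t x * g x) - I (\<lambda>x. u s x * g x)"
  proof -
    have "(l2norm \<Omega> g)\<^sup>2 = I (\<lambda>x. u t x * g x - u s x * g x)"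
      unfolding l2norm_sq by (intro Bochner_Integration.integral_cong) (auto simp: g_def power2_eq_square algebra_simps)
    also have "\<dots> = I (\<lambda>x. u t x * g x) - I (\<lambda>x. u s x * g x)"
      by (rule Bochner_Integration.integral_diff) (use s in \<open>auto intro!: L2_mult_integrable uL2 Lg\<close>)
    finally show ?thesis .
  qed
  ultimately have le: "l2norm \<Omega> g * l2norm \<Omega> g \<le> l2norm \<Omega> g * (m s - m t)"
    by (simp add: power2_eq_square right_diff_distrib)
  have "m t \<le> m s"
  proof (rule DERIV_nonpos_imp_nonincreasing[OF s(2)])
    fix r assume "s \<le> r" "r \<le> t"
    then obtain y where "(m has_real_derivative y) (at r)" "l2norm \<Omega> (ut r) \<le> - y" using m by blast
    then show "\<exists>y. (m has_real_derivative y) (at r) \<and> y \<le> 0" using l2norm_nonneg[of \<Omega> "ut r"] by (intro exI[of _ y]) auto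
  qed
  then have "l2norm \<Omega> g \<le> m s - m t"
    using le l2norm_nonneg[of \<Omega> g] by (cases "l2norm \<Omega> g = 0") auto
  then show ?thesis by (simp add: g_def)
qed

end

section \<open>Rates of convergence\<close>

lemma dissipation_exp_decay:
  fixes e n :: "real \<Rightarrow> real"
  assumes der: "\<And>t. t \<ge> T \<Longrightarrow> (e has_real_derivative - (n t)\<^sup>2) (at t)"
    and low: "\<And>t. t \<ge> T \<Longrightarrow> c * e t \<le> (n t)\<^sup>2" and t: "t \<ge> T"
  shows "e t \<le> e T * exp (- c * (t - T))"
proof -
  have "exp (c * t) * e t \<le> exp (c * T) * e T"
  proof (rule DERIV_nonpos_imp_nonincreasing[OF t])
    fix r assume r: "T \<le> r" "r \<le> t"
    have "((\<lambda>r. exp (c * r) * e r) has_real_derivative exp (c * r) * c * e r + - (n r)\<^sup>2 * exp (c * r)) (at r)"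
      by (rule DERIV_mult[OF _ der[OF r(1)]]) (auto intro!: derivative_eq_intros)
    moreover have "exp (c * r) * c * e r + - (n r)\<^sup>2 * exp (c * r) \<le> 0"
      using mult_left_mono[OF low[OF r(1)], of "exp (c * r)"] by (simp add: algebra_simps)
    ultimately show "\<exists>y. ((\<lambda>r. exp (c * r) * e r) has_real_derivative y) (at r) \<and> y \<le> 0" by blast
  qed
  then have "exp (- c * t) * (exp (c * t) * e t) \<le> exp (- c * t) * (exp (c * T) * e T)" by (intro mult_left_mono) auto
  then have "e t \<le> exp (- c * t + c * T) * e T" by (simp only: mult.assoc[symmetric] exp_add[symmetric]) simp
  also have "- c * t + c * T = - c * (t - T)" by (simp add: algebra_simps)
  finally show ?thesis by (simp add: mult.commute)
qed

text \<open>For e^(-beta) the inequality e' <= - c e^(1 + beta) becomes linear: it grows at rate at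
  least beta c. Dropping its nonnegative initial value gives the bound.\<close>

lemma dissipation_powr_decay:
  fixes e n :: "real \<Rightarrow> real"
  assumes der: "\<And>t. t \<ge> T \<Longrightarrow> (e has_real_derivative - (n t)\<^sup>2) (at t)"
    and pos: "\<And>t. t \<ge> T \<Longrightarrow> e t > 0" and c: "c > 0" and \<beta>: "\<beta> > 0"
    and low: "\<And>t. t \<ge> T \<Longrightarrow> c * e t powr (1 + \<beta>) \<le> (n t)\<^sup>2" and t: "t > T"
  shows "e t \<le> (\<beta> * c * (t - T)) powr (- 1 / \<beta>)"
proof -
  have "e T powr (- \<beta>) - \<beta> * c * T \<le> e t powr (- \<beta>) - \<beta> * c * t"
  proof (rule DERIV_nonneg_imp_nondecreasing[where f="\<lambda>r. e r powr (- \<beta>) - \<beta> * c * r"])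
    show "T \<le> t" using t by simp
    fix r assume r: "T \<le> r" "r \<le> t"
    have D: "((\<lambda>r. e r powr (- \<beta>) - \<beta> * c * r) has_real_derivative (- \<beta> * e r powr (- \<beta> - 1) * - (n r)\<^sup>2 - \<beta> * c)) (at r)"
      using DERIV_diff[OF DERIV_fun_powr[OF der[OF r(1)] pos[OF r(1)], of "- \<beta>"] DERIV_cmult_Id[of "\<beta> * c"]] by simp
    have "c = c * e r powr (1 + \<beta>) * e r powr (- \<beta> - 1)"
      using pos[OF r(1)] by (simp add: mult.assoc flip: powr_add)
    also have "\<dots> \<le> (n r)\<^sup>2 * e r powr (- \<beta> - 1)" by (intro mult_right_mono low r) auto
    finally have "\<beta> * c \<le> \<beta> * ((n r)\<^sup>2 * e r powr (- \<beta> - 1))" using \<beta> by (intro mult_left_mono) auto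
    then have "0 \<le> - \<beta> * e r powr (- \<beta> - 1) * - (n r)\<^sup>2 - \<beta> * c" by (simp add: algebra_simps)
    with D show "\<exists>y. ((\<lambda>r. e r powr (- \<beta>) - \<beta> * c * r) has_real_derivative y) (at r) \<and> 0 \<le> y" by blast
  qed
  then have "\<beta> * c * (t - T) \<le> e t powr (- \<beta>)"
    using powr_ge_zero[of "e T" "- \<beta>"] unfolding right_diff_distrib by linarith
  then have "(e t powr (- \<beta>)) powr (- 1 / \<beta>) \<le> (\<beta> * c * (t - T)) powr (- 1 / \<beta>)"
    using \<beta> c t by (intro powr_mono2') auto
  then show ?thesis using pos[of t] t \<beta> by (simp add: powr_powr)
qed

text \<open>The excess of |f| over B is at most |F t - f| pointwise, so its L2 norm is dominated by
  a quantity tending to 0. In this way psi inherits from u its distance from the singular value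
  1.\<close>

lemma AE_bound_L2_limit:
  fixes \<Omega> :: "'a::euclidean_space set"
  assumes L: "\<And>t. t \<ge> T \<Longrightarrow> L2 \<Omega> (F t)" "L2 \<Omega> f" and b: "\<And>t. t \<ge> (T::real) \<Longrightarrow> AE x in lebesgue_on \<Omega>. \<bar>F t x\<bar> \<le> B"
    and lim: "((\<lambda>t. l2norm \<Omega> (\<lambda>x. F t x - f x)) \<longlongrightarrow> 0) at_top"
  shows "AE x in lebesgue_on \<Omega>. \<bar>f x\<bar> \<le> B"
proof -
  let ?g = "\<lambda>x. max 0 (\<bar>f x\<bar> - B)"
  note [measurable] = L2_measurable[OF L(2)]
  have gm: "?g \<in> borel_measurable (lebesgue_on \<Omega>)" by measurable
  have g: "L2 \<Omega> ?g" "l2norm \<Omega> ?g \<le> l2norm \<Omega> (\<lambda>x. F t x - f x)" if t: "t \<ge> T" for t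
  proof -
    have "AE x in lebesgue_on \<Omega>. \<bar>?g x\<bar> \<le> \<bar>F t x - f x\<bar>" using b[OF t] by eventually_elim auto
    then show "L2 \<Omega> ?g" "l2norm \<Omega> ?g \<le> l2norm \<Omega> (\<lambda>x. F t x - f x)"
      using l2norm_mono_AE[OF L2_diff[OF L(1)[OF t] L(2)] gm] by auto
  qed
  have "l2norm \<Omega> ?g \<le> 0"
    by (rule tendsto_le[OF _ lim tendsto_const]) (auto simp: eventually_at_top_linorder intro!: exI[of _ T] g)
  then have "l2norm \<Omega> ?g = 0" using l2norm_nonneg[of \<Omega> ?g] by simp
  from l2norm_eq0[OF g(1)[OF order_refl] this] show ?thesis
    by eventually_elim (auto simp: max_def split: if_splits)
qed

section \<open>Convergence to the stationary solution and its rate\<close>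

context flow
begin

text \<open>\<open>energy_eq\<close> reduces the limit to L2 convergence of u, of its Laplacian,
  which the H2 norm controls, and of the mass, which is Lipschitz in L2.\<close>

lemma energy_tendsto:
  assumes psi: "H2 \<Omega> \<psi>" "H01 \<Omega> \<psi>" and conv: "((\<lambda>t. h2norm \<Omega> (\<lambda>x. u t x - \<psi> x)) \<longlongrightarrow> 0) at_top"
    and b\<psi>: "AE x in lebesgue_on \<Omega>. \<bar>\<psi> x\<bar> \<le> 1 - \<delta>"
  shows "((\<lambda>t. energy \<Omega> lam (u t)) \<longlongrightarrow> energy \<Omega> lam \<psi>) at_top"
proof -
  have p1: "H1 \<Omega> \<psi>" using psi by (simp add: H2_def)
  have L\<psi>: "L2 \<Omega> \<psi>" by (rule H1_L2[OF p1])
  have ev: "eventually (\<lambda>t::real. t \<ge> 0) at_top" by (rule eventually_ge_at_top)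
  have l0: "((\<lambda>t. l2norm \<Omega> (\<lambda>x. u t x - \<psi> x)) \<longlongrightarrow> 0) at_top"
    by (rule tendsto_sandwich[OF _ _ tendsto_const conv]) (auto simp: l2norm_nonneg l2norm_le_h2norm)
  have l1: "((\<lambda>t. l2norm \<Omega> (\<lambda>x. lap \<Omega> (u t) x - lap \<Omega> \<psi> x)) \<longlongrightarrow> 0) at_top"
  proof (rule tendsto_sandwich[OF _ _ tendsto_const])
    show "((\<lambda>t. real DIM('a) * h2norm \<Omega> (\<lambda>x. u t x - \<psi> x)) \<longlongrightarrow> 0) at_top" by (rule tendsto_mult_right_zero[OF conv])
    show "eventually (\<lambda>t. l2norm \<Omega> (\<lambda>x. lap \<Omega> (u t) x - lap \<Omega> \<psi> x) \<le> real DIM('a) * h2norm \<Omega> (\<lambda>x. u t x - \<psi> x)) at_top"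
      using ev
    proof eventually_elim
      case (elim t)
      let ?v = "\<lambda>x. u t x - \<psi> x"
      have H: "H2 \<Omega> ?v" by (rule H2_diff(1)[OF open_dom bounded_dom uH2[OF elim] psi(1)])
      have "l2norm \<Omega> (\<lambda>x. lap \<Omega> (u t) x - lap \<Omega> \<psi> x) = l2norm \<Omega> (lap \<Omega> ?v)"
        using lap_diff[OF open_dom bounded_dom uH2[OF elim] psi(1)]
        by (intro l2norm_cong_AE L2_diff lapL2 elim lap_L2 psi H) (simp add: eq_commute)
      also have "\<dots> \<le> (\<Sum>i\<in>Basis. l2norm \<Omega> (wd \<Omega> i (wd \<Omega> i ?v)))"
        unfolding lap_def using H by (intro l2norm_sum H1_wd) (auto simp: H2_def)
      also have "\<dots> \<le> (\<Sum>i\<in>(Basis::'a set). h2norm \<Omega> ?v)" by (intro sum_mono l2norm_wd_wd_le_h2norm)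
      finally show ?case by simp
    qed
  qed (simp add: l2norm_nonneg)
  have A: "((\<lambda>t. I (\<lambda>x. u t x * lap \<Omega> (u t) x)) \<longlongrightarrow> I (\<lambda>x. \<psi> x * lap \<Omega> \<psi> x)) at_top"
  proof (rule tendsto_l2_inner[OF l0 l1 L\<psi> lap_L2[OF psi(1)]])
    show "eventually (\<lambda>t. L2 \<Omega> (u t)) at_top" using ev by eventually_elim (rule uL2)
    show "eventually (\<lambda>t. L2 \<Omega> (lap \<Omega> (u t))) at_top" using ev by eventually_elim (rule lapL2)
  qed
  have B: "((\<lambda>t. mass (u t)) \<longlongrightarrow> mass \<psi>) at_top"
  proof -
    have "((\<lambda>t. l2norm \<Omega> (\<lambda>x. 1) / \<delta>\<^sup>2 * l2norm \<Omega> (\<lambda>x. u t x - \<psi> x)) \<longlongrightarrow> 0) at_top" by (rule tendsto_mult_right_zero[OF l0])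
    moreover have "eventually (\<lambda>t. norm (mass (u t) - mass \<psi>) \<le> l2norm \<Omega> (\<lambda>x. 1) / \<delta>\<^sup>2 * l2norm \<Omega> (\<lambda>x. u t x - \<psi> x)) at_top"
      using ev
    proof eventually_elim
      case (elim t)
      show ?case using reciprocal_Lipschitz(2)[OF open_dom bounded_dom \<delta> uL2[OF elim] bound[OF elim] L\<psi> b\<psi>] by simp
    qed
    ultimately have "((\<lambda>t. mass (u t) - mass \<psi>) \<longlongrightarrow> 0) at_top" by (rule Lim_null_comparison[rotated])
    then show ?thesis by (simp add: LIM_zero_iff)
  qed
  have m0: "0 \<le> mass \<psi>" by (rule bounded_away_from_1(4)[OF open_dom bounded_dom \<delta> L\<psi> b\<psi>])
  have "((\<lambda>t. - 1/2 * I (\<lambda>x. u t x * lap \<Omega> (u t) x) + lam / (1 + mass (u t)))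
      \<longlongrightarrow> - 1/2 * I (\<lambda>x. \<psi> x * lap \<Omega> \<psi> x) + lam / (1 + mass \<psi>)) at_top"
    using m0 by (intro tendsto_intros A B) auto
  then show ?thesis
    unfolding energy_eq[OF open_dom bounded_dom psi]
  proof (rule Lim_transform_eventually)
    show "eventually (\<lambda>t. - 1/2 * I (\<lambda>x. u t x * lap \<Omega> (u t) x) + lam / (1 + mass (u t)) = energy \<Omega> lam (u t)) at_top"
      using ev by eventually_elim (simp add: energy_eq[OF open_dom bounded_dom uH2 uH01])
  qed
qed

lemma distance_le_limit:
  assumes psi: "L2 \<Omega> \<psi>" and lim: "((\<lambda>t. l2norm \<Omega> (\<lambda>x. u t x - \<psi> x)) \<longlongrightarrow> 0) at_top"
    and s: "s \<ge> 0" and le: "\<And>t. t \<ge> s \<Longrightarrow> l2norm \<Omega> (\<lambda>x. u t x - u s x) \<le> M"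
  shows "l2norm \<Omega> (\<lambda>x. u s x - \<psi> x) \<le> M"
proof (rule tendsto_le[OF _ _ tendsto_const])
  show "((\<lambda>t. l2norm \<Omega> (\<lambda>x. u t x - \<psi> x) + M) \<longlongrightarrow> M) at_top" using tendsto_add[OF lim tendsto_const, of M] by simp
  show "eventually (\<lambda>t. l2norm \<Omega> (\<lambda>x. u s x - \<psi> x) \<le> l2norm \<Omega> (\<lambda>x. u t x - \<psi> x) + M) at_top"
    using eventually_ge_at_top[of s]
  proof eventually_elim
    case (elim t)
    have Lt: "L2 \<Omega> (u t)" "L2 \<Omega> (u s)" using elim s by (intro uL2; simp)+
    have "l2norm \<Omega> (\<lambda>x. u s x - \<psi> x) = l2norm \<Omega> (\<lambda>x. (u t x - \<psi> x) - (u t x - u s x))" by simp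
    also have "\<dots> \<le> l2norm \<Omega> (\<lambda>x. u t x - \<psi> x) + l2norm \<Omega> (\<lambda>x. u t x - u s x)"
      by (intro l2norm_triangle_diff L2_diff Lt psi)
    also have "\<dots> \<le> l2norm \<Omega> (\<lambda>x. u t x - \<psi> x) + M" by (intro add_left_mono le elim)
    finally show ?case .
  qed
qed simp

text \<open>Everything rests on three relations: e' = - n^2, C e^(1 - theta) <= n, and the bound of
  the H2 distance by n and the L2 distance. The second and third use n in opposite directions, so an
  upper bound of n by e is needed too; it looks back one unit of time.\<close>

lemma convergence_rates:
  assumes psi: "H2 \<Omega> \<psi>" "H01 \<Omega> \<psi>" "AE x in lebesgue_on \<Omega>. - lap \<Omega> \<psi> x = nl \<Omega> lam \<psi> x"
    and conv: "((\<lambda>t. h2norm \<Omega> (\<lambda>x. u t x - \<psi> x)) \<longlongrightarrow> 0) at_top"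
    and \<theta>: "0 < \<theta>" "\<theta> \<le> 1/2" and \<sigma>: "\<sigma> > 0" and C: "C > 0"
    and LS: "\<And>w. H2 \<Omega> w \<Longrightarrow> H01 \<Omega> w \<Longrightarrow> AE x in lebesgue_on \<Omega>. w x < 1 \<Longrightarrow> h2norm \<Omega> (\<lambda>x. w x - \<psi> x) \<le> \<sigma> \<Longrightarrow>
      C * \<bar>energy \<Omega> lam w - energy \<Omega> lam \<psi>\<bar> powr (1 - \<theta>) \<le> l2norm \<Omega> (\<lambda>x. lap \<Omega> w x + nl \<Omega> lam w x)"
    and CH: "CH > 0" "\<And>f g. H2 \<Omega> f \<Longrightarrow> H01 \<Omega> f \<Longrightarrow> H2 \<Omega> g \<Longrightarrow> H01 \<Omega> g \<Longrightarrow>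
    h2norm \<Omega> (\<lambda>x. f x - g x) \<le> CH * (l2norm \<Omega> (\<lambda>x. lap \<Omega> f x - lap \<Omega> g x) + l2norm \<Omega> (\<lambda>x. f x - g x))"
  shows "(\<theta> = 1/2 \<longrightarrow> (\<exists>C0>0. \<exists>C1>0. eventually (\<lambda>t. h2norm \<Omega> (\<lambda>x. u t x - \<psi> x) \<le> C0 * exp (- C1 * t)) at_top))
       \<and> (\<theta> < 1/2 \<longrightarrow> (\<exists>C>0. eventually (\<lambda>t. h2norm \<Omega> (\<lambda>x. u t x - \<psi> x) \<le> C * (1 + t) powr (- \<theta> / (1 - 2 * \<theta>))) at_top))"
proof -
  define e where "e t = energy \<Omega> lam (u t) - energy \<Omega> lam \<psi>" for t
  define n where "n t = l2norm \<Omega> (ut t)" for t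
  have L\<psi>: "L2 \<Omega> \<psi>" using psi by (auto simp: H2_def H1_def)
  have l0: "((\<lambda>t. l2norm \<Omega> (\<lambda>x. u t x - \<psi> x)) \<longlongrightarrow> 0) at_top"
    by (rule tendsto_sandwich[OF _ _ tendsto_const conv]) (auto simp: l2norm_nonneg l2norm_le_h2norm)
  have b\<psi>: "AE x in lebesgue_on \<Omega>. \<bar>\<psi> x\<bar> \<le> 1 - \<delta>"
    by (rule AE_bound_L2_limit[OF _ L\<psi> _ l0, of 0]) (auto intro: uL2 bound)
  have e0: "(e \<longlongrightarrow> 0) at_top"
    unfolding e_def using energy_tendsto[OF psi(1,2) conv b\<psi>] by (simp add: LIM_zero_iff)
  have "eventually (\<lambda>t. h2norm \<Omega> (\<lambda>x. u t x - \<psi> x) < \<sigma>) at_top" "eventually (\<lambda>t. e t < 1) at_top"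
    using order_tendstoD(2)[OF conv \<sigma>] order_tendstoD(2)[OF e0, of 1] by auto
  then have "eventually (\<lambda>t. h2norm \<Omega> (\<lambda>x. u t x - \<psi> x) < \<sigma> \<and> e t < 1) at_top" by (rule eventually_conj)
  then obtain T0 where T0: "\<And>t. t \<ge> T0 \<Longrightarrow> h2norm \<Omega> (\<lambda>x. u t x - \<psi> x) < \<sigma> \<and> e t < 1"
    unfolding eventually_at_top_linorder by blast
  \<comment> \<open>After T0 the solution is within sigma of psi and e < 1; the maximum with 1 keeps
    all times positive.\<close>
  define T where "T = max T0 1"
  have T: "T \<ge> 1" "T \<ge> T0" by (auto simp: T_def)
  have der: "(e has_real_derivative - (n t)\<^sup>2) (at t)" if "t \<ge> T" for t
    unfolding e_def n_def using energy_deriv[of t] that T by (auto intro!: derivative_eq_intros)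
  have n0: "n t \<ge> 0" for t by (simp add: n_def l2norm_nonneg)
  have e_mono: "e t \<le> e s" if "T \<le> s" "s \<le> t" for s t
  proof (rule DERIV_nonpos_imp_nonincreasing[OF that(2)])
    fix r assume "s \<le> r" "r \<le> t"
    then show "\<exists>y. (e has_real_derivative y) (at r) \<and> y \<le> 0"
      using der[of r] that(1) by (intro exI[of _ "- (n r)\<^sup>2"]) auto
  qed
  have e_nonneg: "e s \<ge> 0" if "s \<ge> T" for s
    by (rule tendsto_upperbound[OF e0]) (use e_mono[OF that] in \<open>auto simp: eventually_at_top_linorder\<close>)
  have LSn: "C * e t powr (1 - \<theta>) \<le> n t" if t: "t \<ge> T" for t
  proof -
    have t0: "t > 0" "t \<ge> 0" using t T by auto
    have "AE x in lebesgue_on \<Omega>. u t x < 1" using bound[OF t0(2)] by eventually_elim (use \<delta> in auto)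
    then have "C * \<bar>e t\<bar> powr (1 - \<theta>) \<le> l2norm \<Omega> (\<lambda>x. lap \<Omega> (u t) x + nl \<Omega> lam (u t) x)"
      unfolding e_def using T0[of t] t T by (intro LS uH2 uH01 t0) auto
    also have "\<dots> = n t"
      unfolding n_def
    proof (rule l2norm_cong_AE)
      show "AE x in lebesgue_on \<Omega>. lap \<Omega> (u t) x + nl \<Omega> lam (u t) x = ut t x"
        using equation[OF t0(1)] by eventually_elim linarith
    qed (intro L2_add lapL2 nlL2 utL2 t0)+
    finally show ?thesis using e_nonneg[OF t] by simp
  qed
  have lapd: "l2norm \<Omega> (\<lambda>x. lap \<Omega> (u t) x - lap \<Omega> \<psi> x) \<le> n t + L * l2norm \<Omega> (\<lambda>x. u t x - \<psi> x)" if t: "t \<ge> T" for t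
  proof -
    have t0: "t > 0" "t \<ge> 0" using t T by auto
    have Ln: "L2 \<Omega> (nl \<Omega> lam \<psi>)" by (rule nl_L2[OF open_dom bounded_dom \<delta> L\<psi> b\<psi>])
    have "l2norm \<Omega> (\<lambda>x. lap \<Omega> (u t) x - lap \<Omega> \<psi> x) = l2norm \<Omega> (\<lambda>x. ut t x - (nl \<Omega> lam (u t) x - nl \<Omega> lam \<psi> x))"
    proof (rule l2norm_cong_AE)
      show "AE x in lebesgue_on \<Omega>. lap \<Omega> (u t) x - lap \<Omega> \<psi> x = ut t x - (nl \<Omega> lam (u t) x - nl \<Omega> lam \<psi> x)"
        using equation[OF t0(1)] psi(3) by eventually_elim linarith
    qed (intro L2_diff lapL2 lap_L2 psi utL2 nlL2 Ln t0)+
    also have "\<dots> \<le> n t + l2norm \<Omega> (\<lambda>x. nl \<Omega> lam (u t) x - nl \<Omega> lam \<psi> x)"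
      unfolding n_def by (intro l2norm_triangle_diff L2_diff utL2 nlL2 Ln t0)
    also have "\<dots> \<le> n t + L * l2norm \<Omega> (\<lambda>x. u t x - \<psi> x)"
      by (intro add_left_mono Lipschitz uL2 bound t0 L\<psi> b\<psi>)
    finally show ?thesis .
  qed
  have h2: "h2norm \<Omega> (\<lambda>x. u t x - \<psi> x) \<le> CH * (n t + (L + 1) * l2norm \<Omega> (\<lambda>x. u t x - \<psi> x))" if t: "t \<ge> T" for t
  proof -
    have t0: "t \<ge> 0" using t T by auto
    have "h2norm \<Omega> (\<lambda>x. u t x - \<psi> x) \<le> CH * (l2norm \<Omega> (\<lambda>x. lap \<Omega> (u t) x - lap \<Omega> \<psi> x) + l2norm \<Omega> (\<lambda>x. u t x - \<psi> x))"
      by (intro CH(2) uH2 uH01 psi t0)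
    also have "\<dots> \<le> CH * (n t + (L + 1) * l2norm \<Omega> (\<lambda>x. u t x - \<psi> x))"
      using lapd[OF t] CH(1) by (intro mult_left_mono) (auto simp: algebra_simps)
    finally show ?thesis .
  qed
  show ?thesis
  proof (cases "\<exists>t0\<ge>T. e t0 = 0")
    \<comment> \<open>As e is nonincreasing and nonnegative, it stays zero, the velocity vanishes
      and the solution has reached psi.\<close>
    case True
    then obtain t0 where t0: "t0 \<ge> T" "e t0 = 0" by blast
    have ez: "e t = 0" if "t \<ge> t0" for t
      using e_mono[OF t0(1) that] e_nonneg[of t] t0 that by auto
    have nz: "n t = 0" if "t > t0" for t
    proof -
      have "((\<lambda>_. 0) has_real_derivative - (n t)\<^sup>2) (at t)"
        by (rule has_field_derivative_transform_within_open[OF der, of t "{t0<..}"]) (use that t0 ez in auto)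
      then have "- (n t)\<^sup>2 = 0" by (rule DERIV_unique) simp
      then show ?thesis by simp
    qed
    have vz: "l2norm \<Omega> (\<lambda>x. u s x - \<psi> x) \<le> 0" if s: "s > t0" for s
    proof (rule distance_le_limit[OF L\<psi> l0])
      show "s \<ge> 0" using s t0 T by simp
      fix t assume t: "t \<ge> s"
      have "l2norm \<Omega> (\<lambda>x. u t x - u s x) \<le> (\<lambda>_. 0) s - (\<lambda>_. 0) t"
        by (rule trajectory_length_bound) (use s t t0 T nz in \<open>auto simp: n_def intro!: exI[of _ 0]\<close>)
      then show "l2norm \<Omega> (\<lambda>x. u t x - u s x) \<le> 0" by simp
    qed
    have z: "eventually (\<lambda>t. h2norm \<Omega> (\<lambda>x. u t x - \<psi> x) \<le> 0) at_top"
      using eventually_gt_at_top[of t0]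
    proof eventually_elim
      case (elim t)
      have "l2norm \<Omega> (\<lambda>x. u t x - \<psi> x) = 0" using vz[OF elim] l2norm_nonneg[of \<Omega> "\<lambda>x. u t x - \<psi> x"] by simp
      then show ?case using h2[of t] nz[OF elim] elim t0 by simp
    qed
    have "eventually (\<lambda>t. h2norm \<Omega> (\<lambda>x. u t x - \<psi> x) \<le> 1 * exp (- 1 * t)) at_top"
      using z by eventually_elim (rule order_trans, assumption, simp)
    moreover have "eventually (\<lambda>t. h2norm \<Omega> (\<lambda>x. u t x - \<psi> x) \<le> 1 * (1 + t) powr (- \<theta> / (1 - 2 * \<theta>))) at_top"
      using z by eventually_elim (rule order_trans, assumption, simp)
    ultimately show ?thesis using zero_less_one by blast
  next
    case False
    then have pos: "e t > 0" if "t \<ge> T" for t using e_nonneg[OF that] that by (metis order_le_less)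
    \<comment> \<open>Chosen so that minus the derivative of \<open>K * e r powr \<theta>\<close>,
      which is K theta e^(theta - 1) n^2, is at least n: multiply C e^(1 - theta) <= n by n e^(theta
      - 1) / C.\<close>
    define K where "K = 1 / (\<theta> * C)"
    have K: "K > 0" using \<theta> C by (simp add: K_def)
    have vb: "l2norm \<Omega> (\<lambda>x. u s x - \<psi> x) \<le> K * e s powr \<theta>" if s: "s \<ge> T" for s
    proof (rule distance_le_limit[OF L\<psi> l0])
      show "s \<ge> 0" using s T by simp
      fix t assume t: "t \<ge> s"
      have "l2norm \<Omega> (\<lambda>x. u t x - u s x) \<le> K * e s powr \<theta> - K * e t powr \<theta>"
      proof (rule trajectory_length_bound[where m="\<lambda>r. K * e r powr \<theta>"])
        fix r assume "s \<le> r" "r \<le> t"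
        then have r: "r \<ge> T" using s by simp
        have D: "((\<lambda>r. K * e r powr \<theta>) has_real_derivative K * (\<theta> * e r powr (\<theta> - 1) * - (n r)\<^sup>2)) (at r)"
          using DERIV_cmult[OF DERIV_fun_powr[OF der[OF r] pos[OF r], of \<theta>], of K] by simp
        have "n r \<le> K * (\<theta> * e r powr (\<theta> - 1) * (n r)\<^sup>2)"
        proof -
          have "C = C * e r powr (1 - \<theta>) * e r powr (\<theta> - 1)"
            using pos[OF r] by (simp add: mult.assoc flip: powr_add)
          also have "\<dots> \<le> n r * e r powr (\<theta> - 1)" by (intro mult_right_mono LSn r) auto
          finally have "1 * n r \<le> (e r powr (\<theta> - 1) * n r / C) * n r"
            using C n0 by (intro mult_right_mono) (auto simp: field_simps)
          then show ?thesis using \<theta> C by (simp add: K_def power2_eq_square field_simps)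
        qed
        then have "l2norm \<Omega> (ut r) \<le> - (K * (\<theta> * e r powr (\<theta> - 1) * - (n r)\<^sup>2))" by (simp add: n_def)
        with D show "\<exists>y. ((\<lambda>r. K * e r powr \<theta>) has_real_derivative y) (at r) \<and> l2norm \<Omega> (ut r) \<le> - y" by blast
      qed (use s t T in auto)
      also have "\<dots> \<le> K * e s powr \<theta>" using K by simp
      finally show "l2norm \<Omega> (\<lambda>x. u t x - u s x) \<le> K * e s powr \<theta>" .
    qed
    \<comment> \<open>The velocity contributes exp L, the L2 distance contributes (L + 1) K.\<close>
    define M where "M = CH * (exp L + (L + 1) * K)"
    have M: "M > 0" unfolding M_def using CH L K by (intro mult_pos_pos add_pos_pos) auto
    have hb: "h2norm \<Omega> (\<lambda>x. u t x - \<psi> x) \<le> M * e (t - 1) powr \<theta>" if t: "t \<ge> T + 1" for t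
    proof -
      have t': "t \<ge> T" "t - 1 \<ge> T" "t > 1" using t T by auto
      have "(n t)\<^sup>2 \<le> (exp L)\<^sup>2 * (e (t - 1) - e t)"
        using velocity_energy_bound[OF t'(3)] by (simp add: n_def e_def)
      also have "\<dots> \<le> (exp L)\<^sup>2 * e (t - 1)" using e_nonneg[OF t'(1)] by (intro mult_left_mono) auto
      also have "\<dots> \<le> (exp L)\<^sup>2 * (e (t - 1) powr \<theta>)\<^sup>2"
      proof (intro mult_left_mono)
        \<comment> \<open>As e < 1 and 2 theta <= 1, passing from the square root of e to e^theta
          only enlarges the bound on n.\<close>
        have "e (t - 1) powr 1 \<le> e (t - 1) powr (2 * \<theta>)"
          using pos[OF t'(2)] T0[of "t - 1"] t' T \<theta> by (intro powr_mono') auto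
        then show "e (t - 1) \<le> (e (t - 1) powr \<theta>)\<^sup>2"
          using pos[OF t'(2)] by (simp add: powr_power mult.commute)
      qed auto
      finally have "(n t)\<^sup>2 \<le> (exp L * e (t - 1) powr \<theta>)\<^sup>2" by (simp add: power_mult_distrib)
      then have nt: "n t \<le> exp L * e (t - 1) powr \<theta>" by (rule power2_le_imp_le) simp
      have "e t powr \<theta> \<le> e (t - 1) powr \<theta>"
        using \<theta> e_nonneg[OF t'(1)] e_mono[OF t'(2), of t] by (intro powr_mono2) auto
      then have "K * e t powr \<theta> \<le> K * e (t - 1) powr \<theta>" using K by (intro mult_left_mono) auto
      then have v: "(L + 1) * l2norm \<Omega> (\<lambda>x. u t x - \<psi> x) \<le> (L + 1) * (K * e (t - 1) powr \<theta>)"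
        using vb[OF t'(1)] L by (intro mult_left_mono) auto
      have "h2norm \<Omega> (\<lambda>x. u t x - \<psi> x) \<le> CH * (exp L * e (t - 1) powr \<theta> + (L + 1) * (K * e (t - 1) powr \<theta>))"
        using h2[OF t'(1)] mult_left_mono[OF add_mono[OF nt v], of CH] CH(1) by linarith
      then show ?thesis by (simp add: M_def algebra_simps)
    qed
    \<comment> \<open>The exponent 2 - 2 theta is 1 for theta = 1/2 and 1 + beta with beta = 1 - 2
      theta below, as the two decay lemmas require.\<close>
    have low: "C\<^sup>2 * e t powr (2 - 2 * \<theta>) \<le> (n t)\<^sup>2" if "t \<ge> T" for t
    proof -
      have "(C * e t powr (1 - \<theta>))\<^sup>2 \<le> (n t)\<^sup>2" using LSn[OF that] C by (intro power_mono) auto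
      then show ?thesis using pos[OF that] by (simp add: power_mult_distrib powr_power algebra_simps)
    qed
    show ?thesis
    proof (intro conjI impI)
      assume half: "\<theta> = 1/2"
      have dec: "e s \<le> e T * exp (- C\<^sup>2 * (s - T))" if "s \<ge> T" for s
      proof (rule dissipation_exp_decay[OF der _ that])
        show "C\<^sup>2 * e t \<le> (n t)\<^sup>2" if "t \<ge> T" for t using low[OF that] pos[OF that] half by simp
      qed
      \<comment> \<open>Collects the factors independent of t when the decay with rate C^2 after T
        is evaluated at t - 1 and raised to the power 1/2.\<close>
      let ?C0 = "M * (e T powr \<theta> * exp (C\<^sup>2 * (1 + T) / 2))"
      have "eventually (\<lambda>t. h2norm \<Omega> (\<lambda>x. u t x - \<psi> x) \<le> ?C0 * exp (- (C\<^sup>2 / 2) * t)) at_top"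
        using eventually_ge_at_top[of "T + 1"]
      proof eventually_elim
        case (elim t)
        have t1: "t - 1 \<ge> T" using elim by simp
        have "e (t - 1) powr \<theta> \<le> (e T * exp (- C\<^sup>2 * (t - 1 - T))) powr \<theta>"
          using dec[OF t1] pos[OF t1] \<theta> by (intro powr_mono2) auto
        also have "\<dots> = e T powr \<theta> * exp (- C\<^sup>2 * (t - 1 - T) * \<theta>)"
          using pos[of T] by (simp add: powr_mult powr_def[of "exp _"] mult.commute)
        also have "- C\<^sup>2 * (t - 1 - T) * \<theta> = C\<^sup>2 * (1 + T) / 2 + - (C\<^sup>2 / 2) * t"
          by (simp add: half field_simps)
        finally have "M * e (t - 1) powr \<theta> \<le> M * (e T powr \<theta> * exp (C\<^sup>2 * (1 + T) / 2 + - (C\<^sup>2 / 2) * t))"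
          using M by (intro mult_left_mono) auto
        then show ?case using hb[OF elim] by (simp only: exp_add mult.assoc)
      qed
      moreover have "?C0 > 0" using M pos[of T] by simp
      moreover have "C\<^sup>2 / 2 > 0" using C by simp
      ultimately show "\<exists>C0>0. \<exists>C1>0. eventually (\<lambda>t. h2norm \<Omega> (\<lambda>x. u t x - \<psi> x) \<le> C0 * exp (- C1 * t)) at_top" by blast
    next
      assume lt: "\<theta> < 1/2"
      define \<beta> where "\<beta> = 1 - 2 * \<theta>"
      have \<beta>: "\<beta> > 0" using lt by (simp add: \<beta>_def)
      have dec: "e s \<le> (\<beta> * C\<^sup>2 * (s - T)) powr (- 1 / \<beta>)" if "s > T" for s
        by (rule dissipation_powr_decay[OF der pos _ \<beta> _ that]) (use low C in \<open>auto simp: \<beta>_def\<close>)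
      \<comment> \<open>Half of beta C^2, because from time 2 T + 3 on the elapsed time t - 1 - T is
        at least (1 + t)/2.\<close>
      let ?c = "\<beta> * C\<^sup>2 / 2"
      have c: "?c > 0" using \<beta> C by simp
      have "eventually (\<lambda>t. h2norm \<Omega> (\<lambda>x. u t x - \<psi> x) \<le> (M * ?c powr (- \<theta> / \<beta>)) * (1 + t) powr (- \<theta> / \<beta>)) at_top"
        using eventually_ge_at_top[of "2 * T + 3"]
      proof eventually_elim
        case (elim t)
        have t1: "t - 1 > T" "t \<ge> T + 1" "1 + t > 0" using elim T by auto
        have "e (t - 1) powr \<theta> \<le> ((\<beta> * C\<^sup>2 * (t - 1 - T)) powr (- 1 / \<beta>)) powr \<theta>"
          using dec[OF t1(1)] pos[of "t - 1"] t1 \<theta> by (intro powr_mono2) auto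
        also have "\<dots> = (\<beta> * C\<^sup>2 * (t - 1 - T)) powr (- \<theta> / \<beta>)" by (simp add: powr_powr)
        also have "\<dots> \<le> (?c * (1 + t)) powr (- \<theta> / \<beta>)"
        proof (rule powr_mono2')
          show "- \<theta> / \<beta> \<le> 0" using \<theta> \<beta> by simp
          show "0 < ?c * (1 + t)" using c t1 by simp
          have "\<beta> * C\<^sup>2 * ((1 + t) / 2) \<le> \<beta> * C\<^sup>2 * (t - 1 - T)"
            using \<beta> elim T by (intro mult_left_mono) auto
          then show "?c * (1 + t) \<le> \<beta> * C\<^sup>2 * (t - 1 - T)" by simp
        qed
        also have "\<dots> = ?c powr (- \<theta> / \<beta>) * (1 + t) powr (- \<theta> / \<beta>)" by (rule powr_mult)
        finally have "M * e (t - 1) powr \<theta> \<le> M * (?c powr (- \<theta> / \<beta>) * (1 + t) powr (- \<theta> / \<beta>))"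
          using M by (intro mult_left_mono) auto
        then show ?case using hb[OF t1(2)] by (simp only: mult.assoc)
      qed
      moreover have "M * ?c powr (- \<theta> / \<beta>) > 0" by (rule mult_pos_pos[OF M]) (use \<beta> C in simp)
      ultimately show "\<exists>C>0. eventually (\<lambda>t. h2norm \<Omega> (\<lambda>x. u t x - \<psi> x) \<le> C * (1 + t) powr (- \<theta> / (1 - 2 * \<theta>))) at_top"
        unfolding \<beta>_def by blast
    qed
  qed
qed

end

text \<open>The constant of the H2 estimate depends only on the domain, the Lipschitz constant only
  on the domain, \<open>lam\<close> and \<open>\<delta>\<close>; both are fixed before the solution
  is viewed as a \<open>flow\<close>.\<close>

theorem theorem1p4:
  fixes \<Omega> :: "'a::euclidean_space set"
    and lam \<delta> \<theta> :: real
    and u0 \<psi> :: "'a \<Rightarrow> real"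
    and u ut :: "real \<Rightarrow> 'a \<Rightarrow> real"
  assumes dim: "DIM('a) \<le> 3"
    and dom: "smooth_bounded_domain \<Omega>"
    and lam: "lam > 0"
    and u0: "H2 \<Omega> u0" "H01 \<Omega> u0"
    and u_space: "\<forall>t\<ge>0. H2 \<Omega> (u t) \<and> H01 \<Omega> (u t)"
    and u_cont: "\<forall>t\<ge>0. ((\<lambda>s. h2norm \<Omega> (\<lambda>x. u s x - u t x)) \<longlongrightarrow> 0) (at t within {0..})"
    and ut_L2: "\<forall>t\<ge>0. L2 \<Omega> (ut t)"
    and ut_deriv: "\<forall>t\<ge>0. ((\<lambda>s. l2norm \<Omega> (\<lambda>x. (u s x - u t x) / (s - t) - ut t x))
                             \<longlongrightarrow> 0) (at t within {0..})"
    and ut_cont: "\<forall>t\<ge>0. ((\<lambda>s. l2norm \<Omega> (\<lambda>x. ut s x - ut t x)) \<longlongrightarrow> 0) (at t within {0..})"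
    and equation: "\<forall>t>0. AE x in lebesgue_on \<Omega>. ut t x - lap \<Omega> (u t) x = nl \<Omega> lam (u t) x"
    and initial: "AE x in lebesgue_on \<Omega>. u 0 x = u0 x"
    and \<delta>: "0 < \<delta>" "\<delta> < 1"
    and bound: "\<forall>t\<ge>0. AE x in lebesgue_on \<Omega>. \<bar>u t x\<bar> \<le> 1 - \<delta>"
    and psi_space: "H2 \<Omega> \<psi>" "H01 \<Omega> \<psi>"
    and psi_eq: "AE x in lebesgue_on \<Omega>. - lap \<Omega> \<psi> x = nl \<Omega> lam \<psi> x"
    and conv: "((\<lambda>t. h2norm \<Omega> (\<lambda>x. u t x - \<psi> x)) \<longlongrightarrow> 0) at_top"
    and \<theta>: "0 < \<theta>" "\<theta> \<le> 1/2"
    and LS: "\<exists>\<sigma>>0. \<exists>C>0. \<forall>w. H2 \<Omega> w \<and> H01 \<Omega> w \<and> (AE x in lebesgue_on \<Omega>. w x < 1)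
               \<and> h2norm \<Omega> (\<lambda>x. w x - \<psi> x) \<le> \<sigma> \<longrightarrow>
               l2norm \<Omega> (\<lambda>x. lap \<Omega> w x + nl \<Omega> lam w x)
                 \<ge> C * \<bar>energy \<Omega> lam w - energy \<Omega> lam \<psi>\<bar> powr (1 - \<theta>)"
  shows "(\<theta> = 1/2 \<longrightarrow> (\<exists>C0>0. \<exists>C1>0. eventually
            (\<lambda>t. h2norm \<Omega> (\<lambda>x. u t x - \<psi> x) \<le> C0 * exp (- C1 * t)) at_top))
       \<and> (\<theta> < 1/2 \<longrightarrow> (\<exists>C>0. eventually
            (\<lambda>t. h2norm \<Omega> (\<lambda>x. u t x - \<psi> x) \<le> C * (1 + t) powr (- \<theta> / (1 - 2 * \<theta>))) at_top))"
  proof (rule H2_estimate[OF dom])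
  fix CH
  assume CH: "CH > 0" "\<And>f g. H2 \<Omega> f \<Longrightarrow> H01 \<Omega> f \<Longrightarrow> H2 \<Omega> g \<Longrightarrow> H01 \<Omega> g \<Longrightarrow>
    h2norm \<Omega> (\<lambda>x. f x - g x) \<le> CH * (l2norm \<Omega> (\<lambda>x. lap \<Omega> f x - lap \<Omega> g x) + l2norm \<Omega> (\<lambda>x. f x - g x))"
  have \<Omega>: "open \<Omega>" "bounded \<Omega>" using dom by (auto simp: smooth_bounded_domain_def)
  obtain \<sigma> C where "\<sigma> > 0" "C > 0" and LS': "\<forall>w. H2 \<Omega> w \<and> H01 \<Omega> w \<and> (AE x in lebesgue_on \<Omega>. w x < 1)
      \<and> h2norm \<Omega> (\<lambda>x. w x - \<psi> x) \<le> \<sigma> \<longrightarrow>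
      l2norm \<Omega> (\<lambda>x. lap \<Omega> w x + nl \<Omega> lam w x) \<ge> C * \<bar>energy \<Omega> lam w - energy \<Omega> lam \<psi>\<bar> powr (1 - \<theta>)"
    using LS by (elim exE conjE)
  show ?thesis
  proof (rule nl_Lipschitz[OF \<Omega> \<delta>(1) lam])
    fix L
    assume L: "L > 0" "\<And>v w. L2 \<Omega> v \<Longrightarrow> AE x in lebesgue_on \<Omega>. \<bar>v x\<bar> \<le> 1 - \<delta> \<Longrightarrow> L2 \<Omega> w \<Longrightarrow>
      AE x in lebesgue_on \<Omega>. \<bar>w x\<bar> \<le> 1 - \<delta> \<Longrightarrow>
      l2norm \<Omega> (\<lambda>x. nl \<Omega> lam v x - nl \<Omega> lam w x) \<le> L * l2norm \<Omega> (\<lambda>x. v x - w x)"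
    interpret flow \<Omega> lam \<delta> L u ut
    proof
      show "l2norm \<Omega> (\<lambda>x. nl \<Omega> lam v x - nl \<Omega> lam w x) \<le> L * l2norm \<Omega> (\<lambda>x. v x - w x)"
        if "L2 \<Omega> v" "AE x in lebesgue_on \<Omega>. \<bar>v x\<bar> \<le> 1 - \<delta>" "L2 \<Omega> w" "AE x in lebesgue_on \<Omega>. \<bar>w x\<bar> \<le> 1 - \<delta>" for v w
        by (rule L(2)[OF that])
      \<comment> \<open>For t > 0 the half-line of nonnegative times is a neighbourhood of t, so
        limits within it are limits at t.\<close>
      show "((\<lambda>s. l2norm \<Omega> (\<lambda>x. (u s x - u t x) / (s - t) - ut t x)) \<longlongrightarrow> 0) (at t)"
        "((\<lambda>s. l2norm \<Omega> (\<lambda>x. ut s x - ut t x)) \<longlongrightarrow> 0) (at t)" if "t > 0" for t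
        using ut_deriv ut_cont that unfolding at_within_nonneg[OF that, symmetric] by simp_all
    qed (use \<Omega> \<delta> u_space ut_L2 equation bound L(1) in simp_all)
    show ?thesis
      by (rule convergence_rates[OF psi_space psi_eq conv \<theta> \<open>\<sigma> > 0\<close> \<open>C > 0\<close> _ CH])
        (use LS' in simp)
  qed
qed

end
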